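(* Let $d\ge1$, and for a symmetric Lévy process $Z$ on $\mathbb{R}^d$ and a shape function $\varphi$ let $u^\omega(t,x)=\mathbb{E}_x\left[\exp\left(-\int_0^tV^\omega(Z_s)\,ds\right)\right]$, where $V^\omega$ is the Poissonian potential with intensity $\rho>0$ and shape function $\varphi$. (i) Let $Z$ be a rotationally symmetric $\alpha$-stable process on $\mathbb{R}^d$ with $\alpha\in(0,2)$, and $\varphi(x)=1\wedge|x|^{-d-\alpha}$. Then, $\mathbb{Q}$-almost surely for all $x\in\mathbb{R}^d$, $$-\infty<\liminf_{t\to\infty}\frac{\log u^\omega(t,x)}{t^{d/(d+\alpha)}}\le\limsup_{t\to\infty}\frac{\log u^\omega(t,x)}{t^{d/(d+\alpha)}}<0.$$ (ii) Let $Z$ be a pure-jump rotationally symmetric Lévy process whose Lévy measure has the form $\nu(dz)=j(|z|)\,dz$ with $$c_0^{-1}g(z)\le j(|z|)\le c_0g(z),\qquad g(z)=\frac{1}{|z|^{d+\alpha}}\mathbf{1}_{\{|z|\le1\}}+e^{-c|z|^\theta}\mathbf{1}_{\{|z|>1\}},$$ for some $\alpha\in(0,2)$, $\theta\in(0,\infty]$, $c>0$ and $c_0\ge1$, and let $\varphi(x)=1\wedge|x|^{-d-2}$. Then, $\mathbb{Q}$-almost surely for all $x\in\mathbb{R}^d$, $$-\infty<\liminf_{t\to\infty}\frac{\log u^\omega(t,x)}{t/(\log t)^{2/d}}\le\limsup_{t\to\infty}\frac{\log u^\omega(t,x)}{t/(\log t)^{2/d}}<0.$$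
   Context: $\mathbb{P}_x,\mathbb{E}_x$ denote probability and expectation for $Z$ started at $x$. A rotationally symmetric $\alpha$-stable process has characteristic exponent $\psi(\xi)=c|\xi|^\alpha$ for some $c>0$, i.e. $\mathbb{E}_0e^{i\langle\xi,Z_t\rangle}=e^{-t\psi(\xi)}$. The pure-jump symmetric Lévy process with Lévy measure $\nu$ has $\psi(\xi)=\int_{\mathbb{R}^d\setminus\{0\}}(1-\cos\langle\xi,z\rangle)\,\nu(dz)$. For $\theta=\infty$, the term $e^{-c|z|^\theta}\mathbf{1}_{\{|z|>1\}}$ is understood as $0$. The Poissonian potential is $V^\omega(x)=\int_{\mathbb{R}^d}\varphi(x-y)\,\mu^\omega(dy)=\sum_i\varphi(x-\omega_i)$, where $\mu^\omega=\sum_i\delta_{\omega_i}$ is a Poisson random measure on $\mathbb{R}^d$ with intensity $\rho\,dx$, $\rho>0$ a constant, defined on a probability space $(\Omega,\mathbb{Q})$ and independent of $Z$. *)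

theory Defs
  imports "HOL-Probability.Probability"
begin

section \<open>Levy processes\<close>

text \<open>
  \<open>X t\<close> is the position at time \<open>t\<close> of the process started at the origin; only times
  \<open>t \<ge> 0\<close> matter. The process started at \<open>x\<close> is \<open>x + X t\<close>. Stochastic continuity
  follows from the right-continuity of the paths and the stationarity of the increments.
\<close>

locale levy_process = prob_space M
  for M :: "'w measure" and X :: "real \<Rightarrow> 'w \<Rightarrow> 'a::euclidean_space" +
  assumes measurable_X: "\<And>t. 0 \<le> t \<Longrightarrow> X t \<in> borel_measurable M"
    and start_zero: "AE w in M. X 0 w = 0"
    and stationary_increments:
      "\<And>s t. 0 \<le> s \<Longrightarrow> 0 \<le> t \<Longrightarrow>
         distr M borel (\<lambda>w. X (s + t) w - X s w) = distr M borel (X t)"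
    and independent_increments:
      "\<And>(n::nat) (\<tau>::nat \<Rightarrow> real). 0 \<le> \<tau> 0 \<Longrightarrow> (\<And>i. i < n \<Longrightarrow> \<tau> i \<le> \<tau> (Suc i)) \<Longrightarrow>
         indep_vars (\<lambda>_. borel) (\<lambda>i w. X (\<tau> (Suc i)) w - X (\<tau> i) w) {..<n}"
    and cadlag_paths:
      "AE w in M. (\<forall>t\<ge>0. ((\<lambda>s. X s w) \<longlongrightarrow> X t w) (at_right t)) \<and>
                  (\<forall>t>0. \<exists>l. ((\<lambda>s. X s w) \<longlongrightarrow> l) (at_left t))"

text \<open>The exponents of symmetric processes are real-valued.\<close>

definition has_char_exponent ::
  "'w measure \<Rightarrow> (real \<Rightarrow> 'w \<Rightarrow> 'a::euclidean_space) \<Rightarrow> ('a \<Rightarrow> real) \<Rightarrow> bool" where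
  "has_char_exponent M X \<psi> \<longleftrightarrow>
     (\<forall>t\<ge>0. \<forall>\<xi>. (CLINT w|M. iexp (\<xi> \<bullet> X t w)) = complex_of_real (exp (- t * \<psi> \<xi>)))"

definition rotationally_symmetric_stable ::
  "'w measure \<Rightarrow> (real \<Rightarrow> 'w \<Rightarrow> 'a::euclidean_space) \<Rightarrow> real \<Rightarrow> bool" where
  "rotationally_symmetric_stable M X \<alpha> \<longleftrightarrow>
     levy_process M X \<and> (\<exists>c>0. has_char_exponent M X (\<lambda>\<xi>. c * norm \<xi> powr \<alpha>))"

definition levy_measure :: "'a::euclidean_space measure \<Rightarrow> bool" where
  "levy_measure \<nu> \<longleftrightarrow> sets \<nu> = sets borel \<and> emeasure \<nu> {0} = 0 \<and>
     (\<integral>\<^sup>+z. ennreal (min 1 ((norm z)\<^sup>2)) \<partial>\<nu>) < \<infinity>"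

definition pure_jump_symmetric_levy ::
  "'w measure \<Rightarrow> (real \<Rightarrow> 'w \<Rightarrow> 'a::euclidean_space) \<Rightarrow> 'a measure \<Rightarrow> bool" where
  "pure_jump_symmetric_levy M X \<nu> \<longleftrightarrow>
     levy_process M X \<and> levy_measure \<nu> \<and> distr \<nu> borel uminus = \<nu> \<and>
     has_char_exponent M X (\<lambda>\<xi>. LINT z:-{0}|\<nu>. 1 - cos (\<xi> \<bullet> z))"

text \<open>The comparison function \<open>g\<close>, meaningful for \<open>z \<noteq> 0\<close>.\<close>

definition jump_profile :: "real \<Rightarrow> ereal \<Rightarrow> real \<Rightarrow> 'a::euclidean_space \<Rightarrow> real" where
  "jump_profile \<alpha> \<theta> c z =
     (if norm z \<le> 1 then 1 / norm z powr (real DIM('a) + \<alpha>)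
      else if \<theta> = \<infinity> then 0
      else exp (- c * norm z powr real_of_ereal \<theta>))"


section \<open>Poissonian potentials\<close>

text \<open>
  The Poisson law is written out since \<open>poisson_pmf\<close> excludes rate \<open>0\<close>. For sigma-finite
  intensities, infinite mass on sets of infinite intensity is a consequence. Up to null
  sets, \<open>point_masses\<close> says that \<open>\<mu> q\<close> is a countable sum of Dirac measures: pushing
  counting measure on the index set \<open>I\<close> forward along \<open>p\<close> puts mass one at each \<open>p i\<close>.
\<close>

locale poisson_random_measure = prob_space Q
  for Q :: "'q measure" and \<mu> :: "'q \<Rightarrow> 'a::euclidean_space measure" and \<Lambda> :: "'a measure" +
  assumes sets_\<mu>: "\<And>q. q \<in> space Q \<Longrightarrow> sets (\<mu> q) = sets borel"
    and point_masses:
      "AE q in Q. \<exists>(I::nat set) (p::nat \<Rightarrow> 'a). \<mu> q = distr (count_space I) borel p"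
    and measurable_count:
      "\<And>B. B \<in> sets borel \<Longrightarrow> (\<lambda>q. emeasure (\<mu> q) B) \<in> borel_measurable Q"
    and poisson_count:
      "\<And>B k. B \<in> sets borel \<Longrightarrow> emeasure \<Lambda> B < \<infinity> \<Longrightarrow>
         prob {q \<in> space Q. emeasure (\<mu> q) B = of_nat k} =
           measure \<Lambda> B ^ k / fact k * exp (- measure \<Lambda> B)"
    and independent_counts:
      "\<And>(n::nat) B. (\<And>i. i < n \<Longrightarrow> B i \<in> sets borel) \<Longrightarrow> disjoint_family_on B {..<n} \<Longrightarrow>
         indep_vars (\<lambda>_. borel) (\<lambda>i q. emeasure (\<mu> q) (B i)) {..<n}"

definition potential ::
  "('a::euclidean_space \<Rightarrow> real) \<Rightarrow> 'a measure \<Rightarrow> 'a \<Rightarrow> ennreal" where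
  "potential \<phi> m x = (\<integral>\<^sup>+y. ennreal (\<phi> (x - y)) \<partial>m)"

lemma potential_point_measure:
  fixes p :: "'i \<Rightarrow> 'a::euclidean_space"
  assumes "\<phi> \<in> borel_measurable borel"
  shows "potential \<phi> (distr (count_space I) borel p) x =
           (\<integral>\<^sup>+i. ennreal (\<phi> (x - p i)) \<partial>count_space I)"
  unfolding potential_def using assms by (subst nn_integral_distr) auto

text \<open>
  The shape function \<open>1 \<and> |x|\<^bsup>-\<beta>\<^esup>\<close>. The value at the origin is given separately because
  \<open>0 powr a = 0\<close> in HOL.
\<close>

definition power_shape :: "real \<Rightarrow> 'a::euclidean_space \<Rightarrow> real" where
  "power_shape \<beta> x = (if x = 0 then 1 else min 1 (norm x powr (- \<beta>)))"


section \<open>The Feynman-Kac functional\<close>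

definition exp_minus :: "ennreal \<Rightarrow> ennreal" where
  "exp_minus a = (if a = \<infinity> then 0 else ennreal (exp (- enn2real a)))"

definition log_ennreal :: "ennreal \<Rightarrow> ereal" where
  "log_ennreal a = (if a = 0 then -\<infinity> else if a = \<infinity> then \<infinity> else ereal (ln (enn2real a)))"

text \<open>
  The environment enters only through the deterministic function \<open>V\<close>, and the expectation
  is taken over the probability space of the process alone; this is how the independence of
  process and environment is expressed. The nonnegative integral is insensitive to
  exceptional null sets of paths.
\<close>

definition feynman_kac ::
  "'w measure \<Rightarrow> (real \<Rightarrow> 'w \<Rightarrow> 'a::euclidean_space) \<Rightarrow> ('a \<Rightarrow> ennreal) \<Rightarrow> real \<Rightarrow> 'a \<Rightarrow> ennreal"
  where
  "feynman_kac M X V t x =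
     (\<integral>\<^sup>+w. exp_minus (\<integral>\<^sup>+s\<in>{0..t}. V (x + X s w) \<partial>lborel) \<partial>M)"

end

theory Submission
  imports Defs
begin

text \<open>
  Both parts concern the competition between two costs. Write \<open>a = \<alpha>\<close> in part (i) and \<open>a = 2\<close> in part (ii).
  In both cases the exponent of \<open>Z\<close> is at most \<open>c\<^sub>1 |\<xi>|\<^sup>a\<close> and the shape function decays like \<open>|x|\<^bsup>-d-a\<^esup>\<close>,
  so that staying for a time \<open>t\<close> in a ball of radius \<open>n\<close> without Poisson points nearby costs order \<open>t n\<^bsup>-a\<^esup>\<close>, both
  for the confinement of the path and for the potential created by the points outside.

  \<^emph>\<open>The environment.\<close> An empty ball of radius \<open>2 n\<close> has probability \<open>exp (- J n\<^sup>d)\<close>. Almost surely, for all large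
  \<open>n\<close>, there is therefore a ball of radius \<open>n\<close> at distance at most \<open>exp (C n\<^sup>d)\<close> on which \<open>V \<le> C n\<^bsup>-a\<^esup>\<close>
  (\<open>low_spots_AE\<close>), while for each \<open>\<kappa>\<close> one has \<open>V \<ge> c n\<^bsup>-a\<^esup>\<close> everywhere up to distance \<open>exp (\<kappa> n\<^sup>d)\<close>
  (\<open>dense_environment_AE\<close>). The shape function satisfies \<open>\<phi>(x) \<le> (1 + |x - y|)\<^bsup>d+a\<^esup> \<phi>(y)\<close>, and so does \<open>V\<close>; hence
  \<open>V\<close> is finite and continuous, and both properties hold seen from every starting point \<open>x\<close>
  (\<open>shifted_environment\<close>). What remains is deterministic in the environment.

  \<^emph>\<open>Upper bounds.\<close> Either the path leaves the ball of radius \<open>L = exp (\<kappa> n\<^sup>d)\<close>, or it pays order \<open>t n\<^bsup>-a\<^esup>\<close>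
  (\<open>feynman_kac_le\<close>). For the stable process leaving costs order \<open>n\<^sup>d\<close> in the exponent, and balancing \<open>n\<^sup>d = t n\<^bsup>-a\<^esup>\<close>
  gives \<open>n\<^sup>d = t\<^bsup>d/(d+a)\<^esup>\<close>. With light tails a power of \<open>t\<close> is already out of reach by time \<open>t\<close>
  (\<open>law_stretched_exponential_tail\<close>), so \<open>n\<^sup>d\<close> is of order \<open>log t\<close> and the cost is \<open>t / (log t)\<^bsup>2/d\<^esup>\<close>.

  \<^emph>\<open>Lower bounds.\<close> The path goes to a low spot and stays there. The stable process gets there by one jump over
  the distance \<open>exp (C n\<^sup>d)\<close>, which again costs order \<open>n\<^sup>d\<close> (\<open>lower_bound_single_jump\<close>). In part (ii) it uses a
  chain of about \<open>exp (C n\<^sup>d)\<close> short hops, which for \<open>n\<^sup>d = \<zeta> log t\<close> with small \<open>\<zeta>\<close> costs only a multiple of the square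
  root of \<open>t\<close> (\<open>lower_bound_chain\<close>).

  The lower bounds use only the laws of the increments and the right-continuity of the paths: the functional is bounded below along dyadic time grids (\<open>feynman_kac_ge_discrete\<close>), where it is an iterated
  operator. Staying in a ball is estimated by a test function and the Cauchy-Schwarz inequality for the symmetric
  operator of the killed walk (\<open>confined_ball_lower_bound\<close>), and hops come from the lower bound
  \<open>P(X\<^sub>h \<in> B) \<ge> (h \<kappa>/2) |B|\<close> for small \<open>h\<close> where \<open>\<nu>\<close> dominates \<open>\<kappa>\<close> times Lebesgue measure (\<open>law_ge_lebesgue\<close>). Facts
  about the laws are read off from the characteristic exponent by approximation with compound Poisson laws.
\<close>


section \<open>Gaussian smoothing and characteristic functions\<close>

definition gauss :: "'a::euclidean_space measure" where
  "gauss = density lborel (\<lambda>x. ennreal (\<Prod>b\<in>Basis. std_normal_density (x \<bullet> b)))"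

definition char_fun :: "'a::euclidean_space measure \<Rightarrow> 'a \<Rightarrow> complex" where
  "char_fun \<mu> \<xi> = (CLINT x|\<mu>. iexp (\<xi> \<bullet> x))"

lemma sets_gauss [simp, measurable_cong]: "sets gauss = sets borel"
  and space_gauss [simp]: "space gauss = UNIV"
  by (auto simp: gauss_def)

lemma sum_inner_square: "(\<Sum>b\<in>Basis. (x \<bullet> b)\<^sup>2) = (norm (x::'a::euclidean_space))\<^sup>2"
  by (simp add: power2_norm_eq_inner) (metis (no_types, lifting) euclidean_inner power2_eq_square sum.cong)

lemma gauss_density_eq:
  "(\<Prod>b\<in>Basis. std_normal_density ((x::'a::euclidean_space) \<bullet> b)) =
     (1 / sqrt (2 * pi)) ^ DIM('a) * exp (- (norm x)\<^sup>2 / 2)"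
proof -
  have "(\<Prod>b\<in>Basis. exp (- (x \<bullet> b)\<^sup>2 / 2)) = exp (- (norm x)\<^sup>2 / 2)"
    by (simp add: exp_sum [symmetric] sum_negf sum_divide_distrib [symmetric]
        sum_inner_square)
  then show ?thesis
    by (simp add: std_normal_density_def prod.distrib prod_dividef power_divide)
qed

lemma nn_integral_gauss_prod:
  assumes "\<And>b. b \<in> Basis \<Longrightarrow> f b \<in> borel_measurable borel" "\<And>b x. 0 \<le> f b x"
  shows "(\<integral>\<^sup>+x. ennreal (\<Prod>b\<in>Basis. f b (x \<bullet> b)) \<partial>(gauss::'a::euclidean_space measure)) =
      (\<Prod>b\<in>(Basis::'a set). \<integral>\<^sup>+x. ennreal (f b x) \<partial>std_normal_distribution)"
proof -
  note assms(1)[measurable]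
  have "(\<integral>\<^sup>+x. ennreal (\<Prod>b\<in>Basis. f b (x \<bullet> b)) \<partial>(gauss::'a measure)) =
      (\<integral>\<^sup>+x. (\<Prod>b\<in>Basis. ennreal (std_normal_density (x \<bullet> b) * f b (x \<bullet> b))) \<partial>(lborel::'a measure))"
    unfolding gauss_def using assms
    by (subst nn_integral_density)
       (auto simp: ennreal_mult'[symmetric] prod.distrib[symmetric] prod_ennreal prod_nonneg intro!: nn_integral_cong)
  also have "\<dots> = (\<Prod>b\<in>(Basis::'a set). \<integral>\<^sup>+x. ennreal (std_normal_density x * f b x) \<partial>lborel)"
    using assms by (intro nn_integral_lborel_prod) auto
  also have "\<dots> = (\<Prod>b\<in>(Basis::'a set). \<integral>\<^sup>+x. ennreal (f b x) \<partial>std_normal_distribution)"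
    using assms by (intro prod.cong refl) (subst nn_integral_density, auto simp: ennreal_mult')
  finally show ?thesis .
qed

lemma prob_space_std_normal: "prob_space std_normal_distribution"
  by (rule prob_space_normal_density) simp

lemma prob_space_gauss: "prob_space (gauss::'a::euclidean_space measure)"
proof (rule prob_spaceI)
  interpret N: prob_space std_normal_distribution by (rule prob_space_std_normal)
  show "emeasure (gauss::'a measure) (space gauss) = 1"
    using nn_integral_gauss_prod[of "\<lambda>(_::'a) _. 1"] N.emeasure_space_1
    by (simp add: emeasure_density)
qed

interpretation gauss: prob_space gauss by (rule prob_space_gauss)

lemma integral_gauss_prod:
  fixes f :: "'a::euclidean_space \<Rightarrow> real \<Rightarrow> complex"
  assumes "\<And>b. b \<in> Basis \<Longrightarrow> integrable std_normal_distribution (f b)"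
  shows "(CLINT x|gauss. (\<Prod>b\<in>Basis. f b (x \<bullet> b))) = (\<Prod>b\<in>Basis. CLINT x|std_normal_distribution. f b x)"
proof -
  have [measurable]: "\<And>b. b \<in> Basis \<Longrightarrow> f b \<in> borel_measurable borel"
    using borel_measurable_integrable[OF assms] by simp
  interpret product_sigma_finite "\<lambda>_::'a. lborel :: real measure" ..
  have i: "integrable lborel (\<lambda>x. std_normal_density x *\<^sub>R f b x)" if "b \<in> Basis" for b
    using assms[OF that] that by (subst (asm) integrable_density) auto
  have "(CLINT x|gauss. (\<Prod>b\<in>Basis. f b (x \<bullet> b))) =
     (CLINT x|lborel. (\<Prod>b\<in>Basis. std_normal_density (x \<bullet> b) *\<^sub>R f b (x \<bullet> b)))"
    unfolding gauss_def
    by (subst integral_density) (auto simp: prod_nonneg scaleR_conv_of_real prod.distrib)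
  also have "\<dots> = (CLINT y|(\<Pi>\<^sub>M b\<in>Basis. lborel). (\<Prod>b\<in>(Basis::'a set). std_normal_density (y b) *\<^sub>R f b (y b)))"
    by (subst lborel_eq, subst integral_distr)
       (auto intro!: Bochner_Integration.integral_cong prod.cong simp: inner_sum_left inner_Basis if_distrib cong: if_cong)
  also have "\<dots> = (\<Prod>b\<in>Basis. CLINT x|lborel. std_normal_density x *\<^sub>R f b x)"
    using i by (intro product_integral_prod) auto
  also have "\<dots> = (\<Prod>b\<in>Basis. CLINT x|std_normal_distribution. f b x)"
    by (intro prod.cong refl, subst integral_density) auto
  finally show ?thesis .
qed

lemma iexp_inner_eq_prod: "iexp (\<xi> \<bullet> x) = (\<Prod>b\<in>Basis. iexp ((\<xi> \<bullet> b) * (x \<bullet> b)))"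
  by (subst euclidean_inner) (simp add: exp_sum sum_distrib_left)

lemma char_fun_gauss: "char_fun gauss \<xi> = complex_of_real (exp (- (norm \<xi>)\<^sup>2 / 2))"
proof -
  interpret N: prob_space std_normal_distribution by (rule prob_space_std_normal)
  have "char_fun gauss \<xi> = (\<Prod>b\<in>Basis. char std_normal_distribution (\<xi> \<bullet> b))"
    unfolding char_fun_def char_def iexp_inner_eq_prod
    by (subst integral_gauss_prod) (auto intro!: N.integrable_const_bound[where B=1])
  also have "\<dots> = (\<Prod>b\<in>Basis. complex_of_real (exp (- (\<xi> \<bullet> b)\<^sup>2 / 2)))"
    by (simp add: char_std_normal_distribution)
  also have "\<dots> = complex_of_real (exp (- (norm \<xi>)\<^sup>2 / 2))"
    by (simp add: of_real_prod [symmetric] exp_sum [symmetric] sum_negf sum_divide_distrib [symmetric]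
        sum_inner_square del: of_real_exp)
  finally show ?thesis .
qed

lemma gauss_second_moment: "(\<integral>\<^sup>+x. ennreal ((norm x)\<^sup>2) \<partial>(gauss::'a::euclidean_space measure)) < \<infinity>"
proof -
  have "(\<integral>\<^sup>+x. ennreal ((x \<bullet> b)\<^sup>2) \<partial>(gauss::'a measure)) < \<infinity>" if b: "b \<in> Basis" for b :: 'a
  proof -
    interpret N: prob_space std_normal_distribution by (rule prob_space_std_normal)
    have "(\<integral>\<^sup>+x. ennreal ((x \<bullet> b)\<^sup>2) \<partial>(gauss::'a measure)) =
        (\<integral>\<^sup>+x. ennreal (\<Prod>b'\<in>Basis. if b' = b then (x \<bullet> b')\<^sup>2 else 1) \<partial>gauss)"
      using b by (intro nn_integral_cong) simp
    also have "\<dots> = (\<Prod>b'\<in>(Basis::'a set). \<integral>\<^sup>+x. ennreal (if b' = b then x\<^sup>2 else 1) \<partial>std_normal_distribution)"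
      by (subst nn_integral_gauss_prod[where f="\<lambda>b' y. if b' = b then y\<^sup>2 else 1"]) auto
    also have "\<dots> < \<infinity>"
    proof -
      have "(\<integral>\<^sup>+x. ennreal (if b' = b then x\<^sup>2 else 1) \<partial>std_normal_distribution) < \<infinity>" for b' :: 'a
      proof (cases "b' = b")
        case True
        have "integrable std_normal_distribution (\<lambda>x. x\<^sup>2)"
          by (rule integrable_std_normal_distribution_moment)
        then show ?thesis using True by (auto simp: integrable_iff_bounded)
      qed (use N.emeasure_space_1 in \<open>auto simp: \<close>)
      then show ?thesis by (auto simp: less_top[symmetric] ennreal_prod_eq_top)
    qed
    finally show ?thesis .
  qed
  moreover have "(\<integral>\<^sup>+x. ennreal ((norm x)\<^sup>2) \<partial>(gauss::'a measure)) =
     (\<Sum>b\<in>Basis. \<integral>\<^sup>+x. ennreal ((x \<bullet> b)\<^sup>2) \<partial>(gauss::'a measure))"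
    by (subst nn_integral_sum [symmetric])
       (auto simp: sum_inner_square)
  ultimately show ?thesis by (simp add: less_top[symmetric])
qed

definition gauss_moment :: "'a::euclidean_space itself \<Rightarrow> real" where
  "gauss_moment _ = 1 + (\<integral>x. (norm x)\<^sup>2 \<partial>(gauss::'a measure))"

lemma gauss_moment_pos: "gauss_moment TYPE('a::euclidean_space) \<ge> 1"
  by (simp add: gauss_moment_def)

lemma powr_le_one_plus_square: "0 \<le> r \<Longrightarrow> 0 \<le> a \<Longrightarrow> a \<le> 2 \<Longrightarrow> r powr a \<le> 1 + r\<^sup>2" for r a :: real
proof (cases "r \<le> 1")
  case True
  assume "0 \<le> r" "0 \<le> a"
  then have "r powr a \<le> 1" using True by (simp add: powr_le1)
  then show ?thesis by (simp add: add_increasing2)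
next
  case False
  assume "0 \<le> r" "a \<le> 2"
  have "r powr a \<le> r powr 2" using False \<open>a \<le> 2\<close> by (intro powr_mono) auto
  then show ?thesis using False by (simp add: powr_numeral)
qed

lemma integrable_gauss_powr:
  assumes "0 \<le> a" "a \<le> 2"
  shows "integrable (gauss::'a::euclidean_space measure) (\<lambda>x. norm x powr a)"
    and "(\<integral>x. norm x powr a \<partial>(gauss::'a measure)) \<le> gauss_moment TYPE('a)"
proof -
  have i: "integrable (gauss::'a measure) (\<lambda>x. (norm x)\<^sup>2)"
    using gauss_second_moment[where 'a='a] by (auto simp: integrable_iff_bounded)
  then have i': "integrable (gauss::'a measure) (\<lambda>x. 1 + (norm x)\<^sup>2)" by auto
  show p: "integrable (gauss::'a measure) (\<lambda>x. norm x powr a)"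
    by (rule Bochner_Integration.integrable_bound[OF i']) (use assms powr_le_one_plus_square[of _ a] in auto)
  have "(\<integral>x. norm x powr a \<partial>(gauss::'a measure)) \<le> (\<integral>x. 1 + (norm x)\<^sup>2 \<partial>(gauss::'a measure))"
    using p i' assms by (intro integral_mono) (auto simp: powr_le_one_plus_square)
  also have "\<dots> = gauss_moment TYPE('a)" using i gauss.prob_space by (simp add: gauss_moment_def)
  finally show "(\<integral>x. norm x powr a \<partial>(gauss::'a measure)) \<le> gauss_moment TYPE('a)" .
qed

lemma char_fun_measurable [measurable]:
  assumes "prob_space \<mu>" and [measurable_cong]: "sets \<mu> = sets (borel::'a::euclidean_space measure)"
  shows "char_fun \<mu> \<in> borel_measurable borel"
proof -
  interpret prob_space \<mu> by fact
  show ?thesis unfolding char_fun_def[abs_def] by measurable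
qed

lemma norm_char_fun_le_1:
  assumes "prob_space \<mu>" and [measurable_cong]: "sets \<mu> = sets (borel::'a::euclidean_space measure)"
  shows "norm (char_fun \<mu> \<xi>) \<le> 1"
proof -
  interpret prob_space \<mu> by fact
  have "norm (char_fun \<mu> \<xi>) \<le> (\<integral>x. norm (iexp (\<xi> \<bullet> x)) \<partial>\<mu>)" unfolding char_fun_def by (rule integral_norm_bound)
  then show ?thesis by (simp add: prob_space)
qed

text \<open>
  A Gaussian is its own Fourier transform, so integrals of Gaussian bumps are Gaussian averages
  of the characteristic function. All the Fourier analysis below rests on this identity.
\<close>

lemma integral_gaussian_bump:
  assumes "prob_space \<mu>" and [measurable_cong]: "sets \<mu> = sets (borel::'a::euclidean_space measure)"
  shows "complex_of_real (\<integral>x. exp (- (\<tau> * norm (x - y))\<^sup>2 / 2) \<partial>\<mu>) =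
     (CLINT g|gauss. iexp (- (\<tau> * (g \<bullet> y))) * char_fun \<mu> (\<tau> *\<^sub>R g))"
proof -
  interpret prob_space \<mu> by fact
  interpret P: pair_prob_space \<mu> gauss ..
  have "complex_of_real (\<integral>x. exp (- (\<tau> * norm (x - y))\<^sup>2 / 2) \<partial>\<mu>) =
      (CLINT x|\<mu>. complex_of_real (exp (- (norm (\<tau> *\<^sub>R (x - y)))\<^sup>2 / 2)))"
    by (simp add: power_mult_distrib del: of_real_exp)
  also have "\<dots> = (CLINT x|\<mu>. CLINT g|gauss. iexp ((\<tau> *\<^sub>R (x - y)) \<bullet> g))"
    by (simp only: char_fun_gauss[symmetric] char_fun_def)
  also have "\<dots> = (CLINT g|gauss. CLINT x|\<mu>. iexp ((\<tau> *\<^sub>R (x - y)) \<bullet> g))"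
    by (rule P.Fubini_integral [symmetric], rule P.integrable_const_bound[where B=1]) auto
  also have "\<dots> = (CLINT g|gauss. CLINT x|\<mu>. iexp (- (\<tau> * (g \<bullet> y))) * iexp ((\<tau> *\<^sub>R g) \<bullet> x))"
    by (intro Bochner_Integration.integral_cong refl)
       (simp add: exp_add[symmetric] inner_diff_left algebra_simps inner_commute)
  finally show ?thesis by (simp add: char_fun_def)
qed

lemma nn_integral_gauss_shift:
  fixes f :: "'a::euclidean_space \<Rightarrow> ennreal"
  assumes [measurable]: "f \<in> borel_measurable borel" and "\<tau> > 0"
  shows "(\<integral>\<^sup>+g. f (x + (1/\<tau>) *\<^sub>R g) \<partial>gauss) =
    (\<integral>\<^sup>+y. ennreal ((\<tau> / sqrt (2 * pi)) ^ DIM('a) * exp (- (\<tau> * norm (x - y))\<^sup>2 / 2)) * f y \<partial>lborel)"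
proof -
  have "(\<integral>\<^sup>+y. ennreal ((\<tau> / sqrt (2 * pi)) ^ DIM('a) * exp (- (\<tau> * norm (x - y))\<^sup>2 / 2)) * f y \<partial>lborel)
     = (\<integral>\<^sup>+g. ennreal (\<bar>1/\<tau>\<bar> ^ DIM('a)) * (ennreal ((\<tau> / sqrt (2 * pi)) ^ DIM('a) *
           exp (- (\<tau> * norm (x - (x + (1/\<tau>) *\<^sub>R g)))\<^sup>2 / 2)) * f (x + (1/\<tau>) *\<^sub>R g)) \<partial>lborel)"
    using \<open>\<tau> > 0\<close>
    by (subst lborel_affine[of "1/\<tau>" x]) (auto simp: nn_integral_density nn_integral_distr)
  also have "\<dots> = (\<integral>\<^sup>+g. ennreal ((1 / sqrt (2 * pi)) ^ DIM('a) * exp (- (norm g)\<^sup>2 / 2)) * f (x + (1/\<tau>) *\<^sub>R g) \<partial>lborel)"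
    using \<open>\<tau> > 0\<close>
    by (intro nn_integral_cong)
       (simp add: mult.assoc[symmetric] ennreal_mult[symmetric] power_divide power_one_over)
  also have "\<dots> = (\<integral>\<^sup>+g. f (x + (1/\<tau>) *\<^sub>R g) \<partial>gauss)"
    unfolding gauss_def by (subst nn_integral_density) (auto simp: gauss_density_eq)
  finally show ?thesis ..
qed

text \<open>
  The law of \<open>\<mu>\<close> perturbed by Gaussian noise of size \<open>1/\<tau>\<close> has as its density the
  integral of a Gaussian bump, which is a Gaussian average of the characteristic function.
\<close>

lemma nn_integral_smoothed:
  fixes f :: "'a::euclidean_space \<Rightarrow> ennreal"
  assumes "prob_space \<mu>" and [measurable_cong]: "sets \<mu> = sets borel"
    and [measurable]: "f \<in> borel_measurable borel" and "\<tau> > 0"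
  shows "(\<integral>\<^sup>+x. \<integral>\<^sup>+g. f (x + (1/\<tau>) *\<^sub>R g) \<partial>gauss \<partial>\<mu>) =
    (\<integral>\<^sup>+y. ennreal ((\<tau> / sqrt (2 * pi)) ^ DIM('a) * (\<integral>x. exp (- (\<tau> * norm (x - y))\<^sup>2 / 2) \<partial>\<mu>)) * f y \<partial>lborel)"
proof -
  interpret prob_space \<mu> by fact
  interpret P: pair_sigma_finite \<mu> lborel ..
  have i: "integrable \<mu> (\<lambda>x. exp (- (\<tau> * norm (x - y))\<^sup>2 / 2))" for y
    by (rule integrable_const_bound[where B=1]) auto
  have "(\<integral>\<^sup>+x. \<integral>\<^sup>+g. f (x + (1/\<tau>) *\<^sub>R g) \<partial>gauss \<partial>\<mu>) =
    (\<integral>\<^sup>+x. \<integral>\<^sup>+y. ennreal ((\<tau> / sqrt (2 * pi)) ^ DIM('a) * exp (- (\<tau> * norm (x - y))\<^sup>2 / 2)) * f y \<partial>lborel \<partial>\<mu>)"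
    using \<open>\<tau> > 0\<close> by (simp add: nn_integral_gauss_shift)
  also have "\<dots> = (\<integral>\<^sup>+y. \<integral>\<^sup>+x. ennreal ((\<tau> / sqrt (2 * pi)) ^ DIM('a) * exp (- (\<tau> * norm (x - y))\<^sup>2 / 2)) * f y \<partial>\<mu> \<partial>lborel)"
    by (rule P.Fubini' [symmetric]) measurable
  also have "\<dots> = (\<integral>\<^sup>+y. ennreal ((\<tau> / sqrt (2 * pi)) ^ DIM('a) * (\<integral>x. exp (- (\<tau> * norm (x - y))\<^sup>2 / 2) \<partial>\<mu>)) * f y \<partial>lborel)"
    using \<open>\<tau> > 0\<close> i
    by (intro nn_integral_cong) (simp add: nn_integral_multc nn_integral_cmult ennreal_mult' nn_integral_eq_integral)
  finally show ?thesis .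
qed

lemma gauss_tail_tendsto_0:
  "((\<lambda>n::nat. measure gauss {g::'a::euclidean_space. real n * \<delta> \<le> norm g}) \<longlonglongrightarrow> 0)" if "\<delta> > 0"
proof -
  have "(\<lambda>n::nat. measure gauss {g::'a. real n * \<delta> \<le> norm g}) \<longlonglongrightarrow> measure gauss (\<Inter>n::nat. {g::'a. real n * \<delta> \<le> norm g})"
  proof (rule gauss.finite_Lim_measure_decseq)
    show "decseq (\<lambda>n::nat. {g::'a. real n * \<delta> \<le> norm g})"
    proof (rule decseq_SucI, safe)
      fix n and g :: 'a assume "real (Suc n) * \<delta> \<le> norm g"
      then show "real n * \<delta> \<le> norm g" using that by (simp add: algebra_simps)
    qed
  qed auto
  also have "(\<Inter>n::nat. {g::'a. real n * \<delta> \<le> norm g}) = {}"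
  proof safe
    fix g :: 'a assume *: "g \<in> (\<Inter>n::nat. {g. real n * \<delta> \<le> norm g})"
    obtain n :: nat where "norm g / \<delta> < real n" using reals_Archimedean2 by blast
    then have "norm g < real n * \<delta>" using that by (simp add: divide_simps)
    moreover have "real n * \<delta> \<le> norm g" using * by blast
    ultimately show "g \<in> {}" by simp
  qed
  finally show ?thesis by simp
qed

text \<open>
  One half of the continuity theorem of Levy: convolving with a small Gaussian turns pointwise
  convergence of characteristic functions into pointwise convergence of densities, to which
  Fatou applies.
\<close>

theorem emeasure_open_le_liminf:
  fixes \<mu> :: "'a::euclidean_space measure"
  assumes \<mu>: "prob_space \<mu>" and [measurable_cong]: "sets \<mu> = sets borel"
    and \<mu>n: "\<And>n::nat. prob_space (\<mu>n n)" and sn [measurable_cong]: "\<And>n. sets (\<mu>n n) = sets borel"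
    and conv: "\<And>\<xi>. (\<lambda>n. char_fun (\<mu>n n) \<xi>) \<longlonglongrightarrow> char_fun \<mu> \<xi>"
    and "open U"
  shows "emeasure \<mu> U \<le> liminf (\<lambda>n. emeasure (\<mu>n n) U)"
proof -
  interpret \<mu>: prob_space \<mu> by fact
  interpret \<mu>n: prob_space "\<mu>n n" for n by fact
  have [measurable]: "U \<in> sets borel" using \<open>open U\<close> by auto
  define L where "L = liminf (\<lambda>n. emeasure (\<mu>n n) U)"
  (* V \<delta> shrinks U by \<delta>; the sets V (2 \<delta>) exhaust U as \<delta> tends to 0. *)
  define V where "V \<delta> = {y. ball y \<delta> \<subseteq> U}" for \<delta> :: real
  have V_closed: "closed (V \<delta>)" for \<delta>
  proof -
    have "- V \<delta> = (\<Union>v\<in>-U. ball v \<delta>)" by (auto simp: V_def dist_commute subset_iff)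
    then have "open (- V \<delta>)" by auto
    then show ?thesis by (simp add: closed_def)
  qed
  then have [measurable]: "V \<delta> \<in> sets borel" for \<delta> by auto
  (* Noise of size 1/\<tau> rarely moves a point by \<delta>, so smoothing loses little of the mass of
     V (2 \<delta>) and lets little mass outside U enter V \<delta>. *)
  have main: "ennreal (1 - measure gauss {g::'a. \<tau> * \<delta> \<le> norm g}) * emeasure \<mu> (V (2 * \<delta>)) \<le>
      L + ennreal (measure gauss {g::'a. \<tau> * \<delta> \<le> norm g})" (is "ennreal (1 - ?T) * _ \<le> _")
    if "\<tau> > 0" "\<delta> > 0" for \<tau> \<delta>
  proof -
    define p where "p m y = (\<integral>x. exp (- (\<tau> * norm (x - y))\<^sup>2 / 2) \<partial>m)" for m and y :: 'a
    define c where "c = (\<tau> / sqrt (2 * pi)) ^ DIM('a)"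
    have p_conv: "(\<lambda>n. p (\<mu>n n) y) \<longlonglongrightarrow> p \<mu> y" for y
    proof -
      have "(\<lambda>n. CLINT g|gauss. iexp (- (\<tau> * (g \<bullet> y))) * char_fun (\<mu>n n) (\<tau> *\<^sub>R g)) \<longlonglongrightarrow>
         (CLINT g|gauss. iexp (- (\<tau> * (g \<bullet> y))) * char_fun \<mu> (\<tau> *\<^sub>R g))"
      proof (rule integral_dominated_convergence[where w="\<lambda>_. 1"])
        show "AE x in gauss. norm (iexp (- (\<tau> * (x \<bullet> y))) * char_fun (\<mu>n i) (\<tau> *\<^sub>R x)) \<le> 1" for i
          using norm_char_fun_le_1[OF \<mu>n sn] by (auto simp: norm_mult)
      qed (use conv char_fun_measurable[OF \<mu>n sn] char_fun_measurable[OF \<mu> assms(2)] in \<open>auto intro!: tendsto_intros\<close>)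
      then have "(\<lambda>n. complex_of_real (p (\<mu>n n) y)) \<longlonglongrightarrow> complex_of_real (p \<mu> y)"
        using integral_gaussian_bump[OF \<mu> assms(2), of \<tau> y] integral_gaussian_bump[OF \<mu>n sn, where \<tau>=\<tau> and y=y]
        by (simp add: p_def)
      then show ?thesis by (simp only: tendsto_of_real_iff)
    qed
    have pm [measurable]: "(\<lambda>y. p (\<mu>n n) y) \<in> borel_measurable borel" for n
      unfolding p_def by measurable
    have q: "(\<integral>\<^sup>+x. emeasure gauss {g. x + (1/\<tau>) *\<^sub>R g \<in> V \<delta>} \<partial>m) =
        (\<integral>\<^sup>+y. ennreal (c * p m y) * indicator (V \<delta>) y \<partial>lborel)"
      if "prob_space m" "sets m = sets borel" for m
    proof -
      have "(\<integral>\<^sup>+g. indicator (V \<delta>) (x + (1/\<tau>) *\<^sub>R g) \<partial>gauss) = emeasure gauss {g. x + (1/\<tau>) *\<^sub>R g \<in> V \<delta>}" for x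
      proof -
        have "(\<lambda>g. indicator (V \<delta>) (x + (1/\<tau>) *\<^sub>R g) :: ennreal) = indicator {g. x + (1/\<tau>) *\<^sub>R g \<in> V \<delta>}"
          by (auto simp: indicator_def)
        then show ?thesis by simp
      qed
      then show ?thesis
        using nn_integral_smoothed[OF that, of "indicator (V \<delta>)" \<tau>] \<open>\<tau> > 0\<close> by (simp add: c_def p_def)
    qed
    have T: "emeasure gauss {g::'a. norm g < \<tau> * \<delta>} = ennreal (1 - ?T)"
    proof -
      have "measure gauss (space gauss - {g::'a. \<tau> * \<delta> \<le> norm g}) = 1 - ?T"
        by (rule gauss.prob_compl) auto
      moreover have "space gauss - {g::'a. \<tau> * \<delta> \<le> norm g} = {g. norm g < \<tau> * \<delta>}" by auto
      ultimately show ?thesis by (simp add: gauss.emeasure_eq_measure)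
    qed
    have "ennreal (1 - ?T) * emeasure \<mu> (V (2 * \<delta>)) = (\<integral>\<^sup>+x. ennreal (1 - ?T) * indicator (V (2 * \<delta>)) x \<partial>\<mu>)"
      by (simp add: nn_integral_cmult_indicator)
    also have "\<dots> \<le> (\<integral>\<^sup>+x. emeasure gauss {g. x + (1/\<tau>) *\<^sub>R g \<in> V \<delta>} \<partial>\<mu>)"
    proof (intro nn_integral_mono)
      fix x
      have "{g::'a. norm g < \<tau> * \<delta>} \<subseteq> {g. x + (1/\<tau>) *\<^sub>R g \<in> V \<delta>}" if x: "x \<in> V (2 * \<delta>)"
      proof safe
        fix g :: 'a assume g: "norm g < \<tau> * \<delta>"
        have "ball (x + (1/\<tau>) *\<^sub>R g) \<delta> \<subseteq> ball x (2 * \<delta>)"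
        proof
          fix v assume "v \<in> ball (x + (1/\<tau>) *\<^sub>R g) \<delta>"
          moreover have "dist x (x + (1/\<tau>) *\<^sub>R g) < \<delta>" using g \<open>\<tau> > 0\<close> by (simp add: dist_norm field_simps)
          ultimately show "v \<in> ball x (2 * \<delta>)" using dist_triangle[of x v "x + (1/\<tau>) *\<^sub>R g"] by simp
        qed
        then show "x + (1/\<tau>) *\<^sub>R g \<in> V \<delta>" using x by (auto simp: V_def)
      qed
      then show "ennreal (1 - ?T) * indicator (V (2 * \<delta>)) x \<le> emeasure gauss {g. x + (1/\<tau>) *\<^sub>R g \<in> V \<delta>}"
        unfolding T[symmetric] by (auto simp: indicator_def intro!: emeasure_mono)
    qed
    also have "\<dots> = (\<integral>\<^sup>+y. ennreal (c * p \<mu> y) * indicator (V \<delta>) y \<partial>lborel)"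
      using q[OF \<mu> assms(2)] by simp
    also have "\<dots> = (\<integral>\<^sup>+y. liminf (\<lambda>n. ennreal (c * p (\<mu>n n) y) * indicator (V \<delta>) y) \<partial>lborel)"
    proof (intro nn_integral_cong lim_imp_Liminf[symmetric])
      fix y show "(\<lambda>n. ennreal (c * p (\<mu>n n) y) * indicator (V \<delta>) y) \<longlonglongrightarrow> ennreal (c * p \<mu> y) * indicator (V \<delta>) y"
        using p_conv[of y] by (auto simp: indicator_def intro!: tendsto_intros)
    qed simp
    also have "\<dots> \<le> liminf (\<lambda>n. \<integral>\<^sup>+y. ennreal (c * p (\<mu>n n) y) * indicator (V \<delta>) y \<partial>lborel)"
      by (rule nn_integral_liminf) measurable
    also have "\<dots> \<le> liminf (\<lambda>n. emeasure (\<mu>n n) U + ennreal ?T)"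
    proof (intro Liminf_mono always_eventually allI)
      fix n
      have "(\<integral>\<^sup>+y. ennreal (c * p (\<mu>n n) y) * indicator (V \<delta>) y \<partial>lborel) =
        (\<integral>\<^sup>+x. emeasure gauss {g. x + (1/\<tau>) *\<^sub>R g \<in> V \<delta>} \<partial>\<mu>n n)"
        using q[OF \<mu>n sn] by simp
      also have "\<dots> \<le> (\<integral>\<^sup>+x. indicator U x + ennreal ?T \<partial>\<mu>n n)"
      proof (intro nn_integral_mono)
        fix x
        show "emeasure gauss {g. x + (1/\<tau>) *\<^sub>R g \<in> V \<delta>} \<le> indicator U x + ennreal ?T"
        proof (cases "x \<in> U")
          case True
          have "emeasure gauss {g. x + (1/\<tau>) *\<^sub>R g \<in> V \<delta>} \<le> 1 + 0"
            using gauss.emeasure_le_1 by simp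
          also have "\<dots> \<le> indicator U x + ennreal ?T" using True by (intro add_mono) auto
          finally show ?thesis .
        next
          case False
          have "{g. x + (1/\<tau>) *\<^sub>R g \<in> V \<delta>} \<subseteq> {g. \<tau> * \<delta> \<le> norm g}"
          proof safe
            fix g assume "x + (1/\<tau>) *\<^sub>R g \<in> V \<delta>"
            then have "x \<notin> ball (x + (1/\<tau>) *\<^sub>R g) \<delta>" using False by (auto simp: V_def)
            then show "\<tau> * \<delta> \<le> norm g" using \<open>\<tau> > 0\<close> by (simp add: dist_norm field_simps)
          qed
          then have "emeasure gauss {g. x + (1/\<tau>) *\<^sub>R g \<in> V \<delta>} \<le> emeasure gauss {g::'a. \<tau> * \<delta> \<le> norm g}"
            by (intro emeasure_mono) auto
          then show ?thesis using False by (simp add: gauss.emeasure_eq_measure)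
        qed
      qed
      also have "\<dots> = emeasure (\<mu>n n) U + ennreal ?T"
        using \<mu>n.emeasure_space_1[of n] by (subst nn_integral_add) auto
      finally show "(\<integral>\<^sup>+y. ennreal (c * p (\<mu>n n) y) * indicator (V \<delta>) y \<partial>lborel) \<le> emeasure (\<mu>n n) U + ennreal ?T" .
    qed
    also have "\<dots> = L + ennreal ?T"
      unfolding L_def by (rule Liminf_add_const) auto
    finally show ?thesis .
  qed
  have VL: "emeasure \<mu> (V (2 * \<delta>)) \<le> L" if "\<delta> > 0" for \<delta>
  proof -
    let ?T = "\<lambda>n::nat. measure gauss {g::'a. real n * \<delta> \<le> norm g}"
    have T0: "?T \<longlonglongrightarrow> 0" by (rule gauss_tail_tendsto_0) fact
    have l: "(\<lambda>n. ennreal (1 - ?T n) * emeasure \<mu> (V (2 * \<delta>))) \<longlonglongrightarrow> ennreal (1 - 0) * emeasure \<mu> (V (2 * \<delta>))"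
      by (intro tendsto_mult_ennreal tendsto_ennrealI tendsto_diff tendsto_const T0) auto
    have r: "(\<lambda>n. L + ennreal (?T n)) \<longlonglongrightarrow> L + ennreal 0"
      by (intro tendsto_add tendsto_ennrealI tendsto_const T0)
    have "ennreal (1 - 0) * emeasure \<mu> (V (2 * \<delta>)) \<le> L + ennreal 0"
      using main[OF _ that] by (intro LIMSEQ_le[OF l r]) (auto intro!: exI[of _ 1])
    then show ?thesis by simp
  qed
  have "(\<lambda>n::nat. emeasure \<mu> (V (2 * (1 / real (Suc n))))) \<longlonglongrightarrow> emeasure \<mu> (\<Union>n::nat. V (2 * (1 / real (Suc n))))"
  proof (rule Lim_emeasure_incseq)
    show "incseq (\<lambda>n::nat. V (2 * (1 / real (Suc n))))"
    proof (rule incseq_SucI)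
      fix n
      have "(2::real) * (1 / real (Suc (Suc n))) \<le> 2 * (1 / real (Suc n))" by (simp add: field_simps)
      then have "ball y (2 * (1 / real (Suc (Suc n)))) \<subseteq> ball y (2 * (1 / real (Suc n)))" for y :: 'a by (rule subset_ball)
      then show "V (2 * (1 / real (Suc n))) \<subseteq> V (2 * (1 / real (Suc (Suc n))))" unfolding V_def by blast
    qed
  qed auto
  moreover have "(\<Union>n::nat. V (2 * (1 / real (Suc n)))) = U"
  proof safe
    fix x and n :: nat assume x: "x \<in> V (2 * (1 / real (Suc n)))"
    have "x \<in> ball x (2 * (1 / real (Suc n)))" by simp
    then show "x \<in> U" using x by (auto simp: V_def simp del: mem_ball)
  next
    fix x assume "x \<in> U"
    then obtain e where e: "e > 0" "ball x e \<subseteq> U" using \<open>open U\<close> open_contains_ball by blast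
    then obtain n :: nat where "1 / real (Suc n) < e / 2" using nat_approx_posE[of "e/2"] by auto
    then have "ball x (2 * (1 / real (Suc n))) \<subseteq> ball x e" by (intro subset_ball) auto
    then show "x \<in> (\<Union>n::nat. V (2 * (1 / real (Suc n))))" using e by (auto simp: V_def)
  qed
  ultimately have lim: "(\<lambda>n::nat. emeasure \<mu> (V (2 * (1 / real (Suc n))))) \<longlonglongrightarrow> emeasure \<mu> U" by simp
  show ?thesis unfolding L_def[symmetric] by (rule LIMSEQ_le_const2[OF lim]) (intro exI allI impI VL, simp)
qed


text \<open>
  Equal characteristic functions are a constant convergent sequence, so the two measures agree
  on open sets.
\<close>

theorem char_fun_unique:
  fixes \<mu> :: "'a::euclidean_space measure"
  assumes \<mu>: "prob_space \<mu>" "sets \<mu> = sets borel" and \<nu>: "prob_space \<nu>" "sets \<nu> = sets borel"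
    and eq: "\<And>\<xi>. char_fun \<mu> \<xi> = char_fun \<nu> \<xi>"
  shows "\<mu> = \<nu>"
proof (rule measure_eqI_generator_eq[where \<Omega>=UNIV and E="{S. open S}" and A="\<lambda>_. UNIV"])
  fix U :: "'a set" assume "U \<in> {S. open S}"
  then have "open U" by simp
  have "emeasure \<mu> U \<le> emeasure \<nu> U"
    using emeasure_open_le_liminf[OF \<mu>, of "\<lambda>_. \<nu>", OF \<nu> _ \<open>open U\<close>] eq by (simp add: Liminf_const)
  moreover have "emeasure \<nu> U \<le> emeasure \<mu> U"
    using emeasure_open_le_liminf[OF \<nu>, of "\<lambda>_. \<mu>", OF \<mu> _ \<open>open U\<close>] eq by (simp add: Liminf_const)
  ultimately show "emeasure \<mu> U = emeasure \<nu> U" by simp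
next
  interpret \<mu>: prob_space \<mu> by fact
  show "emeasure \<mu> UNIV \<noteq> \<infinity>" by simp
qed (use assms in \<open>auto simp: Int_stable_def borel_def\<close>)

lemma min_one_le_one_minus_exp: "min 1 v \<le> 3 * (1 - exp (- v / 2))" if "0 \<le> v" for v :: real
proof -
  have "exp (- v / 2) = 1 / exp (v / 2)" by (simp add: exp_minus' )
  also have "\<dots> \<le> 1 / (1 + v / 2)"
    using that by (intro divide_left_mono exp_ge_add_one_self mult_pos_pos) auto
  finally have "1 - exp (- v / 2) \<ge> v / (2 + v)" using that by (simp add: field_simps)
  moreover have "min 1 v \<le> 3 * (v / (2 + v))"
  proof (cases "v \<le> 1")
    case True
    have "v * (2 + v) \<le> v * 3" using that True by (intro mult_left_mono) auto
    then show ?thesis using that True by (simp add: field_simps)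
  qed (use that in \<open>auto simp: field_simps\<close>)
  ultimately show ?thesis by (meson mult_left_mono order_trans zero_le_numeral)
qed

text \<open>
  Taking the bump centred at the origin bounds truncated second moments, hence tails, by the
  behaviour of the characteristic function near the origin.
\<close>

lemma truncated_second_moment_le:
  fixes \<mu> :: "'a::euclidean_space measure"
  assumes \<mu>: "prob_space \<mu>" and sets [measurable_cong]: "sets \<mu> = sets borel"
    and cf: "\<And>\<xi>. char_fun \<mu> \<xi> = complex_of_real (c \<xi>)"
    and le: "\<And>\<xi>. 1 - c \<xi> \<le> h * norm \<xi> powr a"
    and "0 \<le> h" "0 \<le> a" "a \<le> 2" "R > 0"
  shows "(\<integral>\<^sup>+x. ennreal (min 1 ((norm x / R)\<^sup>2)) \<partial>\<mu>) \<le>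
    ennreal (3 * h * R powr (- a) * gauss_moment TYPE('a))"
proof -
  interpret \<mu>: prob_space \<mu> by fact
  have cm [measurable]: "c \<in> borel_measurable borel"
  proof -
    have "(\<lambda>\<xi>. Re (char_fun \<mu> \<xi>)) \<in> borel_measurable borel"
      using char_fun_measurable[OF \<mu> sets] by measurable
    then show ?thesis by (simp add: cf)
  qed
  have c1: "\<bar>c \<xi>\<bar> \<le> 1" for \<xi> using norm_char_fun_le_1[OF \<mu> sets, of \<xi>] by (simp add: cf)
  have i1: "integrable \<mu> (\<lambda>x. exp (- (1 / R * norm x)\<^sup>2 / 2))"
    by (rule \<mu>.integrable_const_bound[where B=1]) auto
  have i2: "integrable gauss (\<lambda>g. c ((1 / R) *\<^sub>R g))"
    by (rule gauss.integrable_const_bound[where B=1]) (use c1 in auto)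
  have "complex_of_real (\<integral>x. exp (- (1 / R * norm x)\<^sup>2 / 2) \<partial>\<mu>) = complex_of_real (\<integral>g. c ((1 / R) *\<^sub>R g) \<partial>gauss)"
    using integral_gaussian_bump[OF \<mu> sets, of "1/R" 0] by (simp add: cf)
  then have eq: "(\<integral>x. exp (- (1 / R * norm x)\<^sup>2 / 2) \<partial>\<mu>) = (\<integral>g. c ((1 / R) *\<^sub>R g) \<partial>gauss)"
    by (simp only: of_real_eq_iff)
  have "(\<integral>\<^sup>+x. ennreal (min 1 ((norm x / R)\<^sup>2)) \<partial>\<mu>) \<le> (\<integral>\<^sup>+x. ennreal (3 * (1 - exp (- (1 / R * norm x)\<^sup>2 / 2))) \<partial>\<mu>)"
    by (intro nn_integral_mono ennreal_leI) (use min_one_le_one_minus_exp[of "(norm x / R)\<^sup>2" for x] in simp)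
  also have "\<dots> = ennreal (\<integral>x. 3 * (1 - exp (- (1 / R * norm x)\<^sup>2 / 2)) \<partial>\<mu>)"
    using i1 by (intro nn_integral_eq_integral) auto
  also have "(\<integral>x. 3 * (1 - exp (- (1 / R * norm x)\<^sup>2 / 2)) \<partial>\<mu>) = 3 * (\<integral>g. 1 - c ((1 / R) *\<^sub>R g) \<partial>gauss)"
  proof -
    have "(\<integral>x. 3 * (1 - exp (- (1 / R * norm x)\<^sup>2 / 2)) \<partial>\<mu>) = 3 * (1 - (\<integral>x. exp (- (1 / R * norm x)\<^sup>2 / 2) \<partial>\<mu>))"
      using i1 by (simp add: \<mu>.prob_space)
    also have "\<dots> = 3 * (1 - (\<integral>g. c ((1 / R) *\<^sub>R g) \<partial>gauss))" by (simp only: eq)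
    also have "\<dots> = 3 * (\<integral>g. 1 - c ((1 / R) *\<^sub>R g) \<partial>gauss)"
      using i2 gauss.prob_space[unfolded space_gauss] by simp
    finally show ?thesis .
  qed
  also have "\<dots> \<le> 3 * (\<integral>g. (h * R powr (- a)) * norm g powr a \<partial>(gauss::'a measure))"
  proof (intro mult_left_mono integral_mono)
    fix g :: 'a
    show "1 - c ((1 / R) *\<^sub>R g) \<le> (h * R powr (- a)) * norm g powr a"
      using le[of "(1 / R) *\<^sub>R g"] \<open>R > 0\<close> by (simp add: powr_divide powr_minus field_simps)
  qed (use i2 assms in \<open>auto intro!: integrable_gauss_powr\<close>)
  also have "\<dots> \<le> 3 * ((h * R powr (- a)) * gauss_moment TYPE('a))"
    using integrable_gauss_powr(2)[of a, where 'a='a] assms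
    by (auto intro!: mult_left_mono)
  finally show ?thesis by (simp add: mult.assoc ennreal_leI)
qed


section \<open>Convolutions and compound Poisson laws\<close>

definition law_conv :: "'a::euclidean_space measure \<Rightarrow> 'a measure \<Rightarrow> 'a measure" where
  "law_conv \<mu> \<nu> = distr (\<mu> \<Otimes>\<^sub>M \<nu>) borel (\<lambda>(x, y). x + y)"

lemma sets_law_conv [simp, measurable_cong]: "sets (law_conv \<mu> \<nu>) = sets borel"
  and space_law_conv [simp]: "space (law_conv \<mu> \<nu>) = UNIV"
  by (auto simp: law_conv_def)

context
  fixes \<mu> \<nu> :: "'a::euclidean_space measure"
  assumes \<mu>: "prob_space \<mu>" and [measurable_cong]: "sets \<mu> = sets borel"
    and \<nu>: "prob_space \<nu>" and [measurable_cong]: "sets \<nu> = sets borel"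
begin

interpretation \<mu>: prob_space \<mu> by (rule \<mu>)
interpretation \<nu>: prob_space \<nu> by (rule \<nu>)
interpretation P: pair_prob_space \<mu> \<nu> ..

lemma prob_space_law_conv: "prob_space (law_conv \<mu> \<nu>)"
  unfolding law_conv_def by (rule P.prob_space_distr) measurable

lemma nn_integral_law_conv:
  assumes [measurable]: "f \<in> borel_measurable borel"
  shows "(\<integral>\<^sup>+x. f x \<partial>law_conv \<mu> \<nu>) = (\<integral>\<^sup>+x. \<integral>\<^sup>+y. f (x + y) \<partial>\<nu> \<partial>\<mu>)"
proof -
  have "(\<integral>\<^sup>+x. f x \<partial>law_conv \<mu> \<nu>) = (\<integral>\<^sup>+z. f (fst z + snd z) \<partial>(\<mu> \<Otimes>\<^sub>M \<nu>))"
    unfolding law_conv_def by (subst nn_integral_distr) (auto simp: split_beta')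
  also have "\<dots> = (\<integral>\<^sup>+x. \<integral>\<^sup>+y. f (x + y) \<partial>\<nu> \<partial>\<mu>)"
    by (subst \<nu>.nn_integral_fst[symmetric]) auto
  finally show ?thesis .
qed

lemma char_fun_law_conv: "char_fun (law_conv \<mu> \<nu>) \<xi> = char_fun \<mu> \<xi> * char_fun \<nu> \<xi>"
proof -
  have "char_fun (law_conv \<mu> \<nu>) \<xi> = (CLINT z|\<mu> \<Otimes>\<^sub>M \<nu>. iexp (\<xi> \<bullet> (fst z + snd z)))"
    unfolding char_fun_def law_conv_def by (subst integral_distr) (auto simp: split_beta')
  also have "\<dots> = (CLINT x|\<mu>. CLINT y|\<nu>. iexp (\<xi> \<bullet> (x + y)))"
    by (subst P.integral_fst'[symmetric]) (auto intro!: P.integrable_const_bound[where B=1])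
  also have "\<dots> = (CLINT x|\<mu>. CLINT y|\<nu>. iexp (\<xi> \<bullet> x) * iexp (\<xi> \<bullet> y))"
    by (simp add: inner_add_right distrib_left exp_add)
  finally show ?thesis by (simp add: char_fun_def)
qed

end

fun conv_pow :: "'a::euclidean_space measure \<Rightarrow> nat \<Rightarrow> 'a measure" where
  "conv_pow \<pi> 0 = return borel 0"
| "conv_pow \<pi> (Suc k) = law_conv (conv_pow \<pi> k) \<pi>"

lemma sets_conv_pow [simp, measurable_cong]: "sets (conv_pow \<pi> k) = sets borel"
  by (cases k) auto

lemma space_conv_pow [simp]: "space (conv_pow \<pi> k) = UNIV"
  by (cases k) auto

definition compound_poisson :: "real \<Rightarrow> 'a::euclidean_space measure \<Rightarrow> 'a measure" where
  "compound_poisson r \<pi> = measure_pmf (poisson_pmf r) \<bind> conv_pow \<pi>"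

context
  fixes \<pi> :: "'a::euclidean_space measure" and r :: real
  assumes \<pi>: "prob_space \<pi>" and s\<pi> [measurable_cong]: "sets \<pi> = sets borel" and r: "0 < r"
begin

interpretation \<pi>: prob_space \<pi> by (rule \<pi>)

lemma prob_space_conv_pow: "prob_space (conv_pow \<pi> k)"
  by (induction k) (auto simp: prob_space_return intro!: prob_space_law_conv \<pi> s\<pi>)

lemma conv_pow_measurable: "conv_pow \<pi> \<in> measurable (measure_pmf p) (subprob_algebra borel)"
  using prob_space_conv_pow by (auto simp: space_subprob_algebra prob_space_imp_subprob_space measurable_pmf_measure1)

lemma sets_compound_poisson [simp, measurable_cong]: "sets (compound_poisson r \<pi>) = sets borel"
  unfolding compound_poisson_def by (rule sets_bind[OF sets_kernel[OF conv_pow_measurable]]) auto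

lemma space_compound_poisson [simp]: "space (compound_poisson r \<pi>) = UNIV"
  using sets_compound_poisson by (metis sets_eq_imp_space_eq space_borel)

lemma nn_integral_compound_poisson:
  assumes [measurable]: "f \<in> borel_measurable borel"
  shows "(\<integral>\<^sup>+x. f x \<partial>compound_poisson r \<pi>) =
    (\<Sum>k. ennreal (r ^ k / fact k * exp (- r)) * (\<integral>\<^sup>+x. f x \<partial>conv_pow \<pi> k))"
  unfolding compound_poisson_def
  by (subst nn_integral_bind[OF _ conv_pow_measurable])
     (auto simp: nn_integral_measure_pmf nn_integral_count_space_nat r)

lemma poisson_weights_sums: "(\<lambda>k. r ^ k / fact k * exp (- r)) sums 1"
proof -
  have "(\<lambda>k. r ^ k / fact k * exp (- r)) sums (exp r * exp (- r))"
    using exp_converges[of r] by (intro sums_mult2) (simp add: divide_inverse mult.commute scaleR_conv_of_real)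
  then show ?thesis by (simp add: exp_minus)
qed

lemma prob_space_compound_poisson: "prob_space (compound_poisson r \<pi>)"
proof (rule prob_spaceI)
  have "emeasure (compound_poisson r \<pi>) UNIV = (\<integral>\<^sup>+x. 1 \<partial>compound_poisson r \<pi>)" by simp
  also have "\<dots> = (\<Sum>k. ennreal (r ^ k / fact k * exp (- r)))"
    using prob_space.emeasure_space_1[OF prob_space_conv_pow] by (subst nn_integral_compound_poisson) auto
  also have "\<dots> = ennreal 1"
    using poisson_weights_sums r by (subst suminf_ennreal2) (auto simp: sums_iff)
  finally show "emeasure (compound_poisson r \<pi>) (space (compound_poisson r \<pi>)) = 1" by simp
qed

lemma integral_compound_poisson_sums:
  fixes f :: "'a \<Rightarrow> real"
  assumes [measurable]: "f \<in> borel_measurable borel" and B: "\<And>x. \<bar>f x\<bar> \<le> B"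
  shows "(\<lambda>k. r ^ k / fact k * exp (- r) * (\<integral>x. f x \<partial>conv_pow \<pi> k)) sums (\<integral>x. f x \<partial>compound_poisson r \<pi>)"
proof -
  interpret C: prob_space "compound_poisson r \<pi>" by (rule prob_space_compound_poisson)
  interpret K: prob_space "conv_pow \<pi> k" for k by (rule prob_space_conv_pow)
  let ?p = "\<lambda>k. r ^ k / fact k * exp (- r)" and ?g = "\<lambda>x. f x + B"
  have B0: "0 \<le> B" using B[of 0] by linarith
  have g0: "0 \<le> ?g x" "?g x \<le> 2 * B" for x using B[of x] by linarith+
  have iC: "integrable (compound_poisson r \<pi>) ?g"
    by (rule C.integrable_const_bound[where B="2*B"]) (use g0 in auto)
  have iK: "integrable (conv_pow \<pi> k) ?g" for k
    by (rule K.integrable_const_bound[where B="2*B"]) (use g0 in auto)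
  have iC': "integrable (compound_poisson r \<pi>) f"
    by (rule C.integrable_const_bound[where B="B"]) (use B in auto)
  have iK': "integrable (conv_pow \<pi> k) f" for k
    by (rule K.integrable_const_bound[where B="B"]) (use B in auto)
  have p0: "0 \<le> ?p k" for k using r by simp
  have I0: "0 \<le> (\<integral>x. ?g x \<partial>conv_pow \<pi> k)" for k using g0 by (intro Bochner_Integration.integral_nonneg) auto
  have I1: "(\<integral>x. ?g x \<partial>conv_pow \<pi> k) \<le> 2 * B" for k
  proof -
    have "(\<integral>x. ?g x \<partial>conv_pow \<pi> k) \<le> (\<integral>x. 2 * B \<partial>conv_pow \<pi> k)"
      by (rule integral_mono[OF iK _ g0(2)]) simp
    also have "\<dots> = 2 * B" using K.prob_space[of k] by simp
    finally show ?thesis .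
  qed
  have sm: "summable (\<lambda>k. ?p k * (\<integral>x. ?g x \<partial>conv_pow \<pi> k))"
  proof (rule summable_comparison_test')
    show "summable (\<lambda>k. ?p k * (2 * B))" by (intro summable_mult2 sums_summable[OF poisson_weights_sums])
    show "norm (?p k * (\<integral>x. ?g x \<partial>conv_pow \<pi> k)) \<le> ?p k * (2 * B)" if "k \<ge> 0" for k
      unfolding real_norm_def abs_of_nonneg[OF mult_nonneg_nonneg[OF p0 I0]] by (rule mult_left_mono[OF I1 p0])
  qed
  have "ennreal (\<integral>x. ?g x \<partial>compound_poisson r \<pi>) = (\<integral>\<^sup>+x. ennreal (?g x) \<partial>compound_poisson r \<pi>)"
    using iC g0 by (intro nn_integral_eq_integral[symmetric]) auto
  also have "\<dots> = (\<Sum>k. ennreal (?p k * (\<integral>x. ?g x \<partial>conv_pow \<pi> k)))"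
  proof -
    have "(\<integral>\<^sup>+x. ennreal (?g x) \<partial>conv_pow \<pi> k) = ennreal (\<integral>x. ?g x \<partial>conv_pow \<pi> k)" for k
      using g0 by (intro nn_integral_eq_integral iK) auto
    then show ?thesis
      unfolding ennreal_mult'[OF p0] by (simp add: nn_integral_compound_poisson)
  qed
  also have "\<dots> = ennreal (\<Sum>k. ?p k * (\<integral>x. ?g x \<partial>conv_pow \<pi> k))"
    by (intro suminf_ennreal2 mult_nonneg_nonneg p0 I0 sm)
  finally have "ennreal (\<integral>x. ?g x \<partial>compound_poisson r \<pi>) = ennreal (\<Sum>k. ?p k * (\<integral>x. ?g x \<partial>conv_pow \<pi> k))" .
  moreover have "0 \<le> (\<integral>x. ?g x \<partial>compound_poisson r \<pi>)"
    by (intro Bochner_Integration.integral_nonneg g0)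
  moreover have "0 \<le> (\<Sum>k. ?p k * (\<integral>x. ?g x \<partial>conv_pow \<pi> k))"
    by (intro suminf_nonneg mult_nonneg_nonneg p0 I0 sm)
  ultimately have "(\<integral>x. ?g x \<partial>compound_poisson r \<pi>) = (\<Sum>k. ?p k * (\<integral>x. ?g x \<partial>conv_pow \<pi> k))"
    by (simp only: ennreal_inj)
  then have "(\<lambda>k. ?p k * (\<integral>x. ?g x \<partial>conv_pow \<pi> k)) sums (\<integral>x. ?g x \<partial>compound_poisson r \<pi>)"
    using sm by (simp add: sums_iff)
  then have "(\<lambda>k. ?p k * (\<integral>x. ?g x \<partial>conv_pow \<pi> k) - ?p k * B) sums ((\<integral>x. ?g x \<partial>compound_poisson r \<pi>) - 1 * B)"
    by (intro sums_diff sums_mult2 poisson_weights_sums)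
  then show ?thesis
    using iC' iK' C.prob_space K.prob_space by (simp add: algebra_simps)
qed

lemma char_fun_conv_pow: "char_fun (conv_pow \<pi> k) \<xi> = char_fun \<pi> \<xi> ^ k"
proof (induction k)
  case 0
  have "char_fun (return borel (0::'a)) \<xi> = iexp (\<xi> \<bullet> 0)"
    unfolding char_fun_def by (rule integral_return) auto
  then show ?case by simp
next
  case (Suc k)
  then show ?case
    using char_fun_law_conv[OF prob_space_conv_pow _ \<pi> s\<pi>] by simp
qed

lemma char_fun_compound_poisson: "char_fun (compound_poisson r \<pi>) \<xi> = exp (r * (char_fun \<pi> \<xi> - 1))"
proof -
  interpret C: prob_space "compound_poisson r \<pi>" by (rule prob_space_compound_poisson)
  interpret K: prob_space "conv_pow \<pi> k" for k by (rule prob_space_conv_pow)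
  have iexp_split: "(CLINT x|m. iexp (\<xi> \<bullet> x)) = Complex (\<integral>x. cos (\<xi> \<bullet> x) \<partial>m) (\<integral>x. sin (\<xi> \<bullet> x) \<partial>m)"
    if "prob_space m" "sets m = sets borel" for m :: "'a measure"
  proof -
    interpret prob_space m by fact
    note that(2)[measurable_cong]
    have "integrable m (\<lambda>x. iexp (\<xi> \<bullet> x))" by (rule integrable_const_bound[where B=1]) auto
    then show ?thesis
      by (simp add: complex_eq_iff integral_Re[symmetric] integral_Im[symmetric] Re_exp Im_exp del: integral_Re integral_Im)
  qed
  let ?p = "\<lambda>k. r ^ k / fact k * exp (- r)"
  have "(\<lambda>k. Complex (?p k * (\<integral>x. cos (\<xi> \<bullet> x) \<partial>conv_pow \<pi> k)) (?p k * (\<integral>x. sin (\<xi> \<bullet> x) \<partial>conv_pow \<pi> k)))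
      sums Complex (\<integral>x. cos (\<xi> \<bullet> x) \<partial>compound_poisson r \<pi>) (\<integral>x. sin (\<xi> \<bullet> x) \<partial>compound_poisson r \<pi>)"
    unfolding sums_complex_iff complex.sel
    by (intro conjI integral_compound_poisson_sums[where B=1]) auto
  moreover have "Complex (?p k * (\<integral>x. cos (\<xi> \<bullet> x) \<partial>conv_pow \<pi> k)) (?p k * (\<integral>x. sin (\<xi> \<bullet> x) \<partial>conv_pow \<pi> k)) =
      ?p k * char_fun \<pi> \<xi> ^ k" for k
    unfolding char_fun_conv_pow[symmetric] unfolding char_fun_def iexp_split[OF prob_space_conv_pow sets_conv_pow]
    by (rule complex_eqI)
       (simp_all only: times_complex.sel complex.sel Re_complex_of_real Im_complex_of_real mult_zero_left
         diff_zero add_0_right add_0_left)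
  ultimately have "(\<lambda>k. ?p k * char_fun \<pi> \<xi> ^ k) sums char_fun (compound_poisson r \<pi>) \<xi>"
    by (simp add: char_fun_def iexp_split[OF prob_space_compound_poisson sets_compound_poisson])
  moreover have "(\<lambda>k. ?p k * char_fun \<pi> \<xi> ^ k) sums (exp (r * char_fun \<pi> \<xi>) * complex_of_real (exp (- r)))"
  proof -
    have "(\<lambda>k. (r * char_fun \<pi> \<xi>) ^ k /\<^sub>R fact k * complex_of_real (exp (- r))) sums
        (exp (r * char_fun \<pi> \<xi>) * complex_of_real (exp (- r)))"
      by (intro sums_mult2 exp_converges)
    moreover have "(r * char_fun \<pi> \<xi>) ^ k /\<^sub>R fact k * complex_of_real (exp (- r)) = ?p k * char_fun \<pi> \<xi> ^ k" for k
      by (simp add: scaleR_conv_of_real power_mult_distrib divide_inverse)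
    ultimately show ?thesis by simp
  qed
  ultimately have "char_fun (compound_poisson r \<pi>) \<xi> = exp (r * char_fun \<pi> \<xi>) * complex_of_real (exp (- r))"
    by (rule sums_unique2)
  then show ?thesis by (simp add: exp_of_real exp_add[symmetric] right_diff_distrib exp_diff exp_minus divide_inverse)
qed

text \<open>Keep the event that there is exactly one jump.\<close>

lemma nn_integral_compound_poisson_ge:
  assumes [measurable]: "f \<in> borel_measurable borel"
  shows "ennreal (r * exp (- r)) * (\<integral>\<^sup>+x. f x \<partial>\<pi>) \<le> (\<integral>\<^sup>+x. f x \<partial>compound_poisson r \<pi>)"
proof -
  have "(\<integral>\<^sup>+x. f x \<partial>conv_pow \<pi> 1) = (\<integral>\<^sup>+x. f x \<partial>\<pi>)"
    by (simp add: nn_integral_law_conv prob_space_return \<pi> s\<pi> nn_integral_return)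
  then have "ennreal (r * exp (- r)) * (\<integral>\<^sup>+x. f x \<partial>\<pi>) =
     (\<Sum>k\<in>{1::nat}. ennreal (r ^ k / fact k * exp (- r)) * (\<integral>\<^sup>+x. f x \<partial>conv_pow \<pi> k))" by simp
  also have "\<dots> \<le> (\<Sum>k. ennreal (r ^ k / fact k * exp (- r)) * (\<integral>\<^sup>+x. f x \<partial>conv_pow \<pi> k))"
    by (intro sum_le_suminf) auto
  finally show ?thesis by (simp add: nn_integral_compound_poisson)
qed

text \<open>
  One jump multiplies the mean of \<open>f\<close> by at most \<open>1 + C\<close>, and a Poisson number of factors
  \<open>1 + C\<close> has mean \<open>exp (r C)\<close>.
\<close>

lemma nn_integral_compound_poisson_Lyapunov:
  assumes [measurable]: "f \<in> borel_measurable borel" and "0 \<le> C"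
    and f: "\<And>x. (\<integral>\<^sup>+z. f (x + z) \<partial>\<pi>) \<le> ennreal (1 + C) * f x"
  shows "(\<integral>\<^sup>+x. f x \<partial>compound_poisson r \<pi>) \<le> ennreal (exp (r * C)) * f 0"
proof -
  have pow: "(\<integral>\<^sup>+x. f x \<partial>conv_pow \<pi> k) \<le> ennreal ((1 + C) ^ k) * f 0" for k
  proof (induction k)
    case 0
    show ?case by (simp add: nn_integral_return)
  next
    case (Suc k)
    have "(\<integral>\<^sup>+x. f x \<partial>conv_pow \<pi> (Suc k)) = (\<integral>\<^sup>+x. \<integral>\<^sup>+z. f (x + z) \<partial>\<pi> \<partial>conv_pow \<pi> k)"
      by (simp add: nn_integral_law_conv prob_space_conv_pow \<pi> s\<pi>)
    also have "\<dots> \<le> (\<integral>\<^sup>+x. ennreal (1 + C) * f x \<partial>conv_pow \<pi> k)"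
      by (intro nn_integral_mono f)
    also have "\<dots> \<le> ennreal (1 + C) * (ennreal ((1 + C) ^ k) * f 0)"
      using Suc by (simp add: nn_integral_cmult mult_left_mono)
    finally show ?case using \<open>0 \<le> C\<close> by (simp add: ennreal_mult mult.assoc)
  qed
  have s: "(\<lambda>k. r ^ k / fact k * exp (- r) * (1 + C) ^ k) sums exp (r * C)"
  proof -
    have "(\<lambda>k. (r * (1 + C)) ^ k /\<^sub>R fact k * exp (- r)) sums (exp (r * (1 + C)) * exp (- r))"
      by (intro sums_mult2 exp_converges)
    moreover have "(r * (1 + C)) ^ k /\<^sub>R fact k * exp (- r) = r ^ k / fact k * exp (- r) * (1 + C) ^ k" for k
      by (simp add: power_mult_distrib divide_inverse)
    ultimately show ?thesis by (simp add: exp_add[symmetric] distrib_left)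
  qed
  have "(\<integral>\<^sup>+x. f x \<partial>compound_poisson r \<pi>) \<le>
     (\<Sum>k. ennreal (r ^ k / fact k * exp (- r)) * (ennreal ((1 + C) ^ k) * f 0))"
    unfolding nn_integral_compound_poisson[OF assms(1)]
    by (intro suminf_le mult_left_mono pow) auto
  also have "\<dots> = (\<Sum>k. ennreal (r ^ k / fact k * exp (- r) * (1 + C) ^ k) * f 0)"
    using r \<open>0 \<le> C\<close>
    by (intro arg_cong[where f=suminf] ext) (subst mult.assoc[symmetric], subst ennreal_mult[symmetric], auto)
  also have "\<dots> = (\<Sum>k. ennreal (r ^ k / fact k * exp (- r) * (1 + C) ^ k)) * f 0"
    by (rule ennreal_suminf_multc)
  also have "(\<Sum>k. ennreal (r ^ k / fact k * exp (- r) * (1 + C) ^ k)) = ennreal (exp (r * C))"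
    using s r \<open>0 \<le> C\<close> by (subst suminf_ennreal2) (auto simp: sums_iff)
  finally show ?thesis .
qed

end


section \<open>Laws with a symmetric Levy exponent\<close>

text \<open>
  The part of the characteristic exponent that is due to jumps in \<open>S\<close>. The sine part of the
  Levy-Khinchin formula cancels for symmetric \<open>S\<close> and \<open>\<nu>\<close>.
\<close>

definition levy_exponent_on :: "'a::euclidean_space measure \<Rightarrow> 'a set \<Rightarrow> 'a \<Rightarrow> real" where
  "levy_exponent_on \<nu> S \<xi> = (\<integral>z. indicator S z * (1 - cos (\<xi> \<bullet> z)) \<partial>\<nu>)"

definition normalized_on :: "'a::euclidean_space measure \<Rightarrow> 'a set \<Rightarrow> 'a measure" where
  "normalized_on \<nu> S = density \<nu> (\<lambda>z. ennreal (indicator S z / measure \<nu> S))"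

text \<open>
  The law at time \<open>h\<close> of the process that makes only the jumps in \<open>S\<close>. If \<open>S\<close> is null there
  are no jumps, and \<open>normalized_on\<close> is not a probability measure.
\<close>

definition jump_law :: "'a::euclidean_space measure \<Rightarrow> 'a set \<Rightarrow> real \<Rightarrow> 'a measure" where
  "jump_law \<nu> S h = (if measure \<nu> S = 0 then return borel 0
     else compound_poisson (h * measure \<nu> S) (normalized_on \<nu> S))"

lemma one_minus_cos_le: "1 - cos x \<le> x\<^sup>2 / 2" for x :: real
proof -
  have "1 - cos x = 2 * (sin (x / 2))\<^sup>2" using cos_double_sin[of "x/2"] by simp
  also have "(sin (x / 2))\<^sup>2 \<le> (x / 2)\<^sup>2" using abs_sin_x_le_abs_x[of "x/2"] by (rule abs_le_square_iff[THEN iffD1])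
  finally show ?thesis by (simp add: power_divide)
qed

lemma one_minus_cos_inner_le: "1 - cos (\<xi> \<bullet> z) \<le> (2 + (norm \<xi>)\<^sup>2) * min 1 ((norm z)\<^sup>2)"
  for \<xi> z :: "'a::euclidean_space"
proof (cases "norm z \<le> 1")
  case True
  have "(\<xi> \<bullet> z)\<^sup>2 \<le> (norm \<xi> * norm z)\<^sup>2"
    using Cauchy_Schwarz_ineq2[of \<xi> z] by (intro abs_le_square_iff[THEN iffD1]) simp
  then have "1 - cos (\<xi> \<bullet> z) \<le> (norm \<xi>)\<^sup>2 * (norm z)\<^sup>2"
    using one_minus_cos_le[of "\<xi> \<bullet> z"] zero_le_power2[of "\<xi> \<bullet> z"] unfolding power_mult_distrib by linarith
  also have "\<dots> \<le> (2 + (norm \<xi>)\<^sup>2) * (norm z)\<^sup>2" by (intro mult_right_mono) auto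
  finally show ?thesis using True by (simp add: power_le_one min_absorb2)
next
  case False
  then have "1 \<le> (norm z)\<^sup>2" by (simp add: one_le_power)
  have "1 - cos (\<xi> \<bullet> z) \<le> 2" using cos_ge_minus_one[of "\<xi> \<bullet> z"] by linarith
  also have "\<dots> \<le> (2 + (norm \<xi>)\<^sup>2) * 1" by simp
  finally show ?thesis using \<open>1 \<le> (norm z)\<^sup>2\<close> by (simp add: min_absorb1)
qed

locale symmetric_levy_measure =
  fixes \<nu> :: "'a::euclidean_space measure"
  assumes levy: "levy_measure \<nu>" and symm: "distr \<nu> borel uminus = \<nu>"
begin

lemma sets_\<nu> [simp, measurable_cong]: "sets \<nu> = sets borel"
  using levy by (simp add: levy_measure_def)

lemma space_\<nu> [simp]: "space \<nu> = UNIV"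
  using sets_eq_imp_space_eq[OF sets_\<nu>] by simp

lemma nn_min_finite: "(\<integral>\<^sup>+z. ennreal (min 1 ((norm z)\<^sup>2)) \<partial>\<nu>) < \<infinity>"
  using levy by (simp add: levy_measure_def)

lemma integrable_min: "integrable \<nu> (\<lambda>z. min 1 ((norm z)\<^sup>2))"
  using nn_min_finite by (intro integrableI_bounded) (auto simp: min_def)

lemma emeasure_far_finite:
  assumes [measurable]: "S \<in> sets borel" and "0 < \<epsilon>" "\<And>z. z \<in> S \<Longrightarrow> \<epsilon> \<le> norm z"
  shows "emeasure \<nu> S < \<infinity>"
proof -
  have e: "0 < min 1 (\<epsilon>\<^sup>2)" using \<open>0 < \<epsilon>\<close> by simp
  have "ennreal (min 1 (\<epsilon>\<^sup>2)) * emeasure \<nu> S = (\<integral>\<^sup>+z. ennreal (min 1 (\<epsilon>\<^sup>2)) * indicator S z \<partial>\<nu>)"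
    by (simp add: nn_integral_cmult_indicator)
  also have "\<dots> \<le> (\<integral>\<^sup>+z. ennreal (min 1 ((norm z)\<^sup>2)) \<partial>\<nu>)"
  proof (intro nn_integral_mono)
    fix z
    show "ennreal (min 1 (\<epsilon>\<^sup>2)) * indicator S z \<le> ennreal (min 1 ((norm z)\<^sup>2))"
    proof (cases "z \<in> S")
      case True
      then have "\<epsilon>\<^sup>2 \<le> (norm z)\<^sup>2" using assms by (intro power_mono) auto
      then show ?thesis using True by (auto intro!: ennreal_leI simp: min_def)
    qed simp
  qed
  also have "\<dots> < \<infinity>" by (rule nn_min_finite)
  finally show ?thesis using e by (auto simp: ennreal_mult_less_top less_top)
qed

lemma nn_integral_uminus:
  assumes [measurable]: "f \<in> borel_measurable borel"
  shows "(\<integral>\<^sup>+z. f (- z) \<partial>\<nu>) = (\<integral>\<^sup>+z. f z \<partial>\<nu>)"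
  by (subst (2) symm[symmetric], subst nn_integral_distr) auto

lemma integral_uminus:
  fixes f :: "'a \<Rightarrow> real"
  assumes [measurable]: "f \<in> borel_measurable borel"
  shows "(\<integral>z. f (- z) \<partial>\<nu>) = (\<integral>z. f z \<partial>\<nu>)"
  by (subst (2) symm[symmetric], subst integral_distr) auto

lemma integrable_levy_exponent:
  assumes [measurable]: "S \<in> sets borel"
  shows "integrable \<nu> (\<lambda>z. indicator S z * (1 - cos (\<xi> \<bullet> z)))"
proof (rule Bochner_Integration.integrable_bound)
  show "integrable \<nu> (\<lambda>z. (2 + (norm \<xi>)\<^sup>2) * min 1 ((norm z)\<^sup>2))" using integrable_min by simp
  show "AE z in \<nu>. norm (indicator S z * (1 - cos (\<xi> \<bullet> z)) :: real) \<le> norm ((2 + (norm \<xi>)\<^sup>2) * min 1 ((norm z)\<^sup>2))"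
    using one_minus_cos_inner_le[of \<xi>] cos_le_one
    by (auto simp: indicator_def abs_mult intro!: AE_I2)
qed measurable

lemma levy_exponent_on_mono:
  assumes "S \<in> sets borel" "T \<in> sets borel" "S \<subseteq> T"
  shows "levy_exponent_on \<nu> S \<xi> \<le> levy_exponent_on \<nu> T \<xi>"
  unfolding levy_exponent_on_def using assms
  by (intro integral_mono integrable_levy_exponent) (auto simp: indicator_def)

lemma levy_exponent_on_Un:
  assumes "S \<in> sets borel" "T \<in> sets borel" "S \<inter> T = {}"
  shows "levy_exponent_on \<nu> (S \<union> T) \<xi> = levy_exponent_on \<nu> S \<xi> + levy_exponent_on \<nu> T \<xi>"
proof -
  have "levy_exponent_on \<nu> (S \<union> T) \<xi> = (\<integral>z. indicator S z * (1 - cos (\<xi> \<bullet> z)) + indicator T z * (1 - cos (\<xi> \<bullet> z)) \<partial>\<nu>)"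
    unfolding levy_exponent_on_def using assms(3)
    by (intro Bochner_Integration.integral_cong) (auto simp: indicator_def)
  also have "\<dots> = levy_exponent_on \<nu> S \<xi> + levy_exponent_on \<nu> T \<xi>"
    unfolding levy_exponent_on_def by (intro Bochner_Integration.integral_add integrable_levy_exponent assms)
  finally show ?thesis .
qed

definition far :: "nat \<Rightarrow> 'a set" where "far n = {z. 1 / real (Suc n) < norm z}"

lemma far_sets [measurable]: "far n \<in> sets borel"
  unfolding far_def by measurable

text \<open>
  Cutting off the jumps of size at most \<open>1/(n+1)\<close> turns every law of the process into a limit of
  compound Poisson laws.
\<close>

lemma levy_exponent_on_far_tendsto:
  assumes [measurable]: "S \<in> sets borel"
  shows "(\<lambda>n. levy_exponent_on \<nu> (far n \<inter> S) \<xi>) \<longlonglongrightarrow> levy_exponent_on \<nu> S \<xi>"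
  unfolding levy_exponent_on_def
proof (rule integral_dominated_convergence)
  show "integrable \<nu> (\<lambda>z. (2 + (norm \<xi>)\<^sup>2) * min 1 ((norm z)\<^sup>2))" using integrable_min by simp
  show "AE z in \<nu>. norm (indicator (far i \<inter> S) z * (1 - cos (\<xi> \<bullet> z)) :: real) \<le> (2 + (norm \<xi>)\<^sup>2) * min 1 ((norm z)\<^sup>2)" for i
    using one_minus_cos_inner_le[of \<xi>] cos_le_one
    by (auto simp: indicator_def abs_mult intro!: AE_I2)
  show "AE z in \<nu>. (\<lambda>i. indicator (far i \<inter> S) z * (1 - cos (\<xi> \<bullet> z)) :: real) \<longlonglongrightarrow> indicator S z * (1 - cos (\<xi> \<bullet> z))"
  proof (intro AE_I2)
    fix z
    show "(\<lambda>i. indicator (far i \<inter> S) z * (1 - cos (\<xi> \<bullet> z)) :: real) \<longlonglongrightarrow> indicator S z * (1 - cos (\<xi> \<bullet> z))"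
    proof (cases "z = 0")
      case False
      then obtain n where n: "1 / real (Suc n) < norm z" using nat_approx_posE[of "norm z"] by auto
      have "z \<in> far i" if "i \<ge> n" for i
      proof -
        have "1 / real (Suc i) \<le> 1 / real (Suc n)" using that by (intro divide_left_mono) auto
        then show ?thesis using n by (simp add: far_def)
      qed
      then have "\<forall>\<^sub>F i in sequentially. indicator (far i \<inter> S) z * (1 - cos (\<xi> \<bullet> z)) = (indicator S z * (1 - cos (\<xi> \<bullet> z)) :: real)"
        by (intro eventually_sequentiallyI[of n]) (auto simp: indicator_def)
      then show ?thesis by (rule tendsto_eventually)
    qed simp
  qed
qed measurable

context
  fixes S :: "'a set" and \<epsilon> :: real
  assumes S [measurable]: "S \<in> sets borel" and \<epsilon>: "0 < \<epsilon>" and S_far: "\<And>z. z \<in> S \<Longrightarrow> \<epsilon> \<le> norm z"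
begin

lemma emeasure_S: "emeasure \<nu> S = ennreal (measure \<nu> S)"
  using emeasure_far_finite[OF S \<epsilon> S_far] by (intro emeasure_eq_ennreal_measure) auto

lemma sets_normalized_on [simp, measurable_cong]: "sets (normalized_on \<nu> S) = sets borel"
  by (simp add: normalized_on_def)

lemma nn_integral_normalized_on:
  assumes [measurable]: "f \<in> borel_measurable borel" and "0 < measure \<nu> S"
  shows "(\<integral>\<^sup>+z. f z \<partial>normalized_on \<nu> S) = ennreal (1 / measure \<nu> S) * (\<integral>\<^sup>+z. f z * indicator S z \<partial>\<nu>)"
proof -
  have "(\<integral>\<^sup>+z. f z \<partial>normalized_on \<nu> S) = (\<integral>\<^sup>+z. ennreal (1 / measure \<nu> S) * (f z * indicator S z) \<partial>\<nu>)"
    unfolding normalized_on_def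
    by (subst nn_integral_density) (auto intro!: nn_integral_cong simp: indicator_def mult.commute)
  then show ?thesis by (simp add: nn_integral_cmult)
qed

lemma prob_space_normalized_on:
  assumes "0 < measure \<nu> S"
  shows "prob_space (normalized_on \<nu> S)"
proof (rule prob_spaceI)
  have "emeasure (normalized_on \<nu> S) (space (normalized_on \<nu> S)) = (\<integral>\<^sup>+z. 1 \<partial>normalized_on \<nu> S)" by simp
  also have "\<dots> = ennreal (1 / measure \<nu> S) * ennreal (measure \<nu> S)"
    using nn_integral_normalized_on[OF _ assms, of "\<lambda>_. 1"] by (simp add: emeasure_S)
  also have "\<dots> = 1" using assms by (subst ennreal_mult[symmetric]) auto
  finally show "emeasure (normalized_on \<nu> S) (space (normalized_on \<nu> S)) = 1" .
qed

lemma prob_space_jump_law: "0 < h \<Longrightarrow> prob_space (jump_law \<nu> S h)"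
  by (auto simp: jump_law_def prob_space_return zero_less_measure_iff
       intro!: prob_space_compound_poisson prob_space_normalized_on)

lemma sets_jump_law [simp]: "0 < h \<Longrightarrow> sets (jump_law \<nu> S h) = sets borel"
  using sets_compound_poisson[OF prob_space_normalized_on sets_normalized_on, of "h * measure \<nu> S"]
  by (auto simp: jump_law_def zero_less_measure_iff)

text \<open>
  The path makes exactly one jump, and it lies in \<open>S\<close>: the rate is \<open>h\<close> times \<open>\<nu>\<close>, and
  \<open>exp (- h \<nu>(S))\<close> is the probability of no further jump.
\<close>

lemma nn_integral_jump_law_ge:
  assumes [measurable]: "f \<in> borel_measurable borel" and h: "0 < h"
  shows "ennreal (h * exp (- h * measure \<nu> S)) * (\<integral>\<^sup>+z. f z * indicator S z \<partial>\<nu>) \<le> (\<integral>\<^sup>+z. f z \<partial>jump_law \<nu> S h)"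
proof (cases "measure \<nu> S = 0")
  case True
  then have "emeasure \<nu> S = 0" by (simp add: emeasure_S)
  then have "AE z in \<nu>. f z * indicator S z = 0"
    by (intro AE_I[of _ _ S]) (auto simp: indicator_def split: if_splits)
  then have "(\<integral>\<^sup>+z. f z * indicator S z \<partial>\<nu>) = 0" by (subst nn_integral_0_iff_AE) auto
  then show ?thesis by simp
next
  case False
  then have pos: "0 < measure \<nu> S" by (simp add: zero_less_measure_iff)
  let ?m = "measure \<nu> S"
  have "ennreal (h * exp (- h * ?m)) * (\<integral>\<^sup>+z. f z * indicator S z \<partial>\<nu>) =
     ennreal (h * ?m * exp (- (h * ?m))) * (\<integral>\<^sup>+z. f z \<partial>normalized_on \<nu> S)"
    unfolding nn_integral_normalized_on[OF assms(1) pos] using pos h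
    by (simp add: mult.assoc[symmetric] ennreal_mult[symmetric])
  also have "\<dots> \<le> (\<integral>\<^sup>+z. f z \<partial>jump_law \<nu> S h)"
    using False nn_integral_compound_poisson_ge[OF prob_space_normalized_on[OF pos] sets_normalized_on _ assms(1), of "h * ?m"] pos h
    by (simp add: jump_law_def)
  finally show ?thesis .
qed

lemma nn_integral_jump_law_Lyapunov:
  assumes [measurable]: "f \<in> borel_measurable borel" and h: "0 < h" and "0 \<le> C"
    and f: "\<And>x. (\<integral>\<^sup>+z. f (x + z) * indicator S z \<partial>\<nu>) \<le> ennreal (measure \<nu> S + C) * f x"
  shows "(\<integral>\<^sup>+z. f z \<partial>jump_law \<nu> S h) \<le> ennreal (exp (h * C)) * f 0"
proof (cases "measure \<nu> S = 0")
  case True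
  have "ennreal 1 * f 0 \<le> ennreal (exp (h * C)) * f 0"
    using h \<open>0 \<le> C\<close> by (intro mult_right_mono ennreal_leI) auto
  then show ?thesis using True by (simp add: jump_law_def nn_integral_return)
next
  case False
  then have pos: "0 < measure \<nu> S" by (simp add: zero_less_measure_iff)
  let ?m = "measure \<nu> S"
  have *: "(\<integral>\<^sup>+z. f (x + z) \<partial>normalized_on \<nu> S) \<le> ennreal (1 + C / ?m) * f x" for x
  proof -
    have "(\<integral>\<^sup>+z. f (x + z) \<partial>normalized_on \<nu> S) \<le> ennreal (1 / ?m) * (ennreal (?m + C) * f x)"
      using f[of x] pos by (subst nn_integral_normalized_on) (auto intro!: mult_left_mono)
    also have "\<dots> = ennreal (1 + C / ?m) * f x"
      using pos \<open>0 \<le> C\<close> by (simp add: mult.assoc[symmetric] ennreal_mult[symmetric] add_divide_distrib del: ennreal_plus)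
    finally show ?thesis .
  qed
  have "(\<integral>\<^sup>+z. f z \<partial>jump_law \<nu> S h) \<le> ennreal (exp ((h * ?m) * (C / ?m))) * f 0"
    using nn_integral_compound_poisson_Lyapunov[OF prob_space_normalized_on[OF pos] sets_normalized_on _ assms(1) _ *, of "h * ?m"]
      False pos h \<open>0 \<le> C\<close> by (simp add: jump_law_def)
  then show ?thesis using pos by simp
qed

lemma char_fun_jump_law:
  assumes h: "0 < h" and sym: "\<And>z. - z \<in> S \<longleftrightarrow> z \<in> S"
  shows "char_fun (jump_law \<nu> S h) \<xi> = complex_of_real (exp (- h * levy_exponent_on \<nu> S \<xi>))"
proof (cases "measure \<nu> S = 0")
  case True
  then have "emeasure \<nu> S = 0" by (simp add: emeasure_S)
  then have "AE z in \<nu>. z \<notin> S" by (intro AE_I[of _ _ S]) auto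
  then have "AE z in \<nu>. indicator S z * (1 - cos (\<xi> \<bullet> z)) = (0::real)" by eventually_elim simp
  then have "levy_exponent_on \<nu> S \<xi> = (\<integral>z. 0 \<partial>\<nu>)" unfolding levy_exponent_on_def by (intro integral_cong_AE) auto
  moreover have "char_fun (return borel (0::'a)) \<xi> = iexp (\<xi> \<bullet> 0)"
    unfolding char_fun_def by (rule integral_return) auto
  ultimately show ?thesis using True by (simp add: jump_law_def)
next
  case False
  then have pos: "0 < measure \<nu> S" by (simp add: zero_less_measure_iff)
  let ?m = "measure \<nu> S"
  have fin: "emeasure \<nu> S < \<infinity>" by (rule emeasure_far_finite[OF S \<epsilon> S_far])
  have iS: "integrable \<nu> (indicator S :: _ \<Rightarrow> real)"
    using fin by (intro integrable_real_indicator) auto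
  have iC: "integrable \<nu> (\<lambda>z. indicator S z * cos (\<xi> \<bullet> z) :: real)"
    by (rule Bochner_Integration.integrable_bound[OF iS]) (auto simp: indicator_def)
  have ic: "integrable \<nu> (\<lambda>z. indicator S z *\<^sub>R iexp (\<xi> \<bullet> z))"
    by (rule Bochner_Integration.integrable_bound[OF iS]) (auto simp: indicator_def)
  have s0: "(\<integral>z. indicator S z * sin (\<xi> \<bullet> z) \<partial>\<nu>) = (0::real)"
    using integral_uminus[of "\<lambda>z. indicator S z * sin (\<xi> \<bullet> z)"] sym by (simp add: indicator_def)
  have c: "char_fun (normalized_on \<nu> S) \<xi> = complex_of_real (1 / ?m * (\<integral>z. indicator S z * cos (\<xi> \<bullet> z) \<partial>\<nu>))"
  proof -
    have "char_fun (normalized_on \<nu> S) \<xi> = (CLINT z|\<nu>. (1 / ?m) *\<^sub>R (indicator S z *\<^sub>R iexp (\<xi> \<bullet> z)))"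
      unfolding char_fun_def normalized_on_def by (subst integral_density) auto
    also have "\<dots> = (1 / ?m) *\<^sub>R (CLINT z|\<nu>. indicator S z *\<^sub>R iexp (\<xi> \<bullet> z))"
      by (rule integral_scaleR_right)
    also have "(CLINT z|\<nu>. indicator S z *\<^sub>R iexp (\<xi> \<bullet> z)) = complex_of_real (\<integral>z. indicator S z * cos (\<xi> \<bullet> z) \<partial>\<nu>)"
    proof (rule complex_eqI)
      show "Re (CLINT z|\<nu>. indicator S z *\<^sub>R iexp (\<xi> \<bullet> z)) = Re (complex_of_real (\<integral>z. indicator S z * cos (\<xi> \<bullet> z) \<partial>\<nu>))"
        unfolding integral_Re[OF ic, symmetric] by (simp add: Re_exp)
      show "Im (CLINT z|\<nu>. indicator S z *\<^sub>R iexp (\<xi> \<bullet> z)) = Im (complex_of_real (\<integral>z. indicator S z * cos (\<xi> \<bullet> z) \<partial>\<nu>))"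
        unfolding integral_Im[OF ic, symmetric] using s0 by (simp add: Im_exp)
    qed
    finally show ?thesis by (simp add: scaleR_conv_of_real)
  qed
  have "levy_exponent_on \<nu> S \<xi> = (\<integral>z. indicator S z - indicator S z * cos (\<xi> \<bullet> z) \<partial>\<nu>)"
    unfolding levy_exponent_on_def by (simp add: right_diff_distrib)
  also have "\<dots> = ?m - (\<integral>z. indicator S z * cos (\<xi> \<bullet> z) \<partial>\<nu>)"
    using iS iC by (subst Bochner_Integration.integral_diff) auto
  finally have e: "(\<integral>z. indicator S z * cos (\<xi> \<bullet> z) \<partial>\<nu>) = ?m - levy_exponent_on \<nu> S \<xi>" by simp
  have "char_fun (jump_law \<nu> S h) \<xi> = exp (complex_of_real (h * ?m) * (complex_of_real (1 / ?m * (?m - levy_exponent_on \<nu> S \<xi>)) - 1))"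
    using char_fun_compound_poisson[OF prob_space_normalized_on[OF pos] sets_normalized_on, of "h * ?m" \<xi>] False pos h
    by (simp add: jump_law_def c e)
  also have "\<dots> = exp (complex_of_real ((h * ?m) * (1 / ?m * (?m - levy_exponent_on \<nu> S \<xi>) - 1)))" by simp
  also have "(h * ?m) * (1 / ?m * (?m - levy_exponent_on \<nu> S \<xi>) - 1) = - h * levy_exponent_on \<nu> S \<xi>"
    using pos by (simp add: field_simps)
  finally show ?thesis by (simp only: exp_of_real)
qed

end

end


text \<open>
  The marginal laws of a process with exponent at most \<open>c\<^sub>1 |\<xi>|\<^sup>a\<close>. The exponent \<open>a\<close> governs
  the scaling: in time \<open>h\<close> the process moves by about \<open>h\<close> to the power \<open>1/a\<close>.
\<close>

locale levy_laws = symmetric_levy_measure \<nu> for \<nu> :: "'a::euclidean_space measure" +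
  fixes law :: "real \<Rightarrow> 'a measure" and c\<^sub>1 a :: real
  assumes prob_space_law: "0 < h \<Longrightarrow> prob_space (law h)"
    and sets_law: "0 < h \<Longrightarrow> sets (law h) = sets borel"
    and char_fun_law: "0 < h \<Longrightarrow> char_fun (law h) \<xi> = complex_of_real (exp (- h * levy_exponent_on \<nu> UNIV \<xi>))"
    and exponent_le: "levy_exponent_on \<nu> UNIV \<xi> \<le> c\<^sub>1 * norm \<xi> powr a"
    and c\<^sub>1: "0 < c\<^sub>1" and a: "0 < a" "a \<le> 2"
begin

definition moment_const :: real where "moment_const = 3 * c\<^sub>1 * gauss_moment TYPE('a)"

lemma moment_const_pos: "0 < moment_const"
  using c\<^sub>1 gauss_moment_pos[where 'a='a] by (auto simp: moment_const_def intro!: mult_pos_pos)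

text \<open>
  Stated for a general exponent below the full one, so that it covers the full law as well as the
  process with some jumps removed.
\<close>

lemma truncated_moment_le:
  fixes \<mu> :: "'a measure"
  assumes \<mu>: "prob_space \<mu>" "sets \<mu> = sets borel" and h: "0 < h"
    and cf: "\<And>\<xi>. char_fun \<mu> \<xi> = complex_of_real (exp (- h * L \<xi>))" and L: "\<And>\<xi>. L \<xi> \<le> levy_exponent_on \<nu> UNIV \<xi>"
    and R: "R > 0"
  shows "(\<integral>\<^sup>+x. ennreal (min 1 ((norm x / R)\<^sup>2)) \<partial>\<mu>) \<le> ennreal (h * moment_const * R powr (- a))"
proof -
  have "(\<integral>\<^sup>+x. ennreal (min 1 ((norm x / R)\<^sup>2)) \<partial>\<mu>) \<le> ennreal (3 * (h * c\<^sub>1) * R powr (- a) * gauss_moment TYPE('a))"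
  proof (rule truncated_second_moment_le[OF \<mu> cf])
    fix \<xi>
    have "1 - exp (- h * L \<xi>) \<le> h * L \<xi>" using exp_ge_add_one_self[of "- h * L \<xi>"] by simp
    also have "\<dots> \<le> h * (c\<^sub>1 * norm \<xi> powr a)" using L[of \<xi>] exponent_le[of \<xi>] h by (intro mult_left_mono) auto
    finally show "1 - exp (- h * L \<xi>) \<le> h * c\<^sub>1 * norm \<xi> powr a" by simp
  qed (use h R c\<^sub>1 a in auto)
  then show ?thesis by (simp add: moment_const_def mult_ac)
qed

lemma law_truncated_moment:
  assumes "0 < h" "R > 0"
  shows "(\<integral>\<^sup>+x. ennreal (min 1 ((norm x / R)\<^sup>2)) \<partial>law h) \<le> ennreal (h * moment_const * R powr (- a))"
  using assms by (intro truncated_moment_le[OF prob_space_law sets_law _ char_fun_law]) auto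

lemma truncated_tail:
  fixes \<mu> :: "'a measure"
  assumes [measurable_cong]: "sets \<mu> = sets borel" and "R > 0"
  shows "emeasure \<mu> {x. R \<le> norm x} \<le> (\<integral>\<^sup>+x. ennreal (min 1 ((norm x / R)\<^sup>2)) \<partial>\<mu>)"
proof -
  have "emeasure \<mu> {x. R \<le> norm x} = (\<integral>\<^sup>+x. indicator {x. R \<le> norm x} x \<partial>\<mu>)"
    by (subst nn_integral_indicator) auto
  also have "\<dots> \<le> (\<integral>\<^sup>+x. ennreal (min 1 ((norm x / R)\<^sup>2)) \<partial>\<mu>)"
    using \<open>R > 0\<close> by (intro nn_integral_mono) (auto simp: indicator_def)
  finally show ?thesis .
qed

lemma law_tail:
  assumes "0 < h" "R > 0"
  shows "emeasure (law h) {x. R \<le> norm x} \<le> ennreal (h * moment_const * R powr (- a))"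
  using truncated_tail[OF sets_law[OF assms(1)] assms(2)] law_truncated_moment[OF assms] by (rule order_trans)

lemma law_symmetric:
  assumes h: "0 < h"
  shows "distr (law h) borel uminus = law h"
proof (rule char_fun_unique)
  note sets_law[OF h, measurable_cong]
  interpret prob_space "law h" by (rule prob_space_law[OF h])
  show "prob_space (distr (law h) borel uminus)" by (rule prob_space_distr) measurable
  show "char_fun (distr (law h) borel uminus) \<xi> = char_fun (law h) \<xi>" for \<xi>
  proof -
    have "char_fun (distr (law h) borel uminus) \<xi> = char_fun (law h) (- \<xi>)"
      unfolding char_fun_def by (subst integral_distr) auto
    also have "\<dots> = char_fun (law h) \<xi>"
      using char_fun_law[OF h, of \<xi>] char_fun_law[OF h, of "- \<xi>"]
      by (simp add: levy_exponent_on_def)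
    finally show ?thesis .
  qed
qed (use sets_law[OF h] prob_space_law[OF h] in auto)

text \<open>
  The process jumps at rate \<open>\<nu>\<close>. If \<open>\<nu>\<close> dominates \<open>\<kappa>\<close> times Lebesgue measure on a symmetric set
  \<open>U\<close> of large jumps, split off these jumps: for small \<open>h\<close> the other part hardly moves, and with
  probability of order \<open>h\<close> there is exactly one jump in \<open>U\<close>. The two parts exist only for the
  jumps exceeding \<open>1/n\<close>; the bound is uniform in \<open>n\<close> and passes to the limit.
\<close>

lemma law_ge_lebesgue:
  assumes U [measurable]: "U \<in> sets borel" and \<epsilon>: "0 < \<epsilon>" and U_far: "\<And>z. z \<in> U \<Longrightarrow> \<epsilon> \<le> norm z"
    and U_sym: "\<And>z. - z \<in> U \<longleftrightarrow> z \<in> U" and \<eta>: "0 < \<eta>" and \<kappa>: "0 \<le> \<kappa>"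
    and dom: "\<And>B. B \<in> sets borel \<Longrightarrow> B \<subseteq> U \<Longrightarrow> ennreal \<kappa> * emeasure lborel B \<le> emeasure \<nu> B"
  obtains h\<^sub>0 where "0 < h\<^sub>0"
    "\<And>h B. \<lbrakk>0 < h; h \<le> h\<^sub>0; B \<in> sets borel; \<And>z y. z \<in> B \<Longrightarrow> norm y \<le> \<eta> \<Longrightarrow> z - y \<in> U\<rbrakk>
      \<Longrightarrow> ennreal (h * \<kappa> / 2) * emeasure lborel B \<le> emeasure (law h) B"
proof -
  define m where "m = measure \<nu> U"
  define K where "K = moment_const * \<eta> powr (- a)"
  have K: "0 < K" using moment_const_pos \<eta> by (simp add: K_def)
  have m: "0 \<le> m" by (simp add: m_def)
  (* For h at most h0 both the small part stays within \<eta> and no second jump in U occurs, each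
     with probability at least 3/4. *)
  define h0 where "h0 = min (1 / (4 * K)) (1 / (4 * (m + 1)))"
  have h0: "0 < h0" using K m by (simp add: h0_def)
  (* Closed sets come first, because weak limits control open sets, here the complement from above;
     inner regularity of Lebesgue measure then gives all Borel sets. *)
  have closed_case: "ennreal (h * \<kappa> / 2) * emeasure lborel C \<le> emeasure (law h) C"
    if h: "0 < h" "h \<le> h0" and C: "closed C" and CU: "\<And>z y. z \<in> C \<Longrightarrow> norm y \<le> \<eta> \<Longrightarrow> z - y \<in> U" for h C
  proof -
    have [measurable]: "C \<in> sets borel" using C by auto
    interpret law: prob_space "law h" by (rule prob_space_law[OF h(1)])
    (* Independent contributions of the jumps in U and of the other jumps larger than 1/(n+1). *)
    define S where "S n = far n \<inter> - U" for n
    have S [measurable]: "S n \<in> sets borel" for n by (simp add: S_def)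
    have S_sym: "- z \<in> S n \<longleftrightarrow> z \<in> S n" for z n using U_sym by (auto simp: S_def far_def)
    have S_far: "z \<in> S n \<Longrightarrow> 1 / real (Suc n) \<le> norm z" for z n by (auto simp: S_def far_def)
    note pS = prob_space_jump_law[OF S _ S_far h(1)] and sS = sets_jump_law[OF S _ S_far h(1)]
    note pU = prob_space_jump_law[OF U \<epsilon> U_far h(1)] and sU = sets_jump_law[OF U \<epsilon> U_far h(1)]
    define \<mu> where "\<mu> n = law_conv (jump_law \<nu> (S n) h) (jump_law \<nu> U h)" for n
    have p\<mu>: "prob_space (\<mu> n)" for n unfolding \<mu>_def by (rule prob_space_law_conv[OF pS sS pU sU]) auto
    have s\<mu>: "sets (\<mu> n) = sets borel" for n by (simp add: \<mu>_def)
    have cfS: "char_fun (jump_law \<nu> (S n) h) \<xi> = complex_of_real (exp (- h * levy_exponent_on \<nu> (S n) \<xi>))" for n \<xi>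
      by (rule char_fun_jump_law[OF S _ S_far h(1) S_sym]) auto
    have cfU: "char_fun (jump_law \<nu> U h) \<xi> = complex_of_real (exp (- h * levy_exponent_on \<nu> U \<xi>))" for \<xi>
      by (rule char_fun_jump_law[OF U \<epsilon> U_far h(1) U_sym])
    have conv: "(\<lambda>n. char_fun (\<mu> n) \<xi>) \<longlonglongrightarrow> char_fun (law h) \<xi>" for \<xi>
    proof -
      have cf: "char_fun (\<mu> n) \<xi> = complex_of_real (exp (- h * (levy_exponent_on \<nu> (S n) \<xi> + levy_exponent_on \<nu> U \<xi>)))" for n
      proof -
        have "char_fun (\<mu> n) \<xi> = char_fun (jump_law \<nu> (S n) h) \<xi> * char_fun (jump_law \<nu> U h) \<xi>"
          unfolding \<mu>_def by (rule char_fun_law_conv[OF pS sS pU sU]) auto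
        then show ?thesis by (simp add: cfS cfU distrib_left exp_add exp_diff exp_minus divide_inverse)
      qed
      have "(\<lambda>n. levy_exponent_on \<nu> (S n) \<xi> + levy_exponent_on \<nu> U \<xi>) \<longlonglongrightarrow>
          levy_exponent_on \<nu> (- U) \<xi> + levy_exponent_on \<nu> U \<xi>"
        unfolding S_def by (intro tendsto_add levy_exponent_on_far_tendsto tendsto_const) measurable
      also have "levy_exponent_on \<nu> (- U) \<xi> + levy_exponent_on \<nu> U \<xi> = levy_exponent_on \<nu> UNIV \<xi>"
        by (subst levy_exponent_on_Un[symmetric]) (auto intro!: arg_cong[where f="\<lambda>S. levy_exponent_on \<nu> S \<xi>"])
      finally show ?thesis
        unfolding cf char_fun_law[OF h(1)] by (intro tendsto_of_real tendsto_exp tendsto_mult tendsto_const)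
    qed
    have CU': "C \<subseteq> U" using CU[of _ 0] \<eta> by auto
    have finC: "ennreal \<kappa> * emeasure lborel C < \<infinity>"
    proof -
      have "ennreal \<kappa> * emeasure lborel C \<le> emeasure \<nu> C" using dom CU' by auto
      also have "\<dots> \<le> emeasure \<nu> U" using CU' by (intro emeasure_mono) auto
      also have "\<dots> < \<infinity>" by (rule emeasure_far_finite[OF U \<epsilon> U_far])
      finally show ?thesis .
    qed
    have half: "1 / 2 \<le> (1 - h * K) * exp (- h * m)"
    proof -
      have "h * K \<le> 1 / (4 * K) * K" using h K by (intro mult_right_mono) (auto simp: h0_def)
      then have 1: "3 / 4 \<le> 1 - h * K" using K by simp
      have "h * m \<le> 1 / (4 * (m + 1)) * m" using h m by (intro mult_right_mono) (auto simp: h0_def)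
      also have "\<dots> \<le> 1 / 4" using m by (simp add: field_simps)
      finally have 2: "3 / 4 \<le> exp (- h * m)" using exp_ge_add_one_self[of "- h * m"] by simp
      have "(3 / 4) * (3 / 4) \<le> (1 - h * K) * exp (- h * m)" using 1 2 by (intro mult_mono) auto
      then show ?thesis by simp
    qed
    then have hK: "0 \<le> 1 - h * K" using exp_gt_zero[of "- h * m"]
      by (smt (verit) mult_nonneg_nonpos zero_less_divide_1_iff mult_nonpos_nonneg)
    define E where "E = ennreal (h * \<kappa> / 2) * emeasure lborel C"
    have low: "E \<le> emeasure (\<mu> n) C" for n
    proof -
      have [measurable_cong]: "sets (jump_law \<nu> (S n) h) = sets borel" by (rule sS) auto
      interpret JS: prob_space "jump_law \<nu> (S n) h" by (rule pS) auto
      have small: "ennreal (1 - h * K) \<le> emeasure (jump_law \<nu> (S n) h) {x. norm x \<le> \<eta>}"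
      proof -
        have L: "levy_exponent_on \<nu> (S n) \<xi> \<le> levy_exponent_on \<nu> UNIV \<xi>" for \<xi> by (rule levy_exponent_on_mono) auto
        have "emeasure (jump_law \<nu> (S n) h) {x. \<eta> \<le> norm x} \<le> ennreal (h * moment_const * \<eta> powr (- a))"
          using truncated_tail[OF _ \<eta>] truncated_moment_le[OF JS.prob_space_axioms _ h(1) cfS L \<eta>] sS
          by (meson order_trans \<open>sets (jump_law \<nu> (S n) h) = sets borel\<close>)
        then have "measure (jump_law \<nu> (S n) h) {x. \<eta> \<le> norm x} \<le> h * K"
          using h K by (simp add: JS.emeasure_eq_measure K_def mult.assoc)
        moreover have sp: "space (jump_law \<nu> (S n) h) = UNIV"
          using sets_eq_imp_space_eq[of "jump_law \<nu> (S n) h" borel] sS by simp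
        have "measure (jump_law \<nu> (S n) h) (space (jump_law \<nu> (S n) h) - {x. \<eta> \<le> norm x}) =
            1 - measure (jump_law \<nu> (S n) h) {x. \<eta> \<le> norm x}"
          by (rule JS.prob_compl) measurable
        moreover have "measure (jump_law \<nu> (S n) h) (space (jump_law \<nu> (S n) h) - {x. \<eta> \<le> norm x}) \<le>
            measure (jump_law \<nu> (S n) h) {x. norm x \<le> \<eta>}"
          by (intro JS.finite_measure_mono) (auto simp: sp)
        ultimately show ?thesis by (simp add: JS.emeasure_eq_measure ennreal_leI)
      qed
      have shift: "ennreal (h * exp (- h * m)) * (ennreal \<kappa> * emeasure lborel C) \<le> (\<integral>\<^sup>+y. indicator C (x + y) \<partial>jump_law \<nu> U h)"
        if x: "norm x \<le> \<eta>" for x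
      proof -
        have V: "{y. x + y \<in> C} \<in> sets borel" by measurable
        have VU: "{y. x + y \<in> C} \<subseteq> U" using CU[of "x + y" x for y] x by auto
        have "emeasure lborel C = emeasure lborel {y. x + y \<in> C}"
          using arg_cong[OF lborel_distr_plus[of x], of "\<lambda>M. emeasure M C"] by (simp add: emeasure_distr vimage_def)
        then have "ennreal \<kappa> * emeasure lborel C \<le> emeasure \<nu> {y. x + y \<in> C}" using dom[OF V VU] by simp
        also have "\<dots> = (\<integral>\<^sup>+y. indicator C (x + y) * indicator U y \<partial>\<nu>)"
        proof -
          have "(\<lambda>y. indicator C (x + y) * indicator U y :: ennreal) = indicator {y. x + y \<in> C}"
            using VU by (intro ext) (auto simp: indicator_def)
          then show ?thesis using V by simp
        qed
        finally have "ennreal (h * exp (- h * m)) * (ennreal \<kappa> * emeasure lborel C) \<le>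
           ennreal (h * exp (- h * m)) * (\<integral>\<^sup>+y. indicator C (x + y) * indicator U y \<partial>\<nu>)" by (rule mult_left_mono) simp
        also have "\<dots> \<le> (\<integral>\<^sup>+y. indicator C (x + y) \<partial>jump_law \<nu> U h)"
          unfolding m_def by (rule nn_integral_jump_law_ge[OF U \<epsilon> U_far _ h(1)]) measurable
        finally show ?thesis .
      qed
      have "E \<le> ennreal (1 - h * K) * (ennreal (h * exp (- h * m)) * (ennreal \<kappa> * emeasure lborel C))"
      proof -
        have "ennreal (h * \<kappa> / 2) \<le> ennreal ((1 - h * K) * ((h * exp (- h * m)) * \<kappa>))"
          using mult_right_mono[OF half, of "h * \<kappa>"] h \<kappa> by (intro ennreal_leI) (simp add: mult_ac)
        also have "\<dots> = ennreal (1 - h * K) * (ennreal (h * exp (- h * m)) * ennreal \<kappa>)"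
          using hK h \<kappa> by (simp add: ennreal_mult)
        finally show ?thesis unfolding E_def by (simp add: mult.assoc[symmetric] mult_right_mono)
      qed
      also have "\<dots> \<le> emeasure (jump_law \<nu> (S n) h) {x. norm x \<le> \<eta>} * (ennreal (h * exp (- h * m)) * (ennreal \<kappa> * emeasure lborel C))"
        by (rule mult_right_mono[OF small]) simp
      also have "\<dots> = (\<integral>\<^sup>+x. (ennreal (h * exp (- h * m)) * (ennreal \<kappa> * emeasure lborel C)) * indicator {x. norm x \<le> \<eta>} x \<partial>jump_law \<nu> (S n) h)"
        by (subst nn_integral_cmult_indicator) (auto simp: mult.commute)
      also have "\<dots> \<le> (\<integral>\<^sup>+x. \<integral>\<^sup>+y. indicator C (x + y) \<partial>jump_law \<nu> U h \<partial>jump_law \<nu> (S n) h)"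
        using shift by (intro nn_integral_mono) (auto simp: indicator_def[of "{x. norm x \<le> \<eta>}"])
      also have "\<dots> = (\<integral>\<^sup>+x. indicator C x \<partial>\<mu> n)"
        unfolding \<mu>_def by (subst nn_integral_law_conv[OF pS sS pU sU]) auto
      also have "\<dots> = emeasure (\<mu> n) C" by (subst nn_integral_indicator) (auto simp: s\<mu>)
      finally show ?thesis .
    qed
    have "E < \<infinity>"
      using low[of 0] prob_space.emeasure_le_1[OF p\<mu>, of 0 C]
      by (simp add: order.strict_trans1[OF order_trans[of E _ 1]])
    then obtain e where e: "E = ennreal e" "0 \<le> e" by (cases E) auto
    have low': "e \<le> measure (\<mu> n) C" for n
    proof -
      interpret prob_space "\<mu> n" by (rule p\<mu>)
      show ?thesis using low[of n] e by (simp add: emeasure_eq_measure)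
    qed
    have compl: "measure P (- C) = 1 - measure P C" if "prob_space P" "sets P = sets borel" for P
    proof -
      interpret prob_space P by fact
      have "space P = UNIV" using sets_eq_imp_space_eq[OF that(2)] by simp
      then show ?thesis using prob_compl[of C] that(2) by (simp add: Compl_eq_Diff_UNIV)
    qed
    have "emeasure (law h) (- C) \<le> liminf (\<lambda>n. emeasure (\<mu> n) (- C))"
      using C by (intro emeasure_open_le_liminf[OF prob_space_law[OF h(1)] sets_law[OF h(1)] p\<mu> s\<mu> conv]) auto
    also have "\<dots> \<le> liminf (\<lambda>n::nat. ennreal (1 - e))"
    proof (intro Liminf_mono always_eventually allI)
      fix n
      interpret prob_space "\<mu> n" by (rule p\<mu>)
      show "emeasure (\<mu> n) (- C) \<le> ennreal (1 - e)"
        using low'[of n] compl[OF p\<mu> s\<mu>, of n] by (simp add: emeasure_eq_measure ennreal_leI)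
    qed
    also have "\<dots> = ennreal (1 - e)" by (simp add: Liminf_const)
    finally have "measure (law h) (- C) \<le> 1 - e"
      using low'[of 0] prob_space.prob_le_1[OF p\<mu>, of 0 C] by (simp add: law.emeasure_eq_measure)
    then have "e \<le> measure (law h) C" using compl[OF prob_space_law[OF h(1)] sets_law[OF h(1)]] by simp
    then show ?thesis unfolding E_def[symmetric] e(1) by (simp add: law.emeasure_eq_measure ennreal_leI)
  qed
  show thesis
  proof (rule that[OF h0])
    fix h B
    assume h: "0 < h" "h \<le> h0" and B [measurable]: "B \<in> sets borel" and BU: "\<And>z y. z \<in> B \<Longrightarrow> norm y \<le> \<eta> \<Longrightarrow> z - y \<in> U"
    show "ennreal (h * \<kappa> / 2) * emeasure lborel B \<le> emeasure (law h) B"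
    proof (cases "\<kappa> = 0")
      case False
      have "ennreal \<kappa> * emeasure lborel B \<le> emeasure \<nu> B" using dom[OF B] BU[of _ 0] \<eta> by auto
      also have "\<dots> \<le> emeasure \<nu> U" using BU[of _ 0] \<eta> by (intro emeasure_mono) auto
      also have "\<dots> < \<infinity>" by (rule emeasure_far_finite[OF U \<epsilon> U_far])
      finally have fin: "emeasure lborel B < \<infinity>" using False \<kappa> by (auto simp: ennreal_mult_less_top)
      define P where "P = density lborel (indicator B :: 'a \<Rightarrow> ennreal)"
      have P: "emeasure P X = emeasure lborel (B \<inter> X)" if "X \<in> sets borel" for X
        unfolding P_def using that by (subst emeasure_density) (auto simp: indicator_inter_arith[symmetric])
      have "emeasure P B = (SUP K \<in> {K. K \<subseteq> B \<and> compact K}. emeasure P K)"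
        using fin P[of UNIV] by (intro inner_regular) (auto simp: P_def)
      then have "ennreal (h * \<kappa> / 2) * emeasure lborel B =
          (SUP K \<in> {K. K \<subseteq> B \<and> compact K}. ennreal (h * \<kappa> / 2) * emeasure P K)"
        using P[OF B] by (simp add: SUP_mult_left_ennreal)
      also have "\<dots> \<le> emeasure (law h) B"
      proof (intro SUP_least)
        fix K assume "K \<in> {K. K \<subseteq> B \<and> compact K}"
        then have K: "K \<subseteq> B" "closed K" by (auto simp: compact_imp_closed)
        then have "emeasure P K = emeasure lborel K" by (subst P) (auto simp: Int_absorb1)
        then have "ennreal (h * \<kappa> / 2) * emeasure P K \<le> emeasure (law h) K"
          using closed_case[OF h K(2)] BU K by auto
        also have "\<dots> \<le> emeasure (law h) B" using K by (intro emeasure_mono) (auto simp: sets_law[OF h(1)])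
        finally show "ennreal (h * \<kappa> / 2) * emeasure P K \<le> emeasure (law h) B" .
      qed
      finally show ?thesis .
    qed simp
  qed
qed

end


section \<open>Tails of laws with light jumps\<close>

text \<open>
  A version of the \<open>p\<close>-th power of the norm that is smooth at the origin, where the \<open>p\<close>-th power
  itself has a cusp for \<open>p \<le> 1\<close>.
\<close>

definition growth :: "real \<Rightarrow> 'a::euclidean_space \<Rightarrow> real" where
  "growth p x = (1 + (norm x)\<^sup>2) powr (p / 2)"

lemma growth_alt: "growth p x = sqrt (1 + (norm x)\<^sup>2) powr p"
  by (simp add: growth_def powr_half_sqrt[symmetric] powr_powr)

lemma sqrt_one_plus_norm_add: "sqrt (1 + (norm (x + z))\<^sup>2) \<le> sqrt (1 + (norm x)\<^sup>2) + norm z"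
  using norm_triangle_ineq[of "(1::real, x)" "(0, z)"] by (simp add: norm_Pair)

lemma powr_add_le_of_le_one:
  fixes u v p :: real
  assumes "0 < u" "0 < v" "p \<le> 1"
  shows "(u + v) powr p \<le> u powr p + v * v powr (p - 1)" "(u + v) powr p \<le> u powr p + v * u powr (p - 1)"
proof -
  have split: "w powr p = w * w powr (p - 1)" if "0 < w" for w :: real
    using that by (simp add: powr_diff)
  have "(u + v) powr p = u * (u + v) powr (p - 1) + v * (u + v) powr (p - 1)"
    using assms by (subst split) (auto simp: distrib_right)
  moreover have "(u + v) powr (p - 1) \<le> u powr (p - 1)" "(u + v) powr (p - 1) \<le> v powr (p - 1)"
    using assms by (auto intro!: powr_mono2')
  ultimately have "(u + v) powr p \<le> u * u powr (p - 1) + v * v powr (p - 1)"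
    "(u + v) powr p \<le> u * u powr (p - 1) + v * u powr (p - 1)"
    using assms by (smt (verit) mult_left_mono)+
  then show "(u + v) powr p \<le> u powr p + v * v powr (p - 1)" "(u + v) powr p \<le> u powr p + v * u powr (p - 1)"
    using split[of u] assms by auto
qed

text \<open>
  The first bound serves large jumps, for which only a concave power is integrable; the second,
  a Lipschitz bound, serves small jumps.
\<close>

lemma growth_add_le:
  assumes p: "0 < p" "p \<le> 1"
  shows "growth p (x + z) \<le> growth p x + norm z powr p" "growth p (x + z) \<le> growth p x + norm z"
proof -
  define u where "u = sqrt (1 + (norm x)\<^sup>2)"
  have u: "1 \<le> u" by (simp add: u_def)
  have g: "growth p (x + z) \<le> (u + norm z) powr p"
    unfolding growth_alt u_def using p sqrt_one_plus_norm_add by (intro powr_mono2) auto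
  have "(u + norm z) powr p \<le> u powr p + norm z powr p \<and> (u + norm z) powr p \<le> u powr p + norm z"
  proof (cases "z = 0")
    case False
    have "norm z * norm z powr (p - 1) = norm z powr p" using False by (simp add: powr_diff)
    moreover have "norm z * u powr (p - 1) \<le> norm z"
      using mult_left_mono[of "u powr (p - 1)" 1 "norm z"] powr_mono2'[of "p - 1" 1 u] u p by simp
    moreover have "(u + norm z) powr p \<le> u powr p + norm z * norm z powr (p - 1)"
      "(u + norm z) powr p \<le> u powr p + norm z * u powr (p - 1)"
      using powr_add_le_of_le_one[of u "norm z" p] u False p by auto
    ultimately show ?thesis by linarith
  qed simp
  then show "growth p (x + z) \<le> growth p x + norm z powr p" "growth p (x + z) \<le> growth p x + norm z"
    using g unfolding growth_alt u_def by auto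
qed

lemma powr_le_tangent:
  fixes s y q :: real
  assumes "1 \<le> s" "0 < y" "0 \<le> q" "q \<le> 1"
  shows "y powr q \<le> s powr q + q * s powr (q - 1) * (y - s)"
proof -
  have "(y / s) powr q * 1 powr (1 - q) \<le> q * (y / s) + (1 - q) * 1"
    using assms by (intro Youngs_inequality_0) auto
  then have "s powr q * (y / s) powr q \<le> s powr q * (1 + q * (y - s) / s)"
    using assms by (intro mult_left_mono) (auto simp: field_simps)
  moreover have "s powr q * (y / s) powr q = y powr q" using assms by (subst powr_mult[symmetric]) auto
  moreover have "s powr q * (1 + q * (y - s) / s) = s powr q + q * s powr (q - 1) * (y - s)"
    using assms by (simp add: powr_diff field_simps)
  ultimately show ?thesis by simp
qed

text \<open>
  The tangent of the concave map \<open>s \<mapsto> s\<^bsup>p/2\<^esup>\<close> lies above its graph, and the linear terms in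
  \<open>z\<close> cancel between \<open>x + z\<close> and \<open>x - z\<close>.
\<close>

lemma growth_second_difference:
  assumes p: "0 < p" "p \<le> 1"
  shows "growth p (x + z) + growth p (x - z) \<le> 2 * growth p x + (norm z)\<^sup>2"
proof -
  define s where "s = 1 + (norm x)\<^sup>2"
  have s: "1 \<le> s" by (simp add: s_def)
  have *: "growth p y \<le> s powr (p / 2) + (p / 2) * s powr (p / 2 - 1) * (1 + (norm y)\<^sup>2 - s)" for y :: 'a
    unfolding growth_def using p s by (intro powr_le_tangent) (auto intro: add_pos_nonneg)
  have eq: "(1 + (norm (x + z))\<^sup>2 - s) + (1 + (norm (x - z))\<^sup>2 - s) = 2 * (norm z)\<^sup>2"
    by (simp add: s_def power2_norm_eq_inner inner_add_left inner_add_right inner_diff_left inner_diff_right)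
  have "growth p (x + z) + growth p (x - z) \<le>
      2 * s powr (p / 2) + (p / 2) * s powr (p / 2 - 1) * ((1 + (norm (x + z))\<^sup>2 - s) + (1 + (norm (x - z))\<^sup>2 - s))"
    using add_mono[OF *[of "x + z"] *[of "x - z"]] by (simp only: distrib_left mult_2 add_ac)
  also have "\<dots> = 2 * growth p x + p * s powr (p / 2 - 1) * (norm z)\<^sup>2"
    unfolding eq by (simp add: growth_def s_def)
  also have "p * s powr (p / 2 - 1) * (norm z)\<^sup>2 \<le> 1 * (norm z)\<^sup>2"
  proof (intro mult_right_mono)
    have "s powr (p / 2 - 1) \<le> 1 powr (p / 2 - 1)" using s p by (intro powr_mono2') auto
    then have "p * s powr (p / 2 - 1) \<le> 1 * 1" using p by (intro mult_mono) auto
    then show "p * s powr (p / 2 - 1) \<le> 1" by simp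
  qed simp
  finally show ?thesis by simp
qed

lemma exp_growth_second_difference:
  assumes p: "0 < p" "p \<le> 1" and z: "norm z \<le> 1"
  shows "exp (growth p (x + z)) + exp (growth p (x - z)) \<le> (2 + 3 * (norm z)\<^sup>2) * exp (growth p x)"
proof -
  define D where "D y = growth p y - growth p x" for y :: 'a
  have Dabs: "\<bar>D (x + v)\<bar> \<le> norm v" for v
    using growth_add_le(2)[OF p, of x v] growth_add_le(2)[OF p, of "x + v" "- v"] by (auto simp: D_def)
  have e: "exp (D (x + v)) \<le> 1 + D (x + v) + (norm v)\<^sup>2" if "norm v \<le> 1" for v
  proof -
    have "exp (D (x + v)) \<le> 1 + D (x + v) + (D (x + v))\<^sup>2"
    proof (cases "0 \<le> D (x + v)")
      case True
      then show ?thesis using exp_bound[of "D (x + v)"] Dabs[of v] that by simp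
    next
      case False
      define t where "t = - D (x + v)"
      have t: "0 \<le> t" "t \<le> 1" using False Dabs[of v] that by (auto simp: t_def)
      have "exp (- t) = 1 / exp t" by (simp add: exp_minus')
      also have "\<dots> \<le> 1 / (1 + t)" using t by (intro divide_left_mono exp_ge_add_one_self mult_pos_pos) auto
      also have "\<dots> \<le> 1 - t + t\<^sup>2"
      proof -
        have "1 \<le> 1 + t ^ 3" using t by simp
        also have "\<dots> = (1 - t + t\<^sup>2) * (1 + t)" by (simp add: algebra_simps power2_eq_square power3_eq_cube)
        finally show ?thesis using t by (simp add: field_simps)
      qed
      finally show ?thesis by (simp add: t_def)
    qed
    moreover have "(D (x + v))\<^sup>2 \<le> (norm v)\<^sup>2" using Dabs[of v] by (intro abs_le_square_iff[THEN iffD1]) simp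
    ultimately show ?thesis by simp
  qed
  have "D (x + z) + D (x + - z) \<le> (norm z)\<^sup>2" using growth_second_difference[OF p, of x z] by (simp add: D_def)
  then have "exp (D (x + z)) + exp (D (x + - z)) \<le> 2 + 3 * (norm z)\<^sup>2"
    using e[of z] e[of "- z"] z by simp
  then have "(exp (D (x + z)) + exp (D (x + - z))) * exp (growth p x) \<le> (2 + 3 * (norm z)\<^sup>2) * exp (growth p x)"
    by (rule mult_right_mono) simp
  then show ?thesis by (simp add: D_def distrib_right exp_diff)
qed

context levy_laws
begin

text \<open>
  The exponential of a concave power of the distance is a Lyapunov function: small jumps change
  it only to second order because \<open>\<nu>\<close> is symmetric, and large jumps at most multiply it by
  \<open>exp (|z|\<^sup>p)\<close>, which is integrable.
\<close>

lemma law_stretched_exponential_tail: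
  assumes p: "0 < p" "p \<le> 1"
    and fin: "(\<integral>\<^sup>+z. ennreal (exp (norm z powr p)) * indicator {z. 1 < norm z} z \<partial>\<nu>) < \<infinity>"
  obtains C where "0 \<le> C"
    "\<And>h r. 0 < h \<Longrightarrow> 0 \<le> r \<Longrightarrow> emeasure (law h) {x. r < norm x} \<le> ennreal (exp (h * C + 1 - r powr p))"
proof -
  obtain I where I: "(\<integral>\<^sup>+z. ennreal (exp (norm z powr p)) * indicator {z. 1 < norm z} z \<partial>\<nu>) = ennreal I" "0 \<le> I"
    using fin by (cases "\<integral>\<^sup>+z. ennreal (exp (norm z powr p)) * indicator {z. 1 < norm z} z \<partial>\<nu>") auto
  define J where "J = (\<integral>z. min 1 ((norm z)\<^sup>2) \<partial>\<nu>)"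
  have J: "0 \<le> J" "(\<integral>\<^sup>+z. ennreal (min 1 ((norm z)\<^sup>2)) \<partial>\<nu>) = ennreal J"
    using integrable_min by (auto simp: J_def intro!: Bochner_Integration.integral_nonneg nn_integral_eq_integral)
  define C where "C = 3 * J + I"
  have C: "0 \<le> C" using J I by (simp add: C_def)
  define f :: "'a \<Rightarrow> ennreal" where "f x = ennreal (exp (growth p x))" for x
  have [measurable]: "growth p \<in> borel_measurable borel" unfolding growth_def[abs_def] by measurable
  have [measurable]: "f \<in> borel_measurable borel" unfolding f_def by measurable
  have Lyap: "(\<integral>\<^sup>+z. f (x + z) * indicator (far n) z \<partial>\<nu>) \<le> ennreal (measure \<nu> (far n) + C) * f x" for n x
  proof -
    define A where "A = far n \<inter> {z. norm z \<le> 1}"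
    define B where "B = {z::'a. 1 < norm z}"
    have A [measurable]: "A \<in> sets borel" and B [measurable]: "B \<in> sets borel" unfolding A_def B_def by measurable
    have A_far: "z \<in> A \<Longrightarrow> 1 / real (Suc n) \<le> norm z" for z by (auto simp: A_def far_def)
    have B_far: "z \<in> B \<Longrightarrow> 1 \<le> norm z" for z by (auto simp: B_def)
    have eA: "emeasure \<nu> A = ennreal (measure \<nu> A)" by (rule emeasure_S[OF A _ A_far]) auto
    have mA: "measure \<nu> A \<le> measure \<nu> (far n)"
    proof (rule measure_mono_fmeasurable)
      have "emeasure \<nu> (far n) < \<infinity>" by (rule emeasure_far_finite[of _ "1 / real (Suc n)"]) (auto simp: far_def)
      then show "far n \<in> fmeasurable \<nu>" by (intro fmeasurableI) auto
    qed (auto simp: A_def)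
    have f_pos: "0 < exp (growth p x)" by simp
    (* Pairing z with - z makes the first order term of a small jump vanish. *)
    have Asym: "(\<integral>\<^sup>+z. f (x + z) * indicator A z \<partial>\<nu>) = (\<integral>\<^sup>+z. f (x - z) * indicator A z \<partial>\<nu>)"
    proof -
      have "indicator A (- z) = (indicator A z :: ennreal)" for z by (auto simp: A_def far_def indicator_def)
      then show ?thesis using nn_integral_uminus[of "\<lambda>z. f (x + z) * indicator A z"] by simp
    qed
    have "2 * (\<integral>\<^sup>+z. f (x + z) * indicator A z \<partial>\<nu>) =
        (\<integral>\<^sup>+z. f (x + z) * indicator A z \<partial>\<nu>) + (\<integral>\<^sup>+z. f (x - z) * indicator A z \<partial>\<nu>)"
      unfolding Asym[symmetric] by (simp add: mult_2)
    also have "\<dots> = (\<integral>\<^sup>+z. (f (x + z) + f (x - z)) * indicator A z \<partial>\<nu>)"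
      by (subst nn_integral_add[symmetric]) (auto simp: distrib_right)
    also have "\<dots> \<le> (\<integral>\<^sup>+z. (2 * f x) * indicator A z + (3 * f x) * ennreal (min 1 ((norm z)\<^sup>2)) \<partial>\<nu>)"
    proof (intro nn_integral_mono)
      fix z
      show "(f (x + z) + f (x - z)) * indicator A z \<le> (2 * f x) * indicator A z + (3 * f x) * ennreal (min 1 ((norm z)\<^sup>2))"
      proof (cases "z \<in> A")
        case True
        then have z: "norm z \<le> 1" by (simp add: A_def)
        have "f (x + z) + f (x - z) = ennreal (exp (growth p (x + z)) + exp (growth p (x - z)))"
          by (simp add: f_def)
        also have "\<dots> \<le> ennreal ((2 + 3 * (norm z)\<^sup>2) * exp (growth p x))"
          by (intro ennreal_leI exp_growth_second_difference p z)
        also have "\<dots> = 2 * f x + 3 * f x * ennreal ((norm z)\<^sup>2)"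
          by (simp add: f_def ennreal_mult distrib_left mult_ac)
        finally show ?thesis using True z by (simp add: min_absorb2 power_le_one)
      qed simp
    qed
    also have "\<dots> = 2 * (f x * ennreal (measure \<nu> A)) + 3 * (f x * ennreal J)"
      by (subst nn_integral_add) (auto simp: nn_integral_cmult_indicator nn_integral_cmult eA J(2) mult.assoc)
    also have "\<dots> \<le> 2 * (f x * ennreal (measure \<nu> A) + 3 * (f x * ennreal J))"
      by (simp add: distrib_left add_left_mono mult_right_mono)
    finally have "2 * (\<integral>\<^sup>+z. f (x + z) * indicator A z \<partial>\<nu>) \<le> 2 * (f x * ennreal (measure \<nu> A) + 3 * (f x * ennreal J))" .
    then have bA: "(\<integral>\<^sup>+z. f (x + z) * indicator A z \<partial>\<nu>) \<le> f x * ennreal (measure \<nu> A) + 3 * (f x * ennreal J)"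
      by (subst (asm) ennreal_mult_le_mult_iff) auto
    have bB: "(\<integral>\<^sup>+z. f (x + z) * indicator B z \<partial>\<nu>) \<le> f x * ennreal I"
    proof -
      have "(\<integral>\<^sup>+z. f (x + z) * indicator B z \<partial>\<nu>) \<le> (\<integral>\<^sup>+z. f x * (ennreal (exp (norm z powr p)) * indicator B z) \<partial>\<nu>)"
      proof (intro nn_integral_mono)
        fix z
        have "f (x + z) \<le> f x * ennreal (exp (norm z powr p))"
          using growth_add_le(1)[OF p, of x z] by (simp add: f_def ennreal_mult[symmetric] exp_add[symmetric] ennreal_leI)
        then show "f (x + z) * indicator B z \<le> f x * (ennreal (exp (norm z powr p)) * indicator B z)"
          by (simp add: mult.assoc[symmetric] mult_right_mono)
      qed
      also have "\<dots> = f x * ennreal I" unfolding I(1)[symmetric] B_def by (rule nn_integral_cmult) measurable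
      finally show ?thesis .
    qed
    have "(\<integral>\<^sup>+z. f (x + z) * indicator (far n) z \<partial>\<nu>) \<le> (\<integral>\<^sup>+z. f (x + z) * indicator A z + f (x + z) * indicator B z \<partial>\<nu>)"
      by (intro nn_integral_mono) (auto simp: A_def B_def indicator_def)
    also have "\<dots> = (\<integral>\<^sup>+z. f (x + z) * indicator A z \<partial>\<nu>) + (\<integral>\<^sup>+z. f (x + z) * indicator B z \<partial>\<nu>)"
      by (rule nn_integral_add) measurable
    also have "\<dots> \<le> (f x * ennreal (measure \<nu> A) + 3 * (f x * ennreal J)) + f x * ennreal I"
      by (intro add_mono bA bB)
    also have "\<dots> = f x * ennreal (measure \<nu> A + C)"
      using J(1) I(2) by (simp add: C_def distrib_left ennreal_mult mult_ac add_ac)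
    also have "\<dots> \<le> f x * ennreal (measure \<nu> (far n) + C)"
      using mA by (intro mult_left_mono ennreal_leI) auto
    finally show ?thesis by (simp add: mult.commute)
  qed
  show thesis
  proof (rule that[OF C])
    fix h r :: real assume h: "0 < h" and r: "0 \<le> r"
    have f_far: "far n \<in> sets borel" "0 < 1 / real (Suc n)" "z \<in> far n \<Longrightarrow> 1 / real (Suc n) \<le> norm z" "- z \<in> far n \<longleftrightarrow> z \<in> far n" for n z
      by (auto simp: far_def)
    have op: "open {x::'a. r < norm x}" by (intro open_Collect_less continuous_intros)
    have lim: "(\<lambda>n. char_fun (jump_law \<nu> (far n) h) \<xi>) \<longlonglongrightarrow> char_fun (law h) \<xi>" for \<xi>
    proof -
      have "char_fun (jump_law \<nu> (far n) h) \<xi> = complex_of_real (exp (- h * levy_exponent_on \<nu> (far n) \<xi>))" for n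
        by (rule char_fun_jump_law[OF f_far(1) f_far(2)[of n] _ h]) (auto simp: far_def)
      moreover have "(\<lambda>n. levy_exponent_on \<nu> (far n) \<xi>) \<longlonglongrightarrow> levy_exponent_on \<nu> UNIV \<xi>"
        using levy_exponent_on_far_tendsto[of UNIV \<xi>] by simp
      ultimately show ?thesis
        unfolding char_fun_law[OF h] by (simp only:) (intro tendsto_of_real tendsto_exp tendsto_mult tendsto_const)
    qed
    have pj: "prob_space (jump_law \<nu> (far n) h)" and sj [measurable_cong]: "sets (jump_law \<nu> (far n) h) = sets borel" for n
      using prob_space_jump_law[OF f_far(1) f_far(2)[of n] _ h, of n] sets_jump_law[OF f_far(1) f_far(2)[of n] _ h, of n]
      by (auto simp: far_def)
    have "emeasure (law h) {x. r < norm x} \<le> liminf (\<lambda>n. emeasure (jump_law \<nu> (far n) h) {x. r < norm x})"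
      by (rule emeasure_open_le_liminf[OF prob_space_law[OF h] sets_law[OF h]
            pj sj lim op])
    also have "\<dots> \<le> liminf (\<lambda>n::nat. ennreal (exp (h * C + 1 - r powr p)))"
    proof (intro Liminf_mono always_eventually allI)
      fix n
      have "emeasure (jump_law \<nu> (far n) h) {x. r < norm x} =
         (\<integral>\<^sup>+x. indicator {x. r < norm x} x \<partial>jump_law \<nu> (far n) h)"
        by (subst nn_integral_indicator) auto
      also have "\<dots> \<le> (\<integral>\<^sup>+x. ennreal (exp (- (r powr p))) * f x \<partial>jump_law \<nu> (far n) h)"
      proof (intro nn_integral_mono)
        fix x
        show "indicator {x. r < norm x} x \<le> ennreal (exp (- (r powr p))) * f x"
        proof (cases "r < norm x")
          case True
          have "r powr p \<le> sqrt (1 + (norm x)\<^sup>2) powr p"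
          proof -
            have "r\<^sup>2 \<le> (norm x)\<^sup>2" by (rule power_mono) (use True r in auto)
            then have "r\<^sup>2 \<le> 1 + (norm x)\<^sup>2" by linarith
            then have "r \<le> sqrt (1 + (norm x)\<^sup>2)" by (rule real_le_rsqrt)
            then show ?thesis using r p by (intro powr_mono2) auto
          qed
          then have "1 \<le> exp (- (r powr p)) * exp (growth p x)" by (simp add: growth_alt exp_add[symmetric])
          then show ?thesis using True by (simp add: f_def ennreal_mult[symmetric] del: ennreal_1 flip: ennreal_1)
        qed simp
      qed
      also have "\<dots> = ennreal (exp (- (r powr p))) * (\<integral>\<^sup>+x. f x \<partial>jump_law \<nu> (far n) h)"
        by (rule nn_integral_cmult) measurable
      also have "\<dots> \<le> ennreal (exp (- (r powr p))) * (ennreal (exp (h * C)) * f 0)"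
        by (intro mult_left_mono nn_integral_jump_law_Lyapunov[OF f_far(1) f_far(2)[of n] _ _ h C Lyap]) (auto simp: far_def)
      also have "\<dots> = ennreal (exp (h * C + 1 - r powr p))"
        by (simp add: f_def growth_def ennreal_mult[symmetric] exp_add[symmetric] exp_diff exp_minus field_simps)
      finally show "emeasure (jump_law \<nu> (far n) h) {x. r < norm x} \<le> ennreal (exp (h * C + 1 - r powr p))" .
    qed
    also have "\<dots> = ennreal (exp (h * C + 1 - r powr p))" by (simp add: Liminf_const)
    finally show "emeasure (law h) {x. r < norm x} \<le> ennreal (exp (h * C + 1 - r powr p))" .
  qed
qed

end


section \<open>Stable laws as mixtures of Gaussians\<close>

text \<open>
  The Levy density of the \<open>\<alpha>/2\<close>-stable subordinator, up to the factor \<open>\<kappa>\<close>.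
\<close>

definition subordinator_density :: "real \<Rightarrow> real \<Rightarrow> real \<Rightarrow> real" where
  "subordinator_density \<alpha> \<kappa> s = indicator {0<..} s * (\<kappa> * s powr (- 1 - \<alpha> / 2))"

text \<open>
  Brownian motion run by an \<open>\<alpha>/2\<close>-stable subordinator is rotationally symmetric stable: its jumps
  are Gaussian with the jumps of the subordinator as variances. Describing the Levy measure as this
  mixture gives its exponent and a lower bound on its density without computing the density.
\<close>

definition stable_measure :: "real \<Rightarrow> real \<Rightarrow> 'a::euclidean_space measure" where
  "stable_measure \<alpha> \<kappa> =
     distr (density lborel (\<lambda>s. ennreal (subordinator_density \<alpha> \<kappa> s)) \<Otimes>\<^sub>M gauss) borel (\<lambda>(s, g). sqrt s *\<^sub>R g)"

lemma subordinator_density_measurable [measurable]: "subordinator_density \<alpha> \<kappa> \<in> borel_measurable borel"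
  unfolding subordinator_density_def[abs_def] by measurable

lemma sets_stable_measure [simp, measurable_cong]: "sets (stable_measure \<alpha> \<kappa>) = sets borel"
  by (simp add: stable_measure_def)

lemma nn_integral_stable_measure:
  fixes f :: "'a::euclidean_space \<Rightarrow> ennreal"
  assumes [measurable]: "f \<in> borel_measurable borel"
  shows "(\<integral>\<^sup>+z. f z \<partial>stable_measure \<alpha> \<kappa>) =
    (\<integral>\<^sup>+s. ennreal (subordinator_density \<alpha> \<kappa> s) * (\<integral>\<^sup>+g. f (sqrt s *\<^sub>R g) \<partial>gauss) \<partial>lborel)"
proof -
  have "(\<integral>\<^sup>+z. f z \<partial>stable_measure \<alpha> \<kappa>) =
     (\<integral>\<^sup>+p. f (sqrt (fst p) *\<^sub>R snd p) \<partial>(density lborel (\<lambda>s. ennreal (subordinator_density \<alpha> \<kappa> s)) \<Otimes>\<^sub>M gauss))"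
    unfolding stable_measure_def by (subst nn_integral_distr) (auto simp: split_beta')
  also have "\<dots> = (\<integral>\<^sup>+s. \<integral>\<^sup>+g. f (sqrt s *\<^sub>R g) \<partial>gauss \<partial>density lborel (\<lambda>s. ennreal (subordinator_density \<alpha> \<kappa> s)))"
    by (subst gauss.nn_integral_fst[symmetric]) auto
  also have "\<dots> = (\<integral>\<^sup>+s. ennreal (subordinator_density \<alpha> \<kappa> s) * (\<integral>\<^sup>+g. f (sqrt s *\<^sub>R g) \<partial>gauss) \<partial>lborel)"
    by (subst nn_integral_density) auto
  finally show ?thesis .
qed

lemma nn_integral_powr_tail:
  assumes "e < - 1"
  shows "(\<integral>\<^sup>+s. ennreal (s powr e) * indicator {1..} s \<partial>lborel) = ennreal (- 1 / (e + 1))"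
proof -
  have "(\<integral>\<^sup>+s. ennreal (s powr e) * indicator {1..} s \<partial>lborel) = ennreal (0 - 1 powr (e + 1) / (e + 1))"
  proof (rule nn_integral_FTC_atLeast[where F="\<lambda>s. s powr (e + 1) / (e + 1)"])
    show "((\<lambda>s. s powr (e + 1) / (e + 1)) has_real_derivative s powr e) (at s)" if "1 \<le> s" for s
    proof -
      have "((\<lambda>s. s powr (e + 1)) has_real_derivative (e + 1) * s powr (e + 1 - 1)) (at s)"
        using that by (intro has_real_derivative_powr) simp
      from DERIV_cdivide[OF this, of "e + 1"] show ?thesis using assms by simp
    qed
    have "((\<lambda>s. s powr (e + 1)) \<longlongrightarrow> 0) at_top" using assms by (intro tendsto_neg_powr filterlim_ident) auto
    then show "((\<lambda>s. s powr (e + 1) / (e + 1)) \<longlongrightarrow> 0) at_top" by (rule tendsto_divide_zero)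
  qed auto
  then show ?thesis by simp
qed

lemma nn_integral_subordinator_min_finite:
  assumes "0 < \<alpha>" "\<alpha> < 2"
  shows "(\<integral>\<^sup>+s. ennreal (subordinator_density \<alpha> 1 s) * ennreal (min 1 s) \<partial>lborel) < \<infinity>"
proof -
  have "(\<integral>\<^sup>+s. ennreal (subordinator_density \<alpha> 1 s) * ennreal (min 1 s) \<partial>lborel) \<le>
    (\<integral>\<^sup>+s. ennreal (s powr (- \<alpha> / 2)) * indicator {0..1} s + ennreal (s powr (- 1 - \<alpha> / 2)) * indicator {1..} s \<partial>lborel)"
  proof (intro nn_integral_mono)
    fix s :: real
    show "ennreal (subordinator_density \<alpha> 1 s) * ennreal (min 1 s) \<le>
       ennreal (s powr (- \<alpha> / 2)) * indicator {0..1} s + ennreal (s powr (- 1 - \<alpha> / 2)) * indicator {1..} s"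
    proof (cases "0 < s \<and> s < 1")
      case True
      then have "s powr (- 1 - \<alpha> / 2) * s = s powr (- \<alpha> / 2)"
        using powr_mult_base[of s "- 1 - \<alpha> / 2"] by (simp add: mult.commute)
      then show ?thesis using True by (simp add: subordinator_density_def ennreal_mult[symmetric])
    next
      case False
      then show ?thesis by (cases "1 \<le> s") (auto simp: subordinator_density_def min_absorb1)
    qed
  qed
  also have "\<dots> = (\<integral>\<^sup>+s. ennreal (s powr (- \<alpha> / 2)) * indicator {0..1} s \<partial>lborel) +
      (\<integral>\<^sup>+s. ennreal (s powr (- 1 - \<alpha> / 2)) * indicator {1..} s \<partial>lborel)"
    by (rule nn_integral_add) measurable
  also have "(\<integral>\<^sup>+s. ennreal (s powr (- \<alpha> / 2)) * indicator {0..1} s \<partial>lborel) = ennreal (1 powr (- \<alpha> / 2 + 1) / (- \<alpha> / 2 + 1))"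
    using assms by (intro nn_integral_has_integral_lebesgue' has_integral_powr_from_0) auto
  also have "(\<integral>\<^sup>+s. ennreal (s powr (- 1 - \<alpha> / 2)) * indicator {1..} s \<partial>lborel) = ennreal (- 1 / ((- 1 - \<alpha> / 2) + 1))"
    using assms by (intro nn_integral_powr_tail) auto
  also have "ennreal (1 powr (- \<alpha> / 2 + 1) / (- \<alpha> / 2 + 1)) + ennreal (- 1 / ((- 1 - \<alpha> / 2) + 1)) < \<infinity>" by simp
  finally show ?thesis .
qed

text \<open>
  The Laplace exponent of the subordinator at \<open>1/2\<close>, where \<open>exp (- s/2)\<close> is the Gaussian
  characteristic function with variance \<open>s\<close> at a unit vector. It relates \<open>\<kappa>\<close> to the constant in front
  of \<open>|\<xi>|\<^sup>\<alpha>\<close>.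
\<close>

definition subordinator_const :: "real \<Rightarrow> ennreal" where
  "subordinator_const \<alpha> = (\<integral>\<^sup>+s. ennreal (subordinator_density \<alpha> 1 s) * ennreal (1 - exp (- s / 2)) \<partial>lborel)"

lemma subordinator_const:
  assumes "0 < \<alpha>" "\<alpha> < 2"
  shows "subordinator_const \<alpha> < \<infinity>" "0 < subordinator_const \<alpha>"
proof -
  have "subordinator_const \<alpha> \<le> (\<integral>\<^sup>+s. ennreal (subordinator_density \<alpha> 1 s) * ennreal (min 1 s) \<partial>lborel)"
    unfolding subordinator_const_def
  proof (intro nn_integral_mono)
    fix s :: real
    show "ennreal (subordinator_density \<alpha> 1 s) * ennreal (1 - exp (- s / 2)) \<le> ennreal (subordinator_density \<alpha> 1 s) * ennreal (min 1 s)"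
    proof (cases "0 < s")
      case True
      then show ?thesis using exp_ge_add_one_self[of "- s / 2"] by (intro mult_left_mono ennreal_leI) auto
    qed (simp add: subordinator_density_def)
  qed
  also have "\<dots> < \<infinity>" by (rule nn_integral_subordinator_min_finite[OF assms])
  finally show "subordinator_const \<alpha> < \<infinity>" .
  show "0 < subordinator_const \<alpha>"
  proof (rule ccontr)
    assume "\<not> 0 < subordinator_const \<alpha>"
    then have "subordinator_const \<alpha> = 0" by simp
    then have "AE s in lborel. ennreal (subordinator_density \<alpha> 1 s) * ennreal (1 - exp (- s / 2)) = 0"
      unfolding subordinator_const_def by (subst (asm) nn_integral_0_iff_AE) auto
    moreover have "ennreal (subordinator_density \<alpha> 1 s) * ennreal (1 - exp (- s / 2)) \<noteq> 0" if "0 < s" for s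
      using that by (simp add: subordinator_density_def ennreal_eq_0_iff)
    ultimately have "AE s in lborel. s \<notin> {1..2::real}" by (auto elim!: eventually_mono)
    then have "emeasure lborel {1..2::real} = 0" by (subst (asm) AE_iff_measurable[of "{1..2}"]) auto
    then show False by simp
  qed
qed

lemma nn_integral_subordinator_exp:
  assumes "0 < \<alpha>" "\<alpha> < 2" "0 \<le> r" "0 \<le> \<kappa>"
  shows "(\<integral>\<^sup>+s. ennreal (subordinator_density \<alpha> \<kappa> s) * ennreal (1 - exp (- s * r\<^sup>2 / 2)) \<partial>lborel) =
     ennreal (\<kappa> * r powr \<alpha>) * subordinator_const \<alpha>"
proof (cases "r = 0")
  case False
  then have r: "0 < r" using assms by simp
  have "(\<integral>\<^sup>+s. ennreal (subordinator_density \<alpha> \<kappa> s) * ennreal (1 - exp (- s * r\<^sup>2 / 2)) \<partial>lborel) =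
     ennreal \<bar>1 / r\<^sup>2\<bar> * (\<integral>\<^sup>+s. ennreal (subordinator_density \<alpha> \<kappa> (0 + 1 / r\<^sup>2 * s)) * ennreal (1 - exp (- (0 + 1 / r\<^sup>2 * s) * r\<^sup>2 / 2)) \<partial>lborel)"
    using r by (intro nn_integral_real_affine) auto
  also have "\<dots> = ennreal (1 / r\<^sup>2) * (\<integral>\<^sup>+s. ennreal (\<kappa> * r powr (2 + \<alpha>)) * (ennreal (subordinator_density \<alpha> 1 s) * ennreal (1 - exp (- s / 2))) \<partial>lborel)"
  proof -
    have "ennreal (subordinator_density \<alpha> \<kappa> (0 + 1 / r\<^sup>2 * s)) * ennreal (1 - exp (- (0 + 1 / r\<^sup>2 * s) * r\<^sup>2 / 2)) =
       ennreal (\<kappa> * r powr (2 + \<alpha>)) * (ennreal (subordinator_density \<alpha> 1 s) * ennreal (1 - exp (- s / 2)))" for s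
    proof (cases "0 < s")
      case True
      have "(s / r\<^sup>2) powr (- 1 - \<alpha> / 2) = s powr (- 1 - \<alpha> / 2) * r powr (2 + \<alpha>)"
      proof -
        have "(s / r\<^sup>2) powr (- 1 - \<alpha> / 2) = s powr (- 1 - \<alpha> / 2) / (r\<^sup>2) powr (- 1 - \<alpha> / 2)"
          using True r by (simp add: powr_divide)
        also have "(r\<^sup>2) powr (- 1 - \<alpha> / 2) = r powr (- (2 + \<alpha>))"
        proof -
          have e: "2 * (- 1 - \<alpha> / 2) = - (2 + \<alpha>)" by simp
          have "(r\<^sup>2) powr (- 1 - \<alpha> / 2) = (r powr 2) powr (- 1 - \<alpha> / 2)" using r by (simp add: powr_numeral)
          then show ?thesis by (simp only: powr_powr e)
        qed
        finally show ?thesis by (simp only: powr_minus divide_inverse inverse_inverse_eq)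
      qed
      then have "subordinator_density \<alpha> \<kappa> (0 + 1 / r\<^sup>2 * s) = (\<kappa> * r powr (2 + \<alpha>)) * subordinator_density \<alpha> 1 s"
      proof -
        have "0 + 1 / r\<^sup>2 * s = s / r\<^sup>2" by simp
        moreover have "subordinator_density \<alpha> \<kappa> (s / r\<^sup>2) = \<kappa> * (s / r\<^sup>2) powr (- 1 - \<alpha> / 2)"
          using True r by (simp add: subordinator_density_def)
        moreover have "subordinator_density \<alpha> 1 s = s powr (- 1 - \<alpha> / 2)"
          using True by (simp add: subordinator_density_def)
        ultimately show ?thesis using \<open>(s / r\<^sup>2) powr (- 1 - \<alpha> / 2) = s powr (- 1 - \<alpha> / 2) * r powr (2 + \<alpha>)\<close>
          by (simp only: mult_ac)
      qed
      moreover have "- (0 + 1 / r\<^sup>2 * s) * r\<^sup>2 / 2 = - s / 2" using r by simp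
      ultimately show ?thesis using assms by (simp only: ennreal_mult' mult_nonneg_nonneg powr_ge_zero mult.assoc)
    qed (use r in \<open>simp add: subordinator_density_def zero_less_divide_iff\<close>)
    then show ?thesis using r by (simp only: abs_of_pos[of "1 / r\<^sup>2"] zero_less_divide_iff zero_less_one zero_less_power2) simp
  qed
  also have "\<dots> = ennreal (1 / r\<^sup>2) * (ennreal (\<kappa> * r powr (2 + \<alpha>)) * subordinator_const \<alpha>)"
    unfolding subordinator_const_def by (subst nn_integral_cmult) auto
  also have "\<dots> = ennreal (1 / r\<^sup>2 * (\<kappa> * r powr (2 + \<alpha>))) * subordinator_const \<alpha>"
    using assms by (subst mult.assoc[symmetric], subst ennreal_mult[symmetric]) auto
  also have "1 / r\<^sup>2 * (\<kappa> * r powr (2 + \<alpha>)) = \<kappa> * r powr \<alpha>"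
    using r by (simp add: powr_add powr_numeral)
  finally show ?thesis .
qed (use assms in simp)

lemma measure_gauss_UNIV [simp]: "measure gauss UNIV = 1"
  using gauss.prob_space by simp

lemma gauss_symmetric: "distr gauss borel uminus = (gauss :: 'a::euclidean_space measure)"
proof (rule char_fun_unique)
  show "char_fun (distr gauss borel uminus) \<xi> = char_fun gauss (\<xi> :: 'a)" for \<xi>
  proof -
    have "char_fun (distr gauss borel uminus) \<xi> = char_fun gauss (- \<xi>)"
      unfolding char_fun_def by (subst integral_distr) auto
    then show ?thesis by (simp add: char_fun_gauss)
  qed
qed (auto intro: gauss.prob_space_distr prob_space_gauss)

lemma integral_cos_gauss: "(\<integral>g. cos (\<xi> \<bullet> g) \<partial>gauss) = exp (- (norm \<xi>)\<^sup>2 / 2)"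
proof -
  have "integrable gauss (\<lambda>g. iexp (\<xi> \<bullet> g))" by (rule gauss.integrable_const_bound[where B=1]) auto
  then have "(\<integral>g. Re (iexp (\<xi> \<bullet> g)) \<partial>gauss) = Re (char_fun gauss \<xi>)" unfolding char_fun_def by (rule integral_Re)
  then show ?thesis by (simp add: char_fun_gauss Re_exp)
qed

lemma stable_measure_exponent:
  assumes "0 < \<alpha>" "\<alpha> < 2" "0 \<le> \<kappa>"
  shows "(\<integral>\<^sup>+z. ennreal (1 - cos (\<xi> \<bullet> z)) \<partial>stable_measure \<alpha> \<kappa>) = ennreal (\<kappa> * norm \<xi> powr \<alpha>) * subordinator_const \<alpha>"
proof -
  have "(\<integral>\<^sup>+z. ennreal (1 - cos (\<xi> \<bullet> z)) \<partial>stable_measure \<alpha> \<kappa>) =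
     (\<integral>\<^sup>+s. ennreal (subordinator_density \<alpha> \<kappa> s) * (\<integral>\<^sup>+g. ennreal (1 - cos (\<xi> \<bullet> (sqrt s *\<^sub>R g))) \<partial>gauss) \<partial>lborel)"
    by (rule nn_integral_stable_measure) measurable
  also have "\<dots> = (\<integral>\<^sup>+s. ennreal (subordinator_density \<alpha> \<kappa> s) * ennreal (1 - exp (- s * (norm \<xi>)\<^sup>2 / 2)) \<partial>lborel)"
  proof (intro nn_integral_cong)
    fix s :: real
    show "ennreal (subordinator_density \<alpha> \<kappa> s) * (\<integral>\<^sup>+g. ennreal (1 - cos (\<xi> \<bullet> (sqrt s *\<^sub>R g))) \<partial>gauss) =
        ennreal (subordinator_density \<alpha> \<kappa> s) * ennreal (1 - exp (- s * (norm \<xi>)\<^sup>2 / 2))"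
    proof (cases "0 < s")
      case True
      have i: "integrable gauss (\<lambda>g. cos ((sqrt s *\<^sub>R \<xi>) \<bullet> g))" by (rule gauss.integrable_const_bound[where B=1]) auto
      have "(\<integral>\<^sup>+g. ennreal (1 - cos ((sqrt s *\<^sub>R \<xi>) \<bullet> g)) \<partial>gauss) = ennreal (\<integral>g. 1 - cos ((sqrt s *\<^sub>R \<xi>) \<bullet> g) \<partial>gauss)"
        using i by (intro nn_integral_eq_integral) auto
      also have "(\<integral>g. 1 - cos ((sqrt s *\<^sub>R \<xi>) \<bullet> g) \<partial>gauss) = 1 - exp (- (norm (sqrt s *\<^sub>R \<xi>))\<^sup>2 / 2)"
        using i gauss.prob_space[unfolded space_gauss] by (subst Bochner_Integration.integral_diff) (auto simp only: integral_cos_gauss, auto)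
      also have "(norm (sqrt s *\<^sub>R \<xi>))\<^sup>2 = s * (norm \<xi>)\<^sup>2" using True by (simp add: power_mult_distrib)
      finally show ?thesis by simp
    qed (simp add: subordinator_density_def)
  qed
  also have "\<dots> = ennreal (\<kappa> * norm \<xi> powr \<alpha>) * subordinator_const \<alpha>"
    using assms by (intro nn_integral_subordinator_exp) auto
  finally show ?thesis .
qed

lemma symmetric_levy_stable_measure:
  assumes \<alpha>: "0 < \<alpha>" "\<alpha> < 2" and \<kappa>: "0 \<le> \<kappa>"
  shows "symmetric_levy_measure (stable_measure \<alpha> \<kappa> :: 'a::euclidean_space measure)"
proof
  have dens: "ennreal (subordinator_density \<alpha> \<kappa> s) = ennreal \<kappa> * ennreal (subordinator_density \<alpha> 1 s)" for s
    using \<kappa> by (simp add: subordinator_density_def ennreal_mult'[symmetric] indicator_def)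
  show "levy_measure (stable_measure \<alpha> \<kappa> :: 'a measure)"
    unfolding levy_measure_def
  proof (intro conjI)
    have g0: "emeasure gauss {0::'a} = 0"
      unfolding gauss_def by (subst emeasure_density) (auto intro!: nn_integral_null_set simp: null_sets_def)
    have "emeasure (stable_measure \<alpha> \<kappa>) {0::'a} = (\<integral>\<^sup>+z. indicator {0::'a} z \<partial>stable_measure \<alpha> \<kappa>)" by simp
    also have "\<dots> = (\<integral>\<^sup>+s. ennreal (subordinator_density \<alpha> \<kappa> s) * (\<integral>\<^sup>+g. indicator {0::'a} (sqrt s *\<^sub>R g) \<partial>gauss) \<partial>lborel)"
      by (rule nn_integral_stable_measure) measurable
    also have "\<dots> = (\<integral>\<^sup>+s. 0 \<partial>(lborel::real measure))"
    proof (intro nn_integral_cong)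
      fix s :: real
      show "ennreal (subordinator_density \<alpha> \<kappa> s) * (\<integral>\<^sup>+g. indicator {0::'a} (sqrt s *\<^sub>R g) \<partial>gauss) = 0"
      proof (cases "0 < s")
        case True
        then have "(\<lambda>g. indicator {0::'a} (sqrt s *\<^sub>R g) :: ennreal) = indicator {0}" by (auto simp: indicator_def)
        then show ?thesis using g0 by simp
      qed (simp add: subordinator_density_def)
    qed
    finally show "emeasure (stable_measure \<alpha> \<kappa>) {0::'a} = 0" by simp
    have "(\<integral>\<^sup>+z. ennreal (min 1 ((norm z)\<^sup>2)) \<partial>(stable_measure \<alpha> \<kappa> :: 'a measure)) =
       (\<integral>\<^sup>+s. ennreal (subordinator_density \<alpha> \<kappa> s) * (\<integral>\<^sup>+g. ennreal (min 1 ((norm (sqrt s *\<^sub>R g))\<^sup>2)) \<partial>(gauss::'a measure)) \<partial>lborel)"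
      by (rule nn_integral_stable_measure) measurable
    also have "\<dots> \<le> (\<integral>\<^sup>+s. (ennreal \<kappa> * ennreal (gauss_moment TYPE('a))) * (ennreal (subordinator_density \<alpha> 1 s) * ennreal (min 1 s)) \<partial>lborel)"
    proof (intro nn_integral_mono)
      fix s :: real
      show "ennreal (subordinator_density \<alpha> \<kappa> s) * (\<integral>\<^sup>+g. ennreal (min 1 ((norm (sqrt s *\<^sub>R g))\<^sup>2)) \<partial>(gauss::'a measure)) \<le>
        (ennreal \<kappa> * ennreal (gauss_moment TYPE('a))) * (ennreal (subordinator_density \<alpha> 1 s) * ennreal (min 1 s))"
      proof (cases "0 < s")
        case True
        have m: "min 1 ((norm (sqrt s *\<^sub>R g))\<^sup>2) \<le> min 1 s * (1 + (norm g)\<^sup>2)" for g :: 'a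
        proof (cases "s \<le> 1")
          case True
          have "min 1 ((norm (sqrt s *\<^sub>R g))\<^sup>2) \<le> s * (norm g)\<^sup>2" using \<open>0 < s\<close> by (simp add: power_mult_distrib)
          also have "\<dots> \<le> s * (1 + (norm g)\<^sup>2)" using \<open>0 < s\<close> by simp
          finally show ?thesis using True by simp
        next
          case False
          have "min 1 ((norm (sqrt s *\<^sub>R g))\<^sup>2) \<le> 1" by simp
          also have "\<dots> \<le> 1 + (norm g)\<^sup>2" by simp
          finally show ?thesis using False by simp
        qed
        have i: "integrable (gauss::'a measure) (\<lambda>g. (norm g)\<^sup>2)"
          using gauss_second_moment[where 'a='a] by (auto simp: integrable_iff_bounded)
        have "(\<integral>\<^sup>+g. ennreal (min 1 ((norm (sqrt s *\<^sub>R g))\<^sup>2)) \<partial>(gauss::'a measure)) \<le> (\<integral>\<^sup>+g. ennreal (min 1 s * (1 + (norm g)\<^sup>2)) \<partial>(gauss::'a measure))"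
          by (intro nn_integral_mono ennreal_leI m)
        also have "\<dots> = ennreal (\<integral>g. min 1 s * (1 + (norm g)\<^sup>2) \<partial>(gauss::'a measure))"
          using i \<open>0 < s\<close> by (intro nn_integral_eq_integral) auto
        also have "(\<integral>g. min 1 s * (1 + (norm g)\<^sup>2) \<partial>(gauss::'a measure)) = min 1 s * gauss_moment TYPE('a)"
          using i by (simp add: gauss_moment_def)
        also have "ennreal (min 1 s * gauss_moment TYPE('a)) = ennreal (gauss_moment TYPE('a)) * ennreal (min 1 s)"
          using \<open>0 < s\<close> gauss_moment_pos[where 'a='a] by (subst ennreal_mult[symmetric]) (auto simp: mult.commute)
        finally have I: "(\<integral>\<^sup>+g. ennreal (min 1 ((norm (sqrt s *\<^sub>R g))\<^sup>2)) \<partial>(gauss::'a measure)) \<le>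
          ennreal (gauss_moment TYPE('a)) * ennreal (min 1 s)" .
        have "ennreal \<kappa> * ennreal (subordinator_density \<alpha> 1 s) * (\<integral>\<^sup>+g. ennreal (min 1 ((norm (sqrt s *\<^sub>R g))\<^sup>2)) \<partial>(gauss::'a measure)) \<le>
          ennreal \<kappa> * ennreal (subordinator_density \<alpha> 1 s) * (ennreal (gauss_moment TYPE('a)) * ennreal (min 1 s))"
          by (rule mult_left_mono[OF I]) simp
        then show ?thesis
          unfolding dens by (simp only: mult.assoc mult.left_commute[of "ennreal (gauss_moment TYPE('a))"])
      qed (simp add: subordinator_density_def)
    qed
    also have "\<dots> = (ennreal \<kappa> * ennreal (gauss_moment TYPE('a))) * (\<integral>\<^sup>+s. ennreal (subordinator_density \<alpha> 1 s) * ennreal (min 1 s) \<partial>lborel)"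
      by (rule nn_integral_cmult) measurable
    also have "\<dots> < \<infinity>" using nn_integral_subordinator_min_finite[OF \<alpha>] by (simp add: ennreal_mult_less_top)
    finally show "(\<integral>\<^sup>+z. ennreal (min 1 ((norm z)\<^sup>2)) \<partial>(stable_measure \<alpha> \<kappa> :: 'a measure)) < \<infinity>" .
  qed simp
  show "distr (stable_measure \<alpha> \<kappa>) borel uminus = (stable_measure \<alpha> \<kappa> :: 'a measure)"
  proof (rule measure_eqI)
    fix B assume "B \<in> sets (distr (stable_measure \<alpha> \<kappa> :: 'a measure) borel uminus)"
    then have B [measurable]: "B \<in> sets borel" by simp
    have "emeasure (distr (stable_measure \<alpha> \<kappa>) borel uminus) B = (\<integral>\<^sup>+z. indicator B z \<partial>distr (stable_measure \<alpha> \<kappa>) borel uminus)"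
      by (subst nn_integral_indicator) auto
    also have "\<dots> = (\<integral>\<^sup>+z. indicator B (- z) \<partial>stable_measure \<alpha> \<kappa>)"
      by (subst nn_integral_distr) auto
    also have "\<dots> = (\<integral>\<^sup>+s. ennreal (subordinator_density \<alpha> \<kappa> s) * (\<integral>\<^sup>+g. indicator B (sqrt s *\<^sub>R (- g)) \<partial>gauss) \<partial>lborel)"
      by (subst nn_integral_stable_measure) auto
    also have "\<dots> = (\<integral>\<^sup>+s. ennreal (subordinator_density \<alpha> \<kappa> s) * (\<integral>\<^sup>+g. indicator B (sqrt s *\<^sub>R g) \<partial>gauss) \<partial>lborel)"
    proof -
      have "(\<integral>\<^sup>+g. indicator B (sqrt s *\<^sub>R (- g)) \<partial>gauss) = (\<integral>\<^sup>+g. indicator B (sqrt s *\<^sub>R g) \<partial>distr gauss borel uminus)" for s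
        by (subst nn_integral_distr) auto
      then show ?thesis by (simp only: gauss_symmetric)
    qed
    also have "\<dots> = (\<integral>\<^sup>+z. indicator B z \<partial>stable_measure \<alpha> \<kappa>)"
      by (rule nn_integral_stable_measure[symmetric]) measurable
    also have "\<dots> = emeasure (stable_measure \<alpha> \<kappa>) B" by (subst nn_integral_indicator) auto
    finally show "emeasure (distr (stable_measure \<alpha> \<kappa>) borel uminus) B = emeasure (stable_measure \<alpha> \<kappa>) B" .
  qed simp
qed

text \<open>
  Gaussians of variance between \<open>L\<^sup>2\<close> and \<open>4 L\<^sup>2\<close> alone give the mixture a density of order
  \<open>L powr (- d - \<alpha>)\<close> on balls of radius of order \<open>L\<close>.
\<close>

lemma stable_measure_ge_lebesgue:
  assumes \<alpha>: "0 < \<alpha>" and \<kappa>: "0 < \<kappa>"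
  obtains c where "0 < c"
    "\<And>L B. 0 < L \<Longrightarrow> B \<in> sets borel \<Longrightarrow> B \<subseteq> cball 0 (3 * L) \<Longrightarrow>
      ennreal (c * L powr (- real DIM('a) - \<alpha>)) * emeasure lborel B \<le> emeasure (stable_measure \<alpha> \<kappa> :: 'a::euclidean_space measure) B"
proof -
  define b where "b = (1 / (2 * sqrt (2 * pi))) ^ DIM('a) * exp (- (9 / 2))"
  have b: "0 < b" by (simp add: b_def)
  define c where "c = 3 * \<kappa> * 4 powr (- 1 - \<alpha> / 2) * b"
  have c: "0 < c" using b \<kappa> by (simp add: c_def)
  show thesis
  proof (rule that[OF c])
    fix L :: real and B :: "'a set"
    assume L: "0 < L" and B [measurable]: "B \<in> sets borel" and BL: "B \<subseteq> cball 0 (3 * L)"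
    have inner: "ennreal (b * L powr (- real DIM('a))) * emeasure lborel B \<le> (\<integral>\<^sup>+g. indicator B (sqrt s *\<^sub>R g) \<partial>gauss)"
      if s: "L\<^sup>2 \<le> s" "s \<le> 4 * L\<^sup>2" for s
    proof -
      have s0: "0 < s" using s L by (auto intro: less_le_trans[of 0 "L\<^sup>2"])
      have sq: "L \<le> sqrt s" "sqrt s \<le> 2 * L"
        using s L real_le_rsqrt[of L s] real_sqrt_le_mono[OF s(2)] by (auto simp: real_sqrt_mult)
      define \<tau> where "\<tau> = 1 / sqrt s"
      have \<tau>: "0 < \<tau>" "1 / (2 * L) \<le> \<tau>" "\<tau> \<le> 1 / L"
        using sq s0 L by (auto simp: \<tau>_def intro!: divide_left_mono mult_pos_pos)
      have "ennreal (b * L powr (- real DIM('a))) * emeasure lborel B = (\<integral>\<^sup>+y. ennreal (b * L powr (- real DIM('a))) * indicator B y \<partial>lborel)"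
        by (simp add: nn_integral_cmult_indicator)
      also have "\<dots> \<le> (\<integral>\<^sup>+y. ennreal ((\<tau> / sqrt (2 * pi)) ^ DIM('a) * exp (- (\<tau> * norm (0 - y))\<^sup>2 / 2)) * indicator B y \<partial>lborel)"
      proof (intro nn_integral_mono)
        fix y :: 'a
        show "ennreal (b * L powr (- real DIM('a))) * indicator B y \<le>
          ennreal ((\<tau> / sqrt (2 * pi)) ^ DIM('a) * exp (- (\<tau> * norm (0 - y))\<^sup>2 / 2)) * indicator B y"
        proof (cases "y \<in> B")
          case True
          then have "norm y \<le> 3 * L" using BL by auto
          then have "\<tau> * norm y \<le> 1 / L * (3 * L)" using \<tau> L by (intro mult_mono) auto
          then have "(\<tau> * norm y)\<^sup>2 \<le> 3\<^sup>2" using \<tau> L by (intro power_mono) auto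
          then have e: "exp (- (9 / 2)) \<le> exp (- (\<tau> * norm (0 - y))\<^sup>2 / 2)" by simp
          have "b * L powr (- real DIM('a)) = ((1 / (2 * L)) / sqrt (2 * pi)) ^ DIM('a) * exp (- (9 / 2))"
          proof -
            have "L powr (- real DIM('a)) = (1 / L) ^ DIM('a)"
              using L by (simp add: powr_minus powr_realpow power_one_over inverse_eq_divide)
            moreover have "(1 / (2 * L)) / sqrt (2 * pi) = 1 / (2 * sqrt (2 * pi)) * (1 / L)" by simp
            ultimately show ?thesis by (simp only: b_def power_mult_distrib) simp
          qed
          also have "\<dots> \<le> (\<tau> / sqrt (2 * pi)) ^ DIM('a) * exp (- (\<tau> * norm (0 - y))\<^sup>2 / 2)"
            using \<tau> L by (intro mult_mono power_mono divide_right_mono e) auto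
          finally show ?thesis by (intro mult_right_mono ennreal_leI) auto
        qed simp
      qed
      also have "\<dots> = (\<integral>\<^sup>+g. indicator B (0 + (1/\<tau>) *\<^sub>R g) \<partial>gauss)"
        by (rule nn_integral_gauss_shift[symmetric]) (use \<tau> in auto)
      finally show ?thesis by (simp add: \<tau>_def)
    qed
    have "ennreal (c * L powr (- real DIM('a) - \<alpha>)) * emeasure lborel B =
      ennreal (3 * L\<^sup>2 * (\<kappa> * (4 * L\<^sup>2) powr (- 1 - \<alpha> / 2))) * (ennreal (b * L powr (- real DIM('a))) * emeasure lborel B)"
    proof -
      have "(4 * L\<^sup>2) powr (- 1 - \<alpha> / 2) = 4 powr (- 1 - \<alpha> / 2) * L powr (- 2 - \<alpha>)"
      proof -
        have e: "2 * (- 1 - \<alpha> / 2) = - 2 - \<alpha>" by simp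
        have "(L\<^sup>2) powr (- 1 - \<alpha> / 2) = (L powr 2) powr (- 1 - \<alpha> / 2)" using L by (simp add: powr_numeral)
        then have "(L\<^sup>2) powr (- 1 - \<alpha> / 2) = L powr (- 2 - \<alpha>)" by (simp only: powr_powr e)
        then show ?thesis using L by (simp add: powr_mult)
      qed
      moreover have "L\<^sup>2 * L powr (- 2 - \<alpha>) * L powr (- real DIM('a)) = L powr (- real DIM('a) - \<alpha>)"
      proof -
        have "L\<^sup>2 = L powr 2" using L by (simp add: powr_numeral)
        moreover have "2 + (- 2 - \<alpha>) + (- real DIM('a)) = - real DIM('a) - \<alpha>" by simp
        ultimately show ?thesis by (simp only: powr_add[symmetric])
      qed
      ultimately have "c * L powr (- real DIM('a) - \<alpha>) = (3 * L\<^sup>2 * (\<kappa> * (4 * L\<^sup>2) powr (- 1 - \<alpha> / 2))) * (b * L powr (- real DIM('a)))"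
        by (simp add: c_def mult_ac)
      then show ?thesis using L \<kappa> b by (simp add: ennreal_mult mult.assoc)
    qed
    also have "\<dots> = (\<integral>\<^sup>+s. (ennreal (\<kappa> * (4 * L\<^sup>2) powr (- 1 - \<alpha> / 2)) * (ennreal (b * L powr (- real DIM('a))) * emeasure lborel B)) * indicator {L\<^sup>2..4 * L\<^sup>2} s \<partial>lborel)"
      using L \<kappa> by (subst nn_integral_cmult_indicator) (auto simp: ennreal_mult mult_ac)
    also have "\<dots> \<le> (\<integral>\<^sup>+s. ennreal (subordinator_density \<alpha> \<kappa> s) * (\<integral>\<^sup>+g. indicator B (sqrt s *\<^sub>R g) \<partial>gauss) \<partial>lborel)"
    proof (intro nn_integral_mono)
      fix s :: real
      show "(ennreal (\<kappa> * (4 * L\<^sup>2) powr (- 1 - \<alpha> / 2)) * (ennreal (b * L powr (- real DIM('a))) * emeasure lborel B)) * indicator {L\<^sup>2..4 * L\<^sup>2} s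
        \<le> ennreal (subordinator_density \<alpha> \<kappa> s) * (\<integral>\<^sup>+g. indicator B (sqrt s *\<^sub>R g) \<partial>gauss)"
      proof (cases "s \<in> {L\<^sup>2..4 * L\<^sup>2}")
        case True
        then have s: "L\<^sup>2 \<le> s" "s \<le> 4 * L\<^sup>2" by auto
        have s0: "0 < s" using s L by (auto intro: less_le_trans[of 0 "L\<^sup>2"])
        have "\<kappa> * (4 * L\<^sup>2) powr (- 1 - \<alpha> / 2) \<le> subordinator_density \<alpha> \<kappa> s"
          using s s0 \<alpha> \<kappa> by (auto simp: subordinator_density_def intro!: mult_left_mono powr_mono2')
        then show ?thesis using inner[OF s] True by (auto intro!: mult_mono ennreal_leI)
      qed simp
    qed
    also have "\<dots> = (\<integral>\<^sup>+z. indicator B z \<partial>stable_measure \<alpha> \<kappa>)"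
      by (rule nn_integral_stable_measure[symmetric]) measurable
    also have "\<dots> = emeasure (stable_measure \<alpha> \<kappa>) B" by (subst nn_integral_indicator) auto
    finally show "ennreal (c * L powr (- real DIM('a) - \<alpha>)) * emeasure lborel B \<le> emeasure (stable_measure \<alpha> \<kappa>) B" .
  qed
qed


section \<open>Discrete Feynman-Kac operators\<close>

text \<open>
  One time step: the walk moves by a \<open>\<mu>\<close>-distributed increment and is weighted by \<open>k\<close> at its new
  position. Iterates applied to \<open>1\<close> are expectations of products of weights along the walk.
\<close>

definition fk_step :: "'a::euclidean_space measure \<Rightarrow> ('a \<Rightarrow> ennreal) \<Rightarrow> ('a \<Rightarrow> ennreal) \<Rightarrow> 'a \<Rightarrow> ennreal" where
  "fk_step \<mu> k g x = (\<integral>\<^sup>+y. k (x + y) * g (x + y) \<partial>\<mu>)"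

text \<open>
  The step of the walk killed outside \<open>K\<close>. Cutting off on both sides makes the operator
  symmetric in \<open>L\<^sup>2\<close> whenever \<open>\<mu>\<close> is symmetric.
\<close>

definition confined_step :: "'a::euclidean_space measure \<Rightarrow> 'a set \<Rightarrow> ('a \<Rightarrow> ennreal) \<Rightarrow> 'a \<Rightarrow> ennreal" where
  "confined_step \<mu> K g x = indicator K x * (\<integral>\<^sup>+y. indicator K (x + y) * g (x + y) \<partial>\<mu>)"

lemma ennreal_two_mult_le: "2 * (a * b) \<le> a * a + b * b" for a b :: ennreal
proof (cases "a = \<infinity> \<or> b = \<infinity>")
  case True
  then show ?thesis by auto
next
  case False
  then obtain x y where xy: "a = ennreal x" "0 \<le> x" "b = ennreal y" "0 \<le> y" by (cases a; cases b) auto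
  have "2 * (x * y) \<le> x * x + y * y" using zero_le_square[of "x - y"] by (simp add: algebra_simps)
  then have "ennreal (2 * (x * y)) \<le> ennreal (x * x + y * y)" by (rule ennreal_leI)
  then show ?thesis using xy by (simp add: ennreal_mult)
qed

lemma nn_integral_lborel_shift:
  fixes f :: "'a::euclidean_space \<Rightarrow> ennreal"
  assumes [measurable]: "f \<in> borel_measurable borel"
  shows "(\<integral>\<^sup>+x. f (x + c) \<partial>lborel) = (\<integral>\<^sup>+x. f x \<partial>lborel)"
proof -
  have "(\<integral>\<^sup>+x. f x \<partial>lborel) = (\<integral>\<^sup>+x. f x \<partial>distr lborel borel ((+) c))" by (simp only: lborel_distr_plus)
  also have "\<dots> = (\<integral>\<^sup>+x. f (x + c) \<partial>lborel)" by (subst nn_integral_distr) (auto simp: add.commute)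
  finally show ?thesis ..
qed

lemma exp_minus_two_le: "exp (- (2 * x)) \<le> 1 - x" if "0 \<le> x" "x \<le> 1 / 2" for x :: real
proof -
  have "exp (- (2 * x)) = 1 / exp (2 * x)" by (simp add: exp_minus')
  also have "\<dots> \<le> 1 / (1 + 2 * x)" using that by (intro divide_left_mono exp_ge_add_one_self mult_pos_pos) auto
  also have "\<dots> \<le> 1 - x"
  proof -
    have "x * (2 * x) \<le> x * 1" using that by (intro mult_left_mono) auto
    then have "1 \<le> (1 - x) * (1 + 2 * x)" by (simp add: algebra_simps)
    then show ?thesis using that by (simp add: divide_le_eq)
  qed
  finally show ?thesis .
qed

context
  fixes \<mu> :: "'a::euclidean_space measure"
  assumes p: "prob_space \<mu>" and s [measurable_cong]: "sets \<mu> = sets borel"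
begin

interpretation prob_space \<mu> by (rule p)

lemma fk_step_measurable [measurable]:
  assumes [measurable]: "k \<in> borel_measurable borel" "g \<in> borel_measurable borel"
  shows "fk_step \<mu> k g \<in> borel_measurable borel"
  unfolding fk_step_def[abs_def] by measurable

lemma fk_step_pow_measurable [measurable]:
  assumes [measurable]: "k \<in> borel_measurable borel" "g \<in> borel_measurable borel"
  shows "(fk_step \<mu> k ^^ n) g \<in> borel_measurable borel"
  by (induction n) auto

lemma confined_step_measurable [measurable]:
  assumes [measurable]: "K \<in> sets borel" "g \<in> borel_measurable borel"
  shows "confined_step \<mu> K g \<in> borel_measurable borel"
  unfolding confined_step_def[abs_def] by measurable

lemma confined_step_pow_measurable [measurable]:
  assumes [measurable]: "K \<in> sets borel" "g \<in> borel_measurable borel"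
  shows "(confined_step \<mu> K ^^ n) g \<in> borel_measurable borel"
  by (induction n) auto

lemma fk_step_mono: "(\<And>x. g x \<le> g' x) \<Longrightarrow> fk_step \<mu> k g x \<le> fk_step \<mu> k g' x"
  unfolding fk_step_def by (intro nn_integral_mono mult_left_mono) auto

lemma confined_step_mono: "(\<And>x. g x \<le> g' x) \<Longrightarrow> confined_step \<mu> K g x \<le> confined_step \<mu> K g' x"
  unfolding confined_step_def by (intro nn_integral_mono mult_left_mono) auto

lemma confined_step_pow_mono: "(\<And>x. g x \<le> g' x) \<Longrightarrow> (confined_step \<mu> K ^^ n) g x \<le> (confined_step \<mu> K ^^ n) g' x"
  by (induction n arbitrary: x) (auto intro: confined_step_mono)

lemma confined_step_le_1: "(\<And>x. g x \<le> 1) \<Longrightarrow> confined_step \<mu> K g x \<le> indicator K x"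
proof -
  assume g: "\<And>x. g x \<le> 1"
  have "(\<integral>\<^sup>+y. indicator K (x + y) * g (x + y) \<partial>\<mu>) \<le> (\<integral>\<^sup>+y. 1 \<partial>\<mu>)"
    using g by (intro nn_integral_mono) (auto simp: indicator_def)
  also have "\<dots> = 1" by (simp add: emeasure_space_1)
  finally show ?thesis unfolding confined_step_def by (auto simp: indicator_def)
qed

lemma fk_step_le_1: "(\<And>x. k x \<le> 1) \<Longrightarrow> (\<And>x. g x \<le> 1) \<Longrightarrow> fk_step \<mu> k g x \<le> 1"
proof -
  assume k: "\<And>x. k x \<le> 1" and g: "\<And>x. g x \<le> 1"
  have "fk_step \<mu> k g x \<le> (\<integral>\<^sup>+y. 1 * 1 \<partial>\<mu>)"
    unfolding fk_step_def using k g by (intro nn_integral_mono mult_mono) auto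
  also have "\<dots> = 1" by (simp add: emeasure_space_1)
  finally show ?thesis .
qed

lemma fk_step_pow_antimono:
  assumes k: "\<And>x. k x \<le> 1" and "m \<le> n"
  shows "(fk_step \<mu> k ^^ n) (\<lambda>_. 1) x \<le> (fk_step \<mu> k ^^ m) (\<lambda>_. 1) x"
proof -
  have "(fk_step \<mu> k ^^ Suc n) (\<lambda>_. 1) x \<le> (fk_step \<mu> k ^^ n) (\<lambda>_. 1) x" for n x
  proof (induction n arbitrary: x)
    case 0
    show ?case using fk_step_le_1[OF k, of "\<lambda>_. 1"] by simp
  next
    case (Suc n)
    then show ?case using fk_step_mono by auto
  qed
  then show ?thesis by (rule lift_Suc_antimono_le[of "\<lambda>n. (fk_step \<mu> k ^^ n) (\<lambda>_. 1) x", OF _ \<open>m \<le> n\<close>])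
qed

lemma confined_step_pow_antimono:
  assumes "m \<le> n"
  shows "(confined_step \<mu> K ^^ n) (indicator K) x \<le> (confined_step \<mu> K ^^ m) (indicator K) x"
proof -
  have "(confined_step \<mu> K ^^ Suc n) (indicator K) x \<le> (confined_step \<mu> K ^^ n) (indicator K) x" for n x
  proof (induction n arbitrary: x)
    case 0
    have "indicator K y \<le> (1::ennreal)" for y by (simp add: indicator_def)
    from confined_step_le_1[of "indicator K" K x, OF this] show ?case by simp
  next
    case (Suc n)
    then show ?case using confined_step_mono by auto
  qed
  then show ?thesis by (rule lift_Suc_antimono_le[of "\<lambda>n. (confined_step \<mu> K ^^ n) (indicator K) x", OF _ \<open>m \<le> n\<close>])
qed

lemma confined_le_fk_step:
  assumes k: "\<And>x. x \<in> K \<Longrightarrow> e \<le> k x" and g: "\<And>x. c * g x \<le> g' x"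
    and [measurable]: "K \<in> sets borel" "g \<in> borel_measurable borel"
  shows "(e * c) * confined_step \<mu> K g x \<le> fk_step \<mu> k g' x"
proof -
  have "(e * c) * confined_step \<mu> K g x \<le> (e * c) * (\<integral>\<^sup>+y. indicator K (x + y) * g (x + y) \<partial>\<mu>)"
    unfolding confined_step_def by (intro mult_left_mono) (auto simp: indicator_def)
  also have "\<dots> = (\<integral>\<^sup>+y. (e * c) * (indicator K (x + y) * g (x + y)) \<partial>\<mu>)"
    by (rule nn_integral_cmult[symmetric]) measurable
  also have "\<dots> \<le> fk_step \<mu> k g' x"
    unfolding fk_step_def
  proof (intro nn_integral_mono)
    fix y
    show "(e * c) * (indicator K (x + y) * g (x + y)) \<le> k (x + y) * g' (x + y)"
    proof (cases "x + y \<in> K")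
      case True
      then have "e * (c * g (x + y)) \<le> k (x + y) * g' (x + y)" by (intro mult_mono k g) auto
      then show ?thesis using True by (simp add: mult.assoc)
    qed simp
  qed
  finally show ?thesis .
qed

lemma confined_pow_le_fk_pow:
  assumes k: "\<And>x. x \<in> K \<Longrightarrow> e \<le> k x" and [measurable]: "K \<in> sets borel"
  shows "e ^ n * (confined_step \<mu> K ^^ n) (indicator K) x \<le> (fk_step \<mu> k ^^ n) (\<lambda>_. 1) x"
proof (induction n arbitrary: x)
  case (Suc n)
  show ?case using confined_le_fk_step[OF k Suc] by simp
qed (simp add: indicator_def)

subsection \<open>Hopping from one ball to another\<close>

lemma nn_integral_ge_of_emeasure_ge:
  fixes g :: "'a \<Rightarrow> ennreal"
  assumes [measurable]: "g \<in> borel_measurable borel" "q \<in> sets borel"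
    and dom: "\<And>B. B \<in> sets borel \<Longrightarrow> B \<subseteq> q \<Longrightarrow> \<kappa> * emeasure lborel B \<le> emeasure \<mu> {y. x + y \<in> B}"
  shows "\<kappa> * (\<integral>\<^sup>+z. indicator q z * g z \<partial>lborel) \<le> (\<integral>\<^sup>+y. indicator q (x + y) * g (x + y) \<partial>\<mu>)"
proof -
  let ?N = "density (distr \<mu> borel ((+) x)) (indicator q)" and ?M = "density lborel (\<lambda>z. \<kappa> * indicator q z)"
  have "(\<integral>\<^sup>+z. g z \<partial>?M) \<le> (\<integral>\<^sup>+z. g z \<partial>?N)"
  proof (rule nn_integral_mono_measure)
    show "?M \<le> ?N"
    proof (subst le_measure, simp, intro ballI)
        fix B assume B: "B \<in> sets ?M"
        show "emeasure ?M B \<le> emeasure ?N B"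
        proof (cases "B \<in> sets borel")
          case True
          note [measurable] = this
          have "emeasure ?M B = \<kappa> * emeasure lborel (q \<inter> B)"
          proof -
            have "emeasure ?M B = (\<integral>\<^sup>+z. \<kappa> * indicator (q \<inter> B) z \<partial>lborel)"
              by (subst emeasure_density) (auto intro!: nn_integral_cong simp: indicator_def)
            then show ?thesis by (simp add: nn_integral_cmult_indicator)
          qed
          also have "\<dots> \<le> emeasure \<mu> {y. x + y \<in> q \<inter> B}" by (rule dom) auto
          also have "\<dots> = emeasure ?N B"
          proof -
            have "emeasure ?N B = emeasure (distr \<mu> borel ((+) x)) (q \<inter> B)"
              by (subst emeasure_density) (auto simp: indicator_inter_arith[symmetric])
            also have "\<dots> = emeasure \<mu> {y. x + y \<in> q \<inter> B}"
              using sets_eq_imp_space_eq[OF s] by (subst emeasure_distr) (auto simp: vimage_def)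
            finally show ?thesis ..
          qed
          finally show ?thesis .
        qed (use B in simp)
    qed
  qed auto
  also have "(\<integral>\<^sup>+z. g z \<partial>?N) = (\<integral>\<^sup>+y. indicator q (x + y) * g (x + y) \<partial>\<mu>)"
    by (subst nn_integral_density, measurable, subst nn_integral_distr) auto
  also have "(\<integral>\<^sup>+z. g z \<partial>?M) = \<kappa> * (\<integral>\<^sup>+z. indicator q z * g z \<partial>lborel)"
    by (subst nn_integral_density, measurable) (simp add: mult.assoc nn_integral_cmult)
  finally show ?thesis .
qed

text \<open>
  Decompose according to the step at which the walk leaves \<open>Q\<close> for \<open>q\<close>; disjointness makes the
  alternatives exclusive.
\<close>

lemma fk_pow_hop_pointwise:
  fixes k :: "'a \<Rightarrow> ennreal"
  defines "D \<equiv> \<lambda>n. (fk_step \<mu> k ^^ n) (\<lambda>_. 1)"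
  assumes [measurable]: "k \<in> borel_measurable borel" "Q \<in> sets borel" "q \<in> sets borel"
    and k1: "\<And>x. k x \<le> 1" and disj: "Q \<inter> q = {}"
    and e: "\<And>x. x \<in> Q \<union> q \<Longrightarrow> e \<le> k x"
    and dom: "\<And>x B. x \<in> Q \<Longrightarrow> B \<in> sets borel \<Longrightarrow> B \<subseteq> q \<Longrightarrow> \<kappa> * emeasure lborel B \<le> emeasure \<mu> {y. x + y \<in> B}"
  shows "N \<le> n \<Longrightarrow> (e * \<kappa> * (\<integral>\<^sup>+z. indicator q z * D n z \<partial>lborel)) *
     (\<Sum>i<N. e ^ i * (confined_step \<mu> Q ^^ i) (indicator Q) x) \<le> D n x"
proof (induction N arbitrary: n x)
  case (Suc N)
  then obtain m where m: "n = Suc m" "N \<le> m" by (cases n) auto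
  have [measurable]: "D i \<in> borel_measurable borel" for i unfolding D_def by measurable
  define J where "J i = (\<integral>\<^sup>+z. indicator q z * D i z \<partial>lborel)" for i
  have J: "J (Suc m) \<le> J m"
    unfolding J_def D_def by (intro nn_integral_mono mult_left_mono fk_step_pow_antimono[OF k1]) auto
  define c where "c = e * \<kappa> * J n"
  define G where "G x = (\<Sum>i<N. e ^ i * (confined_step \<mu> Q ^^ i) (indicator Q) x)" for x
  have [measurable]: "G \<in> borel_measurable borel" unfolding G_def by measurable
  have IH: "c * G x \<le> D m x" for x
  proof -
    have "c * G x \<le> (e * \<kappa> * J m) * G x" unfolding c_def m using J by (intro mult_right_mono mult_left_mono) auto
    also have "\<dots> \<le> D m x" unfolding G_def J_def by (rule Suc.IH[OF m(2)])
    finally show ?thesis .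
  qed
  show ?case
  proof (cases "x \<in> Q")
    case False
    then have "(confined_step \<mu> Q ^^ i) (indicator Q) x = 0" for i
      by (cases i) (auto simp: confined_step_def)
    then show ?thesis by simp
  next
    case True
    have cG: "confined_step \<mu> Q G x = (\<Sum>i<N. e ^ i * (confined_step \<mu> Q ^^ Suc i) (indicator Q) x)"
    proof -
      define A where "A i = (confined_step \<mu> Q ^^ i) (indicator Q)" for i
      have [measurable]: "A i \<in> borel_measurable borel" for i unfolding A_def by measurable
      have A: "(confined_step \<mu> Q ^^ Suc i) (indicator Q) x = (\<integral>\<^sup>+y. indicator Q (x + y) * A i (x + y) \<partial>\<mu>)" for i
        using True by (simp add: A_def confined_step_def[of \<mu> Q "(confined_step \<mu> Q ^^ i) (indicator Q)"])
      have "confined_step \<mu> Q G x = (\<integral>\<^sup>+y. (\<Sum>i<N. e ^ i * (indicator Q (x + y) * A i (x + y))) \<partial>\<mu>)"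
        using True by (simp add: confined_step_def[of \<mu> Q G] G_def A_def sum_distrib_left mult.left_commute)
      also have "\<dots> = (\<Sum>i<N. e ^ i * (\<integral>\<^sup>+y. indicator Q (x + y) * A i (x + y) \<partial>\<mu>))"
        by (simp add: nn_integral_sum nn_integral_cmult)
      finally show ?thesis unfolding A .
    qed
    have "c * (\<Sum>i<Suc N. e ^ i * (confined_step \<mu> Q ^^ i) (indicator Q) x) =
        c + c * (\<Sum>i<N. e ^ Suc i * (confined_step \<mu> Q ^^ Suc i) (indicator Q) x)"
      using True by (subst sum.lessThan_Suc_shift) (simp add: distrib_left)
    also have "c * (\<Sum>i<N. e ^ Suc i * (confined_step \<mu> Q ^^ Suc i) (indicator Q) x) = (e * c) * confined_step \<mu> Q G x"
      unfolding cG by (simp add: sum_distrib_left mult_ac)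
    also have "(e * c) * confined_step \<mu> Q G x \<le> (\<integral>\<^sup>+y. indicator Q (x + y) * (k (x + y) * D m (x + y)) \<partial>\<mu>)"
    proof -
      have "(e * c) * confined_step \<mu> Q G x = (\<integral>\<^sup>+y. (e * c) * (indicator Q (x + y) * G (x + y)) \<partial>\<mu>)"
        using True by (simp add: confined_step_def nn_integral_cmult)
      also have "\<dots> \<le> (\<integral>\<^sup>+y. indicator Q (x + y) * (k (x + y) * D m (x + y)) \<partial>\<mu>)"
      proof (intro nn_integral_mono)
        fix y
        have "e * (c * G (x + y)) \<le> k (x + y) * D m (x + y)" if "x + y \<in> Q" using that by (intro mult_mono e IH) auto
        then show "(e * c) * (indicator Q (x + y) * G (x + y)) \<le> indicator Q (x + y) * (k (x + y) * D m (x + y))"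
          by (auto simp: indicator_def mult.assoc)
      qed
      finally show ?thesis .
    qed
    also have "c \<le> (\<integral>\<^sup>+y. indicator q (x + y) * (k (x + y) * D m (x + y)) \<partial>\<mu>)"
    proof -
      have "c \<le> e * (\<kappa> * J m)" unfolding c_def m mult.assoc using J by (intro mult_left_mono) auto
      also have "\<dots> \<le> e * (\<integral>\<^sup>+y. indicator q (x + y) * D m (x + y) \<partial>\<mu>)"
        unfolding J_def by (intro mult_left_mono nn_integral_ge_of_emeasure_ge dom[OF True]) auto
      also have "\<dots> = (\<integral>\<^sup>+y. e * (indicator q (x + y) * D m (x + y)) \<partial>\<mu>)"
        by (rule nn_integral_cmult[symmetric]) measurable
      also have "\<dots> \<le> (\<integral>\<^sup>+y. indicator q (x + y) * (k (x + y) * D m (x + y)) \<partial>\<mu>)"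
        using e by (intro nn_integral_mono) (auto simp: indicator_def intro!: mult_right_mono)
      finally show ?thesis .
    qed
    finally have "c * (\<Sum>i<Suc N. e ^ i * (confined_step \<mu> Q ^^ i) (indicator Q) x) \<le>
       (\<integral>\<^sup>+y. indicator q (x + y) * (k (x + y) * D m (x + y)) \<partial>\<mu>) + (\<integral>\<^sup>+y. indicator Q (x + y) * (k (x + y) * D m (x + y)) \<partial>\<mu>)"
      by (simp add: add_mono)
    also have "\<dots> = (\<integral>\<^sup>+y. indicator q (x + y) * (k (x + y) * D m (x + y)) + indicator Q (x + y) * (k (x + y) * D m (x + y)) \<partial>\<mu>)"
      by (rule nn_integral_add[symmetric]) measurable
    also have "\<dots> \<le> (\<integral>\<^sup>+y. k (x + y) * D m (x + y) \<partial>\<mu>)"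
      using disj by (intro nn_integral_mono) (auto simp: indicator_def)
    also have "\<dots> = D n x" unfolding m D_def by (simp add: fk_step_def)
    finally show ?thesis unfolding c_def J_def .
  qed
qed simp

lemma fk_pow_hop:
  fixes k :: "'a \<Rightarrow> ennreal"
  defines "D \<equiv> \<lambda>n. (fk_step \<mu> k ^^ n) (\<lambda>_. 1)"
  assumes [measurable]: "k \<in> borel_measurable borel" "Q \<in> sets borel" "q \<in> sets borel"
    and k1: "\<And>x. k x \<le> 1" and disj: "Q \<inter> q = {}"
    and e: "\<And>x. x \<in> Q \<union> q \<Longrightarrow> e \<le> k x" and e1: "e \<le> 1"
    and dom: "\<And>x B. x \<in> Q \<Longrightarrow> B \<in> sets borel \<Longrightarrow> B \<subseteq> q \<Longrightarrow> \<kappa> * emeasure lborel B \<le> emeasure \<mu> {y. x + y \<in> B}"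
    and N: "0 < N" "N \<le> n"
  shows "of_nat N * e ^ N * \<kappa> * (\<integral>\<^sup>+x. (confined_step \<mu> Q ^^ N) (indicator Q) x \<partial>lborel) *
     (\<integral>\<^sup>+z. indicator q z * D n z \<partial>lborel) \<le> (\<integral>\<^sup>+x. indicator Q x * D n x \<partial>lborel)"
proof -
  have [measurable]: "D i \<in> borel_measurable borel" for i unfolding D_def by measurable
  define J where "J = (\<integral>\<^sup>+z. indicator q z * D n z \<partial>lborel)"
  define A where "A i = (confined_step \<mu> Q ^^ i) (indicator Q)" for i
  have [measurable]: "A i \<in> borel_measurable borel" for i unfolding A_def by measurable
  have sum_ge: "of_nat N * (e ^ N * A N x) \<le> e * (\<Sum>i<N. e ^ i * A i x)" for x
  proof -
    have "of_nat N * (e ^ N * A N x) = (\<Sum>i<N. e ^ N * A N x)" by simp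
    also have "\<dots> \<le> (\<Sum>i<N. e * (e ^ i * A i x))"
    proof (intro sum_mono)
      fix i assume i: "i \<in> {..<N}"
      have "e ^ N \<le> e ^ Suc i" using i e1 by (intro power_decreasing) auto
      moreover have "A N x \<le> A i x" unfolding A_def using i by (intro confined_step_pow_antimono) auto
      ultimately have "e ^ N * A N x \<le> e ^ Suc i * A i x" by (intro mult_mono) auto
      then show "e ^ N * A N x \<le> e * (e ^ i * A i x)" by (simp add: mult.assoc)
    qed
    finally show ?thesis by (simp add: sum_distrib_left)
  qed
  have "of_nat N * e ^ N * \<kappa> * (\<integral>\<^sup>+x. A N x \<partial>lborel) * J = (\<integral>\<^sup>+x. (\<kappa> * J) * (of_nat N * (e ^ N * A N x)) \<partial>lborel)"
  proof -
    have "(\<integral>\<^sup>+x. (\<kappa> * J) * (of_nat N * (e ^ N * A N x)) \<partial>lborel) = (\<integral>\<^sup>+x. (\<kappa> * J * (of_nat N * e ^ N)) * A N x \<partial>lborel)"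
      by (simp only: mult.assoc)
    also have "\<dots> = (\<kappa> * J * (of_nat N * e ^ N)) * (\<integral>\<^sup>+x. A N x \<partial>lborel)"
      by (rule nn_integral_cmult) measurable
    finally show ?thesis by (simp only: mult_ac)
  qed
  also have "\<dots> \<le> (\<integral>\<^sup>+x. indicator Q x * D n x \<partial>lborel)"
  proof (intro nn_integral_mono)
    fix x
    show "(\<kappa> * J) * (of_nat N * (e ^ N * A N x)) \<le> indicator Q x * D n x"
    proof (cases "x \<in> Q")
      case True
      have "(\<kappa> * J) * (of_nat N * (e ^ N * A N x)) \<le> (\<kappa> * J) * (e * (\<Sum>i<N. e ^ i * A i x))"
        by (rule mult_left_mono[OF sum_ge]) simp
      also have "\<dots> = (e * \<kappa> * J) * (\<Sum>i<N. e ^ i * A i x)" by (simp add: mult_ac)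
      also have "\<dots> \<le> D n x"
        unfolding J_def A_def D_def
        by (rule fk_pow_hop_pointwise[OF _ _ _ k1 disj e dom N(2)]) auto
      finally show ?thesis using True by simp
    next
      case False
      then have "A N x = 0" by (cases N) (auto simp: A_def confined_step_def)
      then show ?thesis by simp
    qed
  qed
  finally show ?thesis unfolding J_def A_def .
qed

subsection \<open>Staying in a ball\<close>

context
  assumes sym: "distr \<mu> borel uminus = \<mu>"
begin

lemma confined_step_symmetric:
  assumes [measurable]: "K \<in> sets borel" "u \<in> borel_measurable borel" "v \<in> borel_measurable borel"
  shows "(\<integral>\<^sup>+x. u x * confined_step \<mu> K v x \<partial>lborel) = (\<integral>\<^sup>+x. confined_step \<mu> K u x * v x \<partial>lborel)"
proof -
  interpret P: pair_sigma_finite \<mu> lborel ..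
  let ?f = "\<lambda>x y. u x * indicator K x * (indicator K (x + y) * v (x + y))"
  let ?g = "\<lambda>x y. (indicator K (x + y) * u (x + y)) * (indicator K x * v x)"
  have "(\<integral>\<^sup>+x. u x * confined_step \<mu> K v x \<partial>lborel) = (\<integral>\<^sup>+x. \<integral>\<^sup>+y. ?f x y \<partial>\<mu> \<partial>lborel)"
    unfolding confined_step_def by (simp add: nn_integral_cmult mult.assoc)
  also have "\<dots> = (\<integral>\<^sup>+y. \<integral>\<^sup>+x. ?f x y \<partial>lborel \<partial>\<mu>)" by (rule P.Fubini') measurable
  also have "\<dots> = (\<integral>\<^sup>+y. \<integral>\<^sup>+x. ?f (x + - y) y \<partial>lborel \<partial>\<mu>)"
    by (subst nn_integral_lborel_shift[of _ "- y" for y]) auto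
  also have "\<dots> = (\<integral>\<^sup>+y. \<integral>\<^sup>+x. ?g x (- y) \<partial>lborel \<partial>\<mu>)" by (simp add: mult_ac)
  also have "\<dots> = (\<integral>\<^sup>+y. \<integral>\<^sup>+x. ?g x y \<partial>lborel \<partial>distr \<mu> borel uminus)"
    by (subst nn_integral_distr) auto
  also have "\<dots> = (\<integral>\<^sup>+y. \<integral>\<^sup>+x. ?g x y \<partial>lborel \<partial>\<mu>)" by (simp only: sym)
  also have "\<dots> = (\<integral>\<^sup>+x. \<integral>\<^sup>+y. ?g x y \<partial>\<mu> \<partial>lborel)" by (rule P.Fubini'[symmetric]) measurable
  also have "\<dots> = (\<integral>\<^sup>+x. confined_step \<mu> K u x * v x \<partial>lborel)"
  proof (intro nn_integral_cong)
    fix x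
    have "(\<integral>\<^sup>+y. ?g x y \<partial>\<mu>) = (\<integral>\<^sup>+y. indicator K (x + y) * u (x + y) \<partial>\<mu>) * (indicator K x * v x)"
      by (rule nn_integral_multc) measurable
    then show "(\<integral>\<^sup>+y. ?g x y \<partial>\<mu>) = confined_step \<mu> K u x * v x"
      by (simp add: confined_step_def mult_ac)
  qed
  finally show ?thesis .
qed

lemma confined_step_pow_symmetric:
  assumes [measurable]: "K \<in> sets borel" "u \<in> borel_measurable borel" "v \<in> borel_measurable borel"
  shows "(\<integral>\<^sup>+x. u x * (confined_step \<mu> K ^^ n) v x \<partial>lborel) = (\<integral>\<^sup>+x. (confined_step \<mu> K ^^ n) u x * v x \<partial>lborel)"
  using assms(2)
proof (induction n arbitrary: u)
  case (Suc n)
  note [measurable] = Suc.prems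
  have "(\<integral>\<^sup>+x. u x * (confined_step \<mu> K ^^ Suc n) v x \<partial>lborel) = (\<integral>\<^sup>+x. confined_step \<mu> K u x * (confined_step \<mu> K ^^ n) v x \<partial>lborel)"
    using confined_step_symmetric[of K u "(confined_step \<mu> K ^^ n) v"] by simp
  also have "\<dots> = (\<integral>\<^sup>+x. (confined_step \<mu> K ^^ n) (confined_step \<mu> K u) x * v x \<partial>lborel)"
    by (rule Suc.IH) measurable
  finally show ?case by (simp add: funpow_swap1)
qed simp

text \<open>
  For a symmetric operator \<open>A\<close> the Cauchy-Schwarz inequality gives
  \<open>(f, A\<^sup>2 \<^sup>m f) (f, f) \<ge> (f, A\<^sup>m f)\<^sup>2\<close>, so the decay rate along powers of two is at least the
  one seen in a single step.
\<close>

lemma confined_step_pow_two_power: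
  assumes [measurable]: "K \<in> sets borel" "f \<in> borel_measurable borel"
    and F: "(\<integral>\<^sup>+x. f x * f x \<partial>lborel) = ennreal F" and "0 \<le> F" and r: "0 \<le> r"
    and base: "ennreal (F * r) \<le> (\<integral>\<^sup>+x. f x * confined_step \<mu> K f x \<partial>lborel)"
  shows "ennreal (F * r ^ (2 ^ k)) \<le> (\<integral>\<^sup>+x. f x * (confined_step \<mu> K ^^ (2 ^ k)) f x \<partial>lborel)"
proof (induction k)
  case 0
  show ?case using base by simp
next
  case (Suc k)
  define m :: nat where "m = 2 ^ k"
  define g where "g = (confined_step \<mu> K ^^ m) f"
  define \<sigma> where "\<sigma> = r ^ m"
  have \<sigma>: "0 \<le> \<sigma>" using r by (simp add: \<sigma>_def)
  have [measurable]: "g \<in> borel_measurable borel" unfolding g_def by measurable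
  have sq: "(\<integral>\<^sup>+x. f x * (confined_step \<mu> K ^^ (2 ^ Suc k)) f x \<partial>lborel) = (\<integral>\<^sup>+x. g x * g x \<partial>lborel)"
  proof -
    have "(2::nat) ^ Suc k = m + m" by (simp add: m_def)
    then have "(\<integral>\<^sup>+x. f x * (confined_step \<mu> K ^^ (2 ^ Suc k)) f x \<partial>lborel) = (\<integral>\<^sup>+x. f x * (confined_step \<mu> K ^^ m) g x \<partial>lborel)"
      by (simp add: funpow_add g_def)
    also have "\<dots> = (\<integral>\<^sup>+x. g x * g x \<partial>lborel)"
      by (subst confined_step_pow_symmetric) (auto simp: g_def)
    finally show ?thesis .
  qed
  have "2 * (ennreal \<sigma> * ennreal (F * \<sigma>)) \<le> 2 * (ennreal \<sigma> * (\<integral>\<^sup>+x. f x * g x \<partial>lborel))"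
    using Suc unfolding g_def m_def \<sigma>_def by (intro mult_left_mono) auto
  also have "\<dots> = (\<integral>\<^sup>+x. 2 * ((ennreal \<sigma> * f x) * g x) \<partial>lborel)"
    by (simp add: nn_integral_cmult mult.assoc)
  also have "\<dots> \<le> (\<integral>\<^sup>+x. (ennreal \<sigma> * f x) * (ennreal \<sigma> * f x) + g x * g x \<partial>lborel)"
    by (intro nn_integral_mono ennreal_two_mult_le)
  also have "\<dots> = (\<integral>\<^sup>+x. ennreal (\<sigma> * \<sigma>) * (f x * f x) \<partial>lborel) + (\<integral>\<^sup>+x. g x * g x \<partial>lborel)"
    using \<sigma> by (subst nn_integral_add) (auto simp: ennreal_mult mult_ac)
  also have "(\<integral>\<^sup>+x. ennreal (\<sigma> * \<sigma>) * (f x * f x) \<partial>lborel) = ennreal (\<sigma> * \<sigma> * F)"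
    using \<sigma> \<open>0 \<le> F\<close> by (subst nn_integral_cmult) (auto simp: F ennreal_mult)
  finally have "ennreal (\<sigma> * \<sigma> * F) + ennreal (\<sigma> * \<sigma> * F) \<le> ennreal (\<sigma> * \<sigma> * F) + (\<integral>\<^sup>+x. g x * g x \<partial>lborel)"
    using \<sigma> \<open>0 \<le> F\<close> by (simp add: ennreal_mult[symmetric] mult_2 mult_ac)
  then have "ennreal (\<sigma> * \<sigma> * F) \<le> (\<integral>\<^sup>+x. g x * g x \<partial>lborel)"
    by (simp add: ennreal_add_left_cancel_le)
  then show ?case unfolding sq by (simp add: \<sigma>_def m_def power_add[symmetric] mult_2[symmetric] mult.commute)
qed

text \<open>
  A walk whose steps are small compared to \<open>R\<close> has a chance to stay in a ball of radius \<open>R\<close> that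
  decays at a rate proportional to the truncated second moment per step. The tent function on the ball is
  a test function for the bottom of the spectrum of the killed walk, and the preceding lemma passes
  from one step to \<open>2\<^sup>k\<close> steps.
\<close>

lemma confined_ball_lower_bound:
  fixes z :: 'a and R \<delta> :: real
  defines "V \<equiv> unit_ball_vol (real DIM('a)) * R ^ DIM('a)"
  assumes R: "0 < R" and \<delta>: "0 \<le> \<delta>" "4 * 2 ^ DIM('a) * \<delta> \<le> 1 / 2"
    and mom: "(\<integral>\<^sup>+y. ennreal (min 1 ((norm y / R)\<^sup>2)) \<partial>\<mu>) \<le> ennreal \<delta>"
  shows "ennreal (V / (4 * 2 ^ DIM('a)) * exp (- (8 * 2 ^ DIM('a) * \<delta> * 2 ^ k))) \<le>
    (\<integral>\<^sup>+x. (confined_step \<mu> (cball z R) ^^ (2 ^ k)) (indicator (cball z R)) x \<partial>lborel)"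
proof -
  let ?K = "cball z R"
  have Km [measurable]: "?K \<in> sets borel" by simp
  define \<phi> where "\<phi> x = max 0 (1 - norm (x - z) / R)" for x
  have \<phi>_cont: "continuous_on UNIV \<phi>" unfolding \<phi>_def using R by (intro continuous_intros) auto
  have [measurable]: "\<phi> \<in> borel_measurable borel" using \<phi>_cont by (rule borel_measurable_continuous_onI)
  have \<phi>01: "0 \<le> \<phi> x" "\<phi> x \<le> 1" for x using R by (auto simp: \<phi>_def)
  have \<phi>_out: "\<phi> x = 0" if "x \<notin> ?K" for x
    using that R by (auto simp: \<phi>_def dist_norm norm_minus_commute)
  have \<phi>_lip: "\<bar>\<phi> (x + y) - \<phi> x\<bar> \<le> norm y / R" for x y
  proof -
    have "\<bar>norm (x + y - z) / R - norm (x - z) / R\<bar> = \<bar>norm (x + y - z) - norm (x - z)\<bar> / R"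
      using R by (simp add: diff_divide_distrib[symmetric])
    also have "\<bar>norm (x + y - z) - norm (x - z)\<bar> \<le> norm y"
      using norm_triangle_ineq3[of "x + y - z" "x - z"] by (simp add: algebra_simps)
    finally have "\<bar>norm (x + y - z) / R - norm (x - z) / R\<bar> \<le> norm y / R" using R by (simp add: divide_right_mono)
    then show ?thesis unfolding \<phi>_def by linarith
  qed
  define f where "f x = ennreal (\<phi> x)" for x
  have [measurable]: "f \<in> borel_measurable borel" unfolding f_def by measurable
  have V: "emeasure lborel ?K = ennreal V" "0 < V"
    using R by (auto simp: V_def emeasure_cball intro!: mult_pos_pos)
  have Ffin: "(\<integral>\<^sup>+x. f x * f x \<partial>lborel) \<le> ennreal V"
  proof -
    have "(\<integral>\<^sup>+x. f x * f x \<partial>lborel) \<le> (\<integral>\<^sup>+x. indicator ?K x \<partial>lborel)"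
    proof (intro nn_integral_mono)
      fix x
      show "f x * f x \<le> indicator ?K x"
        using \<phi>_out[of x] \<phi>01[of x] mult_le_one[of "\<phi> x" "\<phi> x"]
        by (cases "x \<in> ?K") (auto simp: f_def ennreal_mult[symmetric])
    qed
    then show ?thesis using V by simp
  qed
  then obtain F where F: "(\<integral>\<^sup>+x. f x * f x \<partial>lborel) = ennreal F" "0 \<le> F"
    by (cases "\<integral>\<^sup>+x. f x * f x \<partial>lborel") (auto simp: top_unique)
  have FV: "V / (4 * 2 ^ DIM('a)) \<le> F"
  proof -
    have "ennreal (1 / 4) * emeasure lborel (cball z (R / 2)) = (\<integral>\<^sup>+x. ennreal (1 / 4) * indicator (cball z (R / 2)) x \<partial>lborel)"
      by (simp add: nn_integral_cmult_indicator)
    also have "\<dots> \<le> (\<integral>\<^sup>+x. f x * f x \<partial>lborel)"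
    proof (intro nn_integral_mono)
      fix x
      show "ennreal (1 / 4) * indicator (cball z (R / 2)) x \<le> f x * f x"
      proof (cases "x \<in> cball z (R / 2)")
        case True
        then have "norm (x - z) / R \<le> 1 / 2" using R by (simp add: dist_norm norm_minus_commute field_simps)
        then have "1 / 2 \<le> \<phi> x" unfolding \<phi>_def by (intro max.coboundedI2) linarith
        then have "1 / 2 * (1 / 2) \<le> \<phi> x * \<phi> x" by (intro mult_mono) auto
        then show ?thesis using True \<phi>01[of x] by (simp add: f_def ennreal_mult[symmetric] ennreal_leI)
      qed simp
    qed
    finally have "ennreal (1 / 4) * ennreal (unit_ball_vol (real DIM('a)) * (R / 2) ^ DIM('a)) \<le> ennreal F"
      using R F by (simp add: emeasure_cball)
    then have "1 / 4 * (unit_ball_vol (real DIM('a)) * (R / 2) ^ DIM('a)) \<le> F"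
      using F(2) R by (subst (asm) ennreal_mult[symmetric]) auto
    then show ?thesis by (simp add: V_def power_divide)
  qed
  have F0: "0 < F" using FV V by (auto intro: less_le_trans[rotated])
  define \<epsilon> where "\<epsilon> = 4 * 2 ^ DIM('a) * \<delta>"
  have \<epsilon>: "0 \<le> \<epsilon>" "\<epsilon> \<le> 1 / 2" using \<delta> by (auto simp: \<epsilon>_def)
  have base: "ennreal (F * (1 - \<epsilon>)) \<le> (\<integral>\<^sup>+x. f x * confined_step \<mu> ?K f x \<partial>lborel)"
  proof -
    interpret P: pair_sigma_finite \<mu> lborel ..
    let ?a = "\<integral>\<^sup>+x. f x * confined_step \<mu> ?K f x \<partial>lborel"
    define m where "m y = min 1 ((norm y / R)\<^sup>2)" for y :: 'a
    have [measurable]: "m \<in> borel_measurable borel" unfolding m_def by measurable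
    have m0: "0 \<le> m y" for y by (simp add: m_def)
    have a: "?a = (\<integral>\<^sup>+y. \<integral>\<^sup>+x. f x * f (x + y) \<partial>lborel \<partial>\<mu>)"
    proof -
      have "f x * confined_step \<mu> ?K f x = (\<integral>\<^sup>+y. f x * f (x + y) \<partial>\<mu>)" for x
      proof -
        have "indicator ?K w * f w = f w" for w using \<phi>_out[of w] by (auto simp: f_def indicator_def)
        then have "f x * confined_step \<mu> ?K f x = f x * (\<integral>\<^sup>+y. f (x + y) \<partial>\<mu>)"
          unfolding confined_step_def by (simp add: mult.assoc[symmetric] mult.commute[of "f x" "indicator ?K x"])
        then show ?thesis by (simp add: nn_integral_cmult)
      qed
      then have "?a = (\<integral>\<^sup>+x. \<integral>\<^sup>+y. f x * f (x + y) \<partial>\<mu> \<partial>lborel)" by simp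
      also have "\<dots> = (\<integral>\<^sup>+y. \<integral>\<^sup>+x. f x * f (x + y) \<partial>lborel \<partial>\<mu>)" by (rule P.Fubini') measurable
      finally show ?thesis .
    qed
    (* u v = (u^2 + v^2)/2 - (u - v)^2/2, moved to the side where all terms are nonnegative. *)
    have pt: "ennreal (1/2) * (f x * f x) + ennreal (1/2) * (f (x + y) * f (x + y)) \<le>
        f x * f (x + y) + ennreal (1/2 * m y) * (indicator ?K x + indicator ?K (x + y))" for x y
    proof -
      have sq: "(\<phi> (x + y) - \<phi> x)\<^sup>2 \<le> m y"
      proof -
        have "\<bar>\<phi> (x + y) - \<phi> x\<bar> \<le> 1" using \<phi>01[of x] \<phi>01[of "x + y"] by linarith
        then have "(\<phi> (x + y) - \<phi> x)\<^sup>2 \<le> 1" by (simp add: abs_square_le_1)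
        moreover have "(\<phi> (x + y) - \<phi> x)\<^sup>2 \<le> (norm y / R)\<^sup>2"
          using \<phi>_lip[of x y] R by (intro abs_le_square_iff[THEN iffD1]) simp
        ultimately show ?thesis by (simp add: m_def)
      qed
      have "1/2 * (\<phi> x * \<phi> x) + 1/2 * (\<phi> (x + y) * \<phi> (x + y)) \<le>
          \<phi> x * \<phi> (x + y) + (1/2 * m y) * (indicator ?K x + indicator ?K (x + y))"
      proof (cases "x \<in> ?K \<or> x + y \<in> ?K")
        case True
        have "1/2 * (\<phi> x * \<phi> x) + 1/2 * (\<phi> (x + y) * \<phi> (x + y)) = \<phi> x * \<phi> (x + y) + 1/2 * (\<phi> (x + y) - \<phi> x)\<^sup>2"
          by (simp add: power2_eq_square algebra_simps)
        also have "\<dots> \<le> \<phi> x * \<phi> (x + y) + (1/2 * m y) * 1" using sq by simp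
        also have "\<dots> \<le> \<phi> x * \<phi> (x + y) + (1/2 * m y) * (indicator ?K x + indicator ?K (x + y))"
          using True m0[of y] by (intro add_left_mono mult_left_mono) (auto simp: indicator_def)
        finally show ?thesis .
      qed (simp add: \<phi>_out)
      then have "ennreal (1/2 * (\<phi> x * \<phi> x) + 1/2 * (\<phi> (x + y) * \<phi> (x + y))) \<le>
          ennreal (\<phi> x * \<phi> (x + y) + (1/2 * m y) * (indicator ?K x + indicator ?K (x + y)))"
        by (rule ennreal_leI)
      then show ?thesis
        using \<phi>01 m0[of y]
        by (simp only: f_def ennreal_plus ennreal_mult mult_nonneg_nonneg add_nonneg_nonneg indicator_pos_le
              ennreal_indicator zero_le_divide_1_iff zero_le_numeral)
    qed
    have eK: "(\<integral>\<^sup>+x. indicator ?K (x + y) \<partial>lborel) = ennreal V" for y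
      using nn_integral_lborel_shift[OF borel_measurable_indicator[of ?K borel], of y] V by simp
    have "ennreal F = (\<integral>\<^sup>+x. ennreal (1/2) * (f x * f x) + ennreal (1/2) * (f (x + y) * f (x + y)) \<partial>lborel)" for y
    proof -
      have "(\<integral>\<^sup>+x. ennreal (1/2) * (f x * f x) + ennreal (1/2) * (f (x + y) * f (x + y)) \<partial>lborel) =
         ennreal (1/2) * ennreal F + ennreal (1/2) * (\<integral>\<^sup>+x. f (x + y) * f (x + y) \<partial>lborel)"
        by (subst nn_integral_add) (auto simp: nn_integral_cmult F)
      also have "(\<integral>\<^sup>+x. f (x + y) * f (x + y) \<partial>lborel) = ennreal F"
        using nn_integral_lborel_shift[of "\<lambda>x. f x * f x" y] F by simp
      also have "ennreal (1/2) * ennreal F + ennreal (1/2) * ennreal F = ennreal F"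
      proof -
        have e: "ennreal (1/2) * ennreal F = ennreal (1/2 * F)" using F(2) by (intro ennreal_mult[symmetric]) auto
        have "ennreal (1/2 * F) + ennreal (1/2 * F) = ennreal F" using F(2) by (subst ennreal_plus[symmetric]) auto
        then show ?thesis by (simp only: e)
      qed
      finally show ?thesis ..
    qed
    also have le: "(\<integral>\<^sup>+x. ennreal (1/2) * (f x * f x) + ennreal (1/2) * (f (x + y) * f (x + y)) \<partial>lborel) \<le>
       (\<integral>\<^sup>+x. f x * f (x + y) \<partial>lborel) + ennreal (m y) * ennreal V" for y
    proof -
      have "(\<integral>\<^sup>+x. ennreal (1/2) * (f x * f x) + ennreal (1/2) * (f (x + y) * f (x + y)) \<partial>lborel) \<le>
        (\<integral>\<^sup>+x. f x * f (x + y) + ennreal (1/2 * m y) * (indicator ?K x + indicator ?K (x + y)) \<partial>lborel)"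
        by (intro nn_integral_mono pt)
      also have "\<dots> = (\<integral>\<^sup>+x. f x * f (x + y) \<partial>lborel) + ennreal (1/2 * m y) * (ennreal V + ennreal V)"
      proof -
        have "(\<integral>\<^sup>+x. ennreal (1/2 * m y) * (indicator ?K x + indicator ?K (x + y)) \<partial>lborel) =
            ennreal (1/2 * m y) * (\<integral>\<^sup>+x. indicator ?K x + indicator ?K (x + y) \<partial>lborel)"
          by (rule nn_integral_cmult) measurable
        also have "(\<integral>\<^sup>+x. indicator ?K x + indicator ?K (x + y) \<partial>lborel) = ennreal V + ennreal V"
          using V(1) eK[of y] by (subst nn_integral_add) auto
        finally show ?thesis by (subst nn_integral_add) auto
      qed
      also have "ennreal (1/2 * m y) * (ennreal V + ennreal V) = ennreal (m y) * ennreal V"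
        using m0[of y] V by (simp add: ennreal_mult[symmetric] ennreal_plus[symmetric] del: ennreal_plus)
      finally show ?thesis .
    qed
    finally have le: "ennreal F \<le> (\<integral>\<^sup>+x. f x * f (x + y) \<partial>lborel) + ennreal (m y) * ennreal V" for y .
    have "ennreal F = (\<integral>\<^sup>+y. ennreal F \<partial>\<mu>)" by (simp add: emeasure_space_1)
    also have "\<dots> \<le> (\<integral>\<^sup>+y. (\<integral>\<^sup>+x. f x * f (x + y) \<partial>lborel) + ennreal (m y) * ennreal V \<partial>\<mu>)"
      by (intro nn_integral_mono le)
    also have "\<dots> = ?a + (\<integral>\<^sup>+y. ennreal (m y) \<partial>\<mu>) * ennreal V"
      unfolding a by (subst nn_integral_add) (auto simp: nn_integral_multc)
    also have "\<dots> \<le> ?a + ennreal \<delta> * ennreal V"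
      using mom unfolding m_def by (intro add_left_mono mult_right_mono) auto
    also have "ennreal \<delta> * ennreal V = ennreal (\<delta> * V)" using \<delta> V by (simp add: ennreal_mult)
    finally have *: "ennreal F \<le> ?a + ennreal (\<delta> * V)" .
    have "\<delta> * V \<le> F * \<epsilon>"
      using mult_left_mono[OF FV, of "\<delta> * (4 * 2 ^ DIM('a))"] \<delta> by (simp add: \<epsilon>_def mult_ac)
    then have "F * (1 - \<epsilon>) \<le> F - \<delta> * V" by (simp add: algebra_simps)
    then have "ennreal (F * (1 - \<epsilon>)) \<le> ennreal (F - \<delta> * V)" by (rule ennreal_leI)
    also have "\<dots> = ennreal F - ennreal (\<delta> * V)" using \<delta> V by (intro ennreal_minus[symmetric]) auto
    also have "\<dots> \<le> ?a" using * by (simp add: ennreal_minus_le_iff add.commute)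
    finally show ?thesis .
  qed
  have "V / (4 * 2 ^ DIM('a)) * exp (- (8 * 2 ^ DIM('a) * \<delta> * 2 ^ k)) \<le> F * (1 - \<epsilon>) ^ (2 ^ k)"
  proof -
    have "exp (- (8 * 2 ^ DIM('a) * \<delta> * 2 ^ k)) = exp (- (2 * \<epsilon>)) ^ (2 ^ k)"
      by (simp add: \<epsilon>_def exp_of_nat_mult[symmetric] mult_ac)
    also have "\<dots> \<le> (1 - \<epsilon>) ^ (2 ^ k)" by (intro power_mono exp_minus_two_le \<epsilon>) auto
    finally show ?thesis using FV F0 V by (intro mult_mono) auto
  qed
  then have "ennreal (V / (4 * 2 ^ DIM('a)) * exp (- (8 * 2 ^ DIM('a) * \<delta> * 2 ^ k))) \<le> ennreal (F * (1 - \<epsilon>) ^ (2 ^ k))"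
    by (rule ennreal_leI)
  also have "\<dots> \<le> (\<integral>\<^sup>+x. f x * (confined_step \<mu> ?K ^^ (2 ^ k)) f x \<partial>lborel)"
    by (rule confined_step_pow_two_power[OF _ _ F _ base]) (use \<epsilon> in auto)
  also have "\<dots> \<le> (\<integral>\<^sup>+x. (confined_step \<mu> ?K ^^ (2 ^ k)) (indicator ?K) x \<partial>lborel)"
  proof (intro nn_integral_mono)
    fix x
    have f_le: "f w \<le> indicator ?K w" for w using \<phi>_out[of w] \<phi>01[of w] by (auto simp: f_def indicator_def)
    have "f x * (confined_step \<mu> ?K ^^ (2 ^ k)) f x \<le> 1 * (confined_step \<mu> ?K ^^ (2 ^ k)) (indicator ?K) x"
      by (intro mult_mono confined_step_pow_mono f_le) (use \<phi>01 in \<open>auto simp: f_def\<close>)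
    then show "f x * (confined_step \<mu> ?K ^^ (2 ^ k)) f x \<le> (confined_step \<mu> ?K ^^ (2 ^ k)) (indicator ?K) x" by simp
  qed
  finally show ?thesis .
qed

end

end


section \<open>From the process to discrete time\<close>

text \<open>
  Integrating out the last increment is one application of the operator.
\<close>

lemma nn_integral_PiM_fk_step:
  fixes \<mu> :: "'a::euclidean_space measure" and k g :: "'a \<Rightarrow> ennreal"
  assumes p: "prob_space \<mu>" and s [measurable_cong]: "sets \<mu> = sets borel"
    and [measurable]: "k \<in> borel_measurable borel" and g: "g \<in> borel_measurable borel"
  shows "(\<integral>\<^sup>+\<omega>. (\<Prod>i<n. k (x + (\<Sum>j<Suc i. \<omega> j))) * g (x + (\<Sum>j<n. \<omega> j)) \<partial>(\<Pi>\<^sub>M i\<in>{..<n}. \<mu>)) = (fk_step \<mu> k ^^ n) g x"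
  using g
proof (induction n arbitrary: g)
  case 0
  then show ?case by (simp add: PiM_empty nn_integral_count_space_finite)
next
  case (Suc n)
  note [measurable] = Suc.prems
  interpret prob_space \<mu> by (rule p)
  interpret product_sigma_finite "\<lambda>_::nat. \<mu>" ..
  have comp: "(\<lambda>\<omega>. \<omega> j) \<in> borel_measurable (\<Pi>\<^sub>M i\<in>{..<m}. \<mu>)" if "j < m" for j m :: nat
    using measurable_component_singleton[of j "{..<m}" "\<lambda>_. \<mu>"] that by (simp add: measurable_cong_sets[OF refl s])
  have sumc: "(\<lambda>\<omega>. x + (\<Sum>j<l. \<omega> j)) \<in> borel_measurable (\<Pi>\<^sub>M i\<in>{..<m}. \<mu>)" if "l \<le> m" for l m :: nat
    using that by (intro borel_measurable_add borel_measurable_const borel_measurable_sum comp) auto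
  define P where "P m = (\<Pi>\<^sub>M i\<in>{..<m}. \<mu>)" for m :: nat
  define F where "F \<omega> = (\<Prod>i<Suc n. k (x + (\<Sum>j<Suc i. \<omega> j))) * g (x + (\<Sum>j<Suc n. \<omega> j))" for \<omega>
  define Q where "Q \<omega> = (\<Prod>i<n. k (x + (\<Sum>j<Suc i. \<omega> j)))" for \<omega>
  have mF: "F \<in> borel_measurable (P (Suc n))"
    unfolding F_def P_def
    by (intro borel_measurable_times_ennreal borel_measurable_prod_ennreal measurable_compose[OF sumc assms(3)]
        measurable_compose[OF sumc Suc.prems]) auto
  have "integral\<^sup>N (P (Suc n)) F = (\<integral>\<^sup>+\<omega>. (\<integral>\<^sup>+y. F (fun_upd \<omega> n y) \<partial>\<mu>) \<partial>P n)"
    using mF unfolding P_def lessThan_Suc by (intro product_nn_integral_insert) auto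
  also have "\<dots> = (\<integral>\<^sup>+\<omega>. Q \<omega> * fk_step \<mu> k g (x + (\<Sum>j<n. \<omega> j)) \<partial>P n)"
  proof (intro nn_integral_cong)
    fix \<omega> :: "nat \<Rightarrow> 'a"
    have S: "(\<Sum>j<l. (fun_upd \<omega> n y) j) = (\<Sum>j<l. \<omega> j)" if "l \<le> n" for l y
      using that by (intro sum.cong) auto
    have "F (fun_upd \<omega> n y) = Q \<omega> * (k ((x + (\<Sum>j<n. \<omega> j)) + y) * g ((x + (\<Sum>j<n. \<omega> j)) + y))" for y
    proof -
      have "(\<Prod>i<n. k (x + (\<Sum>j<Suc i. (fun_upd \<omega> n y) j))) = Q \<omega>"
        unfolding Q_def by (intro prod.cong refl) (subst S, auto)
      moreover have "(\<Sum>j<Suc n. (fun_upd \<omega> n y) j) = (\<Sum>j<n. \<omega> j) + y"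
        using S[of n y] by simp
      ultimately show ?thesis unfolding F_def by (simp add: mult.assoc add.assoc)
    qed
    then show "(\<integral>\<^sup>+y. F (fun_upd \<omega> n y) \<partial>\<mu>) = Q \<omega> * fk_step \<mu> k g (x + (\<Sum>j<n. \<omega> j))"
      by (simp add: fk_step_def nn_integral_cmult)
  qed
  also have "\<dots> = (fk_step \<mu> k ^^ n) (fk_step \<mu> k g) x"
    unfolding P_def Q_def by (rule Suc.IH) (intro fk_step_measurable p s assms(3) Suc.prems)
  finally have "integral\<^sup>N (P (Suc n)) F = (fk_step \<mu> k ^^ n) (fk_step \<mu> k g) x" .
  then show ?case unfolding P_def F_def by (simp add: funpow_swap1)
qed

lemma sum_indicator_grid:
  fixes f :: "nat \<Rightarrow> 'b::real_vector" and n :: nat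
  assumes t: "0 < t" and n: "0 < n" and s: "0 \<le> s" "s < t"
  obtains i where "i < n" "s < real (Suc i) * (t / n)" "real (Suc i) * (t / n) \<le> s + t / n"
    "(\<Sum>i<n. indicator {real i * (t / n)..<real (Suc i) * (t / n)} s *\<^sub>R f i) = f i"
proof -
  define h where "h = t / n"
  have h: "0 < h" using t n by (simp add: h_def)
  define i where "i = nat \<lfloor>s / h\<rfloor>"
  have i: "real i \<le> s / h" "s / h < real i + 1"
    using s h by (auto simp: i_def of_nat_nat)
  then have ih: "real i * h \<le> s" "s < real (Suc i) * h" using h by (auto simp: field_simps)
  have "real i * h < real n * h" using ih s n by (simp add: h_def)
  then have i_n: "i < n" using h by simp
  have uniq: "j = i" if "real j * h \<le> s" "s < real (Suc j) * h" for j
  proof -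
    have "real j * h < real (Suc i) * h" "real i * h < real (Suc j) * h" using that ih by linarith+
    then show ?thesis using h by simp
  qed
  have "(\<Sum>j<n. indicator {real j * h..<real (Suc j) * h} s *\<^sub>R f j) = (\<Sum>j<n. if j = i then f i else 0)"
  proof (intro sum.cong refl)
    fix j
    show "indicator {real j * h..<real (Suc j) * h} s *\<^sub>R f j = (if j = i then f i else 0)"
    proof (cases "j = i")
      case True
      then show ?thesis using ih by (simp add: indicator_def)
    next
      case False
      then have "s \<notin> {real j * h..<real (Suc j) * h}" using uniq[of j] unfolding atLeastLessThan_iff by blast
      then show ?thesis using False by simp
    qed
  qed
  also have "\<dots> = f i" using i_n by (subst sum.delta) auto
  finally have sum: "(\<Sum>j<n. indicator {real j * h..<real (Suc j) * h} s *\<^sub>R f j) = f i" .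
  have "real (Suc i) * h \<le> s + h" using ih by (simp add: distrib_right)
  with sum ih(2) show thesis unfolding h_def by (intro that[OF i_n])
qed

context levy_process
begin

lemma discrete_feynman_kac:
  fixes k :: "'a \<Rightarrow> ennreal"
  assumes h: "0 < h" and [measurable]: "k \<in> borel_measurable borel"
  shows "(\<integral>\<^sup>+w. (\<Prod>i<n. k (x + X (real (Suc i) * h) w)) \<partial>M) = (fk_step (distr M borel (X h)) k ^^ n) (\<lambda>_. 1) x"
proof (cases "n = 0")
  case True
  then show ?thesis by (simp add: emeasure_space_1)
next
  case False
  define \<mu> where "\<mu> = distr M borel (X h)"
  have Xm [measurable]: "X (real i * h) \<in> borel_measurable M" for i using h by (intro measurable_X) auto
  have p\<mu>: "prob_space \<mu>" unfolding \<mu>_def using h by (intro prob_space_distr measurable_X) auto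
  have s\<mu>: "sets \<mu> = sets borel" by (simp add: \<mu>_def)
  define D where "D i w = X (real (Suc i) * h) w - X (real i * h) w" for i w
  have Dm [measurable]: "D i \<in> borel_measurable M" for i
    unfolding D_def by (intro borel_measurable_diff Xm)
  have indep: "indep_vars (\<lambda>_. borel) D {..<n}"
    using independent_increments[of "\<lambda>i. real i * h" n] h
    by (simp add: D_def[abs_def] mult_right_mono)
  have law: "distr M borel (D i) = \<mu>" for i
  proof -
    have "real i * h + h = real (Suc i) * h" by (simp add: algebra_simps)
    then show ?thesis using stationary_increments[of "real i * h" h] h by (simp add: D_def[abs_def] \<mu>_def)
  qed
  have joint: "distr M (\<Pi>\<^sub>M i\<in>{..<n}. borel) (\<lambda>w. \<lambda>i\<in>{..<n}. D i w) = (\<Pi>\<^sub>M i\<in>{..<n}. \<mu>)"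
    using indep False by (subst (asm) indep_vars_iff_distr_eq_PiM') (auto simp: law)
  have comp: "(\<lambda>\<omega>. \<omega> j) \<in> borel_measurable (\<Pi>\<^sub>M i\<in>{..<n}. (borel :: 'a measure))" if "j < n" for j
    using that by (intro measurable_component_singleton) auto
  have sumc: "(\<lambda>\<omega>. x + (\<Sum>j<l. \<omega> j)) \<in> borel_measurable (\<Pi>\<^sub>M i\<in>{..<n}. (borel :: 'a measure))" if "l \<le> n" for l
    using that by (intro borel_measurable_add borel_measurable_const borel_measurable_sum comp) auto
  let ?F = "\<lambda>\<omega>. (\<Prod>i<n. k (x + (\<Sum>j<Suc i. \<omega> j)))"
  have mF: "?F \<in> borel_measurable (\<Pi>\<^sub>M i\<in>{..<n}. (borel :: 'a measure))"
    by (intro borel_measurable_prod_ennreal measurable_compose[OF sumc assms(2)]) auto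
  have "(\<integral>\<^sup>+w. (\<Prod>i<n. k (x + X (real (Suc i) * h) w)) \<partial>M) = (\<integral>\<^sup>+w. ?F (\<lambda>i\<in>{..<n}. D i w) \<partial>M)"
  proof (rule nn_integral_cong_AE)
    show "AE w in M. (\<Prod>i<n. k (x + X (real (Suc i) * h) w)) = ?F (\<lambda>i\<in>{..<n}. D i w)"
      using start_zero
    proof eventually_elim
      case (elim w)
      have "X (real (Suc i) * h) w = (\<Sum>j<Suc i. (\<lambda>i\<in>{..<n}. D i w) j)" if "i < n" for i
      proof -
        have "(\<Sum>j<Suc i. (\<lambda>i\<in>{..<n}. D i w) j) = (\<Sum>j<Suc i. D j w)" using that by (intro sum.cong) auto
        also have "\<dots> = X (real (Suc i) * h) w - X (real 0 * h) w"
          unfolding D_def by (rule sum_lessThan_telescope)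
        finally show ?thesis using elim by simp
      qed
      then show ?case by (intro prod.cong) auto
    qed
  qed
  also have "\<dots> = (\<integral>\<^sup>+\<omega>. ?F \<omega> \<partial>distr M (\<Pi>\<^sub>M i\<in>{..<n}. borel) (\<lambda>w. \<lambda>i\<in>{..<n}. D i w))"
  proof (rule nn_integral_distr[symmetric])
    show "(\<lambda>w. \<lambda>i\<in>{..<n}. D i w) \<in> M \<rightarrow>\<^sub>M (\<Pi>\<^sub>M i\<in>{..<n}. borel)" by (intro measurable_restrict Dm)
  qed (use mF in simp)
  also have "\<dots> = (\<integral>\<^sup>+\<omega>. ?F \<omega> * 1 \<partial>(\<Pi>\<^sub>M i\<in>{..<n}. \<mu>))" by (simp only: joint mult_1_right)
  also have "\<dots> = (fk_step \<mu> k ^^ n) (\<lambda>_. 1) x"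
    using nn_integral_PiM_fk_step[OF p\<mu> s\<mu> assms(2), of "\<lambda>_. 1"] by simp
  finally show ?thesis by (simp add: \<mu>_def)
qed

text \<open>
  The path sampled at the right end points of the \<open>n\<close> intervals of length \<open>t/n\<close>.
\<close>

definition right_step :: "real \<Rightarrow> nat \<Rightarrow> real \<Rightarrow> 'w \<Rightarrow> 'a" where
  "right_step t n s w = (\<Sum>i<n. indicator {real i * (t / n)..<real (Suc i) * (t / n)} s *\<^sub>R X (real (Suc i) * (t / n)) w)"

lemma right_step_tendsto:
  assumes t: "0 < t" and s: "0 \<le> s" "s < t" and rc: "((\<lambda>s. X s w) \<longlongrightarrow> X s w) (at_right s)"
  shows "(\<lambda>k. right_step t (2 ^ k) s w) \<longlonglongrightarrow> X s w"
proof -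
  have "\<exists>\<sigma>. s < \<sigma> \<and> \<sigma> \<le> s + t / 2 ^ k \<and> right_step t (2 ^ k) s w = X \<sigma> w" for k :: nat
  proof -
    define n :: nat where "n = 2 ^ k"
    have n: "0 < n" by (simp add: n_def)
    obtain i where i: "s < real (Suc i) * (t / n)" "real (Suc i) * (t / n) \<le> s + t / n"
      "(\<Sum>i<n. indicator {real i * (t / n)..<real (Suc i) * (t / n)} s *\<^sub>R X (real (Suc i) * (t / n)) w) = X (real (Suc i) * (t / n)) w"
      by (rule sum_indicator_grid[OF t n s])
    then have "right_step t n s w = X (real (Suc i) * (t / n)) w" unfolding right_step_def by simp
    moreover have "real n = 2 ^ k" by (simp add: n_def)
    ultimately show ?thesis using i(1,2) unfolding n_def[symmetric] by auto
  qed
  then obtain \<sigma> where \<sigma>: "\<And>k. s < \<sigma> k" "\<And>k. \<sigma> k \<le> s + t / 2 ^ k" "\<And>k. right_step t (2 ^ k) s w = X (\<sigma> k) w"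
    by metis
  have "(\<lambda>k. s + t / 2 ^ k) \<longlonglongrightarrow> s + 0"
    by (intro tendsto_add tendsto_const LIMSEQ_divide_realpow_zero) auto
  then have "\<sigma> \<longlonglongrightarrow> s"
    using \<sigma> by (intro tendsto_sandwich[of "\<lambda>_. s" \<sigma> sequentially "\<lambda>k. s + t / 2 ^ k"]) (auto simp: eventually_sequentially intro: less_imp_le)
  then have "filterlim \<sigma> (at_right s) sequentially"
    unfolding filterlim_at
  proof (intro conjI)
    show "\<forall>\<^sub>F k in sequentially. \<sigma> k \<in> {s<..} \<and> \<sigma> k \<noteq> s"
    proof (intro always_eventually allI)
      fix k show "\<sigma> k \<in> {s<..} \<and> \<sigma> k \<noteq> s" using \<sigma>(1)[of k] by auto
    qed
  qed assumption
  then have "(\<lambda>k. X (\<sigma> k) w) \<longlonglongrightarrow> X s w" by (rule filterlim_compose[OF rc])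
  then show ?thesis by (simp only: \<sigma>(3))
qed

lemma AE_right_continuous: "AE w in M. \<forall>s\<ge>0. ((\<lambda>s. X s w) \<longlongrightarrow> X s w) (at_right s)"
  using cadlag_paths by eventually_elim auto

text \<open>
  Sampling at the right end points of dyadic intervals converges by right-continuity, and Fatou
  turns discrete lower bounds into a lower bound for the continuous functional.
\<close>

lemma feynman_kac_ge_discrete:
  fixes W :: "'a \<Rightarrow> real"
  assumes W: "continuous_on UNIV W" "\<And>y. 0 \<le> W y" and t: "0 < t"
    and c: "\<And>k. k\<^sub>0 \<le> k \<Longrightarrow> c \<le> (fk_step (distr M borel (X (t / 2 ^ k))) (\<lambda>y. ennreal (exp (- (t / 2 ^ k) * W y))) ^^ (2 ^ k)) (\<lambda>_. 1) x"
  shows "c \<le> feynman_kac M X (\<lambda>y. ennreal (W y)) t x"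
proof -
  have [measurable]: "W \<in> borel_measurable borel" using W by (intro borel_measurable_continuous_onI)
  define h where "h k = t / 2 ^ k" for k :: nat
  have h: "0 < h k" for k using t by (simp add: h_def)
  define J where "J k w = (\<Sum>i<(2::nat) ^ k. h k * W (x + X (real (Suc i) * h k) w))" for k w
  have Xm [measurable]: "X (real i * h k) \<in> borel_measurable M" for i k using h[of k] by (intro measurable_X) auto
  have Jm [measurable]: "J k \<in> borel_measurable M" for k
    unfolding J_def by (intro borel_measurable_sum borel_measurable_times borel_measurable_const
      measurable_compose[OF borel_measurable_add[OF borel_measurable_const Xm] \<open>W \<in> borel_measurable borel\<close>])
  have J0: "0 \<le> J k w" for k w unfolding J_def using h[of k] W(2) by (intro sum_nonneg) auto
  define u where "u k w = ennreal (exp (- J k w))" for k w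
  have [measurable]: "u k \<in> borel_measurable M" for k unfolding u_def by measurable
  have u1: "u k w \<le> 1" for k w using J0 by (simp add: u_def)
  have cu: "c \<le> (\<integral>\<^sup>+w. u k w \<partial>M)" if "k\<^sub>0 \<le> k" for k
  proof -
    have "c \<le> (fk_step (distr M borel (X (h k))) (\<lambda>y. ennreal (exp (- h k * W y))) ^^ (2 ^ k)) (\<lambda>_. 1) x"
      using c[OF that] by (simp add: h_def)
    also have "\<dots> = (\<integral>\<^sup>+w. (\<Prod>i<2 ^ k. ennreal (exp (- h k * W (x + X (real (Suc i) * h k) w)))) \<partial>M)"
      by (rule discrete_feynman_kac[OF h, symmetric]) measurable
    also have "\<dots> = (\<integral>\<^sup>+w. u k w \<partial>M)"
      by (intro nn_integral_cong) (simp only: u_def J_def prod_ennreal exp_ge_zero, simp add: exp_sum[symmetric] sum_negf)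
    finally show ?thesis .
  qed
  have "c \<le> limsup (\<lambda>k. \<integral>\<^sup>+w. u k w \<partial>M)"
  proof -
    have "c \<le> liminf (\<lambda>k. \<integral>\<^sup>+w. u k w \<partial>M)"
      using cu by (intro Liminf_bounded eventually_sequentiallyI[of k\<^sub>0])
    also have "\<dots> \<le> limsup (\<lambda>k. \<integral>\<^sup>+w. u k w \<partial>M)" by (rule Liminf_le_Limsup) simp
    finally show ?thesis .
  qed
  also have "\<dots> \<le> (\<integral>\<^sup>+w. limsup (\<lambda>k. u k w) \<partial>M)"
    by (rule nn_integral_limsup[where w="\<lambda>_. 1"]) (use u1 emeasure_space_1 in auto)
  also have "\<dots> \<le> (\<integral>\<^sup>+w. exp_minus (\<integral>\<^sup>+s\<in>{0..t}. ennreal (W (x + X s w)) \<partial>lborel) \<partial>M)"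
  proof (rule nn_integral_mono_AE)
    show "AE w in M. limsup (\<lambda>k. u k w) \<le> exp_minus (\<integral>\<^sup>+s\<in>{0..t}. ennreal (W (x + X s w)) \<partial>lborel)"
      using AE_right_continuous
    proof eventually_elim
      case (elim w)
      define I where "I = (\<integral>\<^sup>+s\<in>{0..t}. ennreal (W (x + X s w)) \<partial>lborel)"
      define G where "G k s = (\<Sum>i<(2::nat) ^ k. indicator {real i * h k..<real (Suc i) * h k} s *\<^sub>R W (x + X (real (Suc i) * h k) w))" for k s
      have Gm [measurable]: "G k \<in> borel_measurable borel" for k unfolding G_def by measurable
      have GJ: "(\<integral>\<^sup>+s. ennreal (G k s) \<partial>lborel) = ennreal (J k w)" for k
      proof -
        have "(\<integral>\<^sup>+s. ennreal (G k s) \<partial>lborel) =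
          (\<integral>\<^sup>+s. (\<Sum>i<(2::nat) ^ k. ennreal (W (x + X (real (Suc i) * h k) w)) * indicator {real i * h k..<real (Suc i) * h k} s) \<partial>lborel)"
        proof (intro nn_integral_cong)
          fix s
          have "ennreal (G k s) = (\<Sum>i<(2::nat) ^ k. ennreal (indicator {real i * h k..<real (Suc i) * h k} s *\<^sub>R W (x + X (real (Suc i) * h k) w)))"
            unfolding G_def using W(2) by (intro sum_ennreal[symmetric]) auto
            also have "\<dots> = (\<Sum>i<(2::nat) ^ k. ennreal (W (x + X (real (Suc i) * h k) w)) * indicator {real i * h k..<real (Suc i) * h k} s)"
            by (intro sum.cong refl) (simp split: split_indicator)
          finally show "ennreal (G k s) = (\<Sum>i<(2::nat) ^ k. ennreal (W (x + X (real (Suc i) * h k) w)) * indicator {real i * h k..<real (Suc i) * h k} s)" .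
        qed
        also have "\<dots> = (\<Sum>i<(2::nat) ^ k. ennreal (W (x + X (real (Suc i) * h k) w)) * ennreal (h k))"
        proof (subst nn_integral_sum)
          have "emeasure lborel {real i * h k..<real (Suc i) * h k} = ennreal (h k)" for i
            using h[of k] by (simp add: algebra_simps)
          then show "(\<Sum>i<(2::nat) ^ k. \<integral>\<^sup>+s. ennreal (W (x + X (real (Suc i) * h k) w)) * indicator {real i * h k..<real (Suc i) * h k} s \<partial>lborel) =
            (\<Sum>i<(2::nat) ^ k. ennreal (W (x + X (real (Suc i) * h k) w)) * ennreal (h k))"
            by (simp only: nn_integral_cmult_indicator lmeasurable_iff_integrable sets_lborel atLeastLessThan_borel)
        qed simp
        also have "\<dots> = (\<Sum>i<(2::nat) ^ k. ennreal (h k * W (x + X (real (Suc i) * h k) w)))"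
          using h[of k] W(2) by (intro sum.cong refl) (simp add: ennreal_mult mult.commute)
        also have "\<dots> = ennreal (J k w)"
          unfolding J_def using h[of k] W(2) by (intro sum_ennreal) (simp add: less_imp_le)
        finally show ?thesis .
      qed
      have G_lim: "(\<lambda>k. G k s) \<longlonglongrightarrow> W (x + X s w)" if s: "0 \<le> s" "s < t" for s
      proof -
        have "G k s = W (x + right_step t (2 ^ k) s w)" for k
        proof -
          have n: "0 < (2::nat) ^ k" by simp
          have hk: "h k = t / real (2 ^ k)" by (simp add: h_def)
          obtain i where "(\<Sum>i<2 ^ k. indicator {real i * (t / real (2 ^ k))..<real (Suc i) * (t / real (2 ^ k))} s *\<^sub>R
              (X (real (Suc i) * (t / real (2 ^ k))) w, W (x + X (real (Suc i) * (t / real (2 ^ k))) w))) =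
              (X (real (Suc i) * (t / real (2 ^ k))) w, W (x + X (real (Suc i) * (t / real (2 ^ k))) w))"
            by (rule sum_indicator_grid[OF t n s, of "\<lambda>i. (X (real (Suc i) * (t / real (2 ^ k))) w, W (x + X (real (Suc i) * (t / real (2 ^ k))) w))"])
          then have "right_step t (2 ^ k) s w = X (real (Suc i) * (t / real (2 ^ k))) w" "G k s = W (x + X (real (Suc i) * (t / real (2 ^ k))) w)"
            unfolding right_step_def G_def hk by (simp_all add: prod_eq_iff fst_sum snd_sum)
          then show ?thesis by simp
        qed
        moreover have "(\<lambda>k. W (x + right_step t (2 ^ k) s w)) \<longlonglongrightarrow> W (x + X s w)"
        proof (rule isCont_tendsto_compose[of _ W])
          show "isCont W (x + X s w)" using W(1) by (simp add: continuous_on_eq_continuous_at)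
          show "(\<lambda>k. x + right_step t (2 ^ k) s w) \<longlonglongrightarrow> x + X s w"
            using elim s by (intro tendsto_add tendsto_const right_step_tendsto[OF t]) auto
        qed
        ultimately show ?thesis by simp
      qed
      have "I \<le> (\<integral>\<^sup>+s. liminf (\<lambda>k. ennreal (G k s)) \<partial>lborel)"
        unfolding I_def
      proof (rule nn_integral_mono_AE)
        have "AE s in lborel. s \<noteq> t" by (rule AE_lborel_singleton)
        then show "AE s in lborel. ennreal (W (x + X s w)) * indicator {0..t} s \<le> liminf (\<lambda>k. ennreal (G k s))"
        proof eventually_elim
          case (elim s)
          show ?case
          proof (cases "s \<in> {0..t}")
            case True
            then have "(\<lambda>k. ennreal (G k s)) \<longlonglongrightarrow> ennreal (W (x + X s w))"
              using elim by (intro tendsto_ennrealI G_lim) auto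
            then show ?thesis using True by (simp add: lim_imp_Liminf)
          qed simp
        qed
      qed
      also have "\<dots> \<le> liminf (\<lambda>k. \<integral>\<^sup>+s. ennreal (G k s) \<partial>lborel)" by (rule nn_integral_liminf) measurable
      finally have I: "I \<le> liminf (\<lambda>k. ennreal (J k w))" by (simp only: GJ)
      have step: "limsup (\<lambda>k. u k w) \<le> ennreal (exp (- r))" if "ennreal r < I" for r
      proof (rule Limsup_bounded)
        have "\<forall>\<^sub>F k in sequentially. ennreal r < ennreal (J k w)" using that I by (intro less_LiminfD) auto
        then show "\<forall>\<^sub>F k in sequentially. u k w \<le> ennreal (exp (- r))"
        proof eventually_elim
          case (elim k)
          then have "r \<le> J k w" using J0[of k w] by (metis ennreal_leI linorder_not_less order.order_iff_strict)
          then show ?case by (simp add: u_def ennreal_leI)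
        qed
      qed
      have "limsup (\<lambda>k. u k w) \<le> exp_minus I"
      proof (cases I)
        case (real i)
        show ?thesis
        proof (cases "i = 0")
          case True
          have "limsup (\<lambda>k. u k w) \<le> 1" using u1 by (intro Limsup_bounded always_eventually) auto
          then show ?thesis using True real by (simp add: exp_minus_def)
        next
          case False
          have lim: "(\<lambda>n. ennreal (exp (- (i - 1 / real (Suc n))))) \<longlonglongrightarrow> ennreal (exp (- (i - 0)))"
            by (intro tendsto_ennrealI tendsto_exp tendsto_minus tendsto_diff tendsto_const LIMSEQ_Suc[OF lim_1_over_n])
          moreover have "limsup (\<lambda>k. u k w) \<le> ennreal (exp (- (i - 1 / real (Suc n))))" for n
            using real False by (intro step) (simp add: ennreal_less_iff ennreal_lessI)
          ultimately have "limsup (\<lambda>k. u k w) \<le> ennreal (exp (- (i - 0)))"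
            by (intro LIMSEQ_le_const[OF lim] exI allI impI)
          then show ?thesis using real by (simp add: exp_minus_def)
        qed
      next
        case top
        have "(\<lambda>n. exp (- real n)) \<longlonglongrightarrow> 0"
          by (rule filterlim_compose[OF exp_at_bot]) (rule filterlim_compose[OF filterlim_uminus_at_bot_at_top filterlim_real_sequentially])
        then have lim: "(\<lambda>n. ennreal (exp (- real n))) \<longlonglongrightarrow> ennreal 0" by (rule tendsto_ennrealI)
        moreover have "limsup (\<lambda>k. u k w) \<le> ennreal (exp (- real n))" for n using top by (intro step) simp
        ultimately have "limsup (\<lambda>k. u k w) \<le> ennreal 0" by (intro LIMSEQ_le_const[OF lim] exI allI impI)
        then show ?thesis by simp
      qed
      then show ?case by (simp add: I_def)
    qed
  qed
  finally show ?thesis by (simp add: feynman_kac_def)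
qed

text \<open>
  If the potential is at least \<open>b\<close> on a large ball, then either the path spends half of its time
  outside this ball, or the exponent is at least \<open>b t / 2\<close>. Only one-dimensional marginals of the
  process enter.
\<close>

lemma feynman_kac_le:
  fixes V :: "'a \<Rightarrow> ennreal"
  assumes t: "0 < t" and b: "0 \<le> b" and V: "\<And>y. norm y \<le> L \<Longrightarrow> ennreal b \<le> V y"
    and tail: "\<And>s. 0 < s \<Longrightarrow> s < t \<Longrightarrow> emeasure (distr M borel (X s)) {y. L < norm y} \<le> ennreal p" and p: "0 \<le> p"
  shows "feynman_kac M X V t 0 \<le> ennreal (exp (- (b * t / 2)) + 2 * p)"
proof -
  have Xm: "X (real i * (t / real n)) \<in> borel_measurable M" for i n using t by (intro measurable_X) auto
  have rm: "(\<lambda>z. right_step t (2 ^ k) (fst z) (snd z)) \<in> borel_measurable (borel \<Otimes>\<^sub>M M)" for k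
    unfolding right_step_def
    by (intro borel_measurable_sum borel_measurable_scaleR measurable_compose[OF measurable_snd Xm]
        measurable_compose[OF measurable_fst borel_measurable_indicator]) auto
  define Y where "Y z = lim (\<lambda>k. right_step t (2 ^ k) (fst z) (snd z))" for z
  have Ym: "Y \<in> borel_measurable (borel \<Otimes>\<^sub>M M)" unfolding Y_def by (rule borel_measurable_lim_metric[OF rm])
  have YX: "AE w in M. \<forall>s. 0 \<le> s \<longrightarrow> s < t \<longrightarrow> Y (s, w) = X s w"
    using AE_right_continuous by eventually_elim (auto simp: Y_def intro!: limI right_step_tendsto[OF t])
  define A where "A = {z \<in> space (borel \<Otimes>\<^sub>M M). fst z \<in> {0..<t} \<and> L < norm (Y z)}"
  have A [measurable]: "A \<in> sets (borel \<Otimes>\<^sub>M M)"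
    using Ym unfolding A_def by measurable
  interpret P: pair_sigma_finite lborel M ..
  define B where "B w = (\<integral>\<^sup>+s. indicator A (s, w) \<partial>lborel)" for w
  have Bm [measurable]: "B \<in> borel_measurable M"
    unfolding B_def by measurable
  have "(\<integral>\<^sup>+w. B w \<partial>M) = (\<integral>\<^sup>+s. \<integral>\<^sup>+w. indicator A (s, w) \<partial>M \<partial>lborel)"
    unfolding B_def by (rule P.Fubini') measurable
  also have "\<dots> \<le> (\<integral>\<^sup>+s. ennreal p * indicator {0..t} s \<partial>lborel)"
  proof (rule nn_integral_mono_AE)
    have "AE s in lborel. s \<noteq> (0::real)" by (rule AE_lborel_singleton)
    then show "AE s in lborel. (\<integral>\<^sup>+w. indicator A (s, w) \<partial>M) \<le> ennreal p * indicator {0..t} s"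
    proof eventually_elim
      case (elim s)
      show ?case
      proof (cases "0 < s \<and> s < t")
        case True
        then have Xs: "X s \<in> borel_measurable M" by (intro measurable_X) auto
        have "(\<integral>\<^sup>+w. indicator A (s, w) \<partial>M) \<le> (\<integral>\<^sup>+w. indicator {y. L < norm y} (X s w) \<partial>M)"
        proof (rule nn_integral_mono_AE)
          show "AE w in M. indicator A (s, w) \<le> (indicator {y. L < norm y} (X s w) :: ennreal)"
            using YX by eventually_elim (use True in \<open>auto simp: A_def indicator_def\<close>)
        qed
        also have "\<dots> = (\<integral>\<^sup>+y. indicator {y. L < norm y} y \<partial>distr M borel (X s))"
          using Xs by (subst nn_integral_distr) auto
        also have "\<dots> = emeasure (distr M borel (X s)) {y. L < norm y}" by (subst nn_integral_indicator) auto
        also have "\<dots> \<le> ennreal p" using tail True by auto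
        finally show ?thesis using True by simp
      next
        case False
        then have "indicator A (s, w) = (0::ennreal)" for w using elim by (auto simp: A_def indicator_def)
        then show ?thesis by simp
      qed
    qed
  qed
  also have "\<dots> = ennreal p * ennreal t" using t by (simp add: nn_integral_cmult_indicator)
  finally have EB: "(\<integral>\<^sup>+w. B w \<partial>M) \<le> ennreal p * ennreal t" .
  have "feynman_kac M X V t 0 \<le> (\<integral>\<^sup>+w. ennreal (exp (- (b * t / 2))) + ennreal (2 / t) * B w \<partial>M)"
    unfolding feynman_kac_def
  proof (rule nn_integral_mono_AE)
    show "AE w in M. exp_minus (\<integral>\<^sup>+s\<in>{0..t}. V (0 + X s w) \<partial>lborel) \<le> ennreal (exp (- (b * t / 2))) + ennreal (2 / t) * B w"
      using YX AE_space
    proof eventually_elim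
      case (elim w)
      have Am: "(\<lambda>s. indicator A (s, w) :: ennreal) \<in> borel_measurable lborel"
        using elim(2) by measurable
      show ?case
      proof (cases "ennreal (t / 2) \<le> B w")
        case True
        have "exp_minus a \<le> 1" for a by (auto simp: exp_minus_def)
        then have "exp_minus (\<integral>\<^sup>+s\<in>{0..t}. V (0 + X s w) \<partial>lborel) \<le> ennreal (2 / t) * ennreal (t / 2)"
          using t by (simp add: ennreal_mult[symmetric])
        also have "\<dots> \<le> ennreal (2 / t) * B w" by (intro mult_left_mono True) auto
        finally show ?thesis by (simp add: add_increasing)
      next
        case False
        define S where "S s = indicator {0..<t} s * (1 - indicator A (s, w) :: ennreal)" for s
        have Sm [measurable]: "S \<in> borel_measurable lborel" unfolding S_def using Am by measurable
        have "ennreal t = (\<integral>\<^sup>+s. indicator {0..<t} s \<partial>lborel)" using t by simp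
        also have "\<dots> = (\<integral>\<^sup>+s. S s + indicator A (s, w) \<partial>lborel)"
          by (intro nn_integral_cong) (auto simp: S_def A_def indicator_def)
        also have "\<dots> = (\<integral>\<^sup>+s. S s \<partial>lborel) + B w"
          unfolding B_def by (rule nn_integral_add) (use Am in measurable)
        finally have tS: "ennreal t = (\<integral>\<^sup>+s. S s \<partial>lborel) + B w" .
        have "ennreal (t / 2) \<le> (\<integral>\<^sup>+s. S s \<partial>lborel)"
        proof (rule ccontr)
          assume "\<not> ennreal (t / 2) \<le> (\<integral>\<^sup>+s. S s \<partial>lborel)"
          then have "(\<integral>\<^sup>+s. S s \<partial>lborel) + B w < ennreal (t / 2) + ennreal (t / 2)"
            using False by (intro add_strict_mono) auto
          also have "\<dots> = ennreal t" using t by (subst ennreal_plus[symmetric]) auto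
          finally show False using tS by simp
        qed
        then have "ennreal b * ennreal (t / 2) \<le> ennreal b * (\<integral>\<^sup>+s. S s \<partial>lborel)" by (rule mult_left_mono) simp
        also have "\<dots> = (\<integral>\<^sup>+s. ennreal b * S s \<partial>lborel)" by (rule nn_integral_cmult[symmetric]) measurable
        also have "\<dots> \<le> (\<integral>\<^sup>+s\<in>{0..t}. V (0 + X s w) \<partial>lborel)"
        proof (intro nn_integral_mono)
          fix s
          show "ennreal b * S s \<le> V (0 + X s w) * indicator {0..t} s"
          proof (cases "s \<in> {0..<t} \<and> (s, w) \<notin> A")
            case True
            then have "norm (X s w) \<le> L" using elim by (auto simp: A_def space_pair_measure)
            then show ?thesis using True V by (simp add: S_def)
          qed (auto simp: S_def)
        qed
        finally have le: "ennreal (b * t / 2) \<le> (\<integral>\<^sup>+s\<in>{0..t}. V (0 + X s w) \<partial>lborel)"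
          using b t by (simp add: ennreal_mult[symmetric])
        have "exp_minus a \<le> ennreal (exp (- r))" if "ennreal r \<le> a" "0 \<le> r" for a r
          using that by (cases a) (auto simp: exp_minus_def intro!: ennreal_leI)
        from this[OF le] have "exp_minus (\<integral>\<^sup>+s\<in>{0..t}. V (0 + X s w) \<partial>lborel) \<le> ennreal (exp (- (b * t / 2)))"
          using b t by simp
        then show ?thesis by (simp add: add_increasing2)
      qed
    qed
  qed
  also have "\<dots> = ennreal (exp (- (b * t / 2))) + ennreal (2 / t) * (\<integral>\<^sup>+w. B w \<partial>M)"
    by (subst nn_integral_add) (auto simp: nn_integral_cmult emeasure_space_1)
  also have "\<dots> \<le> ennreal (exp (- (b * t / 2))) + ennreal (2 / t) * (ennreal p * ennreal t)"
    by (intro add_left_mono mult_left_mono EB) auto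
  also have "\<dots> = ennreal (exp (- (b * t / 2)) + 2 * p)"
    using t p by (simp add: ennreal_mult[symmetric] ennreal_plus[symmetric] del: ennreal_plus)
  finally show ?thesis .
qed

end


section \<open>Lower bounds in a fixed environment\<close>

locale levy_setting = levy_process M X + levy_laws \<nu> "\<lambda>h. distr M borel (X h)" c\<^sub>1 a
  for M :: "'w measure" and X :: "real \<Rightarrow> 'w \<Rightarrow> 'a::euclidean_space" and \<nu> c\<^sub>1 a
begin

text \<open>
  The Feynman-Kac functional of the process observed at the multiples of \<open>t/2\<^sup>k\<close>. The number of
  steps is a power of two so that the estimate for staying in a ball applies.
\<close>

definition disc :: "('a \<Rightarrow> real) \<Rightarrow> real \<Rightarrow> nat \<Rightarrow> 'a \<Rightarrow> ennreal" where
  "disc W t k x = (fk_step (distr M borel (X (t / 2 ^ k))) (\<lambda>y. ennreal (exp (- (t / 2 ^ k) * W y))) ^^ (2 ^ k)) (\<lambda>_. 1) x"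

text \<open>
  Staying in a ball of radius \<open>R\<close> costs at most the rate \<open>stay_rate R\<^bsup>-a\<^esup>\<close>.
\<close>

definition stay_rate :: real where "stay_rate = 8 * 2 ^ DIM('a) * moment_const"

definition ball_const :: real where "ball_const = unit_ball_vol (real DIM('a)) / (4 * 2 ^ DIM('a))"

lemma stay_rate_pos: "0 < stay_rate" using moment_const_pos by (simp add: stay_rate_def)

lemma ball_const_pos: "0 < ball_const" by (simp add: ball_const_def)

lemma disc_measurable [measurable]:
  assumes [measurable]: "W \<in> borel_measurable borel" and t: "0 < t"
  shows "disc W t k \<in> borel_measurable borel"
proof -
  have h: "0 < t / 2 ^ k" using t by simp
  show ?thesis unfolding disc_def[abs_def]
    by (intro fk_step_pow_measurable prob_space_law sets_law h) measurable
qed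

lemma confined_ball:
  assumes h: "0 < h" and R: "0 < R" and small: "4 * 2 ^ DIM('a) * (h * moment_const * R powr (- a)) \<le> 1 / 2"
  shows "ennreal (ball_const * R ^ DIM('a) * exp (- (stay_rate * R powr (- a) * (h * 2 ^ k)))) \<le>
    (\<integral>\<^sup>+x. (confined_step (distr M borel (X h)) (cball z R) ^^ (2 ^ k)) (indicator (cball z R)) x \<partial>lborel)"
proof -
  have "ennreal (unit_ball_vol (real DIM('a)) * R ^ DIM('a) / (4 * 2 ^ DIM('a)) *
      exp (- (8 * 2 ^ DIM('a) * (h * moment_const * R powr (- a)) * 2 ^ k))) \<le>
    (\<integral>\<^sup>+x. (confined_step (distr M borel (X h)) (cball z R) ^^ (2 ^ k)) (indicator (cball z R)) x \<partial>lborel)"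
    by (rule confined_ball_lower_bound[OF prob_space_law[OF h] sets_law[OF h] law_symmetric[OF h] R _ small law_truncated_moment[OF h R]])
       (use h moment_const_pos in auto)
  then show ?thesis by (simp add: ball_const_def stay_rate_def mult_ac)
qed

lemma confined_pow_outside: "x \<notin> K \<Longrightarrow> (confined_step \<mu> K ^^ n) (indicator K) x = 0"
  by (cases n) (auto simp: confined_step_def)

text \<open>
  Forbidding the walk to leave the ball, where the potential is at most \<open>m\<close>.
\<close>

lemma disc_mass_ball:
  assumes [measurable]: "W \<in> borel_measurable borel" and t: "0 < t" and R: "0 < R"
    and m: "\<And>y. y \<in> cball z R \<Longrightarrow> W y \<le> m"
    and small: "4 * 2 ^ DIM('a) * (t / 2 ^ k * moment_const * R powr (- a)) \<le> 1 / 2"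
  shows "ennreal (ball_const * R ^ DIM('a) * exp (- (t * (m + stay_rate * R powr (- a))))) \<le>
    (\<integral>\<^sup>+x. indicator (cball z R) x * disc W t k x \<partial>lborel)"
proof -
  let ?K = "cball z R"
  define h where "h = t / 2 ^ k"
  have h: "0 < h" using t by (simp add: h_def)
  have ht: "h * 2 ^ k = t" by (simp add: h_def)
  define A where "A = (confined_step (distr M borel (X h)) ?K ^^ (2 ^ k)) (indicator ?K)"
  have Km: "?K \<in> sets borel" by simp
  have [measurable]: "A \<in> borel_measurable borel"
    unfolding A_def by (intro confined_step_pow_measurable prob_space_law sets_law h Km) (use Km in measurable)
  have "ennreal (ball_const * R ^ DIM('a) * exp (- (t * (m + stay_rate * R powr (- a))))) =
      ennreal (exp (- (h * m)) ^ (2 ^ k)) * ennreal (ball_const * R ^ DIM('a) * exp (- (stay_rate * R powr (- a) * (h * 2 ^ k))))"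
  proof -
    have "exp (- (h * m)) ^ (2 ^ k) = exp (- (t * m))" using ht by (simp add: exp_of_nat_mult[symmetric] mult_ac)
    then show ?thesis using ball_const_pos R ht
      by (subst ennreal_mult[symmetric]) (auto simp: distrib_left exp_add[symmetric] mult_ac)
  qed
  also have "\<dots> \<le> ennreal (exp (- (h * m)) ^ (2 ^ k)) * (\<integral>\<^sup>+x. A x \<partial>lborel)"
    unfolding A_def by (intro mult_left_mono confined_ball h R) (use small in \<open>auto simp: h_def\<close>)
  also have "\<dots> = (\<integral>\<^sup>+x. ennreal (exp (- (h * m))) ^ (2 ^ k) * A x \<partial>lborel)"
    by (simp add: nn_integral_cmult ennreal_power)
  also have "\<dots> \<le> (\<integral>\<^sup>+x. indicator ?K x * disc W t k x \<partial>lborel)"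
  proof (intro nn_integral_mono)
    fix x
    show "ennreal (exp (- (h * m))) ^ (2 ^ k) * A x \<le> indicator ?K x * disc W t k x"
    proof (cases "x \<in> ?K")
      case True
      have "ennreal (exp (- (h * m))) ^ (2 ^ k) * A x \<le> disc W t k x"
        unfolding A_def disc_def h_def[symmetric]
      proof (rule confined_pow_le_fk_pow[OF prob_space_law[OF h] sets_law[OF h] _ Km])
        show "ennreal (exp (- (h * m))) \<le> ennreal (exp (- h * W x))" if "x \<in> ?K" for x
          using m[OF that] h by (intro ennreal_leI) simp
      qed
      then show ?thesis using True by simp
    qed (simp add: A_def confined_pow_outside)
  qed
  finally show ?thesis .
qed

lemma disc_hop:
  assumes [measurable]: "W \<in> borel_measurable borel" and W0: "\<And>y. 0 \<le> W y" and t: "0 < t" and r: "0 < r"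
    and q [measurable]: "q \<in> sets borel" and disj: "cball p r \<inter> q = {}" and m: "\<And>y. y \<in> cball p r \<union> q \<Longrightarrow> W y \<le> m" and m0: "0 \<le> m"
    and dom: "\<And>x B. x \<in> cball p r \<Longrightarrow> B \<in> sets borel \<Longrightarrow> B \<subseteq> q \<Longrightarrow>
       ennreal (t / 2 ^ k * \<kappa> / 2) * emeasure lborel B \<le> emeasure (distr M borel (X (t / 2 ^ k))) {y. x + y \<in> B}" and \<kappa>: "0 \<le> \<kappa>"
    and small: "4 * 2 ^ DIM('a) * (t / 2 ^ k * moment_const * r powr (- a)) \<le> 1 / 2" and jk: "j \<le> k"
  shows "ennreal (t / 2 ^ j * \<kappa> / 2 * (ball_const * r ^ DIM('a)) * exp (- (t / 2 ^ j * (m + stay_rate * r powr (- a))))) *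
     (\<integral>\<^sup>+x. indicator q x * disc W t k x \<partial>lborel) \<le> (\<integral>\<^sup>+x. indicator (cball p r) x * disc W t k x \<partial>lborel)"
proof -
  let ?Q = "cball p r"
  define h where "h = t / 2 ^ k"
  have h: "0 < h" using t by (simp add: h_def)
  define N :: nat where "N = 2 ^ (k - j)"
  have N: "0 < N" "N \<le> 2 ^ k" by (auto simp: N_def)
  have hN: "real N * h = t / 2 ^ j"
  proof -
    have "(2::real) ^ k = 2 ^ (k - j) * 2 ^ j" using jk by (simp add: power_add[symmetric])
    then show ?thesis by (simp add: N_def h_def)
  qed
  have Qm: "?Q \<in> sets borel" by simp
  define A where "A = (\<integral>\<^sup>+x. (confined_step (distr M borel (X h)) ?Q ^^ N) (indicator ?Q) x \<partial>lborel)"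
  have A: "ennreal (ball_const * r ^ DIM('a) * exp (- (stay_rate * r powr (- a) * (h * N)))) \<le> A"
    using confined_ball[OF h r, of "k - j" p] small by (simp add: A_def N_def h_def)
  have "ennreal (t / 2 ^ j * \<kappa> / 2 * (ball_const * r ^ DIM('a)) * exp (- (t / 2 ^ j * (m + stay_rate * r powr (- a))))) =
     of_nat N * ennreal (exp (- (h * m))) ^ N * ennreal (h * \<kappa> / 2) * ennreal (ball_const * r ^ DIM('a) * exp (- (stay_rate * r powr (- a) * (h * N))))"
  proof -
    have e: "exp (- (h * m)) ^ N = exp (- (t / 2 ^ j * m))" unfolding hN[symmetric] by (simp add: exp_of_nat_mult[symmetric] mult_ac)
    have "of_nat N * ennreal (exp (- (h * m))) ^ N * ennreal (h * \<kappa> / 2) * ennreal (ball_const * r ^ DIM('a) * exp (- (stay_rate * r powr (- a) * (h * N)))) =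
      ennreal (real N * exp (- (h * m)) ^ N * (h * \<kappa> / 2) * (ball_const * r ^ DIM('a) * exp (- (stay_rate * r powr (- a) * (h * N)))))"
    proof -
      have gen: "ennreal x1 * ennreal x2 * ennreal x3 * ennreal x4 = ennreal (x1 * x2 * x3 * x4)"
        if "0 \<le> x1" "0 \<le> x2" "0 \<le> x3" "0 \<le> x4" for x1 x2 x3 x4
        using that by (simp add: ennreal_mult)
      have "of_nat N = ennreal (real N)" by (simp add: ennreal_of_nat_eq_real_of_nat)
      moreover have "ennreal (exp (- (h * m))) ^ N = ennreal (exp (- (h * m)) ^ N)" by (simp add: ennreal_power)
      ultimately show ?thesis using h \<kappa> ball_const_pos r by (simp only:) (rule gen, auto)
    qed
    also have "real N * exp (- (h * m)) ^ N * (h * \<kappa> / 2) * (ball_const * r ^ DIM('a) * exp (- (stay_rate * r powr (- a) * (h * N)))) =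
      (real N * h) * \<kappa> / 2 * (ball_const * r ^ DIM('a)) * (exp (- (t / 2 ^ j * m)) * exp (- (stay_rate * r powr (- a) * (real N * h))))"
      unfolding e by (simp add: mult_ac)
    also have "\<dots> = t / 2 ^ j * \<kappa> / 2 * (ball_const * r ^ DIM('a)) * exp (- (t / 2 ^ j * (m + stay_rate * r powr (- a))))"
      unfolding hN exp_add[symmetric] by (simp add: algebra_simps)
    finally show ?thesis ..
  qed
  also have "\<dots> \<le> of_nat N * ennreal (exp (- (h * m))) ^ N * ennreal (h * \<kappa> / 2) * A"
    by (intro mult_left_mono A) auto
  finally have "ennreal (t / 2 ^ j * \<kappa> / 2 * (ball_const * r ^ DIM('a)) * exp (- (t / 2 ^ j * (m + stay_rate * r powr (- a))))) *
     (\<integral>\<^sup>+x. indicator q x * disc W t k x \<partial>lborel) \<le>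
     of_nat N * ennreal (exp (- (h * m))) ^ N * ennreal (h * \<kappa> / 2) * A * (\<integral>\<^sup>+x. indicator q x * disc W t k x \<partial>lborel)"
    by (rule mult_right_mono) simp
  also have "\<dots> \<le> (\<integral>\<^sup>+x. indicator ?Q x * disc W t k x \<partial>lborel)"
    unfolding A_def disc_def h_def[symmetric]
  proof (rule fk_pow_hop[OF prob_space_law[OF h] sets_law[OF h] _ Qm q _ disj _ _ _ N])
    show "ennreal (exp (- h * W x)) \<le> 1" for x using W0 h by simp
    show "ennreal (exp (- (h * m))) \<le> 1" using m0 h by simp
    show "ennreal (exp (- (h * m))) \<le> ennreal (exp (- h * W x))" if "x \<in> ?Q \<union> q" for x
      using m[OF that] h by (intro ennreal_leI) simp
    show "ennreal (h * \<kappa> / 2) * emeasure lborel B \<le> emeasure (distr M borel (X h)) {y. x + y \<in> B}"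
      if "x \<in> ?Q" "B \<in> sets borel" "B \<subseteq> q" for x B
      using dom[OF that] by (simp add: h_def)
  qed simp
  finally show ?thesis .
qed

text \<open>
  Shifting the starting point by \<open>x\<close> is the same as shifting the environment.
\<close>

lemma disc_start:
  assumes W: "W \<in> borel_measurable borel" "W' \<in> borel_measurable borel" and t: "0 < t" and le: "\<And>y. W y \<le> W' (x + y)"
  shows "disc W' t k x \<le> disc W t k 0"
proof -
  define h where "h = t / 2 ^ k"
  have h: "0 < h" using t by (simp add: h_def)
  note [measurable] = W
  have "disc W' t k x = (\<integral>\<^sup>+w. (\<Prod>i<2 ^ k. ennreal (exp (- h * W' (x + X (real (Suc i) * h) w)))) \<partial>M)"
    unfolding disc_def h_def[symmetric] by (rule discrete_feynman_kac[OF h, symmetric]) measurable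
  also have "\<dots> \<le> (\<integral>\<^sup>+w. (\<Prod>i<2 ^ k. ennreal (exp (- h * W (0 + X (real (Suc i) * h) w)))) \<partial>M)"
  proof (intro nn_integral_mono)
    fix w
    have "(\<Prod>i<2 ^ k. exp (- h * W' (x + X (real (Suc i) * h) w))) \<le> (\<Prod>i<2 ^ k. exp (- h * W (0 + X (real (Suc i) * h) w)))"
      using le h by (intro prod_mono) auto
    then show "(\<Prod>i<2 ^ k. ennreal (exp (- h * W' (x + X (real (Suc i) * h) w)))) \<le> (\<Prod>i<2 ^ k. ennreal (exp (- h * W (0 + X (real (Suc i) * h) w))))"
      by (simp only: prod_ennreal exp_ge_zero) (rule ennreal_leI)
  qed
  also have "\<dots> = disc W t k 0"
    unfolding disc_def h_def[symmetric] by (rule discrete_feynman_kac[OF h]) measurable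
  finally show ?thesis .
qed

text \<open>
  Since \<open>W\<close> changes by at most a constant factor within a unit ball, starting at the origin is
  as good as starting uniformly in the ball \<open>cball 0 r\<close>, for the potential \<open>A W\<close>.
\<close>

lemma feynman_kac_lower:
  assumes W: "continuous_on UNIV W" "\<And>y. 0 \<le> W y" and t: "0 < t" and r: "0 < r" "r \<le> 1" and R: "0 < R"
    and A: "0 < A" "\<And>x y. norm x \<le> 1 \<Longrightarrow> W y \<le> A * W (x + y)"
    and b: "\<And>y. y \<in> cball z R \<Longrightarrow> W y \<le> b"
    and \<Gamma>: "0 \<le> \<Gamma>" and hop: "\<forall>\<^sub>F k in sequentially. ennreal \<Gamma> * (\<integral>\<^sup>+x. indicator (cball z R) x * disc (\<lambda>y. A * W y) t k x \<partial>lborel) \<le>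
       (\<integral>\<^sup>+x. indicator (cball 0 r) x * disc (\<lambda>y. A * W y) t k x \<partial>lborel)"
  shows "ennreal (\<Gamma> * R ^ DIM('a) * exp (- (t * (A * b + stay_rate * R powr (- a)))) / (4 * 2 ^ DIM('a) * r ^ DIM('a))) \<le>
    feynman_kac M X (\<lambda>y. ennreal (W y)) t 0"
proof -
  have Wm [measurable]: "W \<in> borel_measurable borel" using W by (intro borel_measurable_continuous_onI)
  define v where "v = unit_ball_vol (real DIM('a))"
  have v: "0 < v" by (simp add: v_def)
  let ?c = "\<Gamma> * R ^ DIM('a) * exp (- (t * (A * b + stay_rate * R powr (- a)))) / (4 * 2 ^ DIM('a) * r ^ DIM('a))"
  have "(\<lambda>k. 4 * 2 ^ DIM('a) * moment_const * R powr (- a) * (t / 2 ^ k)) \<longlonglongrightarrow> 4 * 2 ^ DIM('a) * moment_const * R powr (- a) * 0"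
    by (intro tendsto_mult tendsto_const LIMSEQ_divide_realpow_zero) auto
  then have "\<forall>\<^sub>F k in sequentially. 4 * 2 ^ DIM('a) * moment_const * R powr (- a) * (t / 2 ^ k) < 1 / 2"
    by (rule order_tendstoD) auto
  with hop have "\<forall>\<^sub>F k in sequentially. ennreal ?c \<le> disc W t k 0"
  proof eventually_elim
    case (elim k)
    have "ennreal ?c * ennreal (v * r ^ DIM('a)) = ennreal \<Gamma> * ennreal (ball_const * R ^ DIM('a) * exp (- (t * (A * b + stay_rate * R powr (- a)))))"
      using \<Gamma> R r v by (simp add: ennreal_mult[symmetric] ball_const_def v_def[symmetric])
    also have "\<dots> \<le> ennreal \<Gamma> * (\<integral>\<^sup>+x. indicator (cball z R) x * disc (\<lambda>y. A * W y) t k x \<partial>lborel)"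
    proof (rule mult_left_mono[OF disc_mass_ball[OF _ t R]])
      show "(\<lambda>y. A * W y) \<in> borel_measurable borel" by measurable
      show "A * W y \<le> A * b" if "y \<in> cball z R" for y using b[OF that] A(1) by (intro mult_left_mono) auto
      show "4 * 2 ^ DIM('a) * (t / 2 ^ k * moment_const * R powr (- a)) \<le> 1 / 2"
        using less_imp_le[OF elim(2)] by (simp add: mult_ac)
    qed auto
    also have "\<dots> \<le> (\<integral>\<^sup>+x. indicator (cball 0 r) x * disc (\<lambda>y. A * W y) t k x \<partial>lborel)" by (rule elim(1))
    also have "\<dots> \<le> (\<integral>\<^sup>+x. disc W t k 0 * indicator (cball (0::'a) r) x \<partial>lborel)"
    proof (intro nn_integral_mono)
      fix x :: 'a
      show "indicator (cball 0 r) x * disc (\<lambda>y. A * W y) t k x \<le> disc W t k 0 * indicator (cball 0 r) x"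
      proof (cases "x \<in> cball 0 r")
        case True
        then have "norm x \<le> 1" using r by simp
        then have "disc (\<lambda>y. A * W y) t k x \<le> disc W t k 0" by (intro disc_start t A(2)) measurable
        then show ?thesis using True by simp
      qed simp
    qed
    also have "\<dots> = disc W t k 0 * ennreal (v * r ^ DIM('a))"
      using r by (subst nn_integral_cmult_indicator) (auto simp: emeasure_cball v_def)
    finally have *: "ennreal ?c * ennreal (v * r ^ DIM('a)) \<le> disc W t k 0 * ennreal (v * r ^ DIM('a))" .
    have p: "0 < v * r ^ DIM('a)" using v r by simp
    have "ennreal (1 / (v * r ^ DIM('a))) * (ennreal ?c * ennreal (v * r ^ DIM('a))) \<le> ennreal (1 / (v * r ^ DIM('a))) * (disc W t k 0 * ennreal (v * r ^ DIM('a)))"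
      by (rule mult_left_mono[OF *]) simp
    moreover have "ennreal (1 / (v * r ^ DIM('a))) * (y * ennreal (v * r ^ DIM('a))) = y" for y
    proof -
      have "ennreal (1 / (v * r ^ DIM('a))) * ennreal (v * r ^ DIM('a)) = 1" using p r v by (subst ennreal_mult[symmetric]) auto
      then show ?thesis by (metis mult.commute mult.left_commute mult.right_neutral)
    qed
    ultimately show ?case by metis
  qed
  then obtain k0 where k0: "\<And>k. k0 \<le> k \<Longrightarrow> ennreal ?c \<le> disc W t k 0" by (auto simp: eventually_sequentially)
  show ?thesis
    by (rule feynman_kac_ge_discrete[OF W t, of k0]) (use k0 in \<open>simp add: disc_def\<close>)
qed

text \<open>
  During a time \<open>t/2\<^sup>j\<close> the process stays in \<open>cball p r\<close> and then jumps into \<open>q\<close>. The threshold on the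
  discretisation does not depend on \<open>p\<close>, \<open>q\<close> and \<open>m\<close>, so that hops can be chained.
\<close>

lemma one_hop:
  assumes W: "continuous_on UNIV W" "\<And>y. 0 \<le> W y" and t: "0 < t" and r: "0 < r" and \<kappa>: "0 \<le> \<kappa>" and \<eta>: "0 < \<eta>"
    and U: "U \<in> sets borel" "0 < \<epsilon>" "\<And>z. z \<in> U \<Longrightarrow> \<epsilon> \<le> norm z" "\<And>z. - z \<in> U \<longleftrightarrow> z \<in> U"
    and dom: "\<And>B. B \<in> sets borel \<Longrightarrow> B \<subseteq> U \<Longrightarrow> ennreal \<kappa> * emeasure lborel B \<le> emeasure \<nu> B"
  shows "\<forall>\<^sub>F k in sequentially. \<forall>p q m. q \<in> sets borel \<longrightarrow> cball p r \<inter> q = {} \<longrightarrow> 0 \<le> m \<longrightarrow> (\<forall>y\<in>cball p r \<union> q. W y \<le> m) \<longrightarrow>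
      (\<forall>x\<in>cball p r. \<forall>z\<in>q. \<forall>y. norm y \<le> \<eta> \<longrightarrow> z - x - y \<in> U) \<longrightarrow>
      ennreal (t / 2 ^ j * \<kappa> / 2 * (ball_const * r ^ DIM('a)) * exp (- (t / 2 ^ j * (m + stay_rate * r powr (- a))))) *
      (\<integral>\<^sup>+x. indicator q x * disc W t k x \<partial>lborel) \<le> (\<integral>\<^sup>+x. indicator (cball p r) x * disc W t k x \<partial>lborel)"
proof -
  have Wm [measurable]: "W \<in> borel_measurable borel" using W by (intro borel_measurable_continuous_onI)
  obtain h0 where h0: "0 < h0" and dom': "\<And>h B. \<lbrakk>0 < h; h \<le> h0; B \<in> sets borel; \<And>z y. z \<in> B \<Longrightarrow> norm y \<le> \<eta> \<Longrightarrow> z - y \<in> U\<rbrakk>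
      \<Longrightarrow> ennreal (h * \<kappa> / 2) * emeasure lborel B \<le> emeasure (distr M borel (X h)) B"
    using law_ge_lebesgue[OF U \<eta> \<kappa> dom] by blast
  have "(\<lambda>k. 4 * 2 ^ DIM('a) * moment_const * r powr (- a) * (t / 2 ^ k)) \<longlonglongrightarrow> 4 * 2 ^ DIM('a) * moment_const * r powr (- a) * 0"
    by (intro tendsto_mult tendsto_const LIMSEQ_divide_realpow_zero) auto
  then have 1: "\<forall>\<^sub>F k in sequentially. 4 * 2 ^ DIM('a) * moment_const * r powr (- a) * (t / 2 ^ k) < 1 / 2"
    by (rule order_tendstoD) auto
  have "(\<lambda>k. t / 2 ^ k) \<longlonglongrightarrow> 0" by (intro LIMSEQ_divide_realpow_zero) auto
  then have 2: "\<forall>\<^sub>F k in sequentially. t / 2 ^ k < h0" by (rule order_tendstoD) fact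
  have 3: "\<forall>\<^sub>F k in sequentially. j \<le> k" by (rule eventually_ge_at_top)
  show ?thesis
    using 1 2 3
  proof eventually_elim
    case (elim k)
    show ?case
    proof (intro allI impI)
      fix p :: 'a and q m
      assume q: "q \<in> sets borel" and disj: "cball p r \<inter> q = {}" and m: "0 \<le> m" "\<forall>y\<in>cball p r \<union> q. W y \<le> m"
        and geom: "\<forall>x\<in>cball p r. \<forall>z\<in>q. \<forall>y. norm y \<le> \<eta> \<longrightarrow> z - x - y \<in> U"
      show "ennreal (t / 2 ^ j * \<kappa> / 2 * (ball_const * r ^ DIM('a)) * exp (- (t / 2 ^ j * (m + stay_rate * r powr (- a))))) *
        (\<integral>\<^sup>+x. indicator q x * disc W t k x \<partial>lborel) \<le> (\<integral>\<^sup>+x. indicator (cball p r) x * disc W t k x \<partial>lborel)"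
      proof (rule disc_hop[OF Wm W(2) t r q disj _ m(1) _ \<kappa> _ elim(3)])
        show "4 * 2 ^ DIM('a) * (t / 2 ^ k * moment_const * r powr (- a)) \<le> 1 / 2"
          using less_imp_le[OF elim(1)] by (simp add: mult_ac)
        fix x B assume x: "x \<in> cball p r" and B [measurable]: "B \<in> sets borel" and Bq: "B \<subseteq> q"
        have Bx: "{y. x + y \<in> B} \<in> sets borel" by measurable
        have "emeasure lborel B = emeasure lborel {y. x + y \<in> B}"
          using arg_cong[OF lborel_distr_plus[of x], of "\<lambda>M. emeasure M B"] by (simp add: emeasure_distr vimage_def)
        moreover have "ennreal (t / 2 ^ k * \<kappa> / 2) * emeasure lborel {y. x + y \<in> B} \<le> emeasure (distr M borel (X (t / 2 ^ k))) {y. x + y \<in> B}"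
        proof (rule dom'[OF _ _ Bx])
          fix z y :: 'a assume "z \<in> {y. x + y \<in> B}" "norm y \<le> \<eta>"
          then have "(x + z) - x - y \<in> U" using geom x Bq by blast
          then show "z - y \<in> U" by simp
        qed (use t elim in auto)
        ultimately show "ennreal (t / 2 ^ k * \<kappa> / 2) * emeasure lborel B \<le> emeasure (distr M borel (X (t / 2 ^ k))) {y. x + y \<in> B}"
          by simp
      qed (use m in auto)
    qed
  qed
qed

end


text \<open>
  The potential of the shape \<open>1 \<and> |x|\<^bsup>-\<beta>\<^esup>\<close> inherits this Harnack-type inequality from its shape,
  for every configuration of points. It makes the potential continuous and comparable within unit balls.
\<close>

definition comparable :: "real \<Rightarrow> ('a::euclidean_space \<Rightarrow> real) \<Rightarrow> bool" where
  "comparable \<beta> W \<longleftrightarrow> (\<forall>x. 0 \<le> W x) \<and> (\<forall>x y. W x \<le> (1 + norm (x - y)) powr \<beta> * W y)"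

text \<open>
  At distance \<open>exp (C n\<^sup>d)\<close> a hole of radius of order \<open>n\<close> appears in the Poisson configuration, and the
  potential inside is as small as the points outside permit.
\<close>

definition has_low_spots :: "real \<Rightarrow> ('a::euclidean_space \<Rightarrow> real) \<Rightarrow> bool" where
  "has_low_spots a W \<longleftrightarrow> (\<exists>C>0. \<forall>\<^sub>F n::nat in sequentially. \<exists>z. 2 * real n + 2 \<le> norm z \<and>
     norm z \<le> exp (C * real n ^ DIM('a)) \<and> (\<forall>y\<in>cball z (real n). W y \<le> C * real n powr (- a)))"

text \<open>
  Conversely, up to distances exponential in \<open>n\<^sup>d\<close> no place is further than a multiple of \<open>n\<close> from
  order \<open>n\<^sup>d\<close> points, each of which contributes order \<open>n\<^bsup>-d-a\<^esup>\<close>.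
\<close>

definition dense_env :: "real \<Rightarrow> ('a::euclidean_space \<Rightarrow> real) \<Rightarrow> bool" where
  "dense_env a W \<longleftrightarrow> (\<forall>\<kappa>>0. \<exists>c>0. \<forall>\<^sub>F n::nat in sequentially. \<forall>y. norm y \<le> exp (\<kappa> * real n ^ DIM('a)) \<longrightarrow>
     c * real n powr (- a) \<le> W y)"

lemma comparable_continuous:
  assumes "comparable \<beta> W" and "0 < \<beta>"
  shows "continuous_on UNIV W"
proof -
  have "isCont W x" for x
  proof -
    have b: "(1 + norm (y - x)) powr (- \<beta>) * W x \<le> W y" "W y \<le> (1 + norm (y - x)) powr \<beta> * W x" for y
    proof -
      have "W x \<le> (1 + norm (y - x)) powr \<beta> * W y"
        using assms(1) unfolding comparable_def by (metis norm_minus_commute)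
      then have "(1 + norm (y - x)) powr (- \<beta>) * W x \<le> (1 + norm (y - x)) powr (- \<beta>) * ((1 + norm (y - x)) powr \<beta> * W y)"
        by (rule mult_left_mono) simp
      moreover have "(1 + norm (y - x)) powr (- \<beta>) * (1 + norm (y - x)) powr \<beta> = 1"
      proof -
        have "1 + norm (y - x) \<noteq> 0" using norm_ge_zero[of "y - x"] by linarith
        then show ?thesis by (simp add: powr_add[symmetric])
      qed
      ultimately show "(1 + norm (y - x)) powr (- \<beta>) * W x \<le> W y" by (simp add: mult.assoc[symmetric])
      show "W y \<le> (1 + norm (y - x)) powr \<beta> * W x" using assms(1) by (auto simp: comparable_def)
    qed
    have lim: "((\<lambda>y. (1 + norm (y - x)) powr e * W x) \<longlongrightarrow> (1 + norm (x - x)) powr e * W x) (at x)" for e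
      by (intro tendsto_intros) auto
    have "(W \<longlongrightarrow> W x) (at x)"
      by (rule tendsto_sandwich[of "\<lambda>y. (1 + norm (y - x)) powr (- \<beta>) * W x" _ _ "\<lambda>y. (1 + norm (y - x)) powr \<beta> * W x"])
         (use b lim[of "- \<beta>"] lim[of \<beta>] in auto)
    then show ?thesis by (simp add: isCont_def)
  qed
  then show ?thesis by (simp add: continuous_on_eq_continuous_at)
qed

lemma comparable_shift_le:
  assumes "comparable \<beta> W" "0 < \<beta>" "norm x \<le> 1"
  shows "W y \<le> 2 powr \<beta> * W (x + y)"
proof -
  have "W y \<le> (1 + norm (y - (x + y))) powr \<beta> * W (x + y)" using assms(1) unfolding comparable_def by blast
  also have "\<dots> \<le> 2 powr \<beta> * W (x + y)"
    using assms by (intro mult_right_mono powr_mono2) (auto simp: comparable_def)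
  finally show ?thesis .
qed

text \<open>
  Every time horizon has a dyadic fraction of order one, which is the time spent on a hop.
\<close>

lemma dyadic_scale:
  fixes t :: real
  assumes "1 \<le> t"
  obtains j :: nat where "1 / 2 \<le> t / 2 ^ j" "t / 2 ^ j \<le> 1"
proof -
  obtain i :: nat where i: "t \<le> 2 ^ i" using real_arch_pow[of 2 t] by (auto intro: less_imp_le)
  define j where "j = (LEAST i. t \<le> 2 ^ i)"
  have j: "t \<le> 2 ^ j" unfolding j_def by (rule LeastI[of _ i]) (rule i)
  have "1 / 2 \<le> t / 2 ^ j"
  proof (cases j)
    case 0
    then show ?thesis using assms by simp
  next
    case (Suc l)
    then have "\<not> t \<le> 2 ^ l" unfolding j_def using not_less_Least[of l "\<lambda>i. t \<le> 2 ^ i"] by auto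
    then show ?thesis using Suc by (simp add: field_simps)
  qed
  then show thesis using that j by simp
qed

lemma eventually_powr_ge:
  fixes e B :: real
  assumes "0 < e"
  shows "\<forall>\<^sub>F t in at_top. B \<le> t powr e"
proof (rule eventually_mono[OF eventually_ge_at_top])
  fix t assume "(\<bar>B\<bar> + 1) powr (1 / e) \<le> t"
  then have "((\<bar>B\<bar> + 1) powr (1 / e)) powr e \<le> t powr e" using assms by (intro powr_mono2) auto
  then show "B \<le> t powr e" using assms by (simp add: powr_powr)
qed

lemma hop_weight_ge:
  fixes \<tau> \<kappa> b M :: real
  assumes "1 / 2 \<le> \<tau>" "\<tau> \<le> 1" "0 \<le> \<kappa>" "0 \<le> b" "0 \<le> M"
  shows "(1 / 2) * \<kappa> / 2 * b * exp (- (1 * M)) \<le> \<tau> * \<kappa> / 2 * b * exp (- (\<tau> * M))"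
proof -
  have "\<tau> * M \<le> 1 * M" using assms by (intro mult_right_mono) auto
  moreover have "(1 / 2) * \<kappa> / 2 * b \<le> \<tau> * \<kappa> / 2 * b"
    using assms by (intro mult_right_mono divide_right_mono) auto
  ultimately show ?thesis using assms by (intro mult_mono[of "(1 / 2) * \<kappa> / 2 * b" "\<tau> * \<kappa> / 2 * b"]) auto
qed

context levy_setting
begin

text \<open>
  The process waits near the origin for a time of order one, jumps right into a low spot and stays
  there. With \<open>n\<^bsup>d+a\<^esup>\<close> of order \<open>t\<close>, the jump over the distance \<open>exp (C n\<^sup>d)\<close> and the stay both
  cost order \<open>n\<^sup>d\<close> in the exponent.
\<close>

lemma lower_bound_single_jump:
  assumes W: "comparable \<beta> W" "0 < \<beta>" and spots: "has_low_spots a W"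
    and c2: "0 < c2" and dom: "\<And>L B. 0 < L \<Longrightarrow> B \<in> sets borel \<Longrightarrow> B \<subseteq> cball 0 (3 * L) \<Longrightarrow>
      ennreal (c2 * L powr (- real DIM('a) - a)) * emeasure lborel B \<le> emeasure \<nu> B"
  shows "\<exists>C>0. \<forall>\<^sub>F t in at_top. ennreal (exp (- (C * t powr (real DIM('a) / (real DIM('a) + a))))) \<le> feynman_kac M X (\<lambda>y. ennreal (W y)) t 0"
proof -
  let ?d = "real DIM('a)"
  have d: "0 < ?d" "1 \<le> ?d" by auto
  obtain C n0 where C: "0 < C" and n0: "\<And>n. n0 \<le> n \<Longrightarrow> \<exists>z. 2 * real n + 2 \<le> norm z \<and> norm z \<le> exp (C * real n ^ DIM('a)) \<and>
      (\<forall>y\<in>cball z (real n). W y \<le> C * real n powr (- a))"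
    using spots by (auto simp: has_low_spots_def eventually_sequentially)
  have Wc: "continuous_on UNIV W" by (rule comparable_continuous[OF W])
  have W0: "0 \<le> W y" for y using W by (simp add: comparable_def)
  define A where "A = (2::real) powr \<beta>"
  have A: "0 < A" by (simp add: A_def)
  have shift: "W y \<le> A * W (x + y)" if "norm x \<le> 1" for x y
    unfolding A_def by (rule comparable_shift_le[OF W that])
  define m where "m = A * (A * W 0 + C)"
  have m: "0 \<le> m" using A W0 C by (auto simp: m_def intro!: mult_nonneg_nonneg add_nonneg_nonneg)
  define K where "K = ball_const * c2 / (16 * 2 ^ DIM('a)) * exp (- (m + stay_rate))"
  have K: "0 < K" using ball_const_pos c2 by (simp add: K_def)
  define E where "E = (?d + a) * C + A * C + stay_rate + \<bar>ln K\<bar>"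
  have E: "0 < E"
  proof -
    have "0 < (?d + a) * C" "0 < A * C" using d a C A by auto
    then show ?thesis unfolding E_def using stay_rate_pos by linarith
  qed
  (* The estimate at a fixed scale n that is at least of order t^(1/(d+a)). *)
  have main: "ennreal (exp (- (E * real n ^ DIM('a)))) \<le> feynman_kac M X (\<lambda>y. ennreal (W y)) t 0"
    if t: "1 \<le> t" and n: "n0 \<le> n" "1 \<le> n" and tn: "t * real n powr (- a) \<le> real n ^ DIM('a)" for t n
  proof -
    obtain z where z: "2 * real n + 2 \<le> norm z" "norm z \<le> exp (C * real n ^ DIM('a))" "\<And>y. y \<in> cball z (real n) \<Longrightarrow> W y \<le> C * real n powr (- a)"
      using n0[OF n(1)] by blast
    define L where "L = norm z"
    have L: "1 \<le> L" using z by (simp add: L_def)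
    obtain j :: nat where j: "1 / 2 \<le> t / 2 ^ j" "t / 2 ^ j \<le> 1" by (rule dyadic_scale[OF t])
    define \<kappa> where "\<kappa> = c2 * L powr (- ?d - a)"
    have \<kappa>: "0 < \<kappa>" using c2 L by (simp add: \<kappa>_def)
    define U where "U = {v::'a. 1 / 2 \<le> norm v \<and> norm v \<le> 3 * L}"
    have U: "U \<in> sets borel" unfolding U_def by measurable
    define \<Gamma> where "\<Gamma> = t / 2 ^ j * \<kappa> / 2 * (ball_const * 1 ^ DIM('a)) * exp (- (t / 2 ^ j * (m + stay_rate * 1 powr (- a))))"
    have t0: "0 < t" using t by simp
    have \<Gamma>0: "0 \<le> \<Gamma>" using t0 \<kappa> ball_const_pos by (simp add: \<Gamma>_def)
    have n_powr: "real n powr (- a) \<le> 1" using n(2) a powr_mono2'[of "- a" 1 "real n"] by simp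
    have hop: "\<forall>\<^sub>F k in sequentially. ennreal \<Gamma> * (\<integral>\<^sup>+x. indicator (cball z (real n)) x * disc (\<lambda>y. A * W y) t k x \<partial>lborel) \<le>
       (\<integral>\<^sup>+x. indicator (cball 0 1) x * disc (\<lambda>y. A * W y) t k x \<partial>lborel)"
    proof -
      have ev: "\<forall>\<^sub>F k in sequentially. \<forall>p q m. q \<in> sets borel \<longrightarrow> cball p 1 \<inter> q = {} \<longrightarrow> 0 \<le> m \<longrightarrow> (\<forall>y\<in>cball p 1 \<union> q. A * W y \<le> m) \<longrightarrow>
        (\<forall>x\<in>cball p 1. \<forall>z\<in>q. \<forall>y. norm y \<le> 1 / 2 \<longrightarrow> z - x - y \<in> U) \<longrightarrow>
        ennreal (t / 2 ^ j * \<kappa> / 2 * (ball_const * 1 ^ DIM('a)) * exp (- (t / 2 ^ j * (m + stay_rate * 1 powr (- a))))) *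
        (\<integral>\<^sup>+x. indicator q x * disc (\<lambda>y. A * W y) t k x \<partial>lborel) \<le> (\<integral>\<^sup>+x. indicator (cball p 1) x * disc (\<lambda>y. A * W y) t k x \<partial>lborel)"
      proof (rule one_hop[OF _ _ t0 _ _ _ U, of _ _ _ _ "1/2"])
        show "continuous_on UNIV (\<lambda>y. A * W y)" using Wc by (intro continuous_intros)
        show "0 \<le> A * W y" for y using A W0[of y] by simp
        show "ennreal \<kappa> * emeasure lborel B \<le> emeasure \<nu> B" if "B \<in> sets borel" "B \<subseteq> U" for B
          unfolding \<kappa>_def using that L by (intro dom) (auto simp: U_def)
      qed (use \<kappa> in \<open>auto simp: U_def\<close>)
      then show ?thesis
      proof (rule eventually_mono)
        fix k
        assume H: "\<forall>p q m. q \<in> sets borel \<longrightarrow> cball p 1 \<inter> q = {} \<longrightarrow> 0 \<le> m \<longrightarrow> (\<forall>y\<in>cball p 1 \<union> q. A * W y \<le> m) \<longrightarrow>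
          (\<forall>x\<in>cball p 1. \<forall>z\<in>q. \<forall>y. norm y \<le> 1 / 2 \<longrightarrow> z - x - y \<in> U) \<longrightarrow>
          ennreal (t / 2 ^ j * \<kappa> / 2 * (ball_const * 1 ^ DIM('a)) * exp (- (t / 2 ^ j * (m + stay_rate * 1 powr (- a))))) *
          (\<integral>\<^sup>+x. indicator q x * disc (\<lambda>y. A * W y) t k x \<partial>lborel) \<le> (\<integral>\<^sup>+x. indicator (cball p 1) x * disc (\<lambda>y. A * W y) t k x \<partial>lborel)"
        show "ennreal \<Gamma> * (\<integral>\<^sup>+x. indicator (cball z (real n)) x * disc (\<lambda>y. A * W y) t k x \<partial>lborel) \<le>
          (\<integral>\<^sup>+x. indicator (cball 0 1) x * disc (\<lambda>y. A * W y) t k x \<partial>lborel)"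
          unfolding \<Gamma>_def
        proof (rule H[rule_format])
          show "cball z (real n) \<in> sets borel" by simp
          show "cball 0 1 \<inter> cball z (real n) = {}"
          proof safe
            fix y assume "y \<in> cball 0 1" "y \<in> cball z (real n)"
            then have "norm z \<le> 1 + real n" using norm_triangle_ineq[of y "z - y"] by (simp add: dist_norm)
            then show "y \<in> {}" using z(1) by simp
          qed
          show "0 \<le> m" by (rule m)
          show "A * W y \<le> m" if "y \<in> cball 0 1 \<union> cball z (real n)" for y
          proof -
            have "W y \<le> A * W 0 + C"
            proof (cases "y \<in> cball 0 1")
              case True
              then have "W y \<le> A * W 0" using shift[of "- y" y] by simp
              then show ?thesis using C by simp
            next
              case False
              then have "W y \<le> C * real n powr (- a)" using that z(3) by auto
              also have "\<dots> \<le> C * 1" using C n_powr by (intro mult_left_mono) auto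
              finally show ?thesis using A W0[of 0] by (simp add: add_increasing)
            qed
            then show ?thesis unfolding m_def using A by (intro mult_left_mono) auto
          qed
          show "w - x - y \<in> U" if "x \<in> cball 0 1" "w \<in> cball z (real n)" "norm y \<le> 1 / 2" for x w y
          proof -
            have nz: "norm (z - w) \<le> real n" "norm x \<le> 1" using that by (auto simp: dist_norm)
            have "norm z \<le> norm (w - x - y) + norm (z - w) + norm x + norm y"
            proof -
              have "z = (w - x - y) + (z - w) + x + y" by simp
              then show ?thesis by (metis norm_triangle_le add_mono order_refl)
            qed
            moreover have "norm (w - x - y) \<le> norm z + norm (z - w) + norm x + norm y"
            proof -
              have "norm (w - x - y) \<le> norm (w - x) + norm y" by (rule norm_triangle_ineq4)
              also have "norm (w - x) \<le> norm w + norm x" by (rule norm_triangle_ineq4)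
              also have "norm w \<le> norm z + norm (z - w)" using norm_triangle_ineq4[of z "z - w"] by simp
              finally show ?thesis by simp
            qed
            ultimately show ?thesis using z(1) nz that(3) unfolding U_def L_def by auto
          qed
        qed
      qed
    qed
    let ?b = "C * real n powr (- a)"
    have "ennreal (\<Gamma> * real n ^ DIM('a) * exp (- (t * (A * ?b + stay_rate * real n powr (- a)))) / (4 * 2 ^ DIM('a) * 1 ^ DIM('a))) \<le>
      feynman_kac M X (\<lambda>y. ennreal (W y)) t 0"
      by (rule feynman_kac_lower[OF Wc W0 t0 _ _ _ A shift z(3) \<Gamma>0 hop]) (use n in auto)
    moreover have "exp (- (E * real n ^ DIM('a))) \<le> \<Gamma> * real n ^ DIM('a) * exp (- (t * (A * ?b + stay_rate * real n powr (- a)))) / (4 * 2 ^ DIM('a) * 1 ^ DIM('a))"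
    proof -
      let ?N = "real n ^ DIM('a)"
      have N1: "1 \<le> ?N" using n(2) by simp
      have "exp (- (E * ?N)) = exp (- (\<bar>ln K\<bar> * ?N)) * exp (- ((?d + a) * (C * ?N))) * exp (- ((A * C + stay_rate) * ?N))"
        by (simp add: E_def exp_add[symmetric] algebra_simps)
      also have "\<dots> \<le> K * L powr (- ?d - a) * exp (- (t * (A * ?b + stay_rate * real n powr (- a))))"
      proof (intro mult_mono)
        have "- (\<bar>ln K\<bar> * ?N) \<le> - (\<bar>ln K\<bar> * 1)" using N1 by (intro le_imp_neg_le mult_left_mono) auto
        also have "\<dots> \<le> ln K" by simp
        finally have "exp (- (\<bar>ln K\<bar> * ?N)) \<le> exp (ln K)" by simp
        then show "exp (- (\<bar>ln K\<bar> * ?N)) \<le> K" using K by simp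
        have "ln L \<le> ln (exp (C * ?N))" using z(2) L by (subst ln_le_cancel_iff) (auto simp: L_def)
        then have "ln L \<le> C * ?N" by simp
        then have "(?d + a) * ln L \<le> (?d + a) * (C * ?N)" using a by (intro mult_left_mono) auto
        then show "exp (- ((?d + a) * (C * ?N))) \<le> L powr (- ?d - a)" using L by (simp add: powr_def algebra_simps)
        have "t * (A * ?b + stay_rate * real n powr (- a)) = (A * C + stay_rate) * (t * real n powr (- a))" by (simp add: algebra_simps)
        also have "\<dots> \<le> (A * C + stay_rate) * ?N" using A C stay_rate_pos by (intro mult_left_mono tn) auto
        finally show "exp (- ((A * C + stay_rate) * ?N)) \<le> exp (- (t * (A * ?b + stay_rate * real n powr (- a))))" by simp
      qed (use K in auto)
      also have "\<dots> \<le> \<Gamma> * ?N * exp (- (t * (A * ?b + stay_rate * real n powr (- a)))) / (4 * 2 ^ DIM('a) * 1 ^ DIM('a))"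
      proof -
        have "K * L powr (- ?d - a) * (4 * 2 ^ DIM('a)) = (1/2) * \<kappa> / 2 * ball_const * exp (- (1 * (m + stay_rate)))"
          by (simp add: K_def \<kappa>_def)
        also have "\<dots> \<le> \<Gamma>"
          using hop_weight_ge[OF j, of \<kappa> ball_const "m + stay_rate"] \<kappa> ball_const_pos m stay_rate_pos
          unfolding \<Gamma>_def power_one powr_one_eq_one mult_1_right by simp
        also have "\<dots> \<le> \<Gamma> * ?N" using N1 \<Gamma>0 by (simp add: mult_le_cancel_left1)
        finally have "K * L powr (- ?d - a) \<le> \<Gamma> * ?N / (4 * 2 ^ DIM('a))" by (simp add: field_simps)
        then have "K * L powr (- ?d - a) * exp (- (t * (A * ?b + stay_rate * real n powr (- a)))) \<le>
          \<Gamma> * ?N / (4 * 2 ^ DIM('a)) * exp (- (t * (A * ?b + stay_rate * real n powr (- a))))" by (rule mult_right_mono) simp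
        then show ?thesis by simp
      qed
      finally show ?thesis .
    qed
    ultimately show ?thesis by (meson ennreal_leI order_trans)
  qed
  show ?thesis
  proof (intro exI[of _ "E * 2 ^ DIM('a)"] conjI)
    show "0 < E * 2 ^ DIM('a)" using E by simp
    have "\<forall>\<^sub>F t in at_top. real (n0 + 1) \<le> t powr (1 / (?d + a))"
      using d a by (intro eventually_powr_ge) auto
    then show "\<forall>\<^sub>F t in at_top. ennreal (exp (- (E * 2 ^ DIM('a) * t powr (?d / (?d + a))))) \<le> feynman_kac M X (\<lambda>y. ennreal (W y)) t 0"
      using eventually_ge_at_top[of 1]
    proof eventually_elim
      case (elim t)
      define s where "s = t powr (1 / (?d + a))"
      (* Rounding up gives t n^(-a) \<le> n^d, and n is at most twice the optimal scale. *)
      define n where "n = nat \<lceil>s\<rceil>"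
      have s: "real (n0 + 1) \<le> s" "1 \<le> s" using elim by (auto simp: s_def intro: order_trans[of _ "real (n0 + 1)"])
      have n: "s \<le> real n" "real n \<le> 2 * s" using s by (auto simp: n_def) linarith
      have n1: "n0 \<le> n" "1 \<le> n" using n s by linarith+
      have st: "s powr (?d + a) = t" using elim d a by (simp add: s_def powr_powr)
      have "t * real n powr (- a) \<le> real n powr (?d + a) * real n powr (- a)"
        using st n s d a by (intro mult_right_mono) (auto intro: powr_mono2 simp flip: st)
      also have "\<dots> = real n ^ DIM('a)" using n1 by (simp add: powr_add[symmetric] powr_realpow)
      finally have tn: "t * real n powr (- a) \<le> real n ^ DIM('a)" .
      have "real n ^ DIM('a) \<le> (2 * s) ^ DIM('a)" using n by (intro power_mono) auto
      also have "\<dots> = 2 ^ DIM('a) * t powr (?d / (?d + a))"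
      proof -
        have "s ^ DIM('a) = s powr ?d" using s by (simp add: powr_realpow)
        also have "\<dots> = t powr (?d / (?d + a))" by (simp add: s_def powr_powr)
        finally show ?thesis by (simp add: power_mult_distrib)
      qed
      finally have "E * real n ^ DIM('a) \<le> E * (2 ^ DIM('a) * t powr (?d / (?d + a)))" using E by (intro mult_left_mono) auto
      then have "exp (- (E * 2 ^ DIM('a) * t powr (?d / (?d + a)))) \<le> exp (- (E * real n ^ DIM('a)))" by (simp add: mult.assoc)
      then show ?case using main[OF elim(2) n1 tn] by (meson ennreal_leI order_trans)
    qed
  qed
qed

end


context levy_setting
begin

text \<open>
  Walk along the segment from \<open>0\<close> to \<open>y\<close> in steps of length between \<open>1/4\<close> and \<open>1/2\<close>. The lower bound
  on the step length keeps successive balls of radius \<open>1/16\<close> disjoint.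
\<close>

lemma chain_of_hops:
  assumes hop: "\<And>p p'. norm p \<le> \<rho> \<Longrightarrow> norm p' \<le> \<rho> \<Longrightarrow> 1 / 4 \<le> norm (p' - p) \<Longrightarrow> norm (p' - p) \<le> 1 / 2 \<Longrightarrow>
      (\<Gamma>::ennreal) * S p' \<le> S (p::'a)"
    and \<Gamma>1: "\<Gamma> \<le> 1" and y: "1 / 4 \<le> norm y" "norm y \<le> \<rho>" and n: "2 * norm y + 1 \<le> real n"
  shows "\<Gamma> ^ n * S y \<le> S 0"
proof -
  define N where "N = nat \<lceil>2 * norm y\<rceil>"
  have N: "2 * norm y \<le> real N" "real N < 2 * norm y + 1" "0 < N"
    using y by (auto simp: N_def) linarith+
  define p where "p i = (real i / real N) *\<^sub>R y" for i
  have step: "\<Gamma> * S (p (Suc i)) \<le> S (p i)" if i: "i < N" for i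
  proof (rule hop)
    have "real i / real N \<le> 1" "real (Suc i) / real N \<le> 1" using i N by auto
    then show "norm (p i) \<le> \<rho>" "norm (p (Suc i)) \<le> \<rho>"
      using y mult_right_mono[of "real i / real N" 1 "norm y"] mult_right_mono[of "real (Suc i) / real N" 1 "norm y"]
      by (auto simp: p_def)
    have "p (Suc i) - p i = (1 / real N) *\<^sub>R y"
      by (simp add: p_def scaleR_diff_left[symmetric] diff_divide_distrib[symmetric])
    then have nd: "norm (p (Suc i) - p i) = norm y / real N" using N by simp
    show "norm (p (Suc i) - p i) \<le> 1 / 2" unfolding nd using N by (simp add: divide_le_eq)
    show "1 / 4 \<le> norm (p (Suc i) - p i)"
    proof (cases "norm y \<le> 1 / 2")
      case True
      then have "N \<le> 1" unfolding N_def by (simp add: nat_le_iff ceiling_le_iff)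
      then have "real N \<le> 1" by simp
      moreover have "norm y / 1 \<le> norm y / real N" using N \<open>real N \<le> 1\<close> by (intro divide_left_mono) auto
      ultimately show ?thesis unfolding nd using y by linarith
    next
      case False
      then have "real N \<le> 4 * norm y" using N by linarith
      then show ?thesis unfolding nd using N by (simp add: le_divide_eq)
    qed
  qed
  have "i \<le> N \<Longrightarrow> \<Gamma> ^ i * S (p i) \<le> S (p 0)" for i
  proof (induction i)
    case (Suc i)
    have "\<Gamma> ^ Suc i * S (p (Suc i)) = \<Gamma> ^ i * (\<Gamma> * S (p (Suc i)))" by (simp add: mult_ac)
    also have "\<dots> \<le> \<Gamma> ^ i * S (p i)" using Suc.prems by (intro mult_left_mono step) auto
    finally show ?case using Suc by simp
  qed simp
  from this[of N] have "\<Gamma> ^ N * S y \<le> S 0" using N by (simp add: p_def)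
  moreover have "\<Gamma> ^ n \<le> \<Gamma> ^ N" using N n \<Gamma>1 by (intro power_decreasing) auto
  ultimately show ?thesis by (meson mult_right_mono order_trans zero_le)
qed

text \<open>
  The chain ends in a small ball, whereas the stay starts from anywhere in the low spot. Averaging the
  centre of the small ball over \<open>cball z (R + 1)\<close> covers each point of \<open>cball z R\<close> by centres of volume
  proportional to \<open>r\<^sup>d\<close>.
\<close>

lemma average_over_small_balls:
  fixes D :: "'a \<Rightarrow> ennreal"
  assumes [measurable]: "D \<in> borel_measurable borel" and r: "0 < r" "r \<le> 1" and R: "0 < R"
    and S: "\<And>y. y \<in> cball z (R + 1) \<Longrightarrow> c * (\<integral>\<^sup>+x. indicator (cball y r) x * D x \<partial>lborel) \<le> S\<^sub>0"
  shows "c * (ennreal (r ^ DIM('a)) * (\<integral>\<^sup>+x. indicator (cball z R) x * D x \<partial>lborel)) \<le> ennreal ((R + 1) ^ DIM('a)) * S\<^sub>0"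
proof -
  define v where "v = unit_ball_vol (real DIM('a))"
  have v: "0 < v" by (simp add: v_def)
  have ind: "indicator (cball y r) x = (indicator {p. dist (fst p) (snd p) \<le> r} (y, x) :: ennreal)" for x y :: 'a
    by (simp add: indicator_def)
  have [measurable]: "{p :: 'a \<times> 'a. dist (fst p) (snd p) \<le> r} \<in> sets (borel \<Otimes>\<^sub>M borel)"
    unfolding borel_prod by (intro borel_closed closed_Collect_le continuous_intros)
  have [measurable]: "cball z (R + 1) \<in> sets borel" "cball z R \<in> sets borel" by auto
  have "c * (ennreal (v * r ^ DIM('a)) * (\<integral>\<^sup>+x. indicator (cball z R) x * D x \<partial>lborel)) =
      c * (\<integral>\<^sup>+x. (indicator (cball z R) x * D x) * emeasure lborel (cball x r) \<partial>lborel)"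
    using r by (simp add: emeasure_cball v_def nn_integral_multc mult.commute)
  also have "\<dots> \<le> c * (\<integral>\<^sup>+x. \<integral>\<^sup>+y. indicator (cball z (R + 1)) y * (indicator (cball y r) x * D x) \<partial>lborel \<partial>lborel)"
  proof (intro mult_left_mono nn_integral_mono)
    fix x
    show "(indicator (cball z R) x * D x) * emeasure lborel (cball x r) \<le> (\<integral>\<^sup>+y. indicator (cball z (R + 1)) y * (indicator (cball y r) x * D x) \<partial>lborel)"
    proof (cases "x \<in> cball z R")
      case True
      have "D x * emeasure lborel (cball x r) = (\<integral>\<^sup>+y. D x * indicator (cball x r) y \<partial>lborel)"
        by (rule nn_integral_cmult_indicator[symmetric]) simp
      also have "\<dots> \<le> (\<integral>\<^sup>+y. indicator (cball z (R + 1)) y * (indicator (cball y r) x * D x) \<partial>lborel)"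
      proof (intro nn_integral_mono)
        fix y
        show "D x * indicator (cball x r) y \<le> indicator (cball z (R + 1)) y * (indicator (cball y r) x * D x)"
        proof (cases "y \<in> cball x r")
          case yr: True
          then have "y \<in> cball z (R + 1)" using True r dist_triangle[of z y x] by simp
          then show ?thesis using yr by (simp add: dist_commute)
        qed simp
      qed
      finally show ?thesis using True by simp
    qed simp
  qed auto
  also have "(\<integral>\<^sup>+x. \<integral>\<^sup>+y. indicator (cball z (R + 1)) y * (indicator (cball y r) x * D x) \<partial>lborel \<partial>lborel) =
     (\<integral>\<^sup>+y. \<integral>\<^sup>+x. indicator (cball z (R + 1)) y * (indicator (cball y r) x * D x) \<partial>lborel \<partial>lborel)"
    unfolding ind by (rule lborel_pair.Fubini') measurable
  also have "\<dots> = (\<integral>\<^sup>+y. indicator (cball z (R + 1)) y * (\<integral>\<^sup>+x. indicator (cball y r) x * D x \<partial>lborel) \<partial>lborel)"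
    unfolding ind by (intro nn_integral_cong nn_integral_cmult) measurable
  also have "c * \<dots> = (\<integral>\<^sup>+y. c * (indicator (cball z (R + 1)) y * (\<integral>\<^sup>+x. indicator (cball y r) x * D x \<partial>lborel)) \<partial>lborel)"
    unfolding ind by (rule nn_integral_cmult[symmetric]) measurable
  also have "\<dots> \<le> (\<integral>\<^sup>+y. S\<^sub>0 * indicator (cball z (R + 1)) y \<partial>lborel)"
    using S by (intro nn_integral_mono) (auto simp: indicator_def[of "cball z (R + 1)"])
  also have "\<dots> = S\<^sub>0 * ennreal (v * (R + 1) ^ DIM('a))"
    using R by (subst nn_integral_cmult_indicator) (auto simp: emeasure_cball v_def)
  finally have "ennreal (1 / v) * (c * (ennreal (v * r ^ DIM('a)) * (\<integral>\<^sup>+x. indicator (cball z R) x * D x \<partial>lborel))) \<le>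
      ennreal (1 / v) * (S\<^sub>0 * ennreal (v * (R + 1) ^ DIM('a)))" by (rule mult_left_mono) simp
  moreover have "ennreal (1 / v) * ennreal (v * u) = ennreal u" if "0 \<le> u" for u
    using v that by (subst ennreal_mult[symmetric]) auto
  then have "ennreal (1 / v) * (a * ennreal (v * u)) = a * ennreal u" "ennreal (1 / v) * (a * (ennreal (v * u) * b)) = a * (ennreal u * b)"
    if "0 \<le> u" for u a b using that by (metis mult.left_commute, metis mult.left_commute mult.assoc)
  ultimately show ?thesis using r R by (simp add: mult.commute)
qed

text \<open>
  If only short jumps are available, the low spot at distance \<open>L \<le> exp (C n\<^sup>d)\<close> is reached by at most
  order \<open>L\<close> hops. Each hop costs at most the potential along the way, which is polynomial in \<open>L\<close>, so
  that the whole chain costs a power of \<open>L\<close>.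
\<close>

lemma lower_bound_chain:
  assumes W: "comparable \<beta> W" "0 < \<beta>" and spots: "has_low_spots a W"
    and \<kappa>: "0 < \<kappa>" and dom: "\<And>B. B \<in> sets borel \<Longrightarrow> B \<subseteq> {v. 1 / 16 \<le> norm v \<and> norm v \<le> 1} \<Longrightarrow>
      ennreal \<kappa> * emeasure lborel B \<le> emeasure \<nu> B"
  shows "\<exists>C>0. \<forall>\<^sub>F n::nat in sequentially. \<forall>t\<ge>1. ennreal (exp (- (C * exp (C * real n ^ DIM('a)) + C * t * real n powr (- a)))) \<le>
     feynman_kac M X (\<lambda>y. ennreal (W y)) t 0"
proof -
  obtain C where C: "0 < C" and ev: "\<forall>\<^sub>F n::nat in sequentially. \<exists>z. 2 * real n + 2 \<le> norm z \<and> norm z \<le> exp (C * real n ^ DIM('a)) \<and>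
      (\<forall>y\<in>cball z (real n). W y \<le> C * real n powr (- a))"
    using spots by (auto simp: has_low_spots_def)
  have Wc: "continuous_on UNIV W" by (rule comparable_continuous[OF W])
  have W0: "0 \<le> W y" for y using W by (simp add: comparable_def)
  define A where "A = (2::real) powr \<beta>"
  have A: "0 < A" by (simp add: A_def)
  have shift: "W y \<le> A * W (x + y)" if "norm x \<le> 1" for x y
    unfolding A_def by (rule comparable_shift_le[OF W that])
  define r where "r = (1/16::real)"
  have r: "0 < r" "r \<le> 1" by (auto simp: r_def)
  define U where "U = {v::'a. 1 / 16 \<le> norm v \<and> norm v \<le> 1}"
  have U: "U \<in> sets borel" unfolding U_def by measurable
  define g where "g = min 1 (\<kappa> / 4 * (ball_const * r ^ DIM('a)) * exp (- (stay_rate * r powr (- a))))"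
  have g: "0 < g" "g \<le> 1" using \<kappa> ball_const_pos r by (auto simp: g_def)
  define G where "G = - ln g"
  have G: "0 \<le> G" "exp (- G) = g" using g by (auto simp: G_def)
  define K where "K = 4 * (A * W 0 * 4 powr \<beta> + G)"
  have K: "0 \<le> K" using A W0 G by (simp add: K_def)
  define H where "H = K + ln (4 * 4 ^ DIM('a)) + C * (\<beta> + 1) + A * C + stay_rate"
  have H: "K + ln (4 * 4 ^ DIM('a)) \<le> H" "C * (\<beta> + 1) \<le> H" "A * C + stay_rate \<le> H" "0 < H"
  proof -
    have "(1::real) \<le> 4 * 4 ^ DIM('a)" using one_le_power[of "4::real" "DIM('a)"] by linarith
    then have l: "0 \<le> ln (4 * 4 ^ DIM('a) :: real)" by simp
    have "0 < C * (\<beta> + 1)" "0 < A * C" using C W(2) A by auto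
    then show "K + ln (4 * 4 ^ DIM('a)) \<le> H" "C * (\<beta> + 1) \<le> H" "A * C + stay_rate \<le> H" "0 < H"
      unfolding H_def using l K stay_rate_pos by linarith+
  qed
  show ?thesis
  proof (intro exI[of _ H] conjI H(4))
    show "\<forall>\<^sub>F n::nat in sequentially. \<forall>t\<ge>1. ennreal (exp (- (H * exp (H * real n ^ DIM('a)) + H * t * real n powr (- a)))) \<le>
      feynman_kac M X (\<lambda>y. ennreal (W y)) t 0"
      using ev eventually_ge_at_top[of 1]
    proof eventually_elim
      case (elim n)
      obtain z where z: "2 * real n + 2 \<le> norm z" "norm z \<le> exp (C * real n ^ DIM('a))" "\<And>y. y \<in> cball z (real n) \<Longrightarrow> W y \<le> C * real n powr (- a)"
        using elim by blast
      define L where "L = norm z"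
      have L: "1 \<le> L" "2 * real n + 2 \<le> L" using z by (auto simp: L_def)
      define m where "m = A * W 0 * (4 * L) powr \<beta>"
      have m: "0 \<le> m" using A W0 by (simp add: m_def)
      have Wm: "A * W y \<le> m" if "norm y \<le> 2 * L" for y
      proof -
        have "W y \<le> (1 + norm (y - 0)) powr \<beta> * W 0" using W(1) unfolding comparable_def by blast
        also have "\<dots> \<le> (4 * L) powr \<beta> * W 0"
          using that L W(2) W0 by (intro mult_right_mono powr_mono2) auto
        finally show ?thesis unfolding m_def using A by (simp add: mult_ac)
      qed
      (* The price of one hop; m bounds the potential at distance up to 2 L. *)
      define \<Gamma> where "\<Gamma> = exp (- (G + m))"
      have \<Gamma>: "0 \<le> \<Gamma>" "\<Gamma> \<le> 1" using G m by (auto simp: \<Gamma>_def)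
      define N where "N = nat \<lfloor>4 * L\<rfloor>"
      have N: "real N \<le> 4 * L" "4 * L < real N + 1" using L by (auto simp: N_def of_nat_nat)
      show ?case
      proof (intro allI impI)
        fix t :: real assume t: "1 \<le> t"
        then have t0: "0 < t" by simp
        obtain j :: nat where j: "1 / 2 \<le> t / 2 ^ j" "t / 2 ^ j \<le> 1" by (rule dyadic_scale[OF t])
        have hopev: "\<forall>\<^sub>F k in sequentially. \<forall>p q m. q \<in> sets borel \<longrightarrow> cball p r \<inter> q = {} \<longrightarrow> 0 \<le> m \<longrightarrow> (\<forall>y\<in>cball p r \<union> q. A * W y \<le> m) \<longrightarrow>
          (\<forall>x\<in>cball p r. \<forall>z\<in>q. \<forall>y. norm y \<le> 1 / 16 \<longrightarrow> z - x - y \<in> U) \<longrightarrow>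
          ennreal (t / 2 ^ j * \<kappa> / 2 * (ball_const * r ^ DIM('a)) * exp (- (t / 2 ^ j * (m + stay_rate * r powr (- a))))) *
          (\<integral>\<^sup>+x. indicator q x * disc (\<lambda>y. A * W y) t k x \<partial>lborel) \<le> (\<integral>\<^sup>+x. indicator (cball p r) x * disc (\<lambda>y. A * W y) t k x \<partial>lborel)"
        proof (rule one_hop[OF _ _ t0 _ _ _ U, of _ _ _ _ "1/16"])
          show "continuous_on UNIV (\<lambda>y. A * W y)" using Wc by (intro continuous_intros)
          show "0 \<le> A * W y" for y using A W0[of y] by simp
          show "ennreal \<kappa> * emeasure lborel B \<le> emeasure \<nu> B" if "B \<in> sets borel" "B \<subseteq> U" for B
            using that by (intro dom) (auto simp: U_def)
        qed (use \<kappa> r in \<open>auto simp: U_def\<close>)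
        have hop: "\<forall>\<^sub>F k in sequentially. ennreal (\<Gamma> ^ N * (r / (real n + 1)) ^ DIM('a)) * (\<integral>\<^sup>+x. indicator (cball z (real n)) x * disc (\<lambda>y. A * W y) t k x \<partial>lborel) \<le>
          (\<integral>\<^sup>+x. indicator (cball 0 r) x * disc (\<lambda>y. A * W y) t k x \<partial>lborel)"
          using hopev
        proof eventually_elim
          case (elim k)
          define D where "D = disc (\<lambda>y. A * W y) t k"
          have [measurable]: "D \<in> borel_measurable borel"
            unfolding D_def using Wc by (intro disc_measurable t0 borel_measurable_times borel_measurable_const borel_measurable_continuous_onI)
          define S where "S p = (\<integral>\<^sup>+x. indicator (cball p r) x * D x \<partial>lborel)" for p
          have step: "ennreal \<Gamma> * S p' \<le> S p" if p: "norm p \<le> 3 / 2 * L" "norm p' \<le> 3 / 2 * L" "1 / 4 \<le> norm (p' - p)" "norm (p' - p) \<le> 1 / 2" for p p'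
          proof -
            have "ennreal (t / 2 ^ j * \<kappa> / 2 * (ball_const * r ^ DIM('a)) * exp (- (t / 2 ^ j * (m + stay_rate * r powr (- a))))) * S p' \<le> S p"
              unfolding S_def D_def
            proof (rule elim[rule_format])
              show "cball p' r \<in> sets borel" by simp
              show "cball p r \<inter> cball p' r = {}"
              proof safe
                fix y assume "y \<in> cball p r" "y \<in> cball p' r"
                then have "norm (p' - p) \<le> 2 * r" using dist_triangle[of p' p y] by (simp add: dist_norm norm_minus_commute)
                then show "y \<in> {}" using p by (simp add: r_def)
              qed
              show "A * W y \<le> m" if y: "y \<in> cball p r \<union> cball p' r" for y
              proof (rule Wm)
                have "norm y \<le> norm p + r \<or> norm y \<le> norm p' + r"
                  using y norm_triangle_ineq2[of y p] norm_triangle_ineq2[of y p'] by (auto simp: dist_norm norm_minus_commute)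
                then show "norm y \<le> 2 * L" using p r L by (auto simp: r_def)
              qed
              show "w - x - y \<in> U" if x: "x \<in> cball p r" "w \<in> cball p' r" "norm y \<le> 1 / 16" for x w y
              proof -
                define e where "e = (w - p') + (p - x) + (- y)"
                have "norm e \<le> norm (w - p') + norm (p - x) + norm y"
                  unfolding e_def by (metis norm_minus_cancel norm_triangle_le add_mono norm_triangle_ineq order_refl)
                also have "\<dots> \<le> 3 / 16" using x by (simp add: dist_norm norm_minus_commute r_def)
                finally have e: "norm e \<le> 3 / 16" .
                have eq: "w - x - y = (p' - p) + e" by (simp add: e_def)
                have "norm (w - x - y) \<le> norm (p' - p) + norm e" unfolding eq by (rule norm_triangle_ineq)
                moreover have "norm (p' - p) - norm e \<le> norm (w - x - y)"
                  unfolding eq using norm_triangle_ineq2[of "p' - p" "- e"] by simp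
                ultimately show ?thesis using e p by (auto simp: U_def)
              qed
            qed (rule m)
            moreover have "\<Gamma> \<le> t / 2 ^ j * \<kappa> / 2 * (ball_const * r ^ DIM('a)) * exp (- (t / 2 ^ j * (m + stay_rate * r powr (- a))))"
            proof -
              have "\<Gamma> = exp (- G) * exp (- m)" unfolding \<Gamma>_def by (simp add: exp_add[symmetric])
              also have "\<dots> = g * exp (- m)" by (simp only: G(2))
              also have "\<dots> \<le> (\<kappa> / 4 * (ball_const * r ^ DIM('a)) * exp (- (stay_rate * r powr (- a)))) * exp (- m)"
                by (intro mult_right_mono) (auto simp: g_def)
              also have "\<dots> = (1 / 2) * \<kappa> / 2 * (ball_const * r ^ DIM('a)) * exp (- (1 * (m + stay_rate * r powr (- a))))"
                by (simp add: exp_add[symmetric])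
              also have "\<dots> \<le> t / 2 ^ j * \<kappa> / 2 * (ball_const * r ^ DIM('a)) * exp (- (t / 2 ^ j * (m + stay_rate * r powr (- a))))"
                using \<kappa> ball_const_pos r m stay_rate_pos by (intro hop_weight_ge j) auto
              finally show ?thesis .
            qed
            ultimately show ?thesis by (meson ennreal_leI mult_right_mono order_trans zero_le)
          qed
          have avg: "ennreal \<Gamma> ^ N * S y \<le> S 0" if y: "y \<in> cball z (real n + 1)" for y
          proof (rule chain_of_hops[OF step])
            have "norm y \<le> L + (real n + 1)" "L - (real n + 1) \<le> norm y"
              using y norm_triangle_ineq2[of y z] norm_triangle_ineq2[of z y] by (auto simp: dist_norm norm_minus_commute L_def)
            then show "1 / 4 \<le> norm y" "norm y \<le> 3 / 2 * L" "2 * norm y + 1 \<le> real N" using L N by linarith+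
            show "ennreal \<Gamma> \<le> 1" using \<Gamma> by simp
          qed auto
          have "ennreal \<Gamma> ^ N * (ennreal (r ^ DIM('a)) * (\<integral>\<^sup>+x. indicator (cball z (real n)) x * D x \<partial>lborel)) \<le> ennreal ((real n + 1) ^ DIM('a)) * S 0"
            using avg elim(1) \<open>1 \<le> n\<close> unfolding S_def by (intro average_over_small_balls r) auto
          then have "ennreal (1 / (real n + 1) ^ DIM('a)) * (ennreal \<Gamma> ^ N * (ennreal (r ^ DIM('a)) * (\<integral>\<^sup>+x. indicator (cball z (real n)) x * D x \<partial>lborel))) \<le>
             ennreal (1 / (real n + 1) ^ DIM('a)) * (ennreal ((real n + 1) ^ DIM('a)) * S 0)"
            by (rule mult_left_mono) simp
          also have "\<dots> = S 0" by (simp add: mult.assoc[symmetric] ennreal_mult[symmetric] add_nonneg_eq_0_iff)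
          also have "ennreal (1 / (real n + 1) ^ DIM('a)) * (ennreal \<Gamma> ^ N * (ennreal (r ^ DIM('a)) * (\<integral>\<^sup>+x. indicator (cball z (real n)) x * D x \<partial>lborel))) =
             ennreal (\<Gamma> ^ N * (r / (real n + 1)) ^ DIM('a)) * (\<integral>\<^sup>+x. indicator (cball z (real n)) x * D x \<partial>lborel)"
            using \<Gamma> r by (simp add: ennreal_power ennreal_mult[symmetric] mult.assoc[symmetric] power_divide)
          finally show ?case unfolding S_def D_def .
        qed
        let ?b = "C * real n powr (- a)"
        have n0: "0 < real n" using elim by simp
        have "ennreal (\<Gamma> ^ N * (r / (real n + 1)) ^ DIM('a) * real n ^ DIM('a) * exp (- (t * (A * ?b + stay_rate * real n powr (- a)))) / (4 * 2 ^ DIM('a) * r ^ DIM('a))) \<le>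
          feynman_kac M X (\<lambda>y. ennreal (W y)) t 0"
          by (rule feynman_kac_lower[OF Wc W0 t0 r n0 A shift z(3) _ hop]) (use \<Gamma> r in auto)
        moreover have "exp (- (H * exp (H * real n ^ DIM('a)) + H * t * real n powr (- a))) \<le>
          \<Gamma> ^ N * (r / (real n + 1)) ^ DIM('a) * real n ^ DIM('a) * exp (- (t * (A * ?b + stay_rate * real n powr (- a)))) / (4 * 2 ^ DIM('a) * r ^ DIM('a))"
        proof -
          let ?e = "exp (C * (\<beta> + 1) * real n ^ DIM('a))"
          have e1: "1 \<le> ?e" using C W(2) by simp
          have GN: "exp (- (K * ?e)) \<le> \<Gamma> ^ N"
          proof -
            have "real N * (G + m) \<le> 4 * L * (G + m)" using N G m by (intro mult_right_mono) auto
            also have "\<dots> \<le> K * L powr (\<beta> + 1)"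
            proof -
              have "L * G \<le> L powr (\<beta> + 1) * G"
                using powr_mono[of 1 "\<beta> + 1" L] L W(2) G by (intro mult_right_mono) auto
              moreover have "L * m = L powr (\<beta> + 1) * (A * W 0 * 4 powr \<beta>)"
                using L by (simp add: m_def powr_mult powr_add)
              ultimately show ?thesis by (simp add: K_def algebra_simps)
            qed
            also have "\<dots> \<le> K * ?e"
            proof (intro mult_left_mono K)
              have "L powr (\<beta> + 1) \<le> exp (C * real n ^ DIM('a)) powr (\<beta> + 1)" using z(2) L W(2) by (intro powr_mono2) (auto simp: L_def)
              also have "\<dots> = ?e" by (simp add: powr_def algebra_simps)
              finally show "L powr (\<beta> + 1) \<le> ?e" .
            qed
            finally have "exp (- (K * ?e)) \<le> exp (- (real N * (G + m)))" by simp
            also have "\<dots> = \<Gamma> ^ N" by (simp add: \<Gamma>_def exp_of_nat_mult[symmetric] algebra_simps)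
            finally show ?thesis .
          qed
          have ratio: "exp (- ln (4 * 4 ^ DIM('a))) \<le> (r / (real n + 1)) ^ DIM('a) * real n ^ DIM('a) / (4 * 2 ^ DIM('a) * r ^ DIM('a))"
          proof -
            have "(1 / 2) ^ DIM('a) \<le> (real n / (real n + 1)) ^ DIM('a)"
              using elim(2) by (intro power_mono) (auto simp: field_simps)
            then have "(1 / 2) ^ DIM('a) / (4 * 2 ^ DIM('a)) \<le> (real n / (real n + 1)) ^ DIM('a) / (4 * 2 ^ DIM('a))"
              by (intro divide_right_mono) auto
            moreover have "(1 / 2) ^ DIM('a) / (4 * 2 ^ DIM('a)) = exp (- ln (4 * 4 ^ DIM('a) :: real))"
              by (simp add: exp_minus power_divide power_mult_distrib[symmetric] inverse_eq_divide)
            moreover have "(r / (real n + 1)) ^ DIM('a) * real n ^ DIM('a) / (4 * 2 ^ DIM('a) * r ^ DIM('a)) = (real n / (real n + 1)) ^ DIM('a) / (4 * 2 ^ DIM('a))"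
              using r by (simp add: power_divide)
            ultimately show ?thesis by simp
          qed
          have "K * ?e + ln (4 * 4 ^ DIM('a)) \<le> H * exp (H * real n ^ DIM('a))"
          proof -
            have "(1::real) \<le> 4 * 4 ^ DIM('a)" using one_le_power[of "4::real" "DIM('a)"] by linarith
            then have l: "0 \<le> ln (4 * 4 ^ DIM('a) :: real)" by simp
            have "ln (4 * 4 ^ DIM('a)) * 1 \<le> ln (4 * 4 ^ DIM('a)) * ?e" by (rule mult_left_mono[OF e1 l])
            then have "K * ?e + ln (4 * 4 ^ DIM('a)) \<le> (K + ln (4 * 4 ^ DIM('a))) * ?e" by (simp add: distrib_right)
            also have "\<dots> \<le> H * ?e" using H by (intro mult_right_mono) auto
            also have "\<dots> \<le> H * exp (H * real n ^ DIM('a))" using H by (intro mult_left_mono) (auto intro!: mult_right_mono)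
            finally show ?thesis .
          qed
          moreover have "t * (A * ?b + stay_rate * real n powr (- a)) \<le> H * t * real n powr (- a)"
          proof -
            have "t * (A * ?b + stay_rate * real n powr (- a)) = (A * C + stay_rate) * (t * real n powr (- a))" by (simp add: algebra_simps)
            also have "\<dots> \<le> H * (t * real n powr (- a))" using H t0 by (intro mult_right_mono) auto
            finally show ?thesis by (simp add: mult.assoc)
          qed
          ultimately have "exp (- (H * exp (H * real n ^ DIM('a)) + H * t * real n powr (- a))) \<le>
            exp (- (K * ?e) + (- ln (4 * 4 ^ DIM('a))) + (- (t * (A * ?b + stay_rate * real n powr (- a)))))" by simp
          also have "\<dots> = exp (- (K * ?e)) * exp (- ln (4 * 4 ^ DIM('a))) * exp (- (t * (A * ?b + stay_rate * real n powr (- a))))"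
            by (simp only: exp_add)
          also have "\<dots> \<le> \<Gamma> ^ N * ((r / (real n + 1)) ^ DIM('a) * real n ^ DIM('a) / (4 * 2 ^ DIM('a) * r ^ DIM('a))) * exp (- (t * (A * ?b + stay_rate * real n powr (- a))))"
            using \<Gamma> by (intro mult_right_mono mult_mono GN ratio) auto
          finally show ?thesis by simp
        qed
        ultimately show "ennreal (exp (- (H * exp (H * real n ^ DIM('a)) + H * t * real n powr (- a)))) \<le> feynman_kac M X (\<lambda>y. ennreal (W y)) t 0"
          by (meson ennreal_leI order_trans)
      qed
    qed
  qed
qed

end


section \<open>Upper bounds in a fixed environment, and rates\<close>

lemma eventually_affine_le_exp:
  fixes c e B :: real
  assumes "0 < c" "0 < e" "0 \<le> B"
  shows "\<forall>\<^sub>F t in at_top. 1 + B * t \<le> exp (c * t powr e)"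
proof -
  have "\<forall>\<^sub>F t in at_top. max 1 ((ln (1 + B) + 2 / e) / c) \<le> t powr (e / 2)"
    using assms by (intro eventually_powr_ge) auto
  then show ?thesis using eventually_ge_at_top[of 1]
  proof eventually_elim
    case (elim t)
    let ?u = "t powr (e / 2)"
    have l: "0 \<le> ln (1 + B)" using assms by simp
    have "ln t \<le> ?u / (e / 2)" using elim assms by (intro ln_powr_bound) auto
    then have lt: "ln t \<le> 2 / e * ?u" using assms by (simp add: field_simps)
    have "ln ((1 + B) * t) = ln (1 + B) + ln t" using elim assms by (intro ln_mult_pos) auto
    also have "\<dots> \<le> ln (1 + B) * ?u + 2 / e * ?u"
      using lt elim l mult_left_mono[of 1 ?u "ln (1 + B)"] by simp
    also have "\<dots> = (ln (1 + B) + 2 / e) * ?u" by (simp add: distrib_right)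
    also have "\<dots> \<le> (c * ?u) * ?u"
      using elim assms by (intro mult_right_mono) (auto simp: field_simps)
    also have "\<dots> = c * t powr e" by (simp add: mult.assoc powr_add[symmetric])
    finally have "exp (ln ((1 + B) * t)) \<le> exp (c * t powr e)" by simp
    moreover have "0 < (1 + B) * t" using elim assms by (intro mult_pos_pos) auto
    moreover have "1 + B * t \<le> (1 + B) * t" using elim by (simp add: algebra_simps)
    ultimately show ?case by simp
  qed
qed

lemma sqrt_le_over_ln_powr:
  fixes e t :: real
  assumes "0 < e" "1 < t"
  shows "t powr (1 / 2) / (2 * e) powr e \<le> t / ln t powr e"
proof -
  have "ln t powr (2 * e) \<le> (2 * e) powr (2 * e) * t" using assms by (intro ln_powr_bound2) auto
  then have "(ln t powr (2 * e)) powr (1 / 2) \<le> ((2 * e) powr (2 * e) * t) powr (1 / 2)" by (intro powr_mono2) auto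
  then have "ln t powr e \<le> (2 * e) powr e * t powr (1 / 2)"
    using assms by (simp add: powr_powr powr_mult)
  then have "t powr (1 / 2) * ln t powr e \<le> t powr (1 / 2) * ((2 * e) powr e * t powr (1 / 2))"
    by (rule mult_left_mono) simp
  also have "\<dots> = (2 * e) powr e * (t powr (1 / 2) * t powr (1 / 2))" by (simp add: mult_ac)
  also have "t powr (1 / 2) * t powr (1 / 2) = t" using assms by (simp add: powr_add[symmetric])
  finally show ?thesis using assms by (simp add: field_simps)
qed

lemma eventually_ln_powr_ge:
  fixes e B :: real
  assumes "0 < e"
  shows "\<forall>\<^sub>F t in at_top. B \<le> ln t powr e"
  by (rule eventually_compose_filterlim[where P = "\<lambda>x. B \<le> x powr e", OF eventually_powr_ge[OF assms] ln_at_top])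

context levy_setting
begin

text \<open>
  Inside the ball of radius \<open>exp (n\<^sup>d)\<close> the potential is at least of order \<open>n\<^bsup>-a\<^esup>\<close>, and the polynomial
  tail makes leaving it as unlikely as \<open>t exp (- a n\<^sup>d)\<close>. The choice of \<open>n\<close> is the one of the lower bound.
\<close>

lemma upper_bound_single_jump:
  assumes dense: "dense_env a W"
  shows "\<exists>C>0. \<forall>\<^sub>F t in at_top. feynman_kac M X (\<lambda>y. ennreal (W y)) t 0 \<le>
    ennreal (exp (- (C * t powr (real DIM('a) / (real DIM('a) + a)))))"
proof -
  let ?d = "real DIM('a)"
  let ?e = "?d / (?d + a)"
  have d: "0 < ?d" by simp
  obtain c n0 where c: "0 < c" and n0: "\<And>n y. n0 \<le> n \<Longrightarrow> norm y \<le> exp (1 * real n ^ DIM('a)) \<Longrightarrow> c * real n powr (- a) \<le> W y"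
    using dense unfolding dense_env_def eventually_sequentially by (meson zero_less_one)
  define q where "q = min (c * 2 powr (- a) / 2) a"
  have q: "0 < q" "q \<le> c * 2 powr (- a) / 2" "q \<le> a" using c a by (auto simp: q_def)
  have "\<forall>\<^sub>F t in at_top. real (n0 + 1) \<le> t powr (1 / (?d + a))"
    using d a by (intro eventually_powr_ge) auto
  moreover have "\<forall>\<^sub>F t in at_top. 1 + (2 * moment_const) * t \<le> exp (q / 2 * t powr ?e)"
    using d a q moment_const_pos by (intro eventually_affine_le_exp) auto
  ultimately have "\<forall>\<^sub>F t in at_top. feynman_kac M X (\<lambda>y. ennreal (W y)) t 0 \<le> ennreal (exp (- (q / 2 * t powr ?e)))"
    using eventually_ge_at_top[of 1]
  proof eventually_elim
    case (elim t)
    define s where "s = t powr (1 / (?d + a))"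
    define n where "n = nat \<lceil>s\<rceil>"
    have s: "real (n0 + 1) \<le> s" "1 \<le> s" using elim by (auto simp: s_def intro: order_trans[of _ "real (n0 + 1)"])
    have n: "s \<le> real n" "real n \<le> 2 * s" using s by (auto simp: n_def) linarith
    have n1: "n0 \<le> n" "1 \<le> n" using n s by linarith+
    have st: "s powr (?d + a) = t" using elim d a by (simp add: s_def powr_powr)
    have sd: "s powr ?d = t powr ?e" by (simp add: s_def powr_powr)
    define L where "L = exp (real n ^ DIM('a))"
    define p where "p = t * moment_const * L powr (- a)"
    have "feynman_kac M X (\<lambda>y. ennreal (W y)) t 0 \<le> ennreal (exp (- (c * real n powr (- a) * t / 2)) + 2 * p)"
    proof (rule feynman_kac_le[where L = L])
      show "0 < t" using elim by simp
      show "0 \<le> c * real n powr (- a)" using c by simp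
      show "ennreal (c * real n powr (- a)) \<le> ennreal (W y)" if "norm y \<le> L" for y
        using n0[OF n1(1), of y] that by (intro ennreal_leI) (simp add: L_def)
      show "0 \<le> p" using elim moment_const_pos by (simp add: p_def)
      fix r assume r: "0 < r" "r < t"
      have "emeasure (distr M borel (X r)) {y. L < norm y} \<le> emeasure (distr M borel (X r)) {y. L \<le> norm y}"
        by (rule emeasure_mono) auto
      also have "\<dots> \<le> ennreal (r * moment_const * L powr (- a))" using r by (intro law_tail) (simp_all add: L_def)
      also have "\<dots> \<le> ennreal p" unfolding p_def using r moment_const_pos by (intro ennreal_leI mult_right_mono) auto
      finally show "emeasure (distr M borel (X r)) {y. L < norm y} \<le> ennreal p" .
    qed
    also have "\<dots> \<le> ennreal (exp (- (q / 2 * t powr ?e)))"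
    proof (rule ennreal_leI)
      have "q * s powr ?d \<le> c * 2 powr (- a) / 2 * s powr ?d" using q by (intro mult_right_mono) auto
      also have "\<dots> = c * (2 * s) powr (- a) * s powr (?d + a) / 2"
        using s by (simp add: powr_mult powr_add powr_minus)
      also have "\<dots> \<le> c * real n powr (- a) * t / 2"
        unfolding st using n s a elim c by (intro divide_right_mono mult_right_mono mult_left_mono powr_mono2') auto
      finally have 1: "exp (- (c * real n powr (- a) * t / 2)) \<le> exp (- (q * s powr ?d))" by simp
      have "s powr ?d \<le> real n powr ?d" using n s d by (intro powr_mono2) auto
      also have "\<dots> = real n ^ DIM('a)" using n1 by (simp add: powr_realpow)
      finally have "q * s powr ?d \<le> a * real n ^ DIM('a)" using q by (intro mult_mono) auto
      then have "exp (- (a * real n ^ DIM('a))) \<le> exp (- (q * s powr ?d))" by simp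
      moreover have "L powr (- a) = exp (- (a * real n ^ DIM('a)))" by (simp add: L_def powr_def)
      ultimately have 2: "p \<le> t * moment_const * exp (- (q * s powr ?d))"
        unfolding p_def using elim moment_const_pos by (intro mult_left_mono) auto
      have "exp (- (c * real n powr (- a) * t / 2)) + 2 * p \<le> (1 + (2 * moment_const) * t) * exp (- (q * s powr ?d))"
      proof -
        have "exp (- (c * real n powr (- a) * t / 2)) + 2 * p \<le> exp (- (q * s powr ?d)) + 2 * (t * moment_const * exp (- (q * s powr ?d)))"
          by (intro add_mono mult_left_mono 1 2) simp
        then show ?thesis by (simp add: algebra_simps)
      qed
      also have "\<dots> \<le> exp (q / 2 * t powr ?e) * exp (- (q * s powr ?d))" using elim by (intro mult_right_mono) auto
      also have "\<dots> = exp (- (q / 2 * t powr ?e))" by (simp add: sd exp_add[symmetric])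
      finally show "exp (- (c * real n powr (- a) * t / 2)) + 2 * p \<le> exp (- (q / 2 * t powr ?e))" .
    qed
    finally show ?case .
  qed
  then show ?thesis using q by (intro exI[of _ "q / 2"]) auto
qed

text \<open>
  Jumps with stretched exponential tails confine the process to a ball of polynomial radius in \<open>t\<close>,
  so that only \<open>n\<^sup>d\<close> of order \<open>log t\<close> matters.
\<close>

lemma upper_bound_light_tails:
  assumes dense: "dense_env a W" and p: "0 < p" "p \<le> 1"
    and fin: "(\<integral>\<^sup>+z. ennreal (exp (norm z powr p)) * indicator {z. 1 < norm z} z \<partial>\<nu>) < \<infinity>"
  shows "\<exists>C>0. \<forall>\<^sub>F t in at_top. feynman_kac M X (\<lambda>y. ennreal (W y)) t 0 \<le>
    ennreal (exp (- (C * (t / ln t powr (a / real DIM('a))))))"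
proof -
  let ?d = "real DIM('a)"
  let ?e = "a / ?d"
  have d: "0 < ?d" by simp
  have e: "0 < ?e" using a by simp
  obtain C where C: "0 \<le> C" and
    tail: "\<And>h r. 0 < h \<Longrightarrow> 0 \<le> r \<Longrightarrow> emeasure (distr M borel (X h)) {x. r < norm x} \<le> ennreal (exp (h * C + 1 - r powr p))"
    using law_stretched_exponential_tail[OF p fin] by blast
  obtain c n0 where c: "0 < c" and n0: "\<And>n y. n0 \<le> n \<Longrightarrow> norm y \<le> exp (2 / p * real n ^ DIM('a)) \<Longrightarrow> c * real n powr (- a) \<le> W y"
  proof -
    have "0 < 2 / p" using p by simp
    with dense show thesis using that unfolding dense_env_def eventually_sequentially by blast
  qed
  define q where "q = c * 2 powr (- a) / 2"
  have q: "0 < q" using c by (simp add: q_def)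
  have "\<forall>\<^sub>F t in at_top. real (n0 + 1) \<le> ln t powr (1 / ?d)"
    using d by (intro eventually_ln_powr_ge) auto
  moreover have "\<forall>\<^sub>F t in at_top. ln 3 * (2 / q) * (2 * ?e) powr ?e \<le> t powr (1 / 2)"
    by (intro eventually_powr_ge) auto
  ultimately have "\<forall>\<^sub>F t in at_top. feynman_kac M X (\<lambda>y. ennreal (W y)) t 0 \<le> ennreal (exp (- (q / 2 * (t / ln t powr ?e))))"
    using eventually_ge_at_top[of "max (C + q + 1) (exp 1)"]
  proof eventually_elim
    case (elim t)
    have t: "C + q + 1 \<le> t" "exp 1 \<le> t" using elim by auto
    have t1: "1 < t" using t(2) one_less_exp_iff[of "1::real"] by linarith
    have l1: "1 \<le> ln t" using t(2) t1 by (simp add: ln_ge_iff)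
    (* The p-th power of the radius t^(2/p) is t^2, which beats the linear growth in the tail bound,
       and the scale n is such that this radius is at most exp (2/p n^d). *)
    define s where "s = ln t powr (1 / ?d)"
    define n where "n = nat \<lceil>s\<rceil>"
    have s: "real (n0 + 1) \<le> s" "1 \<le> s" using elim by (auto simp: s_def intro: order_trans[of _ "real (n0 + 1)"])
    have n: "s \<le> real n" "real n \<le> 2 * s" using s by (auto simp: n_def) linarith
    have n1: "n0 \<le> n" "1 \<le> n" using n s by linarith+
    have sd: "s powr ?d = ln t" using l1 by (simp add: s_def powr_powr)
    have sa: "s powr (- a) = 1 / ln t powr ?e" using l1 by (simp add: s_def powr_powr powr_minus_divide)
    define w where "w = t / ln t powr ?e"
    have w: "0 \<le> w" "w \<le> t"
    proof -
      have "1 \<le> ln t powr ?e" using l1 e by (intro ge_one_powr_ge_zero) auto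
      then show "0 \<le> w" "w \<le> t" using t1 by (auto simp: w_def divide_le_eq mult_le_cancel_left1)
    qed
    have "feynman_kac M X (\<lambda>y. ennreal (W y)) t 0 \<le> ennreal (exp (- (c * real n powr (- a) * t / 2)) + 2 * exp (t * C + 1 - t\<^sup>2))"
    proof (rule feynman_kac_le[where L = "t powr (2 / p)"])
      show "0 < t" using t1 by simp
      show "0 \<le> c * real n powr (- a)" using c by simp
      have "ln t \<le> real n ^ DIM('a)"
      proof -
        have "s powr ?d \<le> real n powr ?d" using n s d by (intro powr_mono2) auto
        then show ?thesis using n1 by (simp add: powr_realpow sd)
      qed
      then have "2 / p * ln t \<le> 2 / p * real n ^ DIM('a)" using p by (intro mult_left_mono) auto
      then have "t powr (2 / p) \<le> exp (2 / p * real n ^ DIM('a))" using t1 by (simp add: powr_def)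
      then show "ennreal (c * real n powr (- a)) \<le> ennreal (W y)" if "norm y \<le> t powr (2 / p)" for y
        using n0[OF n1(1), of y] that by (intro ennreal_leI) linarith
      show "0 \<le> exp (t * C + 1 - t\<^sup>2)" by simp
      fix r assume r: "0 < r" "r < t"
      have "(t powr (2 / p)) powr p = t powr 2" using p by (simp add: powr_powr)
      then have tp: "(t powr (2 / p)) powr p = t\<^sup>2" using t1 by simp
      have "emeasure (distr M borel (X r)) {y. t powr (2 / p) < norm y} \<le> ennreal (exp (r * C + 1 - t\<^sup>2))"
        using tail[OF r(1), of "t powr (2 / p)"] by (simp add: tp)
      also have "\<dots> \<le> ennreal (exp (t * C + 1 - t\<^sup>2))" using r C by (intro ennreal_leI) (simp add: mult_right_mono)
      finally show "emeasure (distr M borel (X r)) {y. t powr (2 / p) < norm y} \<le> ennreal (exp (t * C + 1 - t\<^sup>2))" .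
    qed
    also have "\<dots> \<le> ennreal (exp (- (q / 2 * w)))"
    proof (rule ennreal_leI)
      have "q * w = c * (2 * s) powr (- a) * t / 2"
        using s by (simp add: q_def w_def powr_mult sa)
      also have "\<dots> \<le> c * real n powr (- a) * t / 2"
        using n s a t1 c by (intro divide_right_mono mult_right_mono mult_left_mono powr_mono2') auto
      finally have 1: "exp (- (c * real n powr (- a) * t / 2)) \<le> exp (- (q * w))" by simp
      have "(C + q + 1) * t \<le> t * t" using t t1 by (intro mult_right_mono) auto
      then have "t * C + 1 - t\<^sup>2 \<le> - (q * t)" using t1 by (simp add: power2_eq_square algebra_simps)
      also have "\<dots> \<le> - (q * w)" using q w by simp
      finally have 2: "exp (t * C + 1 - t\<^sup>2) \<le> exp (- (q * w))" by simp
      have "ln 3 * (2 / q) \<le> t powr (1 / 2) / (2 * ?e) powr ?e" using elim(2) a by (simp add: le_divide_eq)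
      also have "\<dots> \<le> w" unfolding w_def by (rule sqrt_le_over_ln_powr[OF e t1])
      finally have "ln 3 \<le> q / 2 * w" using q by (simp add: field_simps)
      then have "exp (ln 3) \<le> exp (q / 2 * w)" by (simp only: exp_le_cancel_iff)
      then have 3: "3 \<le> exp (q / 2 * w)" by simp
      have "exp (- (c * real n powr (- a) * t / 2)) + 2 * exp (t * C + 1 - t\<^sup>2) \<le> 3 * exp (- (q * w))" using 1 2 by linarith
      also have "\<dots> \<le> exp (q / 2 * w) * exp (- (q * w))" by (rule mult_right_mono[OF 3]) simp
      also have "\<dots> = exp (- (q / 2 * w))" by (simp add: exp_add[symmetric])
      finally show "exp (- (c * real n powr (- a) * t / 2)) + 2 * exp (t * C + 1 - t\<^sup>2) \<le> exp (- (q / 2 * w))" .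
    qed
    finally show ?case by (simp add: w_def)
  qed
  then show ?thesis using q by (intro exI[of _ "q / 2"]) auto
qed

text \<open>
  With \<open>n\<^sup>d = \<zeta> log t\<close> and \<open>\<zeta>\<close> small, the chain costs at most a multiple of the square root of \<open>t\<close>,
  which is negligible against \<open>t / (log t)\<^bsup>a/d\<^esup>\<close>, the cost of the stay.
\<close>

lemma lower_bound_chain_rate:
  assumes W: "comparable \<beta> W" "0 < \<beta>" and spots: "has_low_spots a W"
    and \<kappa>: "0 < \<kappa>" and dom: "\<And>B. B \<in> sets borel \<Longrightarrow> B \<subseteq> {v. 1 / 16 \<le> norm v \<and> norm v \<le> 1} \<Longrightarrow>
      ennreal \<kappa> * emeasure lborel B \<le> emeasure \<nu> B"
  shows "\<exists>C>0. \<forall>\<^sub>F t in at_top. ennreal (exp (- (C * (t / ln t powr (a / real DIM('a)))))) \<le> feynman_kac M X (\<lambda>y. ennreal (W y)) t 0"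
proof -
  let ?d = "real DIM('a)"
  let ?e = "a / ?d"
  have d: "0 < ?d" by simp
  have e: "0 < ?e" using a by simp
  obtain C n0 where C: "0 < C" and n0: "\<And>n t. n0 \<le> n \<Longrightarrow> 1 \<le> t \<Longrightarrow>
      ennreal (exp (- (C * exp (C * real n ^ DIM('a)) + C * t * real n powr (- a)))) \<le> feynman_kac M X (\<lambda>y. ennreal (W y)) t 0"
    using lower_bound_chain[OF W spots \<kappa> dom] unfolding eventually_sequentially by blast
  define \<zeta> where "\<zeta> = 1 / (2 * C)"
  have \<zeta>: "0 < \<zeta>" "C * \<zeta> = 1 / 2" using C by (auto simp: \<zeta>_def)
  define H where "H = C * (2 * ?e) powr ?e + C * 2 powr a * \<zeta> powr (- ?e)"
  have H: "0 < H" using C \<zeta> unfolding H_def by (intro add_nonneg_pos) auto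
  have "\<forall>\<^sub>F t in at_top. real (n0 + 1) / \<zeta> powr (1 / ?d) \<le> ln t powr (1 / ?d)"
    using d by (intro eventually_ln_powr_ge) auto
  then have "\<forall>\<^sub>F t in at_top. ennreal (exp (- (H * (t / ln t powr ?e)))) \<le> feynman_kac M X (\<lambda>y. ennreal (W y)) t 0"
    using eventually_gt_at_top[of 1]
  proof eventually_elim
    case (elim t)
    have l0: "0 < ln t" using elim by simp
    define s where "s = (\<zeta> * ln t) powr (1 / ?d)"
    define n where "n = nat \<lfloor>s\<rfloor>"
    have "real (n0 + 1) \<le> s" using elim \<zeta> l0 by (simp add: s_def powr_mult field_simps)
    then have s: "real (n0 + 1) \<le> s" "1 \<le> s" by auto
    have "1 \<le> \<lfloor>s\<rfloor>" using s by (simp add: le_floor_iff)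
    then have "1 \<le> real_of_int \<lfloor>s\<rfloor>" "real n = real_of_int \<lfloor>s\<rfloor>" by (auto simp: n_def of_nat_nat)
    then have n: "real n \<le> s" "s / 2 \<le> real n" using floor_correct[of s] by linarith+
    have n1: "n0 \<le> n" "1 \<le> n"
    proof -
      have "s < real n + 1" using s by (simp add: n_def of_nat_nat)
      then show "n0 \<le> n" "1 \<le> n" using s n by linarith+
    qed
    have sd: "s powr ?d = \<zeta> * ln t" using l0 \<zeta> by (simp add: s_def powr_powr)
    have sa: "s powr (- a) = \<zeta> powr (- ?e) / ln t powr ?e"
    proof -
      have "s powr (- a) = (\<zeta> * ln t) powr (- ?e)" by (simp add: s_def powr_powr)
      also have "\<dots> = \<zeta> powr (- ?e) * ln t powr (- ?e)" by (rule powr_mult)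
      finally show ?thesis by (simp add: powr_minus_divide)
    qed
    have "C * exp (C * real n ^ DIM('a)) \<le> C * (2 * ?e) powr ?e * (t / ln t powr ?e)"
    proof -
      have "real n ^ DIM('a) = real n powr ?d" using n1 by (simp add: powr_realpow)
      also have "\<dots> \<le> s powr ?d" using n d by (intro powr_mono2) auto
      finally have "C * real n ^ DIM('a) \<le> C * (\<zeta> * ln t)" using C sd by (intro mult_left_mono) auto
      also have "\<dots> = 1 / 2 * ln t" by (simp only: mult.assoc[symmetric] \<zeta>(2))
      finally have "exp (C * real n ^ DIM('a)) \<le> t powr (1 / 2)" using elim by (simp add: powr_def)
      also have "\<dots> \<le> (2 * ?e) powr ?e * (t / ln t powr ?e)"
        using sqrt_le_over_ln_powr[OF e elim(2)] a by (simp add: field_simps)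
      finally have "C * exp (C * real n ^ DIM('a)) \<le> C * ((2 * ?e) powr ?e * (t / ln t powr ?e))"
        using C by (intro mult_left_mono) auto
      then show ?thesis by (simp only: mult.assoc)
    qed
    moreover have "C * t * real n powr (- a) \<le> C * 2 powr a * \<zeta> powr (- ?e) * (t / ln t powr ?e)"
    proof -
      have "real n powr (- a) \<le> (s / 2) powr (- a)" using n s a by (intro powr_mono2') auto
      also have "\<dots> = 2 powr a * \<zeta> powr (- ?e) / ln t powr ?e"
      proof -
        have "(s / 2) powr (- a) = 2 powr a * s powr (- a)" using s by (simp add: powr_divide powr_minus_divide)
        then show ?thesis by (simp add: sa)
      qed
      finally have "C * t * real n powr (- a) \<le> C * t * (2 powr a * \<zeta> powr (- ?e) / ln t powr ?e)"
        using C elim by (intro mult_left_mono) auto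
      then show ?thesis by (simp add: mult_ac)
    qed
    ultimately have "C * exp (C * real n ^ DIM('a)) + C * t * real n powr (- a) \<le> H * (t / ln t powr ?e)"
      unfolding H_def distrib_right by (rule add_mono)
    then have "ennreal (exp (- (H * (t / ln t powr ?e)))) \<le> ennreal (exp (- (C * exp (C * real n ^ DIM('a)) + C * t * real n powr (- a))))"
      by (intro ennreal_leI) simp
    also have "\<dots> \<le> feynman_kac M X (\<lambda>y. ennreal (W y)) t 0" using elim by (intro n0 n1) auto
    finally show ?case .
  qed
  then show ?thesis using H by blast
qed

end

lemma log_ennreal_ge: "ennreal (exp x) \<le> u \<Longrightarrow> ereal x \<le> log_ennreal u"
  by (cases u) (auto simp: log_ennreal_def ln_ge_iff ennreal_eq_0_iff intro: order_less_le_trans[OF exp_gt_zero] split: if_splits)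

lemma log_ennreal_le: "u \<le> ennreal (exp y) \<Longrightarrow> log_ennreal u \<le> ereal y"
proof (cases u)
  case (real r)
  assume "u \<le> ennreal (exp y)"
  then have "r \<le> exp y" using real by simp
  then show ?thesis using real ln_mono[of r "exp y"] by (auto simp: log_ennreal_def ennreal_eq_0_iff)
qed (simp add: top_unique)

lemma log_rate_bounds:
  fixes r :: "real \<Rightarrow> real" and u :: "real \<Rightarrow> ennreal"
  assumes pos: "\<forall>\<^sub>F t in at_top. 0 < r t"
    and lower: "\<exists>C>0. \<forall>\<^sub>F t in at_top. ennreal (exp (- (C * r t))) \<le> u t"
    and upper: "\<exists>C>0. \<forall>\<^sub>F t in at_top. u t \<le> ennreal (exp (- (C * r t)))"
  shows "let R = (\<lambda>t. log_ennreal (u t) / ereal (r t))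
    in -\<infinity> < Liminf at_top R \<and> Liminf at_top R \<le> Limsup at_top R \<and> Limsup at_top R < 0"
proof -
  define R where "R t = log_ennreal (u t) / ereal (r t)" for t
  obtain C where C: "0 < C" "\<forall>\<^sub>F t in at_top. ennreal (exp (- (C * r t))) \<le> u t" using lower by auto
  obtain c where c: "0 < c" "\<forall>\<^sub>F t in at_top. u t \<le> ennreal (exp (- (c * r t)))" using upper by auto
  have "\<forall>\<^sub>F t in at_top. ereal (- C) \<le> R t"
    using C(2) pos
  proof eventually_elim
    case (elim t)
    have "ereal (- (C * r t)) / ereal (r t) \<le> R t"
      unfolding R_def using elim by (intro ereal_divide_right_mono log_ennreal_ge) auto
    then show ?case using elim by simp
  qed
  then have 1: "ereal (- C) \<le> Liminf at_top R" by (rule Liminf_bounded)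
  have "\<forall>\<^sub>F t in at_top. R t \<le> ereal (- c)"
    using c(2) pos
  proof eventually_elim
    case (elim t)
    have "R t \<le> ereal (- (c * r t)) / ereal (r t)"
      unfolding R_def using elim by (intro ereal_divide_right_mono log_ennreal_le) auto
    then show ?case using elim by simp
  qed
  then have 2: "Limsup at_top R \<le> ereal (- c)" by (rule Limsup_bounded)
  have 3: "Liminf at_top R \<le> Limsup at_top R" by (rule Liminf_le_Limsup) simp
  show ?thesis
    unfolding Let_def R_def[symmetric]
  proof (intro conjI 3)
    show "-\<infinity> < Liminf at_top R" by (rule less_le_trans[OF _ 1]) simp
    show "Limsup at_top R < 0" by (rule le_less_trans[OF 2]) (use c in simp)
  qed
qed


section \<open>Potentials of power-law shape\<close>

lemma power_shape_eq:
  assumes "0 < \<beta>"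
  shows "power_shape \<beta> x = max 1 (norm x) powr (- \<beta>)"
proof (cases "x = 0")
  case False
  show ?thesis
  proof (cases "norm x \<le> 1")
    case True
    then have "1 powr (- \<beta>) \<le> norm x powr (- \<beta>)" using False assms by (intro powr_mono2') auto
    then show ?thesis using False True by (simp add: power_shape_def max_absorb1)
  next
    case nx: False
    then have "norm x powr (- \<beta>) \<le> 1 powr (- \<beta>)" using assms by (intro powr_mono2') auto
    then show ?thesis using False nx by (simp add: power_shape_def)
  qed
qed (simp add: power_shape_def)

lemma power_shape_le: "0 < \<beta> \<Longrightarrow> 0 < r \<Longrightarrow> r \<le> norm x \<Longrightarrow> power_shape \<beta> x \<le> r powr (- \<beta>)"
  by (simp add: power_shape_eq) (intro powr_mono2', auto)

lemma power_shape_ge: "0 < \<beta> \<Longrightarrow> 1 \<le> r \<Longrightarrow> norm x \<le> r \<Longrightarrow> r powr (- \<beta>) \<le> power_shape \<beta> x"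
  by (simp add: power_shape_eq) (intro powr_mono2', auto)

lemma power_shape_comparable:
  fixes x y :: "'a::euclidean_space"
  assumes "0 < \<beta>"
  shows "power_shape \<beta> x \<le> (1 + norm (x - y)) powr \<beta> * power_shape \<beta> y"
proof -
  let ?\<delta> = "1 + norm (x - y)"
  have \<delta>: "1 \<le> ?\<delta>" by simp
  have "norm y \<le> norm x + norm (x - y)" by (metis norm_minus_commute norm_triangle_sub)
  also have "\<dots> \<le> max 1 (norm x) + max 1 (norm x) * norm (x - y)"
    using mult_right_mono[of 1 "max 1 (norm x)" "norm (x - y)"] by (intro add_mono) auto
  finally have "norm y \<le> ?\<delta> * max 1 (norm x)" by (simp add: algebra_simps)
  moreover have "1 * 1 \<le> ?\<delta> * max 1 (norm x)" using \<delta> by (intro mult_mono) auto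
  ultimately have "max 1 (norm y) \<le> ?\<delta> * max 1 (norm x)" by simp
  then have "(?\<delta> * max 1 (norm x)) powr (- \<beta>) \<le> max 1 (norm y) powr (- \<beta>)"
    using assms by (intro powr_mono2') auto
  then have "?\<delta> powr (- \<beta>) * max 1 (norm x) powr (- \<beta>) \<le> max 1 (norm y) powr (- \<beta>)"
    by (simp add: powr_mult)
  then have "?\<delta> powr \<beta> * (?\<delta> powr (- \<beta>) * max 1 (norm x) powr (- \<beta>)) \<le> ?\<delta> powr \<beta> * max 1 (norm y) powr (- \<beta>)"
    by (rule mult_left_mono) simp
  moreover have "?\<delta> powr \<beta> * ?\<delta> powr (- \<beta>) = 1"
  proof -
    have "?\<delta> \<noteq> 0" using \<delta> by linarith
    then show ?thesis by (simp add: powr_add[symmetric])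
  qed
  ultimately show ?thesis using assms by (simp add: power_shape_eq mult.assoc[symmetric])
qed

lemma measurable_power_shape: "0 < \<beta> \<Longrightarrow> power_shape \<beta> \<in> borel_measurable borel"
  by (subst measurable_cong[OF power_shape_eq]) measurable

lemma potential_comparable:
  fixes m :: "'a::euclidean_space measure"
  assumes "0 < \<beta>" and m: "sets m = sets borel"
  shows "potential (power_shape \<beta>) m x \<le> ennreal ((1 + norm (x - y)) powr \<beta>) * potential (power_shape \<beta>) m y"
proof -
  note [measurable_cong] = m
  note [measurable] = measurable_power_shape[OF assms(1)]
  have "potential (power_shape \<beta>) m x \<le> (\<integral>\<^sup>+w. ennreal ((1 + norm (x - y)) powr \<beta>) * ennreal (power_shape \<beta> (y - w)) \<partial>m)"
    unfolding potential_def
  proof (intro nn_integral_mono)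
    fix w
    have "power_shape \<beta> (x - w) \<le> (1 + norm (x - y)) powr \<beta> * power_shape \<beta> (y - w)"
      using power_shape_comparable[OF assms(1), of "x - w" "y - w"] by simp
    then show "ennreal (power_shape \<beta> (x - w)) \<le> ennreal ((1 + norm (x - y)) powr \<beta>) * ennreal (power_shape \<beta> (y - w))"
      using assms by (simp add: ennreal_mult[symmetric] power_shape_eq ennreal_leI)
  qed
  also have "\<dots> = ennreal ((1 + norm (x - y)) powr \<beta>) * potential (power_shape \<beta>) m y"
    unfolding potential_def by (rule nn_integral_cmult) measurable
  finally show ?thesis .
qed

text \<open>
  Rounding all coordinates down moves a point by at most \<open>d\<close>.
\<close>

lemma lattice_cover:
  assumes "1 \<le> (L::real)"
  obtains G :: "'a::euclidean_space set" where "finite G" "real (card G) \<le> (5 * L) ^ DIM('a)"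
    "\<And>x. norm x \<le> L \<Longrightarrow> \<exists>z\<in>G. norm (x - z) \<le> real DIM('a)"
proof -
  define P where "P = (PiE (Basis::'a set) (\<lambda>_. {- \<lceil>L\<rceil>..\<lceil>L\<rceil>}))"
  define g where "g f = (\<Sum>b\<in>(Basis::'a set). real_of_int (f b) *\<^sub>R b)" for f
  have fin: "finite P" unfolding P_def by (intro finite_PiE) auto
  show thesis
  proof (rule that[of "g ` P"])
    show "finite (g ` P)" using fin by simp
    have "real (card (g ` P)) \<le> real (card P)" using card_image_le[OF fin] by simp
    also have "card P = nat (2 * \<lceil>L\<rceil> + 1) ^ DIM('a)"
      unfolding P_def by (subst card_PiE) (auto simp: algebra_simps)
    also have "real (nat (2 * \<lceil>L\<rceil> + 1) ^ DIM('a)) \<le> (5 * L) ^ DIM('a)"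
    proof -
      have "real (nat (2 * \<lceil>L\<rceil> + 1)) = 2 * real_of_int \<lceil>L\<rceil> + 1" using assms by simp
      also have "\<dots> \<le> 5 * L" using assms by linarith
      finally have "real (nat (2 * \<lceil>L\<rceil> + 1)) ^ DIM('a) \<le> (5 * L) ^ DIM('a)" by (rule power_mono) simp
      then show ?thesis by simp
    qed
    finally show "real (card (g ` P)) \<le> (5 * L) ^ DIM('a)" .
    fix x :: 'a assume x: "norm x \<le> L"
    define f where "f = restrict (\<lambda>b. \<lfloor>x \<bullet> b\<rfloor>) Basis"
    have "f \<in> P" unfolding P_def f_def
    proof (intro restrict_PiE_iff[THEN iffD2] ballI)
      fix b :: 'a assume "b \<in> Basis"
      then have "\<bar>x \<bullet> b\<bar> \<le> L" using x Basis_le_norm by (meson order_trans)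
      then show "\<lfloor>x \<bullet> b\<rfloor> \<in> {- \<lceil>L\<rceil>..\<lceil>L\<rceil>}" by (auto simp: le_floor_iff floor_le_iff) linarith+
    qed
    moreover have "norm (x - g f) \<le> real DIM('a)"
    proof -
      have "x - g f = (\<Sum>b\<in>Basis. (x \<bullet> b - real_of_int \<lfloor>x \<bullet> b\<rfloor>) *\<^sub>R b)"
      proof -
        have "x = (\<Sum>b\<in>Basis. (x \<bullet> b) *\<^sub>R b)" by (simp add: euclidean_representation)
        moreover have "g f = (\<Sum>b\<in>Basis. real_of_int \<lfloor>x \<bullet> b\<rfloor> *\<^sub>R b)" by (simp add: g_def f_def)
        ultimately have "x - g f = (\<Sum>b\<in>Basis. (x \<bullet> b) *\<^sub>R b) - (\<Sum>b\<in>Basis. real_of_int \<lfloor>x \<bullet> b\<rfloor> *\<^sub>R b)" by (simp only:)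
        then show ?thesis by (simp only: sum_subtractf scaleR_diff_left)
      qed
      also have "norm \<dots> \<le> (\<Sum>b\<in>(Basis::'a set). 1)"
      proof (rule sum_norm_le)
        fix b :: 'a assume "b \<in> Basis"
        moreover have "\<bar>x \<bullet> b - real_of_int \<lfloor>x \<bullet> b\<rfloor>\<bar> \<le> 1" by linarith
        ultimately show "norm ((x \<bullet> b - real_of_int \<lfloor>x \<bullet> b\<rfloor>) *\<^sub>R b) \<le> 1" by simp
      qed
      finally show ?thesis by simp
    qed
    ultimately show "\<exists>z\<in>g ` P. norm (x - z) \<le> real DIM('a)" by blast
  qed
qed

text \<open>
  Sum over dyadic shells around \<open>z\<close>: the shell at distance \<open>2\<^sup>i n\<close> holds at most order \<open>(2\<^sup>i n)\<^sup>d\<close> points,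
  each contributing at most \<open>(2\<^sup>i n)\<^bsup>-d-a\<^esup>\<close>, and the geometric series is dominated by its first term.
\<close>

lemma potential_far_from_points:
  fixes m :: "'a::euclidean_space measure"
  assumes m: "sets m = sets borel" and a: "0 < a" and n: "1 \<le> (n::real)" and E: "0 \<le> E"
    and empty: "emeasure m (cball z (2 * n)) = 0"
    and count: "\<And>i. emeasure m (cball z (2 ^ (i + 2) * n)) \<le> ennreal (E * (2 ^ (i + 2) * n) ^ DIM('a))"
    and y: "y \<in> cball z n"
  shows "potential (power_shape (real DIM('a) + a)) m y \<le> ennreal (E * 4 ^ DIM('a) / (1 - 2 powr (- a)) * n powr (- a))"
proof -
  let ?\<beta> = "real DIM('a) + a"
  let ?T = "\<lambda>i w. ennreal ((2 ^ i * n) powr (- ?\<beta>)) * indicator (cball z (2 ^ (i + 2) * n)) w"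
  note [measurable_cong] = m
  have cb: "cball z r \<in> sets m" for r by (simp add: m)
  have T: "?T i \<in> borel_measurable m" for i using cb by measurable
  have "cball z (2 * n) \<in> null_sets m" using cb empty by (simp add: null_sets_def)
  then have ae: "AE w in m. w \<notin> cball z (2 * n)" by (rule AE_not_in)
  have "potential (power_shape ?\<beta>) m y \<le> (\<integral>\<^sup>+w. (\<Sum>i. ?T i w) \<partial>m)"
    unfolding potential_def
  proof (rule nn_integral_mono_AE, use ae in eventually_elim)
    fix w assume w: "w \<notin> cball z (2 * n)"
    define D where "D = norm (w - z)"
    have D: "2 * n < D" using w by (simp add: D_def dist_norm norm_minus_commute)
    obtain k :: nat where k: "D / n < 2 ^ k" using real_arch_pow[of 2 "D / n"] by auto
    have "D \<le> 2 ^ (k + 2) * n"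
    proof -
      have "D \<le> 2 ^ k * n" using k n by (simp add: field_simps)
      also have "\<dots> \<le> 2 ^ (k + 2) * n" using n by (intro mult_right_mono power_increasing) auto
      finally show ?thesis .
    qed
    (* The shell that contains w; it lies outside cball z (2 n), so the index starts at radius 2 n. *)
    define i where "i = (LEAST i. D \<le> 2 ^ (i + 2) * n)"
    have i: "D \<le> 2 ^ (i + 2) * n" unfolding i_def by (rule LeastI[of _ k]) fact
    have i': "2 ^ (i + 1) * n < D"
    proof (cases i)
      case 0
      then show ?thesis using D by simp
    next
      case (Suc l)
      then have "\<not> D \<le> 2 ^ (l + 2) * n" unfolding i_def using not_less_Least[of l "\<lambda>i. D \<le> 2 ^ (i + 2) * n"] by auto
      then show ?thesis using Suc by simp
    qed
    have "D \<le> norm (y - w) + n"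
      unfolding D_def using y norm_triangle_ineq[of "w - y" "y - z"] by (simp add: dist_norm norm_minus_commute)
    moreover have "n \<le> 2 ^ i * n" using n by simp
    ultimately have yw: "2 ^ i * n \<le> norm (y - w)" using i' by simp
    have "power_shape ?\<beta> (y - w) \<le> (2 ^ i * n) powr (- ?\<beta>)"
      using yw a n by (intro power_shape_le) auto
    then have "ennreal (power_shape ?\<beta> (y - w)) \<le> ?T i w"
      using i by (simp add: D_def dist_norm norm_minus_commute ennreal_leI)
    also have "\<dots> \<le> (\<Sum>i. ?T i w)" 
    proof -
      have "(\<Sum>j\<in>{i}. ?T j w) \<le> (\<Sum>j. ?T j w)" by (intro sum_le_suminf summableI) auto
      then show ?thesis by (subst (asm) sum.insert) (simp_all only: finite.emptyI empty_iff not_False_eq_True sum.empty add_0_right)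
    qed
    finally show "ennreal (power_shape ?\<beta> (y - w)) \<le> (\<Sum>i. ?T i w)" .
  qed
  also have "\<dots> = (\<Sum>i. \<integral>\<^sup>+w. ?T i w \<partial>m)" by (rule nn_integral_suminf[OF T])
  also have "\<dots> \<le> (\<Sum>i. ennreal (E * 4 ^ DIM('a) * n powr (- a) * (2 powr (- a)) ^ i))"
  proof (rule suminf_le[OF _ summableI summableI])
    fix i
    have s: "0 < 2 ^ i * n" using n by simp
    have "(\<integral>\<^sup>+w. ?T i w \<partial>m) = ennreal ((2 ^ i * n) powr (- ?\<beta>)) * emeasure m (cball z (2 ^ (i + 2) * n))"
      using cb by (rule nn_integral_cmult_indicator)
    also have "\<dots> \<le> ennreal ((2 ^ i * n) powr (- ?\<beta>)) * ennreal (E * (2 ^ (i + 2) * n) ^ DIM('a))"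
      by (intro mult_left_mono count) simp
    also have "\<dots> = ennreal ((2 ^ i * n) powr (- ?\<beta>) * (E * (2 ^ (i + 2) * n) ^ DIM('a)))"
      using E n by (subst ennreal_mult) auto
    also have "(2 ^ i * n) powr (- ?\<beta>) * (E * (2 ^ (i + 2) * n) ^ DIM('a)) = E * 4 ^ DIM('a) * n powr (- a) * (2 powr (- a)) ^ i"
    proof -
      have "2 ^ (i + 2) * n = 4 * (2 ^ i * n)" by simp
      then have "(2 ^ (i + 2) * n) ^ DIM('a) = 4 ^ DIM('a) * (2 ^ i * n) powr real DIM('a)"
        using s by (simp add: power_mult_distrib powr_realpow)
      then have "(2 ^ i * n) powr (- ?\<beta>) * (E * (2 ^ (i + 2) * n) ^ DIM('a)) =
          E * 4 ^ DIM('a) * ((2 ^ i * n) powr (- ?\<beta>) * (2 ^ i * n) powr real DIM('a))" by simp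
      also have "(2 ^ i * n) powr (- ?\<beta>) * (2 ^ i * n) powr real DIM('a) = (2 ^ i * n) powr (- a)"
        by (simp add: powr_add[symmetric])
      also have "\<dots> = (2 ^ i) powr (- a) * n powr (- a)" using n by (simp add: powr_mult)
      also have "(2 ^ i) powr (- a) = (2 powr (- a)) ^ i"
        proof -
          have "(2 powr (- a)) ^ i = (2 powr (- a)) powr real i" by (simp add: powr_realpow)
          also have "\<dots> = (2 powr real i) powr (- a)" by (simp add: powr_powr mult.commute)
          finally show ?thesis by (simp add: powr_realpow)
        qed
      finally show ?thesis by (simp only: mult_ac)
    qed
    finally show "(\<integral>\<^sup>+w. ?T i w \<partial>m) \<le> ennreal (E * 4 ^ DIM('a) * n powr (- a) * (2 powr (- a)) ^ i)" .
  qed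
  also have "\<dots> = ennreal (E * 4 ^ DIM('a) * n powr (- a) * (1 / (1 - 2 powr (- a))))"
  proof (rule suminf_ennreal_eq)
    show "0 \<le> E * 4 ^ DIM('a) * n powr (- a) * (2 powr (- a)) ^ i" for i using E by simp
    have "2 powr (- a) < 2 powr 0" using a by (intro powr_less_mono) auto
    then show "(\<lambda>i. E * 4 ^ DIM('a) * n powr (- a) * (2 powr (- a)) ^ i) sums (E * 4 ^ DIM('a) * n powr (- a) * (1 / (1 - 2 powr (- a))))"
      by (intro sums_mult geometric_sums) auto
  qed
  finally show ?thesis by (simp add: mult_ac)
qed

text \<open>
  A shift by \<open>x\<close> changes the distances of low spots by a bounded amount only, which their exponential
  range absorbs. The almost sure statement at the origin therefore extends to all starting points at once.
  Finiteness at one point, from a low spot, gives finiteness everywhere by comparison.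
\<close>

lemma shifted_environment:
  fixes m :: "'a::euclidean_space measure"
  assumes m: "sets m = sets borel" and a: "0 < a"
    and low: "\<exists>C>0. \<forall>\<^sub>F n::nat in sequentially. \<exists>z. 4 * real n + 2 \<le> norm z \<and> norm z \<le> exp (C * real n ^ DIM('a)) \<and>
      (\<forall>y\<in>cball z (real n). potential (power_shape (real DIM('a) + a)) m y \<le> ennreal (C * real n powr (- a)))"
    and dense: "\<And>k::nat. \<exists>c>0. \<forall>\<^sub>F n::nat in sequentially. \<forall>y. norm y \<le> exp (real k * real n ^ DIM('a)) \<longrightarrow>
      ennreal (c * real n powr (- a)) \<le> potential (power_shape (real DIM('a) + a)) m y"
  shows "\<exists>W. (\<forall>y. potential (power_shape (real DIM('a) + a)) m (x + y) = ennreal (W y)) \<and>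
    comparable (real DIM('a) + a) W \<and> has_low_spots a W \<and> dense_env a W"
proof -
  let ?V = "potential (power_shape (real DIM('a) + a)) m"
  let ?\<beta> = "real DIM('a) + a"
  have \<beta>: "0 < ?\<beta>" using a by simp
  obtain C n0 where C: "0 < C" and n0: "\<And>n. n0 \<le> n \<Longrightarrow> \<exists>z. 4 * real n + 2 \<le> norm z \<and> norm z \<le> exp (C * real n ^ DIM('a)) \<and>
      (\<forall>y\<in>cball z (real n). ?V y \<le> ennreal (C * real n powr (- a)))"
    using low unfolding eventually_sequentially by blast
  obtain z0 where "?V z0 \<le> ennreal (C * real n0 powr (- a))" using n0[OF order_refl] by (metis centre_in_cball of_nat_0_le_iff)
  then have z0: "?V z0 < \<infinity>" by (rule le_less_trans) simp
  have fin: "?V y < \<infinity>" for y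
    by (rule le_less_trans[OF potential_comparable[OF \<beta> m, of y z0]]) (use z0 in \<open>simp add: ennreal_mult_less_top\<close>)
  define W where "W y = enn2real (?V (x + y))" for y
  have VW: "?V (x + y) = ennreal (W y)" for y using fin[of "x + y"] by (simp add: W_def)
  have W0: "0 \<le> W y" for y by (simp add: W_def)
  have big: "2 * real n + r \<le> exp (2 * real n ^ DIM('a)) * r" if "1 \<le> r" for n r
  proof -
    have nn: "real n \<le> real n ^ DIM('a)" by (cases "n = 0") (auto intro: self_le_power)
    have "2 * real n + r \<le> (1 + 2 * real n) * r" using that mult_left_mono[of 1 r "2 * real n"] by (simp add: distrib_right)
    also have "\<dots> \<le> exp (2 * real n) * r" using that exp_ge_add_one_self[of "2 * real n"] by (intro mult_right_mono) auto
    also have "\<dots> \<le> exp (2 * real n ^ DIM('a)) * r" using that nn by (intro mult_right_mono) auto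
    finally show ?thesis .
  qed
  have nx: "\<forall>\<^sub>F n::nat in sequentially. norm x \<le> 2 * real n"
    using eventually_ge_at_top[of "nat \<lceil>norm x\<rceil>"] by eventually_elim linarith
  have "comparable ?\<beta> W"
    unfolding comparable_def
  proof (intro conjI allI W0)
    fix y z
    have "ennreal (W y) \<le> ennreal ((1 + norm (y - z)) powr ?\<beta>) * ennreal (W z)"
      using potential_comparable[OF \<beta> m, of "x + y" "x + z"] by (simp add: VW)
    then show "W y \<le> (1 + norm (y - z)) powr ?\<beta> * W z" using W0 by (simp add: ennreal_mult[symmetric])
  qed
  moreover have "has_low_spots a W"
    unfolding has_low_spots_def
  proof (intro exI[of _ "C + 2"] conjI)
    show "0 < C + 2" using C by simp
    show "\<forall>\<^sub>F n::nat in sequentially. \<exists>z. 2 * real n + 2 \<le> norm z \<and> norm z \<le> exp ((C + 2) * real n ^ DIM('a)) \<and>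
        (\<forall>y\<in>cball z (real n). W y \<le> (C + 2) * real n powr (- a))"
      using nx eventually_ge_at_top[of n0]
    proof eventually_elim
      case (elim n)
      obtain z where z: "4 * real n + 2 \<le> norm z" "norm z \<le> exp (C * real n ^ DIM('a))"
        "\<And>y. y \<in> cball z (real n) \<Longrightarrow> ?V y \<le> ennreal (C * real n powr (- a))" using n0[OF elim(2)] by blast
      show ?case
      proof (intro exI[of _ "z - x"] conjI ballI)
        show "2 * real n + 2 \<le> norm (z - x)" using z(1) elim(1) norm_triangle_ineq2[of z x] by linarith
        have "norm (z - x) \<le> 2 * real n + exp (C * real n ^ DIM('a))" using z(2) elim(1) norm_triangle_ineq4[of z x] by linarith
        also have "\<dots> \<le> exp (2 * real n ^ DIM('a)) * exp (C * real n ^ DIM('a))" using C by (intro big) simp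
        also have "\<dots> = exp ((C + 2) * real n ^ DIM('a))" by (simp add: exp_add[symmetric] algebra_simps)
        finally show "norm (z - x) \<le> exp ((C + 2) * real n ^ DIM('a))" .
        fix y assume "y \<in> cball (z - x) (real n)"
        then have "x + y \<in> cball z (real n)" by (simp add: dist_norm algebra_simps)
        then have "W y \<le> C * real n powr (- a)" using z(3)[of "x + y"] C by (simp add: VW)
        also have "\<dots> \<le> (C + 2) * real n powr (- a)" by (intro mult_right_mono) auto
        finally show "W y \<le> (C + 2) * real n powr (- a)" .
      qed
    qed
  qed
  moreover have "dense_env a W"
    unfolding dense_env_def
  proof (intro allI impI)
    fix \<kappa> :: real assume \<kappa>: "0 < \<kappa>"
    obtain k :: nat where k: "\<kappa> + 2 \<le> real k" using real_arch_simple by blast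
    obtain c where c: "0 < c" "\<forall>\<^sub>F n::nat in sequentially. \<forall>y. norm y \<le> exp (real k * real n ^ DIM('a)) \<longrightarrow> ennreal (c * real n powr (- a)) \<le> ?V y"
      using dense[of k] by blast
    show "\<exists>c>0. \<forall>\<^sub>F n::nat in sequentially. \<forall>y. norm y \<le> exp (\<kappa> * real n ^ DIM('a)) \<longrightarrow> c * real n powr (- a) \<le> W y"
    proof (intro exI[of _ c] conjI c(1), use nx c(2) in eventually_elim, intro allI impI)
      fix n :: nat and y :: 'a
      assume H: "norm x \<le> 2 * real n" "\<forall>y::'a. norm y \<le> exp (real k * real n ^ DIM('a)) \<longrightarrow> ennreal (c * real n powr (- a)) \<le> ?V y"
        and y: "norm y \<le> exp (\<kappa> * real n ^ DIM('a))"
      have "norm (x + y) \<le> 2 * real n + exp (\<kappa> * real n ^ DIM('a))" using H(1) y norm_triangle_ineq[of x y] by linarith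
      also have "\<dots> \<le> exp (2 * real n ^ DIM('a)) * exp (\<kappa> * real n ^ DIM('a))" using \<kappa> by (intro big) simp
      also have "\<dots> = exp ((\<kappa> + 2) * real n ^ DIM('a))" by (simp add: exp_add[symmetric] algebra_simps)
      also have "\<dots> \<le> exp (real k * real n ^ DIM('a))" using k by (simp add: mult_right_mono)
      finally have "ennreal (c * real n powr (- a)) \<le> ?V (x + y)" using H(2) by blast
      then show "c * real n powr (- a) \<le> W y" using W0 by (simp add: VW)
    qed
  qed
  ultimately show ?thesis using VW by blast
qed


section \<open>The Poisson environment\<close>

context poisson_random_measure
begin

text \<open>
  The point probabilities sum to one, so the count is almost surely a natural number.
\<close>

lemma count_sums:
  assumes B: "B \<in> sets borel" "emeasure \<Lambda> B < \<infinity>" and S: "S \<in> sets borel"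
  shows "(\<lambda>k. if of_nat k \<in> S then measure \<Lambda> B ^ k / fact k * exp (- measure \<Lambda> B) else 0) sums
    prob {q \<in> space Q. emeasure (\<mu> q) B \<in> S}"
proof -
  let ?m = "measure \<Lambda> B"
  define A where "A k = {q \<in> space Q. emeasure (\<mu> q) B = of_nat k}" for k
  define T where "T = {q \<in> space Q. emeasure (\<mu> q) B \<in> S}"
  note [measurable] = measurable_count[OF B(1)] S
  have A: "A k \<in> sets Q" for k unfolding A_def by measurable
  have T: "T \<in> sets Q" unfolding T_def by measurable
  have disj: "disjoint_family A" by (auto simp: disjoint_family_on_def A_def)
  have pA: "prob (A k) = ?m ^ k / fact k * exp (- ?m)" for k unfolding A_def by (rule poisson_count[OF B])
  have "(\<lambda>k. ?m ^ k / fact k * exp (- ?m)) sums (exp ?m * exp (- ?m))"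
    using exp_converges[of ?m] by (intro sums_mult2) (simp add: divide_inverse mult.commute)
  moreover have "(\<lambda>k. prob (A k)) sums prob (\<Union>k. A k)" using A disj by (intro finite_measure_UNION) auto
  ultimately have "prob (\<Union>k. A k) = exp ?m * exp (- ?m)" unfolding pA by (rule sums_unique2[rotated])
  then have "prob (\<Union>k. A k) = 1" by (simp add: exp_add[symmetric])
  then have ae: "AE q in Q. q \<in> (\<Union>k. A k)" using A by (subst (asm) prob_eq_1) auto
  have "(\<lambda>k. prob (A k \<inter> T)) sums prob (\<Union>k. A k \<inter> T)"
    using disj A T by (intro finite_measure_UNION) (auto simp: disjoint_family_on_def)
  also have "prob (\<Union>k. A k \<inter> T) = prob T"
    by (rule measure_eq_AE) (use ae A T in auto)
  also have "(\<lambda>k. prob (A k \<inter> T)) = (\<lambda>k. if of_nat k \<in> S then ?m ^ k / fact k * exp (- ?m) else 0)"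
  proof
    fix k
    have "A k \<inter> T = (if of_nat k \<in> S then A k else {})" by (auto simp: A_def T_def)
    then show "prob (A k \<inter> T) = (if of_nat k \<in> S then ?m ^ k / fact k * exp (- ?m) else 0)" by (simp add: pA)
  qed
  finally show ?thesis unfolding T_def .
qed

text \<open>
  The exponential Chebyshev inequality with the generating function of the Poisson law;
  \<open>w < 1\<close> serves lower tails and \<open>w > 1\<close> upper tails.
\<close>

lemma count_chernoff:
  assumes B: "B \<in> sets borel" "emeasure \<Lambda> B < \<infinity>" and S: "S \<in> sets borel"
    and K: "0 \<le> K" "0 \<le> w" and le: "\<And>k. of_nat k \<in> S \<Longrightarrow> 1 \<le> K * w ^ k"
  shows "prob {q \<in> space Q. emeasure (\<mu> q) B \<in> S} \<le> K * exp (measure \<Lambda> B * (w - 1))"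
proof -
  let ?m = "measure \<Lambda> B"
  have "(\<lambda>k. K * ((?m * w) ^ k / fact k * exp (- ?m))) sums (K * (exp (?m * w) * exp (- ?m)))"
    using exp_converges[of "?m * w"] by (intro sums_mult sums_mult2) (simp add: divide_inverse mult.commute)
  moreover have "(if of_nat k \<in> S then ?m ^ k / fact k * exp (- ?m) else 0) \<le> K * ((?m * w) ^ k / fact k * exp (- ?m))" for k
  proof (cases "of_nat k \<in> S")
    case True
    have "1 * (?m ^ k / fact k * exp (- ?m)) \<le> (K * w ^ k) * (?m ^ k / fact k * exp (- ?m))"
      by (rule mult_right_mono[OF le[OF True]]) simp
    then show ?thesis using True by (simp add: power_mult_distrib mult_ac)
  qed (use K in simp)
  ultimately have "prob {q \<in> space Q. emeasure (\<mu> q) B \<in> S} \<le> K * (exp (?m * w) * exp (- ?m))"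
    by (intro sums_le[OF _ count_sums[OF B S]])
  then show ?thesis by (simp add: exp_add[symmetric] algebra_simps)
qed

lemma few_points:
  assumes B: "B \<in> sets borel" "emeasure \<Lambda> B < \<infinity>"
  shows "prob {q \<in> space Q. emeasure (\<mu> q) B < ennreal (measure \<Lambda> B / 4)} \<le> exp (- measure \<Lambda> B / 4)"
proof -
  let ?m = "measure \<Lambda> B"
  have "prob {q \<in> space Q. emeasure (\<mu> q) B \<in> {..<ennreal (?m / 4)}} \<le> 2 powr (?m / 4) * exp (?m * (1 / 2 - 1))"
  proof (rule count_chernoff[OF B])
    fix k assume "of_nat k \<in> {..<ennreal (?m / 4)}"
    then have "real k < ?m / 4" by (simp add: ennreal_of_nat_eq_real_of_nat ennreal_less_iff)
    then have "2 powr 0 \<le> 2 powr (?m / 4 - real k)" by (intro powr_mono) auto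
    also have "\<dots> = 2 powr (?m / 4) * (1 / 2) ^ k" by (simp add: powr_diff powr_realpow power_divide)
    finally show "1 \<le> 2 powr (?m / 4) * (1 / 2) ^ k" by simp
  qed auto
  also have "\<dots> = exp (?m / 4 * ln 2 + ?m * (1 / 2 - 1))" by (simp add: powr_def exp_add[symmetric])
  also have "\<dots> \<le> exp (- ?m / 4)"
    using mult_left_mono[of "ln 2" 1 "?m / 4"] ln_2_less_1 by simp
  finally show ?thesis by simp
qed

lemma many_points:
  assumes B: "B \<in> sets borel" "emeasure \<Lambda> B < \<infinity>" and x: "0 \<le> x"
  shows "prob {q \<in> space Q. ennreal x < emeasure (\<mu> q) B} \<le> exp (measure \<Lambda> B - x / 2)"
proof -
  let ?m = "measure \<Lambda> B"
  have "prob {q \<in> space Q. emeasure (\<mu> q) B \<in> {ennreal x<..}} \<le> 2 powr (- x) * exp (?m * (2 - 1))"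
  proof (rule count_chernoff[OF B])
    fix k assume "of_nat k \<in> {ennreal x<..}"
    then have "x < real k" using x by (simp add: ennreal_of_nat_eq_real_of_nat ennreal_less_iff)
    then have "2 powr 0 \<le> 2 powr (- x + real k)" by (intro powr_mono) auto
    also have "\<dots> = 2 powr (- x) * 2 ^ k" by (subst powr_add) (simp add: powr_realpow)
    finally show "1 \<le> 2 powr (- x) * 2 ^ k" by simp
  qed auto
  also have "\<dots> = exp (?m - x * ln 2)" by (simp add: powr_def exp_add[symmetric] algebra_simps)
  also have "\<dots> \<le> exp (?m - x / 2)"
    using mult_left_mono[of "1 / 2" "ln 2 :: real" x] ln2_ge_two_thirds x by simp
  finally show ?thesis by simp
qed

lemma no_empty_ball:
  assumes B: "\<And>i. i < M \<Longrightarrow> B i \<in> sets borel" "\<And>i. i < M \<Longrightarrow> emeasure \<Lambda> (B i) = ennreal r" "0 \<le> r"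
    and disj: "disjoint_family_on B {..<M}"
  shows "prob {q \<in> space Q. \<forall>i<M. emeasure (\<mu> q) (B i) \<noteq> 0} \<le> exp (- (real M * exp (- r)))"
proof (cases "M = 0")
  case False
  let ?N = "\<lambda>i q. emeasure (\<mu> q) (B i)"
  have ind: "indep_vars (\<lambda>_. borel) ?N {..<M}" by (rule independent_counts[OF B(1) disj])
  have one: "prob (?N i -` (- {0}) \<inter> space Q) \<le> exp (- exp (- r))" if i: "i < M" for i
  proof -
    note [measurable] = measurable_count[OF B(1)[OF i]]
    have "prob {q \<in> space Q. ?N i q = 0} = exp (- r)"
      using poisson_count[OF B(1)[OF i], of 0] B(2)[OF i] B(3) by (simp add: measure_def)
    moreover have "?N i -` (- {0}) \<inter> space Q = space Q - {q \<in> space Q. ?N i q = 0}" by auto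
    moreover have "{q \<in> space Q. ?N i q = 0} \<in> events" by measurable
    ultimately have "prob (?N i -` (- {0}) \<inter> space Q) = 1 - exp (- r)" by (simp add: prob_compl)
    then show ?thesis using exp_ge_add_one_self[of "- exp (- r)"] by simp
  qed
  have "{q \<in> space Q. \<forall>i<M. ?N i q \<noteq> 0} = (\<Inter>i\<in>{..<M}. ?N i -` (- {0}) \<inter> space Q)" using False by auto
  also have "prob \<dots> = (\<Prod>i\<in>{..<M}. prob (?N i -` (- {0}) \<inter> space Q))"
    using False by (intro indep_varsD[OF ind]) auto
  also have "\<dots> \<le> (\<Prod>i\<in>{..<M}. exp (- exp (- r)))" using one by (intro prod_mono) auto
  also have "\<dots> = exp (- (real M * exp (- r)))" by (simp add: exp_of_nat_mult[symmetric])
  finally show ?thesis .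
qed simp

end

locale homogeneous_poisson = poisson_random_measure Q \<mu> "density lborel (\<lambda>_. ennreal \<rho>)"
  for Q :: "'q measure" and \<mu> :: "'q \<Rightarrow> 'a::euclidean_space measure" and \<rho> :: real +
  assumes \<rho>: "0 < \<rho>"
begin

abbreviation "V a q \<equiv> potential (power_shape (real DIM('a) + a)) (\<mu> q)"

definition ball_intensity :: real where "ball_intensity = \<rho> * unit_ball_vol (real DIM('a))"

lemma ball_intensity_pos: "0 < ball_intensity" using \<rho> by (simp add: ball_intensity_def)

lemma emeasure_ball:
  fixes z :: 'a
  assumes "0 \<le> r"
  shows "emeasure (density lborel (\<lambda>_. ennreal \<rho>)) (cball z r) = ennreal (ball_intensity * r ^ DIM('a))"
proof -
  have "emeasure (density lborel (\<lambda>_. ennreal \<rho>)) (cball z r) = ennreal \<rho> * emeasure lborel (cball z r)"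
    by (simp add: emeasure_density nn_integral_cmult_indicator)
  also have "\<dots> = ennreal (ball_intensity * r ^ DIM('a))"
    using assms \<rho> by (simp add: emeasure_cball ball_intensity_def ennreal_mult[symmetric] mult.assoc)
  finally show ?thesis .
qed

lemma measure_ball: "0 \<le> r \<Longrightarrow> measure (density lborel (\<lambda>_. ennreal \<rho>)) (cball (z::'a) r) = ball_intensity * r ^ DIM('a)"
  using emeasure_ball[of r z] ball_intensity_pos by (simp add: measure_def)

lemma power_DIM_ge: "real n \<le> real n ^ DIM('a)"
  by (cases "n = 0") (auto intro: self_le_power)

text \<open>
  A ball of radius \<open>A n\<close> with fewer than a quarter of the expected points has probability at most
  \<open>exp (- c (A n)\<^sup>d)\<close>. For large \<open>A\<close> this beats the exponential number of balls in the cover, and the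
  Borel-Cantelli lemma applies.
\<close>

lemma dense_environment_AE:
  assumes a: "0 < a" and \<kappa>: "0 \<le> \<kappa>"
  shows "\<exists>c>0. AE q in Q. \<forall>\<^sub>F n::nat in sequentially. \<forall>y. norm y \<le> exp (\<kappa> * real n ^ DIM('a)) \<longrightarrow>
    ennreal (c * real n powr (- a)) \<le> V a q y"
proof -
  let ?d = "real DIM('a)"
  let ?I = ball_intensity
  (* Large enough for the probability of a bad ball to beat the d \<kappa> n^d of the cover; the
     remaining 1 makes the probabilities summable. *)
  define A where "A = 4 * (?d * \<kappa> + 1) / ?I + 1"
  have A1: "1 \<le> A" using ball_intensity_pos \<kappa> by (simp add: A_def)
  have IA: "?d * \<kappa> + 1 \<le> ?I * A ^ DIM('a) / 4"
  proof -
    have "4 * (?d * \<kappa> + 1) \<le> ?I * A" using ball_intensity_pos by (simp add: A_def field_simps)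
    also have "\<dots> \<le> ?I * A ^ DIM('a)" using A1 ball_intensity_pos by (intro mult_left_mono self_le_power) auto
    finally show ?thesis by simp
  qed
  have "\<exists>G::'a set. finite G \<and> real (card G) \<le> (5 * exp (\<kappa> * real n ^ DIM('a))) ^ DIM('a) \<and>
      (\<forall>x. norm x \<le> exp (\<kappa> * real n ^ DIM('a)) \<longrightarrow> (\<exists>z\<in>G. norm (x - z) \<le> ?d))" for n
  proof -
    have "1 \<le> exp (\<kappa> * real n ^ DIM('a))" using \<kappa> by simp
    then show ?thesis by (rule lattice_cover) blast
  qed
  then obtain G :: "nat \<Rightarrow> 'a set" where G: "\<And>n. finite (G n)" "\<And>n. real (card (G n)) \<le> (5 * exp (\<kappa> * real n ^ DIM('a))) ^ DIM('a)"
    "\<And>n x. norm x \<le> exp (\<kappa> * real n ^ DIM('a)) \<Longrightarrow> \<exists>z\<in>G n. norm (x - z) \<le> ?d" by metis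
  define bad1 where "bad1 n z = {q \<in> space Q. emeasure (\<mu> q) (cball z (A * real n)) < ennreal (?I * (A * real n) ^ DIM('a) / 4)}" for n z
  define bad where "bad n = (\<Union>z\<in>G n. bad1 n z)" for n
  have m1: "bad1 n z \<in> sets Q" for n z
  proof -
    have [measurable]: "(\<lambda>q. emeasure (\<mu> q) (cball z (A * real n))) \<in> borel_measurable Q" by (rule measurable_count) simp
    show ?thesis unfolding bad1_def by measurable
  qed
  have mb: "bad n \<in> sets Q" for n unfolding bad_def using m1 G by auto
  have p1: "prob (bad1 n z) \<le> exp (- ((?d * \<kappa> + 1) * real n ^ DIM('a)))" for n z
  proof -
    have An: "0 \<le> A * real n" using A1 by simp
    have "prob (bad1 n z) \<le> exp (- (?I * (A * real n) ^ DIM('a)) / 4)"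
      using few_points[of "cball z (A * real n)"] An by (simp add: bad1_def measure_ball emeasure_ball)
    also have "\<dots> = exp (- (?I * A ^ DIM('a) / 4 * real n ^ DIM('a)))" by (simp add: power_mult_distrib)
    also have "\<dots> \<le> exp (- ((?d * \<kappa> + 1) * real n ^ DIM('a)))"
      using mult_right_mono[OF IA, of "real n ^ DIM('a)"] by simp
    finally show ?thesis .
  qed
  have pb: "prob (bad n) \<le> 5 ^ DIM('a) * exp (- 1) ^ n" for n
  proof -
    have "prob (bad n) \<le> (\<Sum>z\<in>G n. prob (bad1 n z))"
      unfolding bad_def using G m1 by (intro finite_measure_subadditive_finite) auto
    also have "\<dots> \<le> real (card (G n)) * exp (- ((?d * \<kappa> + 1) * real n ^ DIM('a)))"
      using sum_mono[of "G n" "\<lambda>z. prob (bad1 n z)" "\<lambda>_. exp (- ((?d * \<kappa> + 1) * real n ^ DIM('a)))"] p1 by simp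
    also have "\<dots> \<le> (5 * exp (\<kappa> * real n ^ DIM('a))) ^ DIM('a) * exp (- ((?d * \<kappa> + 1) * real n ^ DIM('a)))"
      by (intro mult_right_mono G) simp
    also have "\<dots> = 5 ^ DIM('a) * exp (- (real n ^ DIM('a)))"
      by (simp add: power_mult_distrib exp_of_nat_mult[symmetric] mult.assoc exp_add[symmetric] algebra_simps)
    also have "\<dots> \<le> 5 ^ DIM('a) * exp (- real n)" using power_DIM_ge[of n] by simp
    also have "exp (- real n) = exp (- 1) ^ n" by (simp add: exp_of_nat_mult[symmetric])
    finally show ?thesis .
  qed
  have summ: "summable (\<lambda>n. prob (bad n))"
    by (rule summable_comparison_test'[of "\<lambda>n. 5 ^ DIM('a) * exp (- 1) ^ n" 0])
       (use pb in \<open>auto intro!: summable_mult summable_geometric\<close>)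
  have ae: "AE q in Q. \<forall>\<^sub>F n in sequentially. q \<in> space Q - bad n"
    by (rule borel_cantelli_AE1) (use mb summ in \<open>auto simp: emeasure_eq_measure\<close>)
  define c where "c = (2 * A) powr (- (?d + a)) * (?I * A ^ DIM('a) / 4)"
  have c: "0 < c" using A1 ball_intensity_pos by (simp add: c_def)
  have "AE q in Q. \<forall>\<^sub>F n::nat in sequentially. \<forall>y. norm y \<le> exp (\<kappa> * real n ^ DIM('a)) \<longrightarrow>
    ennreal (c * real n powr (- a)) \<le> V a q y"
    using ae
  proof eventually_elim
    case (elim q)
    show ?case using elim eventually_ge_at_top[of "DIM('a)"]
    proof eventually_elim
      case (elim n)
      have n: "?d \<le> real n" "1 \<le> real n" using elim(2) DIM_positive[where 'a='a] by linarith+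
      show ?case
      proof (intro allI impI)
        fix y :: 'a assume "norm y \<le> exp (\<kappa> * real n ^ DIM('a))"
        then obtain z where z: "z \<in> G n" "norm (y - z) \<le> ?d" using G(3) by blast
        let ?B = "cball z (A * real n)"
        have An: "1 * real n \<le> A * real n" using A1 by (intro mult_right_mono) auto
        have dn: "?d \<le> A * real n" "1 \<le> 2 * (A * real n)" using n An by linarith+
        have cnt: "ennreal (?I * (A * real n) ^ DIM('a) / 4) \<le> emeasure (\<mu> q) ?B"
          using elim(1) z(1) by (auto simp: bad_def bad1_def not_less)
        have B: "?B \<in> sets (\<mu> q)" using sets_\<mu> elim(1) by auto
        have "ennreal (c * real n powr (- a)) = ennreal ((2 * (A * real n)) powr (- (?d + a))) * ennreal (?I * (A * real n) ^ DIM('a) / 4)"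
        proof -
          have "(2 * (A * real n)) powr (- (?d + a)) * (?I * (A * real n) ^ DIM('a) / 4) =
              (2 * A) powr (- (?d + a)) * (?I * A ^ DIM('a) / 4) * (real n powr (- (?d + a)) * real n powr ?d)"
            using n A1 by (simp add: powr_mult power_mult_distrib powr_realpow mult_ac)
          also have "real n powr (- (?d + a)) * real n powr ?d = real n powr (- a)" by (simp add: powr_add[symmetric])
          finally have "c * real n powr (- a) = (2 * (A * real n)) powr (- (?d + a)) * (?I * (A * real n) ^ DIM('a) / 4)"
            by (simp only: c_def)
          then show ?thesis using ball_intensity_pos A1 by (simp only:) (intro ennreal_mult, auto)
        qed
        also have "\<dots> \<le> ennreal ((2 * (A * real n)) powr (- (?d + a))) * emeasure (\<mu> q) ?B"
          by (intro mult_left_mono cnt) simp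
        also have "\<dots> = (\<integral>\<^sup>+w. ennreal ((2 * (A * real n)) powr (- (?d + a))) * indicator ?B w \<partial>\<mu> q)"
          by (rule nn_integral_cmult_indicator[OF B, symmetric])
        also have "\<dots> \<le> V a q y"
          unfolding potential_def
        proof (intro nn_integral_mono)
          fix w
          show "ennreal ((2 * (A * real n)) powr (- (?d + a))) * indicator ?B w \<le> ennreal (power_shape (?d + a) (y - w))"
          proof (cases "w \<in> ?B")
            case True
            have "norm (y - w) \<le> norm (y - z) + norm (z - w)" using norm_triangle_ineq[of "y - z" "z - w"] by simp
            also have "\<dots> \<le> 2 * (A * real n)" using True z(2) dn by (simp add: dist_norm)
            finally have "(2 * (A * real n)) powr (- (?d + a)) \<le> power_shape (?d + a) (y - w)"
              using a dn by (intro power_shape_ge) auto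
            then show ?thesis using True by (simp add: ennreal_leI)
          qed simp
        qed
        finally show "ennreal (c * real n powr (- a)) \<le> V a q y" .
      qed
    qed
  qed
  then show ?thesis using c by blast
qed

end


context homogeneous_poisson
begin

text \<open>
  A ball of radius \<open>2 n\<close> is empty with probability \<open>exp (- J n\<^sup>d)\<close>. Among \<open>exp (2 J n\<^sup>d)\<close> disjoint,
  hence independent, candidates one is empty, up to a summable exceptional probability. No candidate has
  a surplus of points in a dyadic ball around it, since such a surplus has probability at most \<open>exp (- D n\<^sup>d)\<close>
  with \<open>D > 2 J\<close>. An empty candidate is then a low spot.
\<close>

lemma low_spots_AE:
  assumes a: "0 < a"
  shows "\<exists>C>0. AE q in Q. \<forall>\<^sub>F n::nat in sequentially. \<exists>z. 4 * real n + 2 \<le> norm z \<and> norm z \<le> exp (C * real n ^ DIM('a)) \<and>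
    (\<forall>y\<in>cball z (real n). V a q y \<le> ennreal (C * real n powr (- a)))"
proof -
  let ?I = ball_intensity
  define J where "J = ?I * 2 ^ DIM('a)"
  define D where "D = 2 * J + 1"
  define E where "E = 2 * (?I + D)"
  have J: "0 < J" using ball_intensity_pos by (simp add: J_def)
  have D: "1 \<le> D" using J by (simp add: D_def)
  have E: "0 < E" using D ball_intensity_pos by (simp add: E_def)
  define M where "M n = nat \<lceil>exp (2 * J * real n ^ DIM('a))\<rceil>" for n
  have M: "exp (2 * J * real n ^ DIM('a)) \<le> real (M n)" "real (M n) \<le> 2 * exp (2 * J * real n ^ DIM('a))" for n
  proof -
    show "exp (2 * J * real n ^ DIM('a)) \<le> real (M n)" unfolding M_def by linarith
    have "1 \<le> exp (2 * J * real n ^ DIM('a))" using J by simp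
    then show "real (M n) \<le> 2 * exp (2 * J * real n ^ DIM('a))" unfolding M_def by linarith
  qed
  (* The candidates lie on a ray, at spacing 4 n + 2, so that balls of radius 2 n are disjoint. *)
  obtain e :: 'a where e: "e \<in> Basis" using nonempty_Basis by blast
  define zz where "zz n k = ((4 * real n + 2) * (real k + 1)) *\<^sub>R e" for n k :: nat
  have nz: "norm (zz n k) = (4 * real n + 2) * (real k + 1)" for n k using e by (simp add: zz_def abs_mult)
  have disj: "disjoint_family_on (\<lambda>k. cball (zz n k) (2 * real n)) {..<M n}" for n
  proof -
    have "cball (zz n k) (2 * real n) \<inter> cball (zz n l) (2 * real n) = {}" if "k \<noteq> l" for k l
    proof (rule ccontr)
      assume "cball (zz n k) (2 * real n) \<inter> cball (zz n l) (2 * real n) \<noteq> {}"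
      then obtain y where "dist (zz n k) y \<le> 2 * real n" "dist (zz n l) y \<le> 2 * real n" by auto
      then have le: "dist (zz n k) (zz n l) \<le> 4 * real n" using dist_triangle2[of "zz n k" "zz n l" y] by simp
      have "dist (zz n k) (zz n l) = \<bar>(4 * real n + 2) * (real k + 1) - (4 * real n + 2) * (real l + 1)\<bar>"
        using e by (simp add: dist_norm zz_def scaleR_diff_left[symmetric])
      also have "\<dots> = (4 * real n + 2) * \<bar>real k - real l\<bar>"
        by (simp add: right_diff_distrib[symmetric] abs_mult)
      also have "\<dots> \<ge> (4 * real n + 2) * 1"
        using that by (intro mult_left_mono) auto
      finally show False using le by simp
    qed
    then show ?thesis by (simp add: disjoint_family_on_def)
  qed
  have cnt [measurable]: "(\<lambda>q. emeasure (\<mu> q) (cball z r)) \<in> borel_measurable Q" for z r by (rule measurable_count) simp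
  define bad1 where "bad1 n = {q \<in> space Q. \<forall>k<M n. emeasure (\<mu> q) (cball (zz n k) (2 * real n)) \<noteq> 0}" for n
  have m1: "bad1 n \<in> sets Q" for n unfolding bad1_def by measurable
  have p1: "prob (bad1 n) \<le> exp (- J) ^ n" for n
  proof -
    have em: "emeasure (density lborel (\<lambda>_. ennreal \<rho>)) (cball z (2 * real n)) = ennreal (J * real n ^ DIM('a))" for z :: 'a
      by (simp add: emeasure_ball J_def power_mult_distrib mult.assoc)
    have "0 \<le> J * real n ^ DIM('a)" using J by simp
    then have "prob (bad1 n) \<le> exp (- (real (M n) * exp (- (J * real n ^ DIM('a)))))"
      unfolding bad1_def by (intro no_empty_ball disj em) auto
    also have "\<dots> \<le> exp (- (J * real n))"
    proof -
      have "J * real n \<le> J * real n ^ DIM('a)" using J power_DIM_ge[of n] by (intro mult_left_mono) auto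
      also have "\<dots> \<le> exp (J * real n ^ DIM('a))" using exp_ge_add_one_self[of "J * real n ^ DIM('a)"] by linarith
      also have "\<dots> = exp (2 * J * real n ^ DIM('a)) * exp (- (J * real n ^ DIM('a)))" by (simp add: exp_add[symmetric])
      also have "\<dots> \<le> real (M n) * exp (- (J * real n ^ DIM('a)))" by (intro mult_right_mono M) simp
      finally show ?thesis by simp
    qed
    also have "\<dots> = exp (- J) ^ n" by (simp add: exp_of_nat_mult[symmetric] mult.commute)
    finally show ?thesis .
  qed
  define crowded where "crowded n k i = {q \<in> space Q. ennreal (E * (2 ^ (i + 2) * real n) ^ DIM('a)) < emeasure (\<mu> q) (cball (zz n k) (2 ^ (i + 2) * real n))}"
    for n k i :: nat
  define bad2 where "bad2 n = (\<Union>k\<in>{..<M n}. \<Union>i. crowded n k i)" for n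
  have md: "crowded n k i \<in> sets Q" for n k i unfolding crowded_def by (rule borel_measurable_less[OF borel_measurable_const cnt])
  have mk: "(\<Union>i. crowded n k i) \<in> sets Q" for n k using md by auto
  have m2: "bad2 n \<in> sets Q" for n unfolding bad2_def using mk by auto
  have pd: "prob (crowded n k i) \<le> exp (- (D * real n ^ DIM('a))) * exp (- 1) ^ i" if n: "1 \<le> n" for n k i
  proof -
    let ?R = "2 ^ (i + 2) * real n"
    have R: "0 \<le> ?R" by simp
    have "prob (crowded n k i) \<le> exp (?I * ?R ^ DIM('a) - E * ?R ^ DIM('a) / 2)"
      using many_points[of "cball (zz n k) ?R" "E * ?R ^ DIM('a)"] R E
      unfolding crowded_def by (simp add: measure_ball emeasure_ball)
    also have "?I * ?R ^ DIM('a) - E * ?R ^ DIM('a) / 2 = - (D * ?R ^ DIM('a))"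
      by (simp add: E_def algebra_simps)
    also have "exp (- (D * ?R ^ DIM('a))) \<le> exp (- (D * real n ^ DIM('a) + real i))"
    proof -
      have N: "1 \<le> real n ^ DIM('a)" using n by simp
      have "real (i + 1) \<le> 2 ^ (i + 2)"
      proof -
        have "i + 1 \<le> 2 ^ (i + 2)" using less_exp[of "i + 2"] by linarith
        then show ?thesis by (metis of_nat_le_iff of_nat_numeral of_nat_power)
      qed
      also have "\<dots> \<le> ((2::real) ^ (i + 2)) ^ DIM('a)" by (rule self_le_power[OF one_le_power]) auto
      finally have "real (i + 1) * real n ^ DIM('a) \<le> ?R ^ DIM('a)"
        unfolding power_mult_distrib by (rule mult_right_mono) simp
      then have "D * (real (i + 1) * real n ^ DIM('a)) \<le> D * ?R ^ DIM('a)" using D by (intro mult_left_mono) auto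
      moreover have "1 * (real i * 1) \<le> D * (real i * real n ^ DIM('a))" using D N by (intro mult_mono) auto
      ultimately show ?thesis by (simp add: algebra_simps)
    qed
    also have "\<dots> = exp (- (D * real n ^ DIM('a))) * exp (- 1) ^ i"
      by (simp add: exp_of_nat_mult[symmetric] exp_add[symmetric])
    finally show ?thesis .
  qed
  define s where "s = 1 / (1 - exp (- 1 :: real))"
  have p2: "prob (bad2 n) \<le> 2 * s * exp (- 1) ^ n" if n: "1 \<le> n" for n
  proof -
    have geo: "(\<lambda>i. exp (- (D * real n ^ DIM('a))) * exp (- 1) ^ i) sums (exp (- (D * real n ^ DIM('a))) * s)"
      unfolding s_def by (intro sums_mult geometric_sums) simp
    have pk: "prob (\<Union>i. crowded n k i) \<le> exp (- (D * real n ^ DIM('a))) * s" for k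
    proof -
      have summ: "summable (\<lambda>i. prob (crowded n k i))"
        by (rule summable_comparison_test'[OF sums_summable[OF geo], of 0]) (use pd[OF n] in auto)
      have "prob (\<Union>i. crowded n k i) \<le> (\<Sum>i. prob (crowded n k i))"
        using md by (intro finite_measure_subadditive_countably summ) auto
      also have "\<dots> \<le> exp (- (D * real n ^ DIM('a))) * s"
        by (rule sums_le[OF pd[OF n] summable_sums[OF summ] geo])
      finally show ?thesis .
    qed
    have "exp (- 1) \<le> (1::real)" by simp
    then have s0: "0 \<le> s" unfolding s_def by (intro divide_nonneg_nonneg) linarith+
    have "prob (bad2 n) \<le> (\<Sum>k\<in>{..<M n}. prob (\<Union>i. crowded n k i))"
      unfolding bad2_def using mk by (intro finite_measure_subadditive_finite) auto
    also have "\<dots> \<le> real (M n) * (exp (- (D * real n ^ DIM('a))) * s)"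
      using sum_mono[of "{..<M n}" "\<lambda>k. prob (\<Union>i. crowded n k i)" "\<lambda>_. exp (- (D * real n ^ DIM('a))) * s"] pk by simp
    also have "\<dots> \<le> (2 * exp (2 * J * real n ^ DIM('a))) * (exp (- (D * real n ^ DIM('a))) * s)"
      using s0 by (intro mult_right_mono M) auto
    also have "\<dots> = 2 * s * (exp (2 * J * real n ^ DIM('a)) * exp (- (D * real n ^ DIM('a))))" by (simp only: mult_ac)
    also have "exp (2 * J * real n ^ DIM('a)) * exp (- (D * real n ^ DIM('a))) = exp (- (real n ^ DIM('a)))"
      by (simp add: D_def exp_add[symmetric] algebra_simps)
    also have "2 * s * \<dots> \<le> 2 * s * exp (- real n)" using s0 power_DIM_ge[of n] by (intro mult_left_mono) auto
    also have "exp (- real n) = exp (- 1) ^ n" by (simp add: exp_of_nat_mult[symmetric])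
    finally show ?thesis .
  qed
  have "summable (\<lambda>n. prob (bad1 n))"
    by (rule summable_comparison_test'[of "\<lambda>n. exp (- J) ^ n" 0]) (use p1 J in \<open>auto intro!: summable_geometric\<close>)
  then have ae1: "AE q in Q. \<forall>\<^sub>F n in sequentially. q \<in> space Q - bad1 n"
    by (intro borel_cantelli_AE1 m1) (auto simp: emeasure_eq_measure)
  have "summable (\<lambda>n. prob (bad2 n))"
    by (rule summable_comparison_test'[of "\<lambda>n. 2 * s * exp (- 1) ^ n" 1]) (use p2 in \<open>auto intro!: summable_mult summable_geometric\<close>)
  then have ae2: "AE q in Q. \<forall>\<^sub>F n in sequentially. q \<in> space Q - bad2 n"
    by (intro borel_cantelli_AE1 m2) (auto simp: emeasure_eq_measure)
  define F where "F = E * 4 ^ DIM('a) / (1 - 2 powr (- a))"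
  define C where "C = max (12 + 2 * J) F"
  have C: "0 < C" "12 + 2 * J \<le> C" "F \<le> C" using J by (auto simp: C_def)
  have "AE q in Q. \<forall>\<^sub>F n::nat in sequentially. \<exists>z. 4 * real n + 2 \<le> norm z \<and> norm z \<le> exp (C * real n ^ DIM('a)) \<and>
    (\<forall>y\<in>cball z (real n). V a q y \<le> ennreal (C * real n powr (- a)))"
    using ae1 ae2
  proof eventually_elim
    case (elim q)
    show ?case using elim eventually_ge_at_top[of 1]
    proof eventually_elim
      case (elim n)
      have n: "1 \<le> real n" using elim by simp
      obtain k where k: "k < M n" "emeasure (\<mu> q) (cball (zz n k) (2 * real n)) = 0" using elim(1) by (auto simp: bad1_def)
      have few: "emeasure (\<mu> q) (cball (zz n k) (2 ^ (i + 2) * real n)) \<le> ennreal (E * (2 ^ (i + 2) * real n) ^ DIM('a))" for i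
        using elim(2) k(1) by (auto simp: bad2_def crowded_def not_less)
      show ?case
      proof (intro exI[of _ "zz n k"] conjI ballI)
        have "(4 * real n + 2) * 1 \<le> (4 * real n + 2) * (real k + 1)" by (intro mult_left_mono) auto
        then show "4 * real n + 2 \<le> norm (zz n k)" by (simp add: nz)
        have "norm (zz n k) \<le> (4 * real n + 2) * real (M n)" unfolding nz using k(1) by (intro mult_left_mono) auto
        also have "\<dots> \<le> (4 * real n + 2) * (2 * exp (2 * J * real n ^ DIM('a)))" by (intro mult_left_mono M) simp
        also have "\<dots> = (8 * real n + 4) * exp (2 * J * real n ^ DIM('a))" by (simp add: algebra_simps)
        also have "\<dots> \<le> exp (12 * real n ^ DIM('a)) * exp (2 * J * real n ^ DIM('a))"
        proof (intro mult_right_mono)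
          have "8 * real n + 4 \<le> 12 * real n" using n by simp
          also have "\<dots> \<le> exp (12 * real n)" using exp_ge_add_one_self[of "12 * real n"] by linarith
          also have "\<dots> \<le> exp (12 * real n ^ DIM('a))" using power_DIM_ge[of n] by simp
          finally show "8 * real n + 4 \<le> exp (12 * real n ^ DIM('a))" .
        qed simp
        also have "\<dots> = exp ((12 + 2 * J) * real n ^ DIM('a))" by (simp add: exp_add[symmetric] algebra_simps)
        also have "\<dots> \<le> exp (C * real n ^ DIM('a))" using C(2) by (simp add: mult_right_mono)
        finally show "norm (zz n k) \<le> exp (C * real n ^ DIM('a))" .
        fix y assume y: "y \<in> cball (zz n k) (real n)"
        have sets: "sets (\<mu> q) = sets borel" using sets_\<mu> elim(1) by auto
        have "V a q y \<le> ennreal (F * real n powr (- a))"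
          unfolding F_def using potential_far_from_points[OF sets a n _ k(2) few y] E by simp
        also have "\<dots> \<le> ennreal (C * real n powr (- a))" using C(3) by (intro ennreal_leI mult_right_mono) auto
        finally show "V a q y \<le> ennreal (C * real n powr (- a))" .
      qed
    qed
  qed
  then show ?thesis using C(1) by blast
qed

lemma environment_AE:
  assumes a: "0 < a"
  shows "AE q in Q. \<forall>x. \<exists>W. (\<forall>y. V a q (x + y) = ennreal (W y)) \<and>
    comparable (real DIM('a) + a) W \<and> has_low_spots a W \<and> dense_env a W"
proof -
  obtain C where C: "0 < C" "AE q in Q. \<forall>\<^sub>F n::nat in sequentially. \<exists>z. 4 * real n + 2 \<le> norm z \<and> norm z \<le> exp (C * real n ^ DIM('a)) \<and>
    (\<forall>y\<in>cball z (real n). V a q y \<le> ennreal (C * real n powr (- a)))" using low_spots_AE[OF a] by blast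
  have "\<forall>k::nat. \<exists>c. 0 < c \<and> (AE q in Q. \<forall>\<^sub>F n::nat in sequentially. \<forall>y. norm y \<le> exp (real k * real n ^ DIM('a)) \<longrightarrow>
    ennreal (c * real n powr (- a)) \<le> V a q y)"
    by (rule allI, rule dense_environment_AE[OF a]) simp
  from choice[OF this] obtain c where c': "\<forall>k::nat. 0 < c k \<and> (AE q in Q. \<forall>\<^sub>F n::nat in sequentially. \<forall>y. norm y \<le> exp (real k * real n ^ DIM('a)) \<longrightarrow>
    ennreal (c k * real n powr (- a)) \<le> V a q y)" ..
  note c = c'[rule_format, THEN conjunct1] c'[rule_format, THEN conjunct2]
  have "AE q in Q. \<forall>k::nat. \<forall>\<^sub>F n::nat in sequentially. \<forall>y. norm y \<le> exp (real k * real n ^ DIM('a)) \<longrightarrow>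
    ennreal (c k * real n powr (- a)) \<le> V a q y" by (rule AE_all_countable[THEN iffD2], rule allI, rule c(2))
  with C(2) AE_space show ?thesis
  proof eventually_elim
    case (elim q)
    have low: "\<exists>C>0. \<forall>\<^sub>F n::nat in sequentially. \<exists>z. 4 * real n + 2 \<le> norm z \<and> norm z \<le> exp (C * real n ^ DIM('a)) \<and>
        (\<forall>y\<in>cball z (real n). V a q y \<le> ennreal (C * real n powr (- a)))"
      by (rule exI[of _ C], rule conjI[OF C(1) elim(1)])
    have dense: "\<exists>c>0. \<forall>\<^sub>F n::nat in sequentially. \<forall>y. norm y \<le> exp (real k * real n ^ DIM('a)) \<longrightarrow>
        ennreal (c * real n powr (- a)) \<le> V a q y" for k :: nat
      by (rule exI[of _ "c k"], rule conjI[OF c(1) elim(3)[rule_format]])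
    show ?case by (intro allI shifted_environment[OF sets_\<mu>[OF elim(2)] a low dense])
  qed
qed

end


section \<open>The two classes of processes\<close>

lemma levy_settingI:
  fixes X :: "real \<Rightarrow> 'w \<Rightarrow> 'a::euclidean_space"
  assumes X: "levy_process M X" "has_char_exponent M X \<psi>" and \<nu>: "symmetric_levy_measure \<nu>"
    and eq: "\<And>\<xi>. \<psi> \<xi> = levy_exponent_on \<nu> UNIV \<xi>"
    and le: "\<And>\<xi>. \<psi> \<xi> \<le> c\<^sub>1 * norm \<xi> powr a" and c: "0 < c\<^sub>1" "0 < a" "a \<le> 2"
  shows "levy_setting M X \<nu> c\<^sub>1 a"
proof -
  interpret levy_process M X by (rule X(1))
  show ?thesis
  proof (intro levy_setting.intro X(1) levy_laws.intro \<nu> levy_laws_axioms.intro c)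
    fix h :: real and \<xi> :: 'a
    show "levy_exponent_on \<nu> UNIV \<xi> \<le> c\<^sub>1 * norm \<xi> powr a" using le[of \<xi>] by (simp add: eq)
    assume h: "0 < h"
    then have m: "X h \<in> borel_measurable M" by (intro measurable_X) simp
    show "prob_space (distr M borel (X h))" by (rule prob_space_distr[OF m])
    show "sets (distr M borel (X h)) = sets borel" by simp
    have "char_fun (distr M borel (X h)) \<xi> = (CLINT w|M. iexp (\<xi> \<bullet> X h w))"
      unfolding char_fun_def by (rule integral_distr[OF m]) measurable
    also have "\<dots> = complex_of_real (exp (- h * levy_exponent_on \<nu> UNIV \<xi>))"
      using X(2) h by (simp add: has_char_exponent_def eq)
    finally show "char_fun (distr M borel (X h)) \<xi> = complex_of_real (exp (- h * levy_exponent_on \<nu> UNIV \<xi>))" .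
  qed
qed

text \<open>
  The locale refers to the process through its exponent only, and the Gaussian mixture with the right factor \<open>\<kappa>\<close> has the exponent of the given process.
\<close>

lemma stable_setting:
  fixes X :: "real \<Rightarrow> 'w \<Rightarrow> 'a::euclidean_space"
  assumes \<alpha>: "0 < \<alpha>" "\<alpha> < 2" and X: "rotationally_symmetric_stable M X \<alpha>"
  obtains c \<kappa> where "0 < \<kappa>" "levy_setting M X (stable_measure \<alpha> \<kappa> :: 'a measure) c \<alpha>"
proof -
  obtain c where c: "0 < c" "has_char_exponent M X (\<lambda>\<xi>. c * norm \<xi> powr \<alpha>)" and lp: "levy_process M X"
    using X by (auto simp: rotationally_symmetric_stable_def)
  define K where "K = enn2real (subordinator_const \<alpha>)"
  have K: "subordinator_const \<alpha> = ennreal K" "0 < K"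
    using subordinator_const[OF \<alpha>] by (auto simp: K_def enn2real_positive_iff)
  define \<kappa> where "\<kappa> = c / K"
  have \<kappa>: "0 < \<kappa>" using c K by (simp add: \<kappa>_def)
  let ?\<nu> = "stable_measure \<alpha> \<kappa> :: 'a measure"
  have \<nu>: "symmetric_levy_measure ?\<nu>" using \<alpha> \<kappa> by (intro symmetric_levy_stable_measure) auto
  interpret \<nu>: symmetric_levy_measure ?\<nu> by (rule \<nu>)
  have eq: "c * norm \<xi> powr \<alpha> = levy_exponent_on ?\<nu> UNIV \<xi>" for \<xi> :: 'a
  proof -
    have "levy_exponent_on ?\<nu> UNIV \<xi> = (\<integral>z. 1 - cos (\<xi> \<bullet> z) \<partial>?\<nu>)" by (simp add: levy_exponent_on_def)
    also have "\<dots> = enn2real (\<integral>\<^sup>+z. ennreal (1 - cos (\<xi> \<bullet> z)) \<partial>?\<nu>)"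
      by (rule integral_eq_nn_integral) auto
    also have "\<dots> = enn2real (ennreal (\<kappa> * norm \<xi> powr \<alpha> * K))"
      using \<alpha> \<kappa> K by (subst stable_measure_exponent) (auto simp: ennreal_mult[symmetric])
    also have "\<dots> = c * norm \<xi> powr \<alpha>" using \<kappa> K c(1) by (simp add: \<kappa>_def)
    finally show ?thesis by simp
  qed
  have "levy_setting M X ?\<nu> c \<alpha>" using \<alpha> c by (intro levy_settingI[OF lp c(2) \<nu> eq]) auto
  then show thesis using that \<kappa> by blast
qed

text \<open>
  Seen from the origin, Lebesgue measure outside the ball of radius \<open>2\<close> is a configuration with a hole,
  so the shell estimate for potentials gives the integrability of \<open>|w|\<^bsup>-d-1\<^esup>\<close> at infinity.
\<close>

lemma power_shape_integrable: "(\<integral>\<^sup>+w. ennreal (power_shape (real DIM('a) + 1) (w::'a::euclidean_space)) \<partial>lborel) < \<infinity>"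
proof -
  let ?\<beta> = "real DIM('a) + 1"
  define v where "v = unit_ball_vol (real DIM('a))"
  have v: "0 \<le> v" by (simp add: v_def)
  define m where "m = density lborel (indicator (- cball (0::'a) 2))"
  have [measurable]: "- cball (0::'a) 2 \<in> sets borel" by simp
  have \<beta>: "0 < ?\<beta>" by simp
  note [measurable] = measurable_power_shape[OF \<beta>, where 'a = 'a]
  have em: "emeasure m A = emeasure lborel (A - cball 0 2)" if "A \<in> sets borel" for A
  proof -
    have "emeasure m A = (\<integral>\<^sup>+w. indicator (- cball (0::'a) 2) w * indicator A w \<partial>lborel)"
      unfolding m_def using that by (subst emeasure_density) auto
    also have "\<dots> = (\<integral>\<^sup>+w. indicator (A - cball 0 2) w \<partial>lborel)"
      by (intro nn_integral_cong) (simp split: split_indicator)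
    also have "\<dots> = emeasure lborel (A - cball 0 2)" using that by (intro nn_integral_indicator) auto
    finally show ?thesis .
  qed
  have "potential (power_shape ?\<beta>) m 0 \<le> ennreal (v * 4 ^ DIM('a) / (1 - 2 powr (- 1)) * 1 powr (- 1))"
  proof (rule potential_far_from_points[where z = 0])
    show "sets m = sets borel" by (simp add: m_def)
    show "emeasure m (cball 0 (2 * 1)) = 0" by (simp add: em)
    show "emeasure m (cball 0 (2 ^ (i + 2) * 1)) \<le> ennreal (v * (2 ^ (i + 2) * 1) ^ DIM('a))" for i
    proof -
      have "emeasure m (cball 0 (2 ^ (i + 2) * 1)) \<le> emeasure lborel (cball (0::'a) (2 ^ (i + 2) * 1))"
        by (subst em) (auto intro: emeasure_mono)
      also have "\<dots> = ennreal (v * (2 ^ (i + 2) * 1) ^ DIM('a))" by (subst emeasure_cball) (auto simp: v_def)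
      finally show ?thesis .
    qed
  qed (use v in auto)
  then have far: "potential (power_shape ?\<beta>) m (0::'a) < \<infinity>" by (rule le_less_trans) simp
  have "(\<integral>\<^sup>+w. ennreal (power_shape ?\<beta> (w::'a)) \<partial>lborel) \<le>
      (\<integral>\<^sup>+w. indicator (- cball (0::'a) 2) w * ennreal (power_shape ?\<beta> (0 - w)) + indicator (cball (0::'a) 2) w \<partial>lborel)"
  proof (intro nn_integral_mono)
    fix w :: 'a
    have s: "power_shape ?\<beta> (0 - w) = power_shape ?\<beta> w" "power_shape ?\<beta> w \<le> 1" by (auto simp: power_shape_def)
    then show "ennreal (power_shape ?\<beta> w) \<le> indicator (- cball (0::'a) 2) w * ennreal (power_shape ?\<beta> (0 - w)) + indicator (cball (0::'a) 2) w"
      by (cases "w \<in> cball 0 2") auto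
  qed
  also have "\<dots> = (\<integral>\<^sup>+w. indicator (- cball (0::'a) 2) w * ennreal (power_shape ?\<beta> (0 - w)) \<partial>lborel) + emeasure lborel (cball (0::'a) 2)"
  proof -
    have [measurable]: "cball (0::'a) 2 \<in> sets borel" by simp
    have "(\<integral>\<^sup>+w. indicator (- cball (0::'a) 2) w * ennreal (power_shape ?\<beta> (0 - w)) + indicator (cball (0::'a) 2) w \<partial>lborel) =
        (\<integral>\<^sup>+w. indicator (- cball (0::'a) 2) w * ennreal (power_shape ?\<beta> (0 - w)) \<partial>lborel) + (\<integral>\<^sup>+w. indicator (cball (0::'a) 2) w \<partial>lborel)"
      by (rule nn_integral_add) measurable
    then show ?thesis by simp
  qed
  also have "(\<integral>\<^sup>+w. indicator (- cball (0::'a) 2) w * ennreal (power_shape ?\<beta> (0 - w)) \<partial>lborel) = potential (power_shape ?\<beta>) m 0"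
    unfolding potential_def m_def by (subst nn_integral_density) auto
  also have "\<dots> + emeasure lborel (cball (0::'a) 2) < \<infinity>" using far by (simp add: emeasure_cball)
  finally show ?thesis .
qed

text \<open>
  Exponential moments of a power of the jump size, for all rates \<open>K\<close> at once: with \<open>p \<le> \<theta>/2\<close> the
  exponent \<open>K r\<^sup>p - c r\<^sup>\<theta>\<close> is bounded after completing the square in \<open>r\<^bsup>\<theta>/2\<^esup>\<close>.
\<close>

lemma jump_profile_tail:
  fixes z :: "'a::euclidean_space"
  assumes \<theta>: "0 < \<theta>" and c: "0 < c"
  obtains p where "0 < p" "p \<le> 1" "\<And>K. 0 \<le> K \<Longrightarrow> \<exists>C\<ge>0. \<forall>z::'a. 1 < norm z \<longrightarrow>
    jump_profile \<alpha> \<theta> c z * exp (K * norm z powr p) \<le> C * power_shape (real DIM('a) + 1) z"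
proof (cases \<theta>)
  case (real t)
  then have t: "0 < t" using \<theta> by simp
  define p where "p = min 1 (t / 2)"
  have p: "0 < p" "p \<le> 1" "p \<le> t / 2" using t by (auto simp: p_def)
  let ?d = "real DIM('a) + 1"
  show thesis
  proof (rule that[OF p(1,2)])
    fix K :: real assume K: "0 \<le> K"
    define L where "L = K + ?d / p"
    have L: "0 \<le> L" using K p by (simp add: L_def)
    have "jump_profile \<alpha> \<theta> c z * exp (K * norm z powr p) \<le> exp (L\<^sup>2 / (4 * c)) * power_shape ?d z" if z: "1 < norm z" for z :: 'a
    proof -
      let ?r = "norm z" and ?s = "norm z powr (t / 2)"
      have "ln ?r \<le> ?r powr p / p" using z p by (intro ln_powr_bound) auto
      then have "?d * ln ?r \<le> ?d * (?r powr p / p)" by (intro mult_left_mono) auto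
      then have "K * ?r powr p + ?d * ln ?r \<le> L * ?r powr p" by (simp add: L_def algebra_simps)
      also have "\<dots> \<le> L * ?s" using L z p by (intro mult_left_mono powr_mono) auto
      finally have 1: "K * ?r powr p + ?d * ln ?r \<le> L * ?s" .
      have "?r powr t = ?s\<^sup>2" by (simp add: power2_eq_square powr_add[symmetric])
      moreover have "L * ?s - c * ?s\<^sup>2 \<le> L\<^sup>2 / (4 * c)"
      proof -
        have "0 \<le> (2 * c * ?s - L)\<^sup>2" by simp
        then have "4 * c * (L * ?s - c * ?s\<^sup>2) \<le> L\<^sup>2" by (simp add: power2_eq_square algebra_simps)
        then show ?thesis using c by (simp add: field_simps)
      qed
      ultimately have "- c * ?r powr t + K * ?r powr p \<le> L\<^sup>2 / (4 * c) - ?d * ln ?r" using 1 by simp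
      then have "exp (- c * ?r powr t + K * ?r powr p) \<le> exp (L\<^sup>2 / (4 * c) - ?d * ln ?r)" by (simp only: exp_le_cancel_iff)
      moreover have "exp (- c * ?r powr t + K * ?r powr p) = jump_profile \<alpha> \<theta> c z * exp (K * ?r powr p)"
        using z real by (subst exp_add) (simp add: jump_profile_def)
      moreover have "exp (L\<^sup>2 / (4 * c) - ?d * ln ?r) = exp (L\<^sup>2 / (4 * c)) * power_shape ?d z"
      proof -
        have "power_shape ?d z = ?r powr (- ?d)" using z by (subst power_shape_eq) (auto simp: max_def)
        also have "\<dots> = exp (- (?d * ln ?r))"
        proof -
          have "z \<noteq> 0" using z by auto
          then show ?thesis by (simp add: powr_def algebra_simps)
        qed
        finally have ps: "power_shape ?d z = exp (- (?d * ln ?r))" .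
        show ?thesis unfolding ps by (simp add: exp_add[symmetric])
      qed
      ultimately show ?thesis by simp
    qed
    then show "\<exists>C\<ge>0. \<forall>z::'a. 1 < norm z \<longrightarrow> jump_profile \<alpha> \<theta> c z * exp (K * norm z powr p) \<le> C * power_shape ?d z"
      by (intro exI[of _ "exp (L\<^sup>2 / (4 * c))"]) auto
  qed
next
  case PInf
  show thesis
  proof (rule that[of 1])
    fix K :: real
    show "\<exists>C\<ge>0. \<forall>z::'a. 1 < norm z \<longrightarrow> jump_profile \<alpha> \<theta> c z * exp (K * norm z powr 1) \<le> C * power_shape (real DIM('a) + 1) z"
      using PInf by (intro exI[of _ 0]) (auto simp: jump_profile_def)
  qed auto
next
  case MInf
  then show thesis using \<theta> by simp
qed

text \<open>
  Light tails give a finite second moment, so that the exponent is at most quadratic; the jumps of size at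
  most \<open>1\<close> have a density bounded below, which is all that the chain of short hops uses.
\<close>

lemma light_tailed_setting:
  fixes X :: "real \<Rightarrow> 'w \<Rightarrow> 'a::euclidean_space" and j :: "real \<Rightarrow> real"
  assumes \<theta>: "0 < \<theta>" and c: "0 < c" "1 \<le> c\<^sub>0" and \<alpha>: "0 < \<alpha>" and [measurable]: "j \<in> borel_measurable borel"
    and j: "\<And>z::'a. z \<noteq> 0 \<Longrightarrow> inverse c\<^sub>0 * jump_profile \<alpha> \<theta> c z \<le> j (norm z)"
      "\<And>z::'a. z \<noteq> 0 \<Longrightarrow> j (norm z) \<le> c\<^sub>0 * jump_profile \<alpha> \<theta> c z"
    and X: "pure_jump_symmetric_levy M X (density lborel (\<lambda>z::'a. ennreal (j (norm z))))"
  obtains c\<^sub>1 p where "levy_setting M X (density lborel (\<lambda>z::'a. ennreal (j (norm z)))) c\<^sub>1 2" "0 < p" "p \<le> 1"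
    "(\<integral>\<^sup>+z. ennreal (exp (norm z powr p)) * indicator {z. 1 < norm z} z \<partial>density lborel (\<lambda>z::'a. ennreal (j (norm z)))) < \<infinity>"
    "\<And>B. B \<in> sets borel \<Longrightarrow> B \<subseteq> {v. 1 / 16 \<le> norm v \<and> norm v \<le> 1} \<Longrightarrow>
      ennreal (inverse c\<^sub>0) * emeasure lborel B \<le> emeasure (density lborel (\<lambda>z::'a. ennreal (j (norm z)))) B"
proof -
  let ?\<nu> = "density lborel (\<lambda>z::'a. ennreal (j (norm z)))"
  have lp: "levy_process M X" and ch: "has_char_exponent M X (\<lambda>\<xi>. LINT z:-{0}|?\<nu>. 1 - cos (\<xi> \<bullet> z))"
    and \<nu>: "symmetric_levy_measure ?\<nu>"
    using X by (auto simp: pure_jump_symmetric_levy_def symmetric_levy_measure_def)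
  interpret \<nu>: symmetric_levy_measure ?\<nu> by (rule \<nu>)
  obtain p where p: "0 < p" "p \<le> 1" and tail: "\<And>K. 0 \<le> K \<Longrightarrow> \<exists>C\<ge>0. \<forall>z::'a. 1 < norm z \<longrightarrow>
    jump_profile \<alpha> \<theta> c z * exp (K * norm z powr p) \<le> C * power_shape (real DIM('a) + 1) z"
    using jump_profile_tail[OF \<theta> c(1), where \<alpha> = \<alpha> and 'a = 'a] by blast
  have moment: "(\<integral>\<^sup>+z. ennreal (exp (K * norm z powr p)) * indicator {z. 1 < norm z} z \<partial>?\<nu>) < \<infinity>" if K: "0 \<le> K" for K
  proof -
    obtain C where C: "0 \<le> C" "\<And>z::'a. 1 < norm z \<Longrightarrow> jump_profile \<alpha> \<theta> c z * exp (K * norm z powr p) \<le> C * power_shape (real DIM('a) + 1) z"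
      using tail[OF K] by blast
    have [measurable]: "{z::'a. 1 < norm z} \<in> sets borel" by measurable
    have "(\<integral>\<^sup>+z. ennreal (exp (K * norm z powr p)) * indicator {z. 1 < norm z} z \<partial>?\<nu>) =
        (\<integral>\<^sup>+z. ennreal (j (norm (z::'a))) * (ennreal (exp (K * norm z powr p)) * indicator {z. 1 < norm z} z) \<partial>lborel)"
      by (rule nn_integral_density) measurable
    also have "\<dots> \<le> (\<integral>\<^sup>+z. ennreal (c\<^sub>0 * C) * ennreal (power_shape (real DIM('a) + 1) (z::'a)) \<partial>lborel)"
    proof (intro nn_integral_mono)
      fix z :: 'a
      show "ennreal (j (norm z)) * (ennreal (exp (K * norm z powr p)) * indicator {z. 1 < norm z} z) \<le>
        ennreal (c\<^sub>0 * C) * ennreal (power_shape (real DIM('a) + 1) z)"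
      proof (cases "1 < norm z")
        case True
        have "j (norm z) * exp (K * norm z powr p) \<le> c\<^sub>0 * jump_profile \<alpha> \<theta> c z * exp (K * norm z powr p)"
          using True by (intro mult_right_mono j(2)) auto
        also have "\<dots> \<le> c\<^sub>0 * (C * power_shape (real DIM('a) + 1) z)"
          unfolding mult.assoc using c by (intro mult_left_mono C(2) True) auto
        finally have "ennreal (j (norm z) * exp (K * norm z powr p)) \<le> ennreal (c\<^sub>0 * C * power_shape (real DIM('a) + 1) z)"
          by (intro ennreal_leI) (simp only: mult.assoc)
        moreover have "0 \<le> c\<^sub>0 * C" using c C by simp
        ultimately show ?thesis using True by (simp add: ennreal_mult' ennreal_mult'' power_shape_def)
      qed simp
    qed
    also have "\<dots> = ennreal (c\<^sub>0 * C) * (\<integral>\<^sup>+z. ennreal (power_shape (real DIM('a) + 1) (z::'a)) \<partial>lborel)"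
      using measurable_power_shape[of "real DIM('a) + 1", where 'a = 'a] by (intro nn_integral_cmult) simp
    also have "\<dots> < \<infinity>" using power_shape_integrable[where 'a = 'a] by (simp add: ennreal_mult_less_top)
    finally show ?thesis .
  qed
  have second: "(\<integral>\<^sup>+z. ennreal ((norm z)\<^sup>2) \<partial>?\<nu>) < \<infinity>"
  proof -
    have [measurable]: "{z::'a. 1 < norm z} \<in> sets borel" by measurable
    have "(\<integral>\<^sup>+z. ennreal ((norm z)\<^sup>2) \<partial>?\<nu>) \<le>
        (\<integral>\<^sup>+z. ennreal (min 1 ((norm z)\<^sup>2)) + ennreal (exp (2 / p * norm z powr p)) * indicator {z. 1 < norm z} z \<partial>?\<nu>)"
    proof (intro nn_integral_mono)
      fix z :: 'a
      show "ennreal ((norm z)\<^sup>2) \<le> ennreal (min 1 ((norm z)\<^sup>2)) + ennreal (exp (2 / p * norm z powr p)) * indicator {z. 1 < norm z} z"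
      proof (cases "1 < norm z")
        case True
        have "ln (norm z) \<le> norm z powr p / p" using True p by (intro ln_powr_bound) auto
        then have "exp (2 * ln (norm z)) \<le> exp (2 / p * norm z powr p)" by simp
        moreover have "exp (2 * ln (norm z)) = (norm z)\<^sup>2"
        proof -
          have "exp (2 * ln (norm z)) = exp (ln (norm z)) * exp (ln (norm z))" by (simp only: exp_add[symmetric]) simp
          also have "exp (ln (norm z)) = norm z" using True by (intro exp_ln) linarith
          finally show ?thesis by (simp add: power2_eq_square)
        qed
        ultimately show ?thesis using True by (simp add: add_increasing ennreal_leI)
      next
        case False
        then have "(norm z)\<^sup>2 \<le> 1" by (simp add: power_le_one)
        then show ?thesis using False by simp
      qed
    qed
    also have "\<dots> = (\<integral>\<^sup>+z. ennreal (min 1 ((norm z)\<^sup>2)) \<partial>?\<nu>) + (\<integral>\<^sup>+z. ennreal (exp (2 / p * norm z powr p)) * indicator {z. 1 < norm z} z \<partial>?\<nu>)"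
      by (rule nn_integral_add) measurable
    also have "\<dots> < \<infinity>" using \<nu>.nn_min_finite moment[of "2 / p"] p by simp
    finally show ?thesis .
  qed
  have int2: "integrable ?\<nu> (\<lambda>z. (norm z)\<^sup>2)" using second by (intro integrableI_bounded) auto
  define s where "s = (\<integral>z. (norm z)\<^sup>2 \<partial>?\<nu>)"
  have s: "0 \<le> s" unfolding s_def by (rule Bochner_Integration.integral_nonneg) simp
  have eq: "(LINT z:-{0}|?\<nu>. 1 - cos (\<xi> \<bullet> z)) = levy_exponent_on ?\<nu> UNIV \<xi>" for \<xi> :: 'a
    unfolding levy_exponent_on_def set_lebesgue_integral_def
    by (intro Bochner_Integration.integral_cong) (auto simp: indicator_def)
  have le: "(LINT z:-{0}|?\<nu>. 1 - cos (\<xi> \<bullet> z)) \<le> (s / 2 + 1) * norm \<xi> powr 2" for \<xi> :: 'a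
  proof -
    have "levy_exponent_on ?\<nu> UNIV \<xi> \<le> (\<integral>z. (norm \<xi>)\<^sup>2 / 2 * (norm z)\<^sup>2 \<partial>?\<nu>)"
      unfolding levy_exponent_on_def
    proof (rule integral_mono[OF \<nu>.integrable_levy_exponent])
      show "integrable ?\<nu> (\<lambda>z. (norm \<xi>)\<^sup>2 / 2 * (norm z)\<^sup>2)" using int2 by simp
      fix z :: 'a
      have "(\<xi> \<bullet> z)\<^sup>2 \<le> (norm \<xi> * norm z)\<^sup>2"
        using Cauchy_Schwarz_ineq2[of \<xi> z] by (intro abs_le_square_iff[THEN iffD1]) simp
      then show "indicator UNIV z * (1 - cos (\<xi> \<bullet> z)) \<le> (norm \<xi>)\<^sup>2 / 2 * (norm z)\<^sup>2"
        using one_minus_cos_le[of "\<xi> \<bullet> z"] by (simp add: power_mult_distrib)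
    qed simp
    also have "\<dots> = s / 2 * (norm \<xi>)\<^sup>2" by (simp add: s_def)
    also have "\<dots> \<le> (s / 2 + 1) * norm \<xi> powr 2" by (simp add: distrib_right)
    finally show ?thesis by (simp only: eq)
  qed
  show thesis
  proof (rule that[OF _ p])
    show "levy_setting M X ?\<nu> (s / 2 + 1) 2" using s by (intro levy_settingI[OF lp ch \<nu> eq le]) auto
    show "(\<integral>\<^sup>+z. ennreal (exp (norm z powr p)) * indicator {z. 1 < norm z} z \<partial>?\<nu>) < \<infinity>" using moment[of 1] by simp
    fix B :: "'a set" assume B: "B \<in> sets borel" "B \<subseteq> {v. 1 / 16 \<le> norm v \<and> norm v \<le> 1}"
    have "ennreal (inverse c\<^sub>0) * emeasure lborel B = (\<integral>\<^sup>+z. ennreal (inverse c\<^sub>0) * indicator B z \<partial>lborel)"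
      using B by (intro nn_integral_cmult_indicator[symmetric]) simp
    also have "\<dots> \<le> (\<integral>\<^sup>+z. ennreal (j (norm z)) * indicator B z \<partial>lborel)"
    proof (intro nn_integral_mono)
      fix z :: 'a
      show "ennreal (inverse c\<^sub>0) * indicator B z \<le> ennreal (j (norm z)) * indicator B z"
      proof (cases "z \<in> B")
        case True
        then have z: "0 < norm z" "norm z \<le> 1" using B by force+
        have "norm z powr (real DIM('a) + \<alpha>) \<le> 1 powr (real DIM('a) + \<alpha>)" using z \<alpha> by (intro powr_mono2) auto
        then have "1 \<le> jump_profile \<alpha> \<theta> c z" using z by (simp add: jump_profile_def)
        then have "inverse c\<^sub>0 * 1 \<le> inverse c\<^sub>0 * jump_profile \<alpha> \<theta> c z" using c by (intro mult_left_mono) auto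
        also have "\<dots> \<le> j (norm z)" using z by (intro j(1)) auto
        finally show ?thesis using True by (simp add: ennreal_leI)
      qed simp
    qed
    also have "\<dots> = emeasure ?\<nu> B" using B by (intro emeasure_density[symmetric]) auto
    finally show "ennreal (inverse c\<^sub>0) * emeasure lborel B \<le> emeasure ?\<nu> B" .
  qed
qed

lemma feynman_kac_shift:
  assumes "\<And>y. V (x + y) = ennreal (W y)"
  shows "feynman_kac M X V t x = feynman_kac M X (\<lambda>y. ennreal (W y)) t 0"
  by (simp add: feynman_kac_def assms)

lemma stable_rate:
  fixes X :: "real \<Rightarrow> 'w \<Rightarrow> 'a::euclidean_space"
  assumes \<alpha>: "0 < \<alpha>" "\<alpha> < 2" and X: "rotationally_symmetric_stable M X \<alpha>"
    and V: "\<And>y. V (x + y) = ennreal (W y)"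
    and W: "comparable (real DIM('a) + \<alpha>) W" "has_low_spots \<alpha> W" "dense_env \<alpha> W"
  shows "let R = (\<lambda>t. log_ennreal (feynman_kac M X V t x) / ereal (t powr (real DIM('a) / (real DIM('a) + \<alpha>))))
    in -\<infinity> < Liminf at_top R \<and> Liminf at_top R \<le> Limsup at_top R \<and> Limsup at_top R < 0"
proof -
  obtain c \<kappa> where \<kappa>: "0 < \<kappa>" and ls: "levy_setting M X (stable_measure \<alpha> \<kappa> :: 'a measure) c \<alpha>"
    by (rule stable_setting[OF \<alpha> X])
  interpret levy_setting M X "stable_measure \<alpha> \<kappa> :: 'a measure" c \<alpha> by (rule ls)
  obtain c2 where c2: "0 < c2" and dom: "\<And>L B. 0 < L \<Longrightarrow> B \<in> sets borel \<Longrightarrow> B \<subseteq> cball 0 (3 * L) \<Longrightarrow>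
    ennreal (c2 * L powr (- real DIM('a) - \<alpha>)) * emeasure lborel B \<le> emeasure (stable_measure \<alpha> \<kappa> :: 'a measure) B"
    by (rule stable_measure_ge_lebesgue[OF \<alpha>(1) \<kappa>, where 'a = 'a]) blast
  have \<beta>: "0 < real DIM('a) + \<alpha>" using \<alpha> by simp
  have pos: "\<forall>\<^sub>F t in at_top. 0 < t powr (real DIM('a) / (real DIM('a) + \<alpha>))"
    using eventually_gt_at_top[of 0] by eventually_elim simp
  show ?thesis
    unfolding feynman_kac_shift[of V, OF V]
    by (rule log_rate_bounds[OF pos lower_bound_single_jump[OF W(1) \<beta> W(2) c2 dom] upper_bound_single_jump[OF W(3)]])
qed

lemma light_tailed_rate:
  fixes X :: "real \<Rightarrow> 'w \<Rightarrow> 'a::euclidean_space" and j :: "real \<Rightarrow> real"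
  assumes \<theta>: "0 < \<theta>" and c: "0 < c" "1 \<le> c\<^sub>0" and \<alpha>: "0 < \<alpha>" and j_measurable: "j \<in> borel_measurable borel"
    and j: "\<And>z::'a. z \<noteq> 0 \<Longrightarrow> inverse c\<^sub>0 * jump_profile \<alpha> \<theta> c z \<le> j (norm z)"
      "\<And>z::'a. z \<noteq> 0 \<Longrightarrow> j (norm z) \<le> c\<^sub>0 * jump_profile \<alpha> \<theta> c z"
    and X: "pure_jump_symmetric_levy M X (density lborel (\<lambda>z::'a. ennreal (j (norm z))))"
    and V: "\<And>y. V (x + y) = ennreal (W y)"
    and W: "comparable (real DIM('a) + 2) W" "has_low_spots 2 W" "dense_env 2 W"
  shows "let R = (\<lambda>t. log_ennreal (feynman_kac M X V t x) / ereal (t / ln t powr (2 / real DIM('a))))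
    in -\<infinity> < Liminf at_top R \<and> Liminf at_top R \<le> Limsup at_top R \<and> Limsup at_top R < 0"
proof -
  let ?\<nu> = "density lborel (\<lambda>z::'a. ennreal (j (norm z)))"
  obtain c\<^sub>1 p where ls: "levy_setting M X ?\<nu> c\<^sub>1 2" and p: "0 < p" "p \<le> 1"
    and fin: "(\<integral>\<^sup>+z. ennreal (exp (norm z powr p)) * indicator {z. 1 < norm z} z \<partial>?\<nu>) < \<infinity>"
    and dom: "\<And>B. B \<in> sets borel \<Longrightarrow> B \<subseteq> {v. 1 / 16 \<le> norm v \<and> norm v \<le> 1} \<Longrightarrow>
      ennreal (inverse c\<^sub>0) * emeasure lborel B \<le> emeasure ?\<nu> B"
    by (rule light_tailed_setting[OF \<theta> c \<alpha> j_measurable j X]) blast+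
  interpret levy_setting M X ?\<nu> c\<^sub>1 2 by (rule ls)
  have c0: "0 < inverse c\<^sub>0" using c by simp
  have \<beta>: "0 < real DIM('a) + 2" by simp
  have pos: "\<forall>\<^sub>F t in at_top. 0 < t / ln t powr (2 / real DIM('a))"
    using eventually_gt_at_top[of 1] by eventually_elim simp
  show ?thesis
    unfolding feynman_kac_shift[of V, OF V]
    by (rule log_rate_bounds[OF pos lower_bound_chain_rate[OF W(1) \<beta> W(2) c0 dom] upper_bound_light_tails[OF W(3) p fin]])
qed

theorem proposition1p3:
  fixes M :: "'w measure" and X :: "real \<Rightarrow> 'w \<Rightarrow> 'a::euclidean_space"
    and Q :: "'q measure" and \<mu> :: "'q \<Rightarrow> 'a measure" and \<rho> :: real
  defines "d \<equiv> real DIM('a)"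
  defines "u \<equiv> \<lambda>\<phi> q t x. feynman_kac M X (potential \<phi> (\<mu> q)) t x"
  assumes "\<rho> > 0"
    and "poisson_random_measure Q \<mu> (density lborel (\<lambda>_. ennreal \<rho>))"
  shows
    "(\<forall>\<alpha>. 0 < \<alpha> \<and> \<alpha> < 2 \<and> rotationally_symmetric_stable M X \<alpha> \<longrightarrow>
       (AE q in Q. \<forall>x.
          let R = (\<lambda>t. log_ennreal (u (power_shape (d + \<alpha>)) q t x) / ereal (t powr (d / (d + \<alpha>))))
          in -\<infinity> < Liminf at_top R \<and> Liminf at_top R \<le> Limsup at_top R \<and> Limsup at_top R < 0))
     \<and>
     (\<forall>\<alpha> (\<theta>::ereal) c c\<^sub>0 (j::real \<Rightarrow> real).
       0 < \<alpha> \<and> \<alpha> < 2 \<and> 0 < \<theta> \<and> 0 < c \<and> 1 \<le> c\<^sub>0 \<and> j \<in> borel_measurable borel \<and>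
       (\<forall>z::'a. z \<noteq> 0 \<longrightarrow>
          inverse c\<^sub>0 * jump_profile \<alpha> \<theta> c z \<le> j (norm z) \<and>
          j (norm z) \<le> c\<^sub>0 * jump_profile \<alpha> \<theta> c z) \<and>
       pure_jump_symmetric_levy M X (density lborel (\<lambda>z. ennreal (j (norm z)))) \<longrightarrow>
       (AE q in Q. \<forall>x.
          let R = (\<lambda>t. log_ennreal (u (power_shape (d + 2)) q t x) / ereal (t / ln t powr (2 / d)))
          in -\<infinity> < Liminf at_top R \<and> Liminf at_top R \<le> Limsup at_top R \<and> Limsup at_top R < 0))"
proof -
  interpret homogeneous_poisson Q \<mu> \<rho>
    using assms(3,4) by (intro homogeneous_poisson.intro homogeneous_poisson_axioms.intro)
  show ?thesis
    unfolding d_def u_def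
  proof (intro conjI allI impI)
    fix \<alpha> :: real
    assume H: "0 < \<alpha> \<and> \<alpha> < 2 \<and> rotationally_symmetric_stable M X \<alpha>"
    have env: "AE q in Q. \<forall>x. \<exists>W. (\<forall>y. V \<alpha> q (x + y) = ennreal (W y)) \<and>
        comparable (real DIM('a) + \<alpha>) W \<and> has_low_spots \<alpha> W \<and> dense_env \<alpha> W" using H by (intro environment_AE) simp
    show "AE q in Q. \<forall>x. let R = (\<lambda>t. log_ennreal (feynman_kac M X (V \<alpha> q) t x) / ereal (t powr (real DIM('a) / (real DIM('a) + \<alpha>))))
    in -\<infinity> < Liminf at_top R \<and> Liminf at_top R \<le> Limsup at_top R \<and> Limsup at_top R < 0"
      using env
    proof (rule eventually_mono, intro allI)
      fix q x
      assume "\<forall>x. \<exists>W. (\<forall>y. V \<alpha> q (x + y) = ennreal (W y)) \<and>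
        comparable (real DIM('a) + \<alpha>) W \<and> has_low_spots \<alpha> W \<and> dense_env \<alpha> W"
      then obtain W where W: "\<And>y. V \<alpha> q (x + y) = ennreal (W y)" "comparable (real DIM('a) + \<alpha>) W"
        "has_low_spots \<alpha> W" "dense_env \<alpha> W" by blast
      show "let R = (\<lambda>t. log_ennreal (feynman_kac M X (V \<alpha> q) t x) / ereal (t powr (real DIM('a) / (real DIM('a) + \<alpha>))))
    in -\<infinity> < Liminf at_top R \<and> Liminf at_top R \<le> Limsup at_top R \<and> Limsup at_top R < 0"
        using H by (intro stable_rate[OF _ _ _ W]) auto
    qed
  next
    fix \<alpha> c c\<^sub>0 :: real and \<theta> :: ereal and j :: "real \<Rightarrow> real"
    assume H: "0 < \<alpha> \<and> \<alpha> < 2 \<and> 0 < \<theta> \<and> 0 < c \<and> 1 \<le> c\<^sub>0 \<and> j \<in> borel_measurable borel \<and>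
       (\<forall>z::'a. z \<noteq> 0 \<longrightarrow> inverse c\<^sub>0 * jump_profile \<alpha> \<theta> c z \<le> j (norm z) \<and> j (norm z) \<le> c\<^sub>0 * jump_profile \<alpha> \<theta> c z) \<and>
       pure_jump_symmetric_levy M X (density lborel (\<lambda>z. ennreal (j (norm z))))"
    have env: "AE q in Q. \<forall>x. \<exists>W. (\<forall>y. V 2 q (x + y) = ennreal (W y)) \<and>
        comparable (real DIM('a) + 2) W \<and> has_low_spots 2 W \<and> dense_env 2 W" by (rule environment_AE) simp
    show "AE q in Q. \<forall>x. let R = (\<lambda>t. log_ennreal (feynman_kac M X (V 2 q) t x) / ereal (t / ln t powr (2 / real DIM('a))))
    in -\<infinity> < Liminf at_top R \<and> Liminf at_top R \<le> Limsup at_top R \<and> Limsup at_top R < 0"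
      using env
    proof (rule eventually_mono, intro allI)
      fix q x
      assume "\<forall>x. \<exists>W. (\<forall>y. V 2 q (x + y) = ennreal (W y)) \<and>
        comparable (real DIM('a) + 2) W \<and> has_low_spots 2 W \<and> dense_env 2 W"
      then obtain W where W: "\<And>y. V 2 q (x + y) = ennreal (W y)" "comparable (real DIM('a) + 2) W"
        "has_low_spots 2 W" "dense_env 2 W" by blast
      show "let R = (\<lambda>t. log_ennreal (feynman_kac M X (V 2 q) t x) / ereal (t / ln t powr (2 / real DIM('a))))
    in -\<infinity> < Liminf at_top R \<and> Liminf at_top R \<le> Limsup at_top R \<and> Limsup at_top R < 0"
        using H by (intro light_tailed_rate[where \<alpha> = \<alpha> and \<theta> = \<theta> and c = c and c\<^sub>0 = c\<^sub>0 and j = j, OF _ _ _ _ _ _ _ _ W]) auto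
    qed
  qed
qed

end
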